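(* Let $\xi$ be a nonnegative integer-valued random variable with $\mathbb{E}(\xi)=1$, $0<\mathrm{Var}(\xi)<\infty$, $\Pr(\xi=0)>0$ and $\gcd\{i : \Pr(\xi=i)>0\}=1$. Let $\mathcal{T}$ be the Galton--Watson tree with offspring distribution $\xi$, and let $\mathcal{T}_n$ be the corresponding conditioned Galton--Watson tree of order $n$ (defined for all sufficiently large $n$). Then there exist constants $\mu_{\rm pr}>0$ and $\sigma_{\rm pr}>0$ such that, as $n\to\infty$, $$\mathbb{E}\,\gamma_{\rm pr}(\mathcal{T}_n)=\mu_{\rm pr}\,n+o(\sqrt n)\qquad\text{and}\qquad \frac{\gamma_{\rm pr}(\mathcal{T}_n)-\mu_{\rm pr}\,n}{\sigma_{\rm pr}\sqrt n}\ \overset{\mathrm d}{\to}\ \mathcal{N}(0,1),$$ where $\overset{\mathrm d}{\to}$ denotes convergence in distribution.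
   Context: A paired dominating set of a graph $G$ without isolated vertices is a set $S\subseteq V(G)$ such that every vertex of $V(G)\setminus S$ is adjacent to some vertex of $S$ and the induced subgraph $G[S]$ contains a perfect matching (not necessarily induced). The paired domination number $\gamma_{\rm pr}(G)$ is the minimum cardinality of a paired dominating set of $G$. All trees are rooted and ordered (plane). The Galton--Watson tree $\mathcal{T}$ with offspring distribution $\xi$ is the random rooted ordered tree obtained by starting with a root and letting every vertex independently have a number of children distributed as $\xi$; for a finite rooted ordered tree $T$, $\Pr(\mathcal{T}=T)=\prod_{j\ge 0}\Pr(\xi=j)^{D_j(T)}$, where $D_j(T)$ is the number of vertices of $T$ with exactly $j$ children. Under the stated assumptions $\mathcal{T}$ is almost surely finite and $\Pr(|\mathcal{T}|=n)>0$ for all sufficiently large $n$, where $|\mathcal{T}|$ is the number of vertices. The conditioned Galton--Watson tree $\mathcal{T}_n$ is $\mathcal{T}$ conditioned on the event $|\mathcal{T}|=n$. *)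

theory Defs
  imports "HOL-Probability.Probability" "HOL-Library.Landau_Symbols"
begin

section \<open>Paired domination in graphs\<close>

text \<open>A graph is a pair of a vertex set and a set of edges, each edge being a two-element set.\<close>

type_synonym 'a graph = "'a set \<times> 'a set set"

definition verts :: "'a graph \<Rightarrow> 'a set" where
  "verts G = fst G"

definition edges :: "'a graph \<Rightarrow> 'a set set" where
  "edges G = snd G"

definition induced_subgraph :: "'a graph \<Rightarrow> 'a set \<Rightarrow> 'a graph" where
  "induced_subgraph G S = (verts G \<inter> S, {e \<in> edges G. e \<subseteq> S})"

definition perfect_matching :: "'a graph \<Rightarrow> 'a set set \<Rightarrow> bool" where
  "perfect_matching G N \<longleftrightarrow> N \<subseteq> edges G \<and> disjoint N \<and> \<Union>N = verts G"

definition paired_dominating_set :: "'a graph \<Rightarrow> 'a set \<Rightarrow> bool" where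
  "paired_dominating_set G S \<longleftrightarrow>
     S \<subseteq> verts G \<and>
     (\<forall>v\<in>verts G - S. \<exists>u\<in>S. {u, v} \<in> edges G) \<and>
     (\<exists>N. perfect_matching (induced_subgraph G S) N)"

text \<open>Infinite sets are excluded because their \<^const>\<open>card\<close> is 0. If there is no finite
  paired dominating set (in particular for the one-vertex graph), the value is
  \<open>Inf {}\<close> and carries no meaning.\<close>

definition paired_domination_number :: "'a graph \<Rightarrow> nat" where
  "paired_domination_number G = Inf (card ` {S. finite S \<and> paired_dominating_set G S})"


section \<open>Plane trees and Galton--Watson trees\<close>

text \<open>Rooted ordered trees are encoded in the Ulam--Harris way: the root is \<open>[]\<close>, and the
  children of \<open>u\<close> are \<open>u @ [0], u @ [1], \<dots>\<close> in this order. Two trees are equal as plane trees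
  iff their vertex sets are equal. The number \<open>c u\<close> of children is prescribed for every
  \<open>u\<close>, whether or not \<open>u\<close> ends up in the tree.\<close>

inductive_set plane_tree :: "(nat list \<Rightarrow> nat) \<Rightarrow> nat list set" for c where
  root: "[] \<in> plane_tree c"
| child: "u \<in> plane_tree c \<Longrightarrow> i < c u \<Longrightarrow> u @ [i] \<in> plane_tree c"

definition tree_graph :: "nat list set \<Rightarrow> nat list graph" where
  "tree_graph T = (T, {{u, u @ [i]} | u i. u \<in> T \<and> u @ [i] \<in> T})"

text \<open>The Galton--Watson tree with offspring distribution \<open>\<xi>\<close> is the random variable
  \<^const>\<open>plane_tree\<close> on the following probability space, on which the coordinates
  \<open>\<omega> u\<close> are independent with law \<open>\<xi>\<close>.\<close>

definition offspring_space :: "nat pmf \<Rightarrow> (nat list \<Rightarrow> nat) measure" where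
  "offspring_space \<xi> = Pi\<^sub>M UNIV (\<lambda>_. measure_pmf \<xi>)"

text \<open>The conditioned Galton--Watson tree of order \<open>n\<close> is the random variable
  \<^const>\<open>plane_tree\<close> under the conditional probability measure below. If the event has
  probability 0, this is the null measure.\<close>

definition conditioned_space :: "nat pmf \<Rightarrow> nat \<Rightarrow> (nat list \<Rightarrow> nat) measure" where
  "conditioned_space \<xi> n =
     uniform_measure (offspring_space \<xi>)
       {\<omega> \<in> space (offspring_space \<xi>). finite (plane_tree \<omega>) \<and> card (plane_tree \<omega>) = n}"


section \<open>Basic properties of the model\<close>

lemma prob_space_offspring_space: "prob_space (offspring_space \<xi>)"
  unfolding offspring_space_def
  by (intro prob_space_PiM measure_pmf.prob_space_axioms)

lemma space_offspring_space [simp]: "space (offspring_space \<xi>) = UNIV"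
  by (simp add: offspring_space_def space_PiM)

lemma offspring_measurable [measurable]:
  "(\<lambda>\<omega>. \<omega> u) \<in> measurable (offspring_space \<xi>) (count_space UNIV)"
proof -
  have "(\<lambda>\<omega>. \<omega> u) \<in> measurable (offspring_space \<xi>) (measure_pmf \<xi>)"
    unfolding offspring_space_def by (rule measurable_component_singleton) simp
  then show ?thesis by simp
qed

lemma snoc_in_plane_tree_iff [simp]:
  "u @ [i] \<in> plane_tree c \<longleftrightarrow> u \<in> plane_tree c \<and> i < c u"
  by (auto elim: plane_tree.cases intro: plane_tree.intros)

lemma plane_tree_eq_iff:
  "plane_tree c' = plane_tree c \<longleftrightarrow> (\<forall>u\<in>plane_tree c. c' u = c u)"
proof
  assume eq: "plane_tree c' = plane_tree c"
  show "\<forall>u\<in>plane_tree c. c' u = c u"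
  proof
    fix u assume u: "u \<in> plane_tree c"
    have "i < c' u \<longleftrightarrow> i < c u" for i
      using u eq snoc_in_plane_tree_iff[of u i c] snoc_in_plane_tree_iff[of u i c'] by simp
    then show "c' u = c u" by (meson linorder_neqE_nat less_irrefl)
  qed
next
  assume eq: "\<forall>u\<in>plane_tree c. c' u = c u"
  have "u \<in> plane_tree c' \<longleftrightarrow> u \<in> plane_tree c" for u
    by (induction u rule: rev_induct) (use eq in \<open>auto intro: plane_tree.root\<close>)
  then show "plane_tree c' = plane_tree c" by blast
qed

lemma prob_plane_tree_eq:
  assumes "finite (plane_tree c)"
  shows "measure (offspring_space \<xi>) {\<omega>. plane_tree \<omega> = plane_tree c} =
           (\<Prod>u\<in>plane_tree c. pmf \<xi> (c u))"
proof -
  interpret product_prob_space "\<lambda>_::nat list. measure_pmf \<xi>" UNIV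
    by unfold_locales
  let ?T = "plane_tree c"
  have "{\<omega>. plane_tree \<omega> = ?T} = {\<omega> \<in> space (offspring_space \<xi>). \<forall>u\<in>?T. \<omega> u \<in> {c u}}"
    by (auto simp: plane_tree_eq_iff)
  also have "emeasure (offspring_space \<xi>) \<dots> = (\<Prod>u\<in>?T. emeasure (measure_pmf \<xi>) {c u})"
    unfolding offspring_space_def
    by (rule emeasure_PiM_Collect) (use assms in auto)
  also have "\<dots> = ennreal (\<Prod>u\<in>?T. pmf \<xi> (c u))"
    by (simp add: emeasure_pmf_single prod_ennreal)
  finally show ?thesis
    by (simp add: measure_def prod_nonneg)
qed

text \<open>Grouping the vertices by their number of children gives the formula with exponents
  \<open>D\<^sub>j(T)\<close>; the factors with \<open>j\<close> not among the occurring numbers of children are 1.\<close>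

lemma prob_plane_tree_eq_degrees:
  assumes "finite (plane_tree c)"
  shows "measure (offspring_space \<xi>) {\<omega>. plane_tree \<omega> = plane_tree c} =
           (\<Prod>j\<in>c ` plane_tree c. pmf \<xi> j ^ card {u \<in> plane_tree c. c u = j})"
proof -
  have "(\<Prod>u\<in>plane_tree c. pmf \<xi> (c u)) =
          (\<Prod>j\<in>c ` plane_tree c. \<Prod>u\<in>{u \<in> plane_tree c. c u = j}. pmf \<xi> (c u))"
    using assms by (rule prod.image_gen)
  also have "\<dots> = (\<Prod>j\<in>c ` plane_tree c. pmf \<xi> j ^ card {u \<in> plane_tree c. c u = j})"
    by (intro prod.cong refl) simp
  finally show ?thesis by (simp add: prob_plane_tree_eq[OF assms])
qed

lemma in_plane_tree_measurable [measurable]: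
  "Measurable.pred (offspring_space \<xi>) (\<lambda>\<omega>. u \<in> plane_tree \<omega>)"
proof (induction u rule: rev_induct)
  case Nil
  then show ?case by (simp add: plane_tree.root)
next
  case (snoc i u)
  then show ?case by simp
qed

lemma plane_tree_eq_measurable [measurable]:
  "Measurable.pred (offspring_space \<xi>) (\<lambda>\<omega>. plane_tree \<omega> = T)"
  unfolding set_eq_iff by measurable

lemma finite_plane_tree_measurable:
  "Measurable.pred (offspring_space \<xi>) (\<lambda>\<omega>. finite (plane_tree \<omega>) \<and> P (plane_tree \<omega>))"
proof -
  have "(\<lambda>\<omega>. finite (plane_tree \<omega>) \<and> P (plane_tree \<omega>)) =
          (\<lambda>\<omega>. \<exists>T\<in>{T. finite T \<and> P T}. plane_tree \<omega> = T)"
    by auto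
  moreover have "countable {T :: nat list set. finite T \<and> P T}"
    by (rule countable_subset[OF _ countable_Collect_finite]) auto
  then have "Measurable.pred (offspring_space \<xi>)
               (\<lambda>\<omega>. \<exists>T\<in>{T. finite T \<and> P T}. plane_tree \<omega> = T)"
    unfolding pred_def by (rule sets.sets_Collect_countable_Ex'[rotated]) measurable
  ultimately show ?thesis by simp
qed

lemma no_finite_paired_dominating_set:
  assumes "infinite (plane_tree c)" "finite S"
  shows "\<not> paired_dominating_set (tree_graph (plane_tree c)) S"
proof
  assume "paired_dominating_set (tree_graph (plane_tree c)) S"
  then have dom: "\<exists>u\<in>S. {u, v} \<in> edges (tree_graph (plane_tree c))"
    if "v \<in> plane_tree c - S" for v
    using that by (auto simp: paired_dominating_set_def tree_graph_def verts_def)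
  have "plane_tree c \<subseteq> S \<union> (\<Union>u\<in>S. insert (butlast u) ((\<lambda>i. u @ [i]) ` {..<c u}))"
    using dom by (fastforce simp: tree_graph_def edges_def doubleton_eq_iff)
  then have "finite (plane_tree c)"
    by (rule finite_subset) (use assms(2) in auto)
  with assms(1) show False by simp
qed

lemma paired_domination_number_measurable [measurable]:
  "(\<lambda>\<omega>. paired_domination_number (tree_graph (plane_tree \<omega>)))
     \<in> measurable (offspring_space \<xi>) (count_space UNIV)"
proof -
  define g where "g \<omega> = paired_domination_number (tree_graph (plane_tree \<omega>))" for \<omega>
  have inf: "g \<omega> = Inf {}" if "infinite (plane_tree \<omega>)" for \<omega>
  proof -
    have "{S. finite S \<and> paired_dominating_set (tree_graph (plane_tree \<omega>)) S} = {}"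
      using no_finite_paired_dominating_set[OF that] by blast
    then show ?thesis
      unfolding g_def paired_domination_number_def by (simp only: image_empty)
  qed
  have fin [measurable]: "Measurable.pred (offspring_space \<xi>) (\<lambda>\<omega>. finite (plane_tree \<omega>))"
    using finite_plane_tree_measurable[where P = "\<lambda>_. True"] by simp
  have [measurable]:
    "Measurable.pred (offspring_space \<xi>) (\<lambda>\<omega>. finite (plane_tree \<omega>) \<and> g \<omega> = k)" for k
    unfolding g_def by (rule finite_plane_tree_measurable)
  have "Measurable.pred (offspring_space \<xi>) (\<lambda>\<omega>. g \<omega> = k)" for k
  proof -
    have "(\<lambda>\<omega>. g \<omega> = k) = (\<lambda>\<omega>. (finite (plane_tree \<omega>) \<and> g \<omega> = k) \<or>
            (\<not> finite (plane_tree \<omega>) \<and> k = Inf {}))"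
      using inf by auto
    then show ?thesis by simp
  qed
  then have "g \<in> measurable (offspring_space \<xi>) (count_space UNIV)"
    by (intro measurable_count_space_eq2_countable[THEN iffD2])
       (auto simp: pred_def vimage_def)
  then show ?thesis by (simp add: g_def[abs_def])
qed

end

theory Submission
  imports Defs
begin

text \<open>
  A bottom-up greedy labelling of the vertices computes a minimum paired dominating set: a vertex is
  labelled \<open>Pend\<close> iff no child is \<open>Pend\<close> and some child is \<open>Bare\<close> (a leaf is \<open>Bare\<close>), and then
  \<open>\<gamma>\<^sub>p\<^sub>r\<close> is twice the number of \<open>Pend\<close> vertices, up to a correction at the root. Cutting a tree at its
  \<open>Pend\<close> vertices turns the pair (size, number of \<open>Pend\<close> vertices) into the total progeny of a
  Galton--Watson forest of blocks with a number of exits and a number of vertices each. By Lagrange inversion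
  (the hitting time identity) the joint law of this pair is given by a two-dimensional random walk, for
  which Fourier inversion yields a local limit theorem; the moments of the blocks that enter it are
  found by letting the argument of their generating functions tend to 1. A generalized dominated
  convergence argument then turns the local limit theorem into the convergence of the distribution
  functions. For the mean, generating functions give
  \<open>E[#Pend; |T| = n] = \<Sum>\<^sub>i P(root Pend, |T| = i) P(S\<^sub>m = m)\<close> with \<open>m = n - i\<close>
  and \<open>S\<close> the random walk with steps \<open>\<xi>\<close>, and the same identity with
  the event "root \<open>Pend\<close>" dropped yields \<open>n P(|T| = n)\<close>; comparing the two convolutions leaves
  an error that is \<open>o(\<surd>n)\<close> after conditioning.
\<close>

section \<open>Greedy labelling of a tree\<close>

text \<open>They exist because, in the linearised equation for the part of a tree above its
  \<open>Pend\<close> vertices, the critical term cancels (mean offspring 1) and a strictly positive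
  coefficient remains, as a leaf occurs with positive probability and is \<open>Bare\<close>. The
  blocks then turn out to be critical again, with mean number of exits 1 and mean size 1/P(root
  \<open>Pend\<close>). Hence \<mu> = 2 P(root \<open>Pend\<close>), while \<sigma> is twice a
  standard deviation that is positive because aperiodicity and an offspring value of at least 2 make
  the block walk nondegenerate in both coordinates. Pointwise local limits could lose mass at
  infinity; this is excluded by the separate asymptotics of P(|T| = n), whose constant equals the
  total mass of the limit density. Convergence in distribution does not control means, and the mean
  is wanted to precision o(\<surd>n), that is, finer than the fluctuations, so it needs identities
  of its own.\<close>

datatype state = Pend | Matched | Covered | Bare

text \<open>The label is what a subtree reports to its parent. \<open>Pend\<close>: has an
  undominated child, so it must be taken, and still accepts the parent as partner.
  \<open>Matched\<close>: taken, with a \<open>Pend\<close> child as partner.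
  \<open>Covered\<close>: dominated by a \<open>Matched\<close> child, asks for nothing.
  \<open>Bare\<close>: no child dominates it, so the parent has to. \<open>Pend\<close> is tested
  before \<open>Bare\<close> because a vertex that becomes the partner of a \<open>Pend\<close>
  child dominates its \<open>Bare\<close> children as well.\<close>

definition combine :: "state set \<Rightarrow> state" where
  "combine A = (if Pend \<in> A then Matched else if Bare \<in> A then Pend
     else if Matched \<in> A then Covered else Bare)"

lemma edges_tree_graph:
  "edges (tree_graph (plane_tree c)) = {{u, u @ [i]} | u i. u \<in> plane_tree c \<and> i < c u}"
  by (auto simp: edges_def tree_graph_def)

lemma verts_tree_graph [simp]: "verts (tree_graph T) = T"
  by (simp add: verts_def tree_graph_def)

locale labelled_plane_tree =
  fixes c :: "nat list \<Rightarrow> nat" and s :: "nat list \<Rightarrow> state"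
  assumes finite_tree: "finite (plane_tree c)"
    and root_not_leaf: "c [] > 0"
    and label: "\<And>u. u \<in> plane_tree c \<Longrightarrow> s u = combine ((\<lambda>i. s (u @ [i])) ` {..<c u})"
begin

abbreviation "T \<equiv> plane_tree c"
abbreviation "G \<equiv> tree_graph T"

definition pends :: "nat list set" where "pends = {u \<in> T. s u = Pend}"

definition bare_child :: "nat list \<Rightarrow> nat list" where
  "bare_child u = u @ [SOME i. i < c u \<and> s (u @ [i]) = Bare]"

definition pend_child :: "nat list \<Rightarrow> nat list" where
  "pend_child u = u @ [SOME i. i < c u \<and> s (u @ [i]) = Pend]"

lemma label_mem: "x \<in> (\<lambda>i. s (u @ [i])) ` {..<c u} \<longleftrightarrow> (\<exists>i<c u. s (u @ [i]) = x)"
  by auto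

lemma label_Pend_iff:
  "u \<in> T \<Longrightarrow> s u = Pend \<longleftrightarrow> (\<forall>i<c u. s (u @ [i]) \<noteq> Pend) \<and> (\<exists>i<c u. s (u @ [i]) = Bare)"
  using label[of u] unfolding combine_def label_mem by (auto split: if_splits)

lemma label_Matched_iff: "u \<in> T \<Longrightarrow> s u = Matched \<longleftrightarrow> (\<exists>i<c u. s (u @ [i]) = Pend)"
  using label[of u] unfolding combine_def label_mem by (auto split: if_splits)

lemma label_Covered_imp: "u \<in> T \<Longrightarrow> s u = Covered \<Longrightarrow> \<exists>i<c u. s (u @ [i]) = Matched"
  using label[of u] unfolding combine_def label_mem by (auto split: if_splits)

lemma label_Bare_imp: "u \<in> T \<Longrightarrow> s u = Bare \<Longrightarrow> i < c u \<Longrightarrow> s (u @ [i]) = Covered"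
  using label[of u] unfolding combine_def label_mem
  by (cases "s (u @ [i])") (auto split: if_splits)

lemma bare_child:
  assumes "u \<in> pends"
  obtains i where "bare_child u = u @ [i]" "i < c u" "s (u @ [i]) = Bare"
proof -
  have "\<exists>i. i < c u \<and> s (u @ [i]) = Bare"
    using assms label_Pend_iff[of u] by (auto simp: pends_def)
  from someI_ex[OF this] show thesis by (intro that) (auto simp: bare_child_def)
qed

lemma pend_child:
  assumes "u \<in> T" "s u = Matched"
  obtains i where "pend_child u = u @ [i]" "i < c u" "s (u @ [i]) = Pend"
proof -
  have "\<exists>i. i < c u \<and> s (u @ [i]) = Pend"
    using assms label_Matched_iff[of u] by auto
  from someI_ex[OF this] show thesis by (intro that) (auto simp: pend_child_def)
qed

lemma finite_pends: "finite pends"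
  using finite_tree by (simp add: pends_def)

lemma edge_snoc: "u \<in> T \<Longrightarrow> i < c u \<Longrightarrow> {u, u @ [i]} \<in> edges G"
  unfolding edges_tree_graph by blast

lemma edge_subset:
  assumes "e \<in> edges G"
  shows "e \<subseteq> T" "card e = 2"
proof -
  from assms obtain u i where "e = {u, u @ [i]}" "u \<in> T" "i < c u"
    unfolding edges_tree_graph by blast
  then show "e \<subseteq> T" "card e = 2" by auto
qed

section \<open>Lower bound: undominated vertices as private witnesses\<close>

definition target :: nat where
  "target = card pends + (if s [] = Bare then 1 else 0)"

text \<open>These vertices need pairwise different edges of the matching: each must be taken or
  dominated, and no edge has two of them at distance at most 1. Only one \<open>Bare\<close> child
  per \<open>Pend\<close> vertex is kept, since siblings can share an edge through their
  parent.\<close>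

definition bares :: "nat list set" where
  "bares = bare_child ` pends \<union> (if s [] = Bare then {[]} else {})"

lemma bares_snoc_iff: "u @ [i] \<in> bares \<longleftrightarrow> u \<in> pends \<and> bare_child u = u @ [i]"
proof
  assume "u @ [i] \<in> bares"
  then obtain v where "v \<in> pends" "u @ [i] = bare_child v"
    unfolding bares_def by (auto split: if_splits)
  then show "u \<in> pends \<and> bare_child u = u @ [i]" by (auto simp: bare_child_def)
next
  assume "u \<in> pends \<and> bare_child u = u @ [i]"
  then show "u @ [i] \<in> bares" unfolding bares_def by (metis UnI1 image_eqI)
qed

lemma pends_in: "u \<in> pends \<Longrightarrow> u \<in> T \<and> s u = Pend"
  by (simp add: pends_def)

lemma bare_child_in: "u \<in> pends \<Longrightarrow> bare_child u \<in> T \<and> s (bare_child u) = Bare"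
  by (metis bare_child pends_in snoc_in_plane_tree_iff)

lemma bares_bare: "u \<in> bares \<Longrightarrow> u \<in> T \<and> s u = Bare"
  using bare_child_in by (auto simp: bares_def plane_tree.root split: if_splits)

lemma card_bares: "card bares = target"
proof -
  have "inj_on bare_child pends"
    by (rule inj_onI) (auto simp: bare_child_def)
  moreover have "[] \<notin> bare_child ` pends"
    by (auto simp: bare_child_def)
  ultimately show ?thesis
    using finite_pends by (auto simp: bares_def target_def card_image)
qed

lemma paired_dominating_set_lower:
  assumes "finite S" "paired_dominating_set G S"
  shows "2 * target \<le> card S"
proof -
  from assms(2) obtain N where S: "S \<subseteq> T" and dom: "\<And>v. v \<in> T - S \<Longrightarrow> \<exists>u\<in>S. {u, v} \<in> edges G"
    and N: "perfect_matching (induced_subgraph G S) N"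
    unfolding paired_dominating_set_def by auto
  have NE: "N \<subseteq> edges G" and dis: "disjoint N" and un: "\<Union>N = S"
    using N S by (auto simp: perfect_matching_def induced_subgraph_def edges_def verts_def tree_graph_def)
  have fin: "finite N"
    using un assms(1) by (metis finite_UnionD)
  have "\<exists>e\<in>N. \<exists>x\<in>e. x = u \<or> {x, u} \<in> edges G" if "u \<in> bares" for u
    using bares_bare[OF that] dom[of u] un by (metis DiffI UnionE)
  then obtain f where f: "\<And>u. u \<in> bares \<Longrightarrow> f u \<in> N"
    "\<And>u. u \<in> bares \<Longrightarrow> \<exists>x\<in>f u. x = u \<or> {x, u} \<in> edges G"
    by metis
  \<comment> \<open>\<open>h\<close> reads the witness off an edge from \<open>a\<close> to its
    child \<open>a @ [i]\<close>. The witness is \<open>a\<close> itself, its parent, a child of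
    \<open>a\<close> or a child of \<open>a @ [i]\<close>, and the label of \<open>a\<close> tells
    which: \<open>Bare\<close>, \<open>Covered\<close>, \<open>Pend\<close>, \<open>Matched\<close>
    in this order.\<close>
  define h where "h a i = (case s a of Pend \<Rightarrow> bare_child a | Matched \<Rightarrow> bare_child (a @ [i])
    | Covered \<Rightarrow> butlast a | Bare \<Rightarrow> a)" for a i
  have key: "u = h a i"
    if u: "u \<in> bares" and e: "f u = {a, a @ [i]}" "a \<in> T" "i < c a" for u a i
  proof -
    obtain x where x: "x = a \<or> x = a @ [i]" "x = u \<or> {x, u} \<in> edges G"
      using f(2)[OF u] e by auto
    have uT: "u \<in> T" "s u = Bare" using bares_bare[OF u] by auto
    have ch: "bare_child b = b @ [j] \<and> s b = Pend" if "u = b @ [j]" for b j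
      using u that bares_snoc_iff by (auto simp: pends_def)
    from x consider "u = a" | j where "u = a @ [j]" | j where "a = u @ [j]" "j < c u"
      | j where "u = (a @ [i]) @ [j]"
      unfolding edges_tree_graph by (auto simp: doubleton_eq_iff)
    then show ?thesis
    proof cases
      case 1 then show ?thesis using uT by (simp add: h_def)
    next
      case 2 then show ?thesis using ch[OF 2] by (simp add: h_def)
    next
      case 3 then show ?thesis using label_Bare_imp[OF uT 3(2)] by (simp add: h_def)
    next
      case 4
      then have "s (a @ [i]) = Pend" using ch[OF 4] by simp
      then have "s a = Matched" using e label_Matched_iff by blast
      then show ?thesis using ch[OF 4] 4 by (simp add: h_def)
    qed
  qed
  have "inj_on f bares"
  proof (rule inj_onI)
    fix u v assume uv: "u \<in> bares" "v \<in> bares" "f u = f v"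
    from f(1)[OF uv(1)] NE obtain a i where "f u = {a, a @ [i]}" "a \<in> T" "i < c a"
      unfolding edges_tree_graph by blast
    with key[of u a i] key[of v a i] uv show "u = v" by simp
  qed
  then have le: "target \<le> card N"
    using card_inj_on_le[of f bares N] f(1) fin by (auto simp: card_bares)
  have two: "card e = 2" if "e \<in> N" for e
    using that NE edge_subset by blast
  have "card S = (\<Sum>e\<in>N. card e)"
    unfolding un[symmetric] using dis two
    by (intro card_Union_disjoint) (auto simp: card_ge_0_finite)
  also have "\<dots> = 2 * card N" using two by simp
  finally show ?thesis using le by simp
qed

section \<open>Upper bound: an explicit set of pairs\<close>

definition mate :: "nat list \<Rightarrow> nat list" where
  "mate v = (if v \<noteq> [] \<and> pend_child (butlast v) = v then butlast v else bare_child v)"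

lemma mate_cases:
  assumes "v \<in> pends"
  obtains (up) w i where "mate v = w" "v = w @ [i]" "w \<in> T" "i < c w" "s w = Matched" "pend_child w = v"
  | (down) i where "mate v = v @ [i]" "i < c v" "s (v @ [i]) = Bare" "bare_child v = v @ [i]"
proof (cases "v \<noteq> [] \<and> pend_child (butlast v) = v")
  case True
  then obtain w i where v: "v = w @ [i]" by (metis append_butlast_last_id)
  with assms have "w \<in> T" "i < c w" by (auto simp: pends_def)
  moreover have "s w = Matched" using assms v calculation label_Matched_iff by (auto simp: pends_def)
  ultimately show thesis using True v by (intro up[of w i]) (auto simp: mate_def)
next
  case False
  from assms obtain i where "bare_child v = v @ [i]" "i < c v" "s (v @ [i]) = Bare" by (rule bare_child)
  with False show thesis by (intro down[of i]) (auto simp: mate_def)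
qed

lemma mate_edge:
  assumes v: "v \<in> pends"
  shows "{v, mate v} \<in> edges G"
  using v
proof (cases rule: mate_cases)
  case (up w i)
  then show ?thesis using edge_snoc[of w i] by (simp add: insert_commute)
next
  case (down i)
  then show ?thesis using pends_in[OF v] edge_snoc[of v i] by simp
qed

lemma mate_inj: "v \<in> pends \<Longrightarrow> w \<in> pends \<Longrightarrow> mate v = mate w \<Longrightarrow> v = w"
  by (erule mate_cases; erule mate_cases) auto

lemma mate_in:
  assumes v: "v \<in> pends"
  shows "mate v \<in> T \<and> s (mate v) \<in> {Matched, Bare} \<and> (s (mate v) = Bare \<longrightarrow> mate v \<noteq> [])"
  using v by (cases rule: mate_cases) (use pends_in[OF v] in auto)

text \<open>A \<open>Bare\<close> root has no parent that could dominate it, so it is taken together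
  with its first child. That child exists by \<open>root_not_leaf\<close> and is
  \<open>Covered\<close>, hence in no other pair.\<close>

definition pairs :: "nat list set set" where
  "pairs = (\<lambda>v. {v, mate v}) ` pends \<union> (if s [] = Bare then {{[], [0]}} else {})"

lemma root_pair:
  assumes "s [] = Bare"
  shows "[0] \<in> T" "s [0] = Covered"
  using label_Bare_imp[of "[]" 0] root_not_leaf assms snoc_in_plane_tree_iff[of "[]" 0 c]
  by (auto simp: plane_tree.root)

lemma pairs_disjoint: "disjoint pairs"
proof (rule disjointI)
  have ndis: "{v, mate v} \<inter> {w, mate w} = {}" if "v \<in> pends" "w \<in> pends" "v \<noteq> w" for v w
    using that mate_inj[of v w] mate_in[of v] mate_in[of w] by (auto simp: pends_def)
  have rdis: "{v, mate v} \<inter> {[], [0]} = {}" if "v \<in> pends" "s [] = Bare" for v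
    using that mate_in[of v] root_pair by (auto simp: pends_def)
  have cases: "(\<exists>v\<in>pends. e = {v, mate v}) \<or> (s [] = Bare \<and> e = {[], [0]})" if "e \<in> pairs" for e
    using that unfolding pairs_def by (auto split: if_splits)
  fix e e' assume e: "e \<in> pairs" "e' \<in> pairs" "e \<noteq> e'"
  show "e \<inter> e' = {}"
    using cases[OF e(1)] cases[OF e(2)]
  proof (elim disjE bexE conjE)
    fix v w assume "v \<in> pends" "e = {v, mate v}" "w \<in> pends" "e' = {w, mate w}"
    then show ?thesis using ndis[of v w] e(3) by (cases "v = w") simp_all
  next
    fix v assume "v \<in> pends" "e = {v, mate v}" "s [] = Bare" "e' = {[], [0]}"
    then show ?thesis using rdis[of v] by simp
  next
    fix v assume "v \<in> pends" "e' = {v, mate v}" "s [] = Bare" "e = {[], [0]}"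
    then show ?thesis using rdis[of v] by (simp add: Int_commute)
  next
    assume "e = {[], [0]}" "e' = {[], [0]}"
    then show ?thesis using e(3) by simp
  qed
qed

lemma pairs_edges: "pairs \<subseteq> edges G"
proof -
  have "{[], [] @ [0]} \<in> edges G"
    using root_not_leaf plane_tree.root[of c] unfolding edges_tree_graph by blast
  then show ?thesis using mate_edge by (auto simp: pairs_def)
qed

lemma Union_pairs_subset: "\<Union>pairs \<subseteq> T"
  using pairs_edges edge_subset by blast

lemma card_Union_pairs: "card (\<Union>pairs) = 2 * target"
proof -
  have two: "card e = 2" if "e \<in> pairs" for e
    using that pairs_edges edge_subset by blast
  have inj: "inj_on (\<lambda>v. {v, mate v}) pends"
  proof (rule inj_onI)
    fix v w assume "v \<in> pends" "w \<in> pends" "{v, mate v} = {w, mate w}"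
    then show "v = w" using mate_in[of w] pends_in[of v] by (auto simp: doubleton_eq_iff)
  qed
  have notin: "{[], [0]} \<notin> (\<lambda>v. {v, mate v}) ` pends" if "s [] = Bare"
  proof
    assume "{[], [0]} \<in> (\<lambda>v. {v, mate v}) ` pends"
    then obtain v where v: "v \<in> pends" "{[], [0]} = {v, mate v}" by blast
    then have "v = [] \<or> v = [0]" by blast
    then show False using pends_in[OF v(1)] that root_pair[OF that] by auto
  qed
  have "card (\<Union>pairs) = (\<Sum>e\<in>pairs. card e)"
    using pairs_disjoint two by (intro card_Union_disjoint) (auto simp: card_ge_0_finite)
  also have "\<dots> = 2 * card pairs" using two by simp
  also have "card pairs = target"
    using finite_pends inj notin by (auto simp: pairs_def target_def card_image)
  finally show ?thesis .
qed

lemma paired_dominating_set_pairs: "paired_dominating_set G (\<Union>pairs)"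
  unfolding paired_dominating_set_def
proof (intro conjI ballI)
  show "\<Union>pairs \<subseteq> verts G" using Union_pairs_subset by simp
  have pend: "v \<in> \<Union>pairs" if "v \<in> pends" for v
    using that by (auto simp: pairs_def)
  have matched: "v \<in> \<Union>pairs" if v: "v \<in> T" "s v = Matched" for v
  proof -
    from v obtain i where i: "pend_child v = v @ [i]" "i < c v" "s (v @ [i]) = Pend" by (rule pend_child)
    then have "v @ [i] \<in> pends" "mate (v @ [i]) = v" using v by (auto simp: pends_def mate_def)
    then show ?thesis by (auto simp: pairs_def intro!: bexI[of _ "v @ [i]"])
  qed
  fix v assume v: "v \<in> verts G - \<Union>pairs"
  then have vT: "v \<in> T" by simp
  show "\<exists>u\<in>\<Union>pairs. {u, v} \<in> edges G"
  proof (cases "s v")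
    case Pend then show ?thesis using v pend by (auto simp: pends_def)
  next
    case Matched then show ?thesis using v matched by auto
  next
    case Covered
    then obtain i where "i < c v" "s (v @ [i]) = Matched" using label_Covered_imp vT by blast
    then have "v @ [i] \<in> \<Union>pairs" "{v @ [i], v} \<in> edges G"
      using vT matched[of "v @ [i]"] edge_snoc[of v i] by (simp_all add: insert_commute)
    then show ?thesis by blast
  next
    case Bare
    show ?thesis
    proof (cases v rule: rev_cases)
      case Nil
      then show ?thesis using v Bare by (auto simp: pairs_def)
    next
      case (snoc w i)
      then have w: "w \<in> T" "i < c w" using vT by auto
      \<comment> \<open>A \<open>Bare\<close> child makes its parent \<open>Pend\<close>, or
        \<open>Matched\<close> if there is also a \<open>Pend\<close> sibling; either way the parent
        has been taken.\<close>
      have "s w = Matched \<or> s w = Pend"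
        using label_Matched_iff[OF w(1)] label_Pend_iff[OF w(1)] w(2) Bare snoc by blast
      then have "w \<in> \<Union>pairs" using pend matched w by (auto simp: pends_def)
      then show ?thesis using w snoc edge_snoc[of w i] by blast
    qed
  qed
next
  have "perfect_matching (induced_subgraph G (\<Union>pairs)) pairs"
    unfolding perfect_matching_def
  proof (intro conjI)
    show "pairs \<subseteq> edges (induced_subgraph G (\<Union>pairs))"
      using pairs_edges by (auto simp: induced_subgraph_def edges_def)
    show "\<Union>pairs = verts (induced_subgraph G (\<Union>pairs))"
      using Union_pairs_subset by (simp add: induced_subgraph_def verts_def[of "(_, _)"] Int_absorb1)
  qed (rule pairs_disjoint)
  then show "\<exists>N. perfect_matching (induced_subgraph G (\<Union>pairs)) N" ..
qed

theorem paired_domination_number_eq: "paired_domination_number G = 2 * target"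
  unfolding paired_domination_number_def
proof (rule antisym)
  have "finite (\<Union>pairs)" using Union_pairs_subset finite_tree by (rule finite_subset)
  then have mem: "2 * target \<in> card ` {S. finite S \<and> paired_dominating_set G S}"
    using paired_dominating_set_pairs
    by (intro image_eqI[where x = "\<Union>pairs"]) (simp_all only: card_Union_pairs mem_Collect_eq simp_thms)
  then show "Inf (card ` {S. finite S \<and> paired_dominating_set G S}) \<le> 2 * target"
    by (intro cInf_lower) simp_all
  show "2 * target \<le> Inf (card ` {S. finite S \<and> paired_dominating_set G S})"
  proof (rule cInf_greatest)
    show "card ` {S. finite S \<and> paired_dominating_set G S} \<noteq> {}" using mem by blast
  next
    fix k assume "k \<in> card ` {S. finite S \<and> paired_dominating_set G S}"
    then obtain S where "finite S" "paired_dominating_set G S" "k = card S" by blast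
    then show "2 * target \<le> k" using paired_dominating_set_lower by simp
  qed
qed

end

section \<open>Labelled Galton--Watson trees\<close>

text \<open>A countable datatype for the finite plane trees: it turns the Galton--Watson law into a
  \<open>pmf\<close> and makes structural recursion available. \<open>shape\<close> leads back to
  the vertex sets.\<close>

datatype tree = Node (children: "tree list")

instance tree :: countable
  by countable_datatype

primrec label :: "tree \<Rightarrow> state" where
  "label (Node ts) = combine (set (map label ts))"

primrec nodes :: "tree \<Rightarrow> nat" where
  "nodes (Node ts) = Suc (sum_list (map nodes ts))"

primrec pend_count :: "tree \<Rightarrow> nat" where
  "pend_count (Node ts) = of_bool (label (Node ts) = Pend) + sum_list (map pend_count ts)"

primrec weight :: "nat pmf \<Rightarrow> tree \<Rightarrow> real" where
  "weight \<xi> (Node ts) = pmf \<xi> (length ts) * prod_list (map (weight \<xi>) ts)"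

text \<open>The 0 returned off the tree is a default: \<open>plane_tree\<close> asks for the degree
  only at vertices that it has already reached. The same holds for \<open>Bare\<close> in
  \<open>label_at\<close>.\<close>

fun deg :: "tree \<Rightarrow> nat list \<Rightarrow> nat" where
  "deg (Node ts) [] = length ts"
| "deg (Node ts) (i # u) = (if i < length ts then deg (ts ! i) u else 0)"

fun label_at :: "tree \<Rightarrow> nat list \<Rightarrow> state" where
  "label_at t [] = label t"
| "label_at (Node ts) (i # u) = (if i < length ts then label_at (ts ! i) u else Bare)"

abbreviation shape :: "tree \<Rightarrow> nat list set" where
  "shape t \<equiv> plane_tree (deg t)"

lemma Cons_in_plane_tree_iff:
  "i # u \<in> plane_tree c \<longleftrightarrow> i < c [] \<and> u \<in> plane_tree (\<lambda>v. c (i # v))"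
proof (induction u rule: rev_induct)
  case Nil
  then show ?case using snoc_in_plane_tree_iff[of "[]" i c] by (auto simp: plane_tree.root)
next
  case (snoc j u)
  then show ?case using snoc_in_plane_tree_iff[of "i # u" j c] by auto
qed

lemma plane_tree_decompose:
  "plane_tree c = insert [] (\<Union>i<c []. (#) i ` plane_tree (\<lambda>v. c (i # v)))"
proof -
  have "u \<in> plane_tree c \<longleftrightarrow> u \<in> insert [] (\<Union>i<c []. (#) i ` plane_tree (\<lambda>v. c (i # v)))" for u
    by (cases u) (auto simp: plane_tree.root Cons_in_plane_tree_iff)
  then show ?thesis by blast
qed

lemma shape_Node: "shape (Node ts) = insert [] (\<Union>i<length ts. (#) i ` shape (ts ! i))"
  by (subst plane_tree_decompose) simp

lemma finite_shape: "finite (shape t)"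
  by (induction t) (auto simp: shape_Node)

lemma sum_shape_Node:
  fixes f :: "nat list \<Rightarrow> nat"
  shows "(\<Sum>u\<in>shape (Node ts). f u) = f [] + (\<Sum>i<length ts. \<Sum>u\<in>shape (ts ! i). f (i # u))"
proof -
  have "(\<Sum>u\<in>shape (Node ts). f u) = f [] + (\<Sum>u\<in>(\<Union>i<length ts. (#) i ` shape (ts ! i)). f u)"
    unfolding shape_Node by (subst sum.insert) (auto simp: finite_shape)
  also have "(\<Sum>u\<in>(\<Union>i<length ts. (#) i ` shape (ts ! i)). f u) =
      (\<Sum>i<length ts. \<Sum>u\<in>(#) i ` shape (ts ! i). f u)"
    by (rule sum.UNION_disjoint) (auto simp: finite_shape)
  finally show ?thesis by (simp add: sum.reindex)
qed

lemma prod_shape_Node: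
  fixes f :: "nat list \<Rightarrow> real"
  shows "(\<Prod>u\<in>shape (Node ts). f u) = f [] * (\<Prod>i<length ts. \<Prod>u\<in>shape (ts ! i). f (i # u))"
proof -
  have "(\<Prod>u\<in>shape (Node ts). f u) = f [] * (\<Prod>u\<in>(\<Union>i<length ts. (#) i ` shape (ts ! i)). f u)"
    unfolding shape_Node by (subst prod.insert) (auto simp: finite_shape)
  also have "(\<Prod>u\<in>(\<Union>i<length ts. (#) i ` shape (ts ! i)). f u) =
      (\<Prod>i<length ts. \<Prod>u\<in>(#) i ` shape (ts ! i). f u)"
    by (rule prod.UNION_disjoint) (auto simp: finite_shape)
  finally show ?thesis by (simp add: prod.reindex)
qed

lemma card_shape: "card (shape t) = nodes t"
proof (induction t)
  case (Node ts)
  have "card (shape (Node ts)) = (\<Sum>u\<in>shape (Node ts). 1)" by simp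
  also have "\<dots> = 1 + (\<Sum>i<length ts. card (shape (ts ! i)))"
    by (subst sum_shape_Node) simp
  also have "\<dots> = nodes (Node ts)"
    using Node by (simp add: sum_list_sum_nth atLeast0LessThan)
  finally show ?case .
qed

lemma card_Pend_shape: "card {u \<in> shape t. label_at t u = Pend} = pend_count t"
proof (induction t)
  case (Node ts)
  have eq: "card {u \<in> shape t. label_at t u = Pend} = (\<Sum>u\<in>shape t. of_bool (label_at t u = Pend))" for t
    using finite_shape[of t] by (simp add: sum.If_cases of_bool_def Int_def)
  show ?case
    using Node unfolding eq
    by (subst sum_shape_Node) (simp add: sum_list_sum_nth atLeast0LessThan)
qed

lemma prod_pmf_shape: "(\<Prod>u\<in>shape t. pmf \<xi> (deg t u)) = weight \<xi> t"
proof (induction t)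
  case (Node ts)
  then show ?case
    by (subst prod_shape_Node) (simp add: prod.list_conv_set_nth atLeast0LessThan)
qed

lemma label_at_shape:
  "u \<in> shape t \<Longrightarrow> label_at t u = combine ((\<lambda>i. label_at t (u @ [i])) ` {..<deg t u})"
proof (induction u arbitrary: t)
  case Nil
  obtain ts where t: "t = Node ts" by (cases t)
  have "set ts = (!) ts ` {..<length ts}" by (auto simp: set_conv_nth)
  then show ?case unfolding t by (simp add: image_image)
next
  case (Cons i u)
  obtain ts where t: "t = Node ts" by (cases t)
  with Cons.prems have i: "i < length ts" by (simp add: Cons_in_plane_tree_iff)
  with Cons.prems t have "u \<in> shape (ts ! i)" by (simp add: Cons_in_plane_tree_iff)
  from Cons.IH[OF this] show ?case using i by (simp add: t)
qed

lemma shape_inj: "shape t = shape t' \<Longrightarrow> t = t'"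
proof (induction t arbitrary: t')
  case (Node ts)
  obtain ts' where t': "t' = Node ts'" by (cases t')
  have eq: "i # u \<in> shape (Node ts) \<longleftrightarrow> i # u \<in> shape (Node ts')" for i u
    using Node.prems t' by simp
  have mem: "i < length ts \<longleftrightarrow> i < length ts'" for i
    using eq[of i "[]"] by (simp add: Cons_in_plane_tree_iff plane_tree.root)
  then have len: "length ts = length ts'" by (meson linorder_neqE_nat less_irrefl)
  have "ts ! i = ts' ! i" if "i < length ts" for i
  proof (rule Node.IH)
    show "ts ! i \<in> set ts" using that by simp
    show "shape (ts ! i) = shape (ts' ! i)"
      using eq[of i] that len by (auto simp: Cons_in_plane_tree_iff)
  qed
  then show ?case using len t' by (simp add: list_eq_iff_nth_eq)
qed

text \<open>Induction on the number of vertices: the subtree at a child, moved to the origin, is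
  smaller because the root is lost. Together with \<open>shape_inj\<close> this makes the datatype a
  faithful copy of the finite plane trees.\<close>

lemma shape_surj:
  assumes "finite (plane_tree c)"
  shows "\<exists>t. shape t = plane_tree c"
  using assms
proof (induction "card (plane_tree c)" arbitrary: c rule: less_induct)
  case less
  have "\<exists>t. shape t = plane_tree (\<lambda>v. c (i # v))" if i: "i < c []" for i
  proof (rule less.hyps)
    have sub: "(#) i ` plane_tree (\<lambda>v. c (i # v)) \<subset> plane_tree c"
      using i by (auto simp: Cons_in_plane_tree_iff plane_tree.root)
    have "finite ((#) i ` plane_tree (\<lambda>v. c (i # v)))"
      using sub less.prems by (meson finite_subset psubset_imp_subset)
    then show "finite (plane_tree (\<lambda>v. c (i # v)))" by (rule finite_imageD) simp
    have "card (plane_tree (\<lambda>v. c (i # v))) = card ((#) i ` plane_tree (\<lambda>v. c (i # v)))"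
      by (simp add: card_image)
    also have "\<dots> < card (plane_tree c)" using sub less.prems by (rule psubset_card_mono[rotated])
    finally show "card (plane_tree (\<lambda>v. c (i # v))) < card (plane_tree c)" .
  qed
  then obtain f where f: "\<And>i. i < c [] \<Longrightarrow> shape (f i) = plane_tree (\<lambda>v. c (i # v))" by metis
  have "shape (Node (map f [0..<c []])) = plane_tree c"
    using f by (subst (2) plane_tree_decompose) (simp add: shape_Node)
  then show ?case ..
qed

text \<open>The single vertex is excluded because it has no paired dominating set. The
  \<open>Bare\<close> term is the extra pair at the root; being at most 1, it will disappear on the
  scale \<surd>n.\<close>

lemma paired_domination_number_shape:
  assumes "nodes t > 1"
  shows "paired_domination_number (tree_graph (shape t)) =
    2 * (pend_count t + of_bool (label t = Bare))"
proof -
  have "deg t [] > 0" using assms by (cases t) auto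
  then interpret labelled_plane_tree "deg t" "label_at t"
    using label_at_shape finite_shape by unfold_locales auto
  show ?thesis
    using paired_domination_number_eq card_Pend_shape[of t]
    by (simp add: target_def pends_def)
qed

lemma weight_nonneg: "weight \<xi> t \<ge> 0"
  unfolding prod_pmf_shape[symmetric] by (simp add: prod_nonneg)

lemma prob_shape: "measure (offspring_space \<xi>) {\<omega>. plane_tree \<omega> = shape t} = weight \<xi> t"
  using prob_plane_tree_eq[OF finite_shape, of \<xi> t] by (simp add: prod_pmf_shape)

section \<open>The Galton--Watson law as a discrete distribution\<close>

lemma emeasure_finite_plane_tree:
  "emeasure (offspring_space \<xi>) {\<omega>. finite (plane_tree \<omega>) \<and> Q (plane_tree \<omega>)} =
     (\<integral>\<^sup>+t. ennreal (weight \<xi> t) \<partial>count_space {t. Q (shape t)})"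
proof -
  interpret prob_space "offspring_space \<xi>" by (rule prob_space_offspring_space)
  have "{\<omega>. finite (plane_tree \<omega>) \<and> Q (plane_tree \<omega>)} =
      (\<Union>t\<in>{t. Q (shape t)}. {\<omega>. plane_tree \<omega> = shape t})" (is "?A = ?B")
  proof (intro set_eqI iffI)
    fix \<omega> assume "\<omega> \<in> ?A"
    with shape_surj[of \<omega>] obtain t where "shape t = plane_tree \<omega>" "Q (shape t)" by auto
    then show "\<omega> \<in> ?B" by (auto intro!: exI[of _ t])
  next
    fix \<omega> assume "\<omega> \<in> ?B"
    then show "\<omega> \<in> ?A" using finite_shape by auto
  qed
  moreover have [measurable]: "{\<omega>. plane_tree \<omega> = shape t} \<in> sets (offspring_space \<xi>)" for t
    using plane_tree_eq_measurable[of "shape t" \<xi>] by (simp add: pred_def)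
  moreover have "disjoint_family_on (\<lambda>t. {\<omega>. plane_tree \<omega> = shape t}) {t. Q (shape t)}"
    unfolding disjoint_family_on_def using shape_inj by blast
  ultimately have "emeasure (offspring_space \<xi>) {\<omega>. finite (plane_tree \<omega>) \<and> Q (plane_tree \<omega>)} =
     (\<integral>\<^sup>+t. emeasure (offspring_space \<xi>) {\<omega>. plane_tree \<omega> = shape t} \<partial>count_space {t. Q (shape t)})"
    by (simp only:) (rule emeasure_UN_countable, simp_all)
  then show ?thesis by (simp add: emeasure_eq_measure prob_shape)
qed

lemma nn_integral_lists_weight:
  "(\<integral>\<^sup>+ts. ennreal (prod_list (map (weight \<xi>) ts)) * indicator {ts. length ts = k} ts \<partial>count_space UNIV) =
     (\<integral>\<^sup>+t. ennreal (weight \<xi> t) \<partial>count_space UNIV) ^ k"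
proof (induction k)
  case 0
  have "(\<integral>\<^sup>+ts. ennreal (prod_list (map (weight \<xi>) ts)) * indicator {ts. length ts = 0} ts \<partial>count_space UNIV)
     = (\<integral>\<^sup>+ts. indicator {[] :: tree list} ts \<partial>count_space UNIV)"
    by (intro nn_integral_cong) (auto simp: indicator_def)
  then show ?case by simp
next
  case (Suc k)
  let ?w = "\<lambda>ts. ennreal (prod_list (map (weight \<xi>) ts))"
  have "(\<integral>\<^sup>+ts. ?w ts * indicator {ts. length ts = Suc k} ts \<partial>count_space UNIV) =
     (\<integral>\<^sup>+ts. ?w ts * indicator {ts. length ts = Suc k} ts \<partial>count_space {ts. ts \<noteq> []})"
    by (rule nn_integral_count_space_eq) (auto simp: indicator_def)
  also have "\<dots> = (\<integral>\<^sup>+z. ?w (fst z # snd z) * indicator {ts. length ts = Suc k} (fst z # snd z) \<partial>count_space UNIV)"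
    by (rule nn_integral_bij_count_space[symmetric], rule bij_betwI[where g = "\<lambda>ts. (hd ts, tl ts)"]) auto
  also have "\<dots> = (\<integral>\<^sup>+z. (case z of (t, ts) \<Rightarrow> ennreal (weight \<xi> t) * (?w ts * indicator {ts. length ts = k} ts)) \<partial>count_space UNIV)"
    by (intro nn_integral_cong)
       (auto simp: indicator_def weight_nonneg ennreal_mult' split: prod.splits)
  also have "\<dots> = (\<integral>\<^sup>+t. \<integral>\<^sup>+ts. ennreal (weight \<xi> t) * (?w ts * indicator {ts. length ts = k} ts) \<partial>count_space UNIV \<partial>count_space UNIV)"
    by (subst nn_integral_fst_count_space[symmetric]) simp
  also have "\<dots> = (\<integral>\<^sup>+t. ennreal (weight \<xi> t) \<partial>count_space UNIV) ^ Suc k"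
    by (simp add: nn_integral_cmult nn_integral_multc Suc)
  finally show ?case .
qed

text \<open>The total weight of the finite trees is the extinction probability; splitting off the
  root makes it a fixed point of the offspring generating function.\<close>

lemma nn_integral_weight_fixpoint:
  "(\<integral>\<^sup>+t. ennreal (weight \<xi> t) \<partial>count_space UNIV) =
    (\<integral>\<^sup>+k. (\<integral>\<^sup>+t. ennreal (weight \<xi> t) \<partial>count_space UNIV) ^ k \<partial>measure_pmf \<xi>)"
proof -
  let ?w = "\<lambda>ts. ennreal (prod_list (map (weight \<xi>) ts))"
  have "(\<integral>\<^sup>+t. ennreal (weight \<xi> t) \<partial>count_space UNIV) =
      (\<integral>\<^sup>+ts. ennreal (weight \<xi> (Node ts)) \<partial>count_space UNIV)"
    by (rule nn_integral_bij_count_space[symmetric]) (auto intro!: bij_betwI[where g = children])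
  also have "\<dots> = (\<integral>\<^sup>+ts. \<integral>\<^sup>+k. ennreal (pmf \<xi> k) * (?w ts * indicator {ts. length ts = k} ts)
      \<partial>count_space UNIV \<partial>count_space UNIV)"
  proof (intro nn_integral_cong)
    fix ts :: "tree list"
    have "(\<integral>\<^sup>+k. ennreal (pmf \<xi> k) * (?w ts * indicator {ts. length ts = k} ts) \<partial>count_space UNIV) =
      (\<integral>\<^sup>+k. ennreal (weight \<xi> (Node ts)) * indicator {length ts} k \<partial>count_space UNIV)"
      by (intro nn_integral_cong)
         (auto simp: indicator_def ennreal_mult')
    then show "ennreal (weight \<xi> (Node ts)) =
      (\<integral>\<^sup>+k. ennreal (pmf \<xi> k) * (?w ts * indicator {ts. length ts = k} ts) \<partial>count_space UNIV)"
      by simp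
  qed
  also have "\<dots> = (\<integral>\<^sup>+k. \<integral>\<^sup>+ts. ennreal (pmf \<xi> k) * (?w ts * indicator {ts. length ts = k} ts)
      \<partial>count_space UNIV \<partial>count_space UNIV)"
    using nn_integral_fst_count_space[of "\<lambda>(ts, k). ennreal (pmf \<xi> k) * (?w ts * indicator {ts. length ts = k} ts)"]
      nn_integral_snd_count_space[of "\<lambda>(ts, k). ennreal (pmf \<xi> k) * (?w ts * indicator {ts. length ts = k} ts)"]
    by simp
  also have "\<dots> = (\<integral>\<^sup>+k. ennreal (pmf \<xi> k) * (\<integral>\<^sup>+t. ennreal (weight \<xi> t) \<partial>count_space UNIV) ^ k \<partial>count_space UNIV)"
    by (simp add: nn_integral_cmult nn_integral_lists_weight)
  also have "\<dots> = (\<integral>\<^sup>+k. (\<integral>\<^sup>+t. ennreal (weight \<xi> t) \<partial>count_space UNIV) ^ k \<partial>measure_pmf \<xi>)"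
    by (simp add: nn_integral_measure_pmf)
  finally show ?thesis .
qed

locale critical_offspring =
  fixes \<xi> :: "nat pmf"
  assumes mean: "measure_pmf.expectation \<xi> real = 1"
    and finite_variance: "integrable (measure_pmf \<xi>) (\<lambda>k. (real k)\<^sup>2)"
    and positive_variance: "0 < measure_pmf.variance \<xi> real"
    and zero: "pmf \<xi> 0 > 0"
    and aperiodic: "Gcd {i. pmf \<xi> i > 0} = 1"
begin

lemma integrable_offspring: "integrable (measure_pmf \<xi>) real"
  by (rule measure_pmf.square_integrable_imp_integrable) (use finite_variance in auto)

text \<open>An offspring number that is at most 1 equals its own square, so the second moment would
  be 1 and the variance 0.\<close>

lemma ex_branching: "\<exists>j\<ge>2. pmf \<xi> j > 0"
proof (rule ccontr)
  assume "\<not> ?thesis"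
  note no = this
  have le: "j \<le> 1" if "j \<in> set_pmf \<xi>" for j
  proof -
    have "\<not> 2 \<le> j" using that pmf_positive[of j \<xi>] no by blast
    then show ?thesis by simp
  qed
  have "AE j in measure_pmf \<xi>. real j = (real j)\<^sup>2"
    using le by (fastforce simp: AE_measure_pmf_iff le_Suc_eq)
  then have "measure_pmf.expectation \<xi> (\<lambda>j. (real j)\<^sup>2) = 1"
    using integral_cong_AE[of real "measure_pmf \<xi>" "\<lambda>j. (real j)\<^sup>2"] mean by simp
  moreover have "measure_pmf.variance \<xi> real =
      measure_pmf.expectation \<xi> (\<lambda>j. (real j)\<^sup>2) - (measure_pmf.expectation \<xi> real)\<^sup>2"
    by (rule measure_pmf.variance_eq[OF integrable_offspring finite_variance])
  ultimately show False using positive_variance mean by simp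
qed

text \<open>Since the mean is 1, the difference of the two sides is the expectation of the Bernoulli
  remainder \<open>d\<close>. This is nonnegative everywhere and strictly positive at a value j
  \<ge> 2, which occurs by \<open>ex_branching\<close>.\<close>

lemma pgf_above_diagonal:
  fixes r :: real
  assumes "0 \<le> r" "r < 1"
  shows "r < measure_pmf.expectation \<xi> (\<lambda>k. r ^ k)"
proof -
  have int: "integrable (measure_pmf \<xi>) (\<lambda>k. r ^ k)"
    using assms by (intro measure_pmf.integrable_const_bound[where B = 1]) (auto simp: power_le_one)
  define d where "d k = r ^ k - 1 + real k * (1 - r)" for k
  have d0: "d k \<ge> 0" for k
    using Bernoulli_inequality[of "r - 1" k] assms by (simp add: d_def algebra_simps)
  obtain j where j: "j \<ge> 2" "pmf \<xi> j > 0" using ex_branching by blast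
  have id: "integrable (measure_pmf \<xi>) d"
    unfolding d_def by (intro Bochner_Integration.integrable_add Bochner_Integration.integrable_diff int
      integrable_mult_left integrable_offspring) auto
  have dj: "d j > 0"
  proof -
    have 1: "d (Suc k) = d k + (1 - r) * (1 - r ^ k)" for k
      by (simp add: d_def algebra_simps)
    have "d j = d (j - 1) + (1 - r) * (1 - r ^ (j - 1))"
      using 1[of "j - 1"] j by simp
    moreover have "r ^ (j - 1) < 1"
      using assms j by (intro power_less_one_iff[THEN iffD2]) auto
    ultimately show ?thesis using d0[of "j - 1"] assms by (simp add: add_nonneg_pos)
  qed
  have "0 < measure_pmf.expectation \<xi> d"
  proof (rule ccontr)
    assume "\<not> ?thesis"
    then have "measure_pmf.expectation \<xi> d = 0"
      using Bochner_Integration.integral_nonneg[of "measure_pmf \<xi>" d] d0 by (simp add: antisym)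
    then have "AE k in measure_pmf \<xi>. d k = 0"
      using integral_nonneg_eq_0_iff_AE[OF id] d0 by simp
    then show False using j dj by (auto simp: AE_measure_pmf_iff set_pmf_iff)
  qed
  also have "measure_pmf.expectation \<xi> d = measure_pmf.expectation \<xi> (\<lambda>k. r ^ k) - 1 + (1 - r)"
    unfolding d_def using int integrable_offspring mean by simp
  finally show ?thesis by simp
qed

text \<open>The total weight is at most 1 and a fixed point of the generating function, which has no
  fixed point below 1 by \<open>pgf_above_diagonal\<close>. So the critical tree is almost surely
  finite and \<open>weight\<close> is a probability mass function.\<close>

lemma nn_integral_weight: "(\<integral>\<^sup>+t. ennreal (weight \<xi> t) \<partial>count_space UNIV) = 1"
proof -
  let ?y = "\<integral>\<^sup>+t. ennreal (weight \<xi> t) \<partial>count_space UNIV"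
  interpret prob_space "offspring_space \<xi>" by (rule prob_space_offspring_space)
  have "?y \<le> 1"
    using emeasure_finite_plane_tree[of \<xi> "\<lambda>_. True"]
      emeasure_le_1[of "{\<omega>. finite (plane_tree \<omega>)}"] by simp
  then obtain r where r: "?y = ennreal r" "0 \<le> r" "r \<le> 1"
    by (cases ?y) (auto simp: top_unique)
  have "ennreal r = (\<integral>\<^sup>+k. ennreal r ^ k \<partial>measure_pmf \<xi>)"
    using nn_integral_weight_fixpoint[of \<xi>] r by simp
  also have "\<dots> = (\<integral>\<^sup>+k. ennreal (r ^ k) \<partial>measure_pmf \<xi>)"
    by (intro nn_integral_cong) (rule ennreal_power[OF r(2)])
  also have "\<dots> = ennreal (measure_pmf.expectation \<xi> (\<lambda>k. r ^ k))"
    using r by (intro nn_integral_eq_integral)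
      (auto simp: power_le_one intro!: measure_pmf.integrable_const_bound[where B = 1])
  finally have "r = measure_pmf.expectation \<xi> (\<lambda>k. r ^ k)"
    using r by (simp add: integral_nonneg)
  with pgf_above_diagonal[of r] r have "r = 1" by force
  then show ?thesis using r by simp
qed

definition GW :: "tree pmf" where
  "GW = embed_pmf (weight \<xi>)"

lemma pmf_GW: "pmf GW t = weight \<xi> t"
  unfolding GW_def by (rule pmf_embed_pmf) (auto simp: weight_nonneg nn_integral_weight)

lemma emeasure_offspring_eq_GW:
  "emeasure (offspring_space \<xi>) {\<omega>. finite (plane_tree \<omega>) \<and> Q (plane_tree \<omega>)} =
     emeasure (measure_pmf GW) {t. Q (shape t)}"
  unfolding emeasure_finite_plane_tree pmf_GW[symmetric] by (rule nn_integral_pmf)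

end

section \<open>Decomposition into blocks\<close>

text \<open>Infinite sets go to the default \<open>Node []\<close>, which makes this a measurable
  function on the whole offspring space; the conditioned spaces do not charge infinite
  trees.\<close>

definition tree_of :: "nat list set \<Rightarrow> tree" where
  "tree_of S = (if finite S then SOME t. shape t = S else Node [])"

lemma tree_of_shape [simp]: "tree_of (shape t) = t"
  unfolding tree_of_def using finite_shape[of t] by (auto intro: some_equality shape_inj)

lemma shape_tree_of: "finite (plane_tree c) \<Longrightarrow> shape (tree_of (plane_tree c)) = plane_tree c"
  using shape_surj[of c] by (metis tree_of_shape)

lemma tree_of_measurable:
  "(\<lambda>\<omega>. tree_of (plane_tree \<omega>)) \<in> measurable (offspring_space \<xi>) (count_space UNIV)"
proof -
  have [measurable]: "Measurable.pred (offspring_space \<xi>) (\<lambda>\<omega>. finite (plane_tree \<omega>))"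
    using finite_plane_tree_measurable[where P = "\<lambda>_. True"] by simp
  have [measurable]:
    "Measurable.pred (offspring_space \<xi>) (\<lambda>\<omega>. finite (plane_tree \<omega>) \<and> tree_of (plane_tree \<omega>) = t)" for t
    by (rule finite_plane_tree_measurable)
  have "Measurable.pred (offspring_space \<xi>) (\<lambda>\<omega>. tree_of (plane_tree \<omega>) = t)" for t
  proof -
    have "(\<lambda>\<omega>. tree_of (plane_tree \<omega>) = t) = (\<lambda>\<omega>. (finite (plane_tree \<omega>) \<and> tree_of (plane_tree \<omega>) = t) \<or>
            (\<not> finite (plane_tree \<omega>) \<and> t = Node []))"
      by (auto simp: tree_of_def)
    then show ?thesis by simp
  qed
  then show ?thesis
    by (intro measurable_count_space_eq2_countable[THEN iffD2]) (auto simp: pred_def vimage_def)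
qed

section \<open>Products and disintegration of discrete laws\<close>

lemma pmf_replicate_pmf:
  "pmf (replicate_pmf k p) xs = (if length xs = k then prod_list (map (pmf p) xs) else 0)"
proof (induction k arbitrary: xs)
  case 0
  then show ?case by (auto simp: indicator_def)
next
  case (Suc k)
  have eq: "replicate_pmf (Suc k) p = map_pmf (\<lambda>(x, xs). x # xs) (pair_pmf p (replicate_pmf k p))"
    by (simp add: pair_pmf_def map_bind_pmf map_pmf_def[symmetric] bind_return_pmf)
       (simp add: map_pmf_def bind_assoc_pmf bind_return_pmf)
  have inj: "inj_on (\<lambda>(x, xs). x # xs) A" for A :: "('a \<times> 'a list) set"
    by (auto intro!: inj_onI)
  show ?case
  proof (cases xs)
    case Nil
    have "pmf (replicate_pmf (Suc k) p) [] = 0"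
      unfolding eq by (subst pmf_map_outside) auto
    then show ?thesis using Nil by simp
  next
    case (Cons y ys)
    have "pmf (replicate_pmf (Suc k) p) ((\<lambda>(x, xs). x # xs) (y, ys)) = pmf (pair_pmf p (replicate_pmf k p)) (y, ys)"
      unfolding eq by (rule pmf_map_inj') (use inj in auto)
    then show ?thesis using Cons Suc by (simp add: pmf_pair)
  qed
qed

lemma expectation_bind_pmf:
  fixes f :: "'a \<Rightarrow> real"
  assumes "\<And>x. \<bar>f x\<bar> \<le> B"
  shows "measure_pmf.expectation (bind_pmf M K) f =
    measure_pmf.expectation M (\<lambda>x. measure_pmf.expectation (K x) f)"
  unfolding measure_pmf_bind
  by (rule integral_bind[where K = "count_space UNIV" and B = B and B' = 1])
     (use assms in \<open>auto intro!: measure_pmf_in_subprob_space\<close>)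

lemma expectation_prod_list_replicate_pmf:
  fixes f :: "'a \<Rightarrow> real"
  assumes "\<And>x. \<bar>f x\<bar> \<le> 1"
  shows "measure_pmf.expectation (replicate_pmf k p) (\<lambda>xs. prod_list (map f xs)) =
    measure_pmf.expectation p f ^ k"
proof (induction k)
  case (Suc k)
  have b: "\<bar>prod_list (map f xs)\<bar> \<le> 1" for xs
    by (induction xs) (auto simp: abs_mult intro!: mult_le_one assms)
  show ?case
    using Suc assms
    by (simp add: expectation_bind_pmf[where B = 1] b mult_le_one abs_mult)
qed simp

text \<open>Summing over \<open>l\<close> shows that \<open>c\<close> is the first marginal, so the
  factorisation says that, given the first coordinate \<open>r\<close>, the second is drawn from
  \<open>K r\<close>. It spares a direct computation of that marginal.\<close>

lemma pmf_disintegrate: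
  assumes "\<And>r l. pmf M (r, l) = c r * pmf (K r) l"
  shows "M = bind_pmf (map_pmf fst M) (\<lambda>r. map_pmf (Pair r) (K r))"
proof (rule pmf_eqI)
  fix z :: "'a \<times> 'b"
  obtain r l where z: "z = (r, l)" by (cases z)
  have c0: "c r \<ge> 0" for r
  proof (rule ccontr)
    assume "\<not> c r \<ge> 0"
    moreover obtain l where "pmf (K r) l > 0"
      using set_pmf_not_empty[of "K r"] pmf_positive by fastforce
    ultimately have "pmf M (r, l) < 0" using assms by (simp add: mult_neg_pos)
    then show False by (simp add: pmf_nonneg leD)
  qed
  have "ennreal (pmf (map_pmf fst M) r) = emeasure (measure_pmf M) (fst -` {r})"
    by (simp add: emeasure_pmf_single[symmetric])
  also have "\<dots> = (\<integral>\<^sup>+z. pmf M z \<partial>count_space (fst -` {r}))"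
    by (simp add: nn_integral_pmf)
  also have "\<dots> = (\<integral>\<^sup>+l. pmf M (r, l) \<partial>count_space UNIV)"
    by (rule nn_integral_bij_count_space[symmetric], rule bij_betwI[where g = snd]) auto
  also have "\<dots> = (\<integral>\<^sup>+l. ennreal (c r) * pmf (K r) l \<partial>count_space UNIV)"
    by (simp add: assms ennreal_mult' c0)
  also have "\<dots> = ennreal (c r)"
    by (simp add: nn_integral_cmult nn_integral_pmf measure_pmf.emeasure_space_1[simplified])
  finally have c: "pmf (map_pmf fst M) r = c r" using c0 by simp
  have "pmf (bind_pmf (map_pmf fst M) (\<lambda>r. map_pmf (Pair r) (K r))) (r, l) =
      measure_pmf.expectation (map_pmf fst M) (\<lambda>r'. indicator {r} r' * pmf (K r) l)"
    unfolding pmf_bind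
  proof (rule Bochner_Integration.integral_cong[OF refl])
    fix r'
    show "pmf (map_pmf (Pair r') (K r')) (r, l) = indicator {r} r' * pmf (K r) l"
    proof (cases "r' = r")
      case True
      then show ?thesis by (simp add: pmf_map_inj' inj_on_def)
    next
      case False
      then show ?thesis by (simp add: pmf_map_outside image_iff)
    qed
  qed
  also have "\<dots> = c r * pmf (K r) l"
    by (simp add: c[symmetric] measure_pmf_single)
  finally show "pmf M z = pmf (bind_pmf (map_pmf fst M) (\<lambda>r. map_pmf (Pair r) (K r))) z"
    using assms z by simp
qed

section \<open>Cutting a tree at its topmost \<open>Pend\<close> vertices\<close>

datatype skel = Mark | Skel "skel list"

text \<open>A \<open>Mark\<close> stands for a \<open>Pend\<close> vertex that was cut off with its
  whole subtree. \<open>marks\<close> counts these cuts, \<open>inner\<close> the vertices that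
  stay, and \<open>skel_label\<close> recomputes labels with every \<open>Mark\<close> read as
  \<open>Pend\<close>.\<close>

primrec marks :: "skel \<Rightarrow> nat" where
  "marks Mark = 1"
| "marks (Skel rs) = sum_list (map marks rs)"

primrec inner :: "skel \<Rightarrow> nat" where
  "inner Mark = 0"
| "inner (Skel rs) = Suc (sum_list (map inner rs))"

primrec skel_label :: "skel \<Rightarrow> state" where
  "skel_label Mark = Pend"
| "skel_label (Skel rs) = combine (set (map skel_label rs))"

primrec skel_weight :: "nat pmf \<Rightarrow> skel \<Rightarrow> real" where
  "skel_weight \<xi> Mark = 1"
| "skel_weight \<xi> (Skel rs) = pmf \<xi> (length rs) * prod_list (map (skel_weight \<xi>) rs)"

text \<open>Describes exactly the skeletons that \<open>top\<close> produces: no remaining vertex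
  may carry the label \<open>Pend\<close>, otherwise the cut would have been made there
  (\<open>reduced_top\<close>, \<open>top_surj\<close>).\<close>

fun reduced :: "skel \<Rightarrow> bool" where
  "reduced Mark = True"
| "reduced (Skel rs) = (skel_label (Skel rs) \<noteq> Pend \<and> (\<forall>r\<in>set rs. reduced r))"

fun top :: "tree \<Rightarrow> skel" where
  "top (Node ts) = (if label (Node ts) = Pend then Mark else Skel (map top ts))"

fun tops :: "tree \<Rightarrow> tree list" where
  "tops (Node ts) = (if label (Node ts) = Pend then [Node ts] else concat (map tops ts))"

text \<open>\<open>top\<close> and \<open>tops\<close> cut at the root already if it is
  \<open>Pend\<close>; \<open>block\<close> and \<open>exits\<close> cut only strictly below the
  root. A \<open>Pend\<close> root thus stays as an inner vertex of its block and is the only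
  \<open>Pend\<close> vertex there, so that blocks and \<open>Pend\<close> vertices correspond one
  to one.\<close>

definition block :: "tree \<Rightarrow> skel" where
  "block t = Skel (map top (children t))"

definition exits :: "tree \<Rightarrow> tree list" where
  "exits t = concat (map tops (children t))"

lemma top_eq: "top t = (if label t = Pend then Mark else block t)"
  by (cases t) (simp add: block_def)

lemma tops_eq: "tops t = (if label t = Pend then [t] else exits t)"
  by (cases t) (simp add: exits_def)

lemma skel_label_top: "skel_label (top t) = label t"
  by (induction t) (auto simp: image_image cong: image_cong)

lemma skel_label_block: "skel_label (block t) = label t"
  by (cases t) (simp add: block_def image_image skel_label_top)

lemma reduced_top: "reduced (top t)"
proof (induction t)
  case (Node ts)
  then show ?case using skel_label_top[of "Node ts"] by auto
qed

lemma tops_Pend: "u \<in> set (tops t) \<Longrightarrow> label u = Pend"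
  by (induction t) (auto split: if_splits)

lemma length_tops: "length (tops t) = marks (top t)"
  by (induction t) (auto simp: length_concat o_def cong: map_cong)

lemma nodes_top: "nodes t = inner (top t) + sum_list (map nodes (tops t))"
proof (induction t)
  case (Node ts)
  have "(\<Sum>t\<leftarrow>ts. nodes t) = (\<Sum>t\<leftarrow>ts. inner (top t)) + (\<Sum>t\<leftarrow>concat (map tops ts). nodes t)"
    using Node by (induction ts) auto
  then show ?case by (simp add: o_def)
qed

lemma pend_count_top: "pend_count t = sum_list (map pend_count (tops t))"
proof (induction t)
  case (Node ts)
  have "(\<Sum>t\<leftarrow>ts. pend_count t) = (\<Sum>t\<leftarrow>concat (map tops ts). pend_count t)"
    using Node by (induction ts) auto
  then show ?case by auto
qed

lemma weight_top: "weight \<xi> t = skel_weight \<xi> (top t) * prod_list (map (weight \<xi>) (tops t))"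
proof (induction t)
  case (Node ts)
  have "prod_list (map (weight \<xi>) ts) =
      prod_list (map (\<lambda>t. skel_weight \<xi> (top t)) ts) * prod_list (map (weight \<xi>) (concat (map tops ts)))"
    using Node by (induction ts) auto
  then show ?case by (simp add: o_def)
qed

text \<open>The skeletons of the children fix how many entries of the list belong to each child
  (\<open>length_tops\<close>), so the concatenated list can be split in only one way.\<close>

lemma top_tops_inj: "top t = top t' \<Longrightarrow> tops t = tops t' \<Longrightarrow> t = t'"
proof (induction t arbitrary: t')
  case (Node ts)
  show ?case
  proof (cases "label (Node ts) = Pend")
    case True
    then have "label t' = Pend" using Node.prems skel_label_top by metis
    then show ?thesis using True Node.prems by (simp add: tops_eq)
  next
    case False
    then have "label t' \<noteq> Pend" using Node.prems skel_label_top by metis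
    moreover obtain ts' where t': "t' = Node ts'" by (cases t')
    ultimately have eq: "map top ts = map top ts'" "concat (map tops ts) = concat (map tops ts')"
      using Node.prems False by auto
    have len: "length ts = length ts'" using eq(1) map_eq_imp_length_eq by blast
    have tp: "top (ts ! i) = top (ts' ! i)" if "i < length ts" for i
      using arg_cong[OF eq(1), of "\<lambda>l. l ! i"] that len by simp
    have "map tops ts = map tops ts'"
    proof (rule concat_injective[OF eq(2)])
      show "length (map tops ts) = length (map tops ts')" using len by simp
      show "\<forall>(x, y)\<in>set (zip (map tops ts) (map tops ts')). length x = length y"
        using tp len by (auto simp: set_zip length_tops)
    qed
    then have tps: "tops (ts ! i) = tops (ts' ! i)" if "i < length ts" for i
      using that len by (metis nth_map)
    have "ts ! i = ts' ! i" if "i < length ts" for i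
      using Node.IH[of "ts ! i" "ts' ! i"] tp tps that by simp
    then show ?thesis using len t' by (simp add: list_eq_iff_nth_eq)
  qed
qed

text \<open>The list is cut into consecutive segments whose lengths are the numbers of marks, and
  each segment is handed to its own skeleton.\<close>

lemma tops_list_surj:
  assumes "\<And>r l. r \<in> set rs \<Longrightarrow> length l = marks r \<Longrightarrow> \<forall>u\<in>set l. label u = Pend \<Longrightarrow>
      \<exists>t. top t = r \<and> tops t = l"
    and "length l = sum_list (map marks rs)" "\<forall>u\<in>set l. label u = Pend"
  shows "\<exists>ts. map top ts = rs \<and> concat (map tops ts) = l"
  using assms
proof (induction rs arbitrary: l)
  case Nil
  then show ?case by simp
next
  case (Cons r rs)
  have "\<exists>t. top t = r \<and> tops t = take (marks r) l"
    by (rule Cons.prems(1)) (use Cons.prems(2,3) in \<open>auto dest: in_set_takeD\<close>)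
  then obtain t where t: "top t = r" "tops t = take (marks r) l" by blast
  have "\<exists>ts. map top ts = rs \<and> concat (map tops ts) = drop (marks r) l"
    by (rule Cons.IH) (use Cons.prems in \<open>auto dest: in_set_dropD\<close>)
  then obtain ts where "map top ts = rs" "concat (map tops ts) = drop (marks r) l" by blast
  then show ?case using t by (intro exI[of _ "t # ts"]) simp
qed

lemma top_surj:
  "reduced r \<Longrightarrow> length l = marks r \<Longrightarrow> \<forall>u\<in>set l. label u = Pend \<Longrightarrow> \<exists>t. top t = r \<and> tops t = l"
proof (induction r arbitrary: l)
  case Mark
  then obtain t where "l = [t]" by (auto simp: length_Suc_conv)
  then show ?case using Mark by (intro exI[of _ t]) (simp add: top_eq tops_eq)
next
  case (Skel rs)
  have "\<exists>ts. map top ts = rs \<and> concat (map tops ts) = l"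
    by (rule tops_list_surj) (use Skel in auto)
  then obtain ts where ts: "map top ts = rs" "concat (map tops ts) = l" by blast
  have "label (Node ts) = skel_label (Skel rs)"
    using skel_label_block[of "Node ts"] ts by (simp add: block_def)
  then show ?case using Skel.prems ts by (intro exI[of _ "Node ts"]) simp
qed

lemma block_exits_inj: "block t = block t' \<Longrightarrow> exits t = exits t' \<Longrightarrow> t = t'"
proof -
  assume eq: "block t = block t'" "exits t = exits t'"
  obtain ts ts' where t: "t = Node ts" "t' = Node ts'" by (cases t; cases t')
  have eq: "map top ts = map top ts'" "concat (map tops ts) = concat (map tops ts')"
    using eq t by (auto simp: block_def exits_def)
  have len: "length ts = length ts'" using eq(1) map_eq_imp_length_eq by blast
  have tp: "top (ts ! i) = top (ts' ! i)" if "i < length ts" for i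
    using arg_cong[OF eq(1), of "\<lambda>l. l ! i"] that len by simp
  have "map tops ts = map tops ts'"
  proof (rule concat_injective[OF eq(2)])
    show "length (map tops ts) = length (map tops ts')" using len by simp
    show "\<forall>(x, y)\<in>set (zip (map tops ts) (map tops ts')). length x = length y"
      using tp len by (auto simp: set_zip length_tops)
  qed
  then have tps: "tops (ts ! i) = tops (ts' ! i)" if "i < length ts" for i
    using that len by (metis nth_map)
  have "ts ! i = ts' ! i" if "i < length ts" for i
    using top_tops_inj[of "ts ! i" "ts' ! i"] tp tps that by simp
  then show "t = t'" using len t by (simp add: list_eq_iff_nth_eq)
qed

lemma block_surj:
  assumes "\<forall>r\<in>set rs. reduced r" "length l = marks (Skel rs)" "\<forall>u\<in>set l. label u = Pend"
  shows "\<exists>t. block t = Skel rs \<and> exits t = l"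
proof -
  have "\<exists>ts. map top ts = rs \<and> concat (map tops ts) = l"
    by (rule tops_list_surj) (use assms top_surj in auto)
  then obtain ts where "map top ts = rs" "concat (map tops ts) = l" by blast
  then show ?thesis by (intro exI[of _ "Node ts"]) (simp add: block_def exits_def)
qed

lemma exits_Pend: "u \<in> set (exits t) \<Longrightarrow> label u = Pend"
  by (auto simp: exits_def dest: tops_Pend)

lemma length_exits: "length (exits t) = marks (block t)"
  by (simp add: exits_def block_def length_concat o_def length_tops)

lemma weight_block: "weight \<xi> t = skel_weight \<xi> (block t) * prod_list (map (weight \<xi>) (exits t))"
proof -
  obtain ts where t: "t = Node ts" by (cases t)
  have "prod_list (map (weight \<xi>) ts) =
      prod_list (map (\<lambda>t. skel_weight \<xi> (top t)) ts) * prod_list (map (weight \<xi>) (concat (map tops ts)))"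
    proof (induction ts)
    case (Cons a ts)
    then show ?case using weight_top[of \<xi> a] by simp
  qed simp
  then show ?thesis by (simp add: t o_def block_def exits_def)
qed

lemma nodes_block: "nodes t = inner (block t) + sum_list (map nodes (exits t))"
proof -
  obtain ts where t: "t = Node ts" by (cases t)
  have "(\<Sum>t\<leftarrow>ts. nodes t) = (\<Sum>t\<leftarrow>ts. inner (top t)) + (\<Sum>t\<leftarrow>concat (map tops ts). nodes t)"
    proof (induction ts)
    case (Cons a ts)
    then show ?case using nodes_top[of a] by simp
  qed simp
  then show ?thesis by (simp add: t o_def block_def exits_def)
qed

lemma pend_count_block: "label t = Pend \<Longrightarrow> pend_count t = Suc (sum_list (map pend_count (exits t)))"
proof -
  assume l: "label t = Pend"
  obtain ts where t: "t = Node ts" by (cases t)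
  have "(\<Sum>t\<leftarrow>ts. pend_count t) = (\<Sum>t\<leftarrow>concat (map tops ts). pend_count t)"
    proof (induction ts)
    case (Cons a ts)
    then show ?case using pend_count_top[of a] by simp
  qed simp
  then show ?thesis using l by (simp add: t exits_def)
qed

lemma map_pmf_bind_replicate_append:
  "bind_pmf (replicate_pmf m p) (\<lambda>xs. bind_pmf (replicate_pmf n p) (\<lambda>ys. f (xs @ ys))) =
    bind_pmf (replicate_pmf (m + n) p) f"
  by (simp add: replicate_pmf_distrib bind_assoc_pmf bind_return_pmf)

section \<open>Laws of the blocks and of forests of blocks\<close>

context critical_offspring
begin

lemma GW_unfold: "GW = bind_pmf \<xi> (\<lambda>k. map_pmf Node (replicate_pmf k GW))"
proof (rule pmf_eqI)
  fix t
  obtain ts where t: "t = Node ts" by (cases t)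
  have "pmf (bind_pmf \<xi> (\<lambda>k. map_pmf Node (replicate_pmf k GW))) t =
      measure_pmf.expectation \<xi> (\<lambda>k. indicator {length ts} k * prod_list (map (pmf GW) ts))"
    unfolding pmf_bind
    by (rule Bochner_Integration.integral_cong[OF refl])
       (auto simp: t pmf_map_inj' inj_on_def pmf_replicate_pmf indicator_def)
  also have "\<dots> = weight \<xi> t"
    by (simp add: t measure_pmf_single pmf_GW cong: map_cong)
  finally show "pmf GW t = pmf (bind_pmf \<xi> (\<lambda>k. map_pmf Node (replicate_pmf k GW))) t"
    by (simp add: pmf_GW)
qed

lemma children_GW: "map_pmf children GW = bind_pmf \<xi> (\<lambda>k. replicate_pmf k GW)"
  by (subst GW_unfold) (simp add: map_bind_pmf pmf.map_comp o_def)

lemma expectation_prod_children: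
  fixes f :: "tree \<Rightarrow> real"
  assumes "\<And>t. \<bar>f t\<bar> \<le> 1"
  shows "measure_pmf.expectation GW (\<lambda>t. prod_list (map f (children t))) =
    measure_pmf.expectation \<xi> (\<lambda>k. measure_pmf.expectation GW f ^ k)"
proof -
  have b: "\<bar>prod_list (map f xs)\<bar> \<le> 1" for xs
    by (induction xs) (auto simp: abs_mult intro!: mult_le_one assms)
  have "measure_pmf.expectation GW (\<lambda>t. prod_list (map f (children t))) =
     measure_pmf.expectation (map_pmf children GW) (\<lambda>ts. prod_list (map f ts))"
    by simp
  also have "\<dots> = measure_pmf.expectation \<xi> (\<lambda>k. measure_pmf.expectation GW f ^ k)"
    unfolding children_GW
    by (simp add: expectation_bind_pmf[where B = 1] b expectation_prod_list_replicate_pmf assms)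
  finally show ?thesis .
qed

text \<open>The bridge from the given probability space to discrete computations: under conditioning
  on the size, the encoded tree has the law \<open>GW\<close> conditioned on the same event.\<close>

lemma conditioned_distr:
  assumes pos: "measure (measure_pmf GW) {t. nodes t = n} > 0"
  shows "distr (conditioned_space \<xi> n) (count_space UNIV) (\<lambda>\<omega>. tree_of (plane_tree \<omega>)) =
    measure_pmf (cond_pmf GW {t. nodes t = n})"
proof (rule measure_eqI)
  let ?A = "{\<omega> \<in> space (offspring_space \<xi>). finite (plane_tree \<omega>) \<and> card (plane_tree \<omega>) = n}"
  have ne: "set_pmf GW \<inter> {t. nodes t = n} \<noteq> {}"
    using pos by (metis measure_Int_set_pmf measure_empty inf_commute less_irrefl)
  fix B assume "B \<in> sets (distr (conditioned_space \<xi> n) (count_space UNIV) (\<lambda>\<omega>. tree_of (plane_tree \<omega>)))"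
  have mX: "(\<lambda>\<omega>. tree_of (plane_tree \<omega>)) \<in> measurable (conditioned_space \<xi> n) (count_space UNIV)"
    using tree_of_measurable by (simp add: conditioned_space_def)
  let ?B = "(\<lambda>\<omega>. tree_of (plane_tree \<omega>)) -` B \<inter> space (offspring_space \<xi>)"
  have A: "?A \<in> sets (offspring_space \<xi>)"
    using finite_plane_tree_measurable[of "\<lambda>T. card T = n" \<xi>] by (simp add: pred_def)
  have B: "?B \<in> sets (offspring_space \<xi>)"
    using tree_of_measurable by (rule measurable_sets) simp
  have AB: "?A \<inter> ?B = {\<omega>. finite (plane_tree \<omega>) \<and> (card (plane_tree \<omega>) = n \<and> tree_of (plane_tree \<omega>) \<in> B)}"
    by auto
  have "emeasure (distr (conditioned_space \<xi> n) (count_space UNIV) (\<lambda>\<omega>. tree_of (plane_tree \<omega>))) B =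
      emeasure (conditioned_space \<xi> n) ?B"
    using mX by (subst emeasure_distr) (auto simp: conditioned_space_def)
  also have "\<dots> = emeasure (offspring_space \<xi>) (?A \<inter> ?B) / emeasure (offspring_space \<xi>) ?A"
    unfolding conditioned_space_def using A B by (rule emeasure_uniform_measure)
  also have "\<dots> = emeasure GW ({t. nodes t = n} \<inter> B) / emeasure GW {t. nodes t = n}"
    unfolding AB
    using emeasure_offspring_eq_GW[of "\<lambda>T. card T = n"]
      emeasure_offspring_eq_GW[of "\<lambda>T. card T = n \<and> tree_of T \<in> B"]
    by (simp add: card_shape Int_def)
  also have "\<dots> = emeasure (cond_pmf GW {t. nodes t = n}) B"
    by (simp add: cond_pmf.rep_eq[OF ne] emeasure_uniform_measure)
  finally show "emeasure (distr (conditioned_space \<xi> n) (count_space UNIV) (\<lambda>\<omega>. tree_of (plane_tree \<omega>))) B =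
    emeasure (cond_pmf GW {t. nodes t = n}) B" .
qed simp

lemma AE_conditioned_space:
  "AE \<omega> in conditioned_space \<xi> n.
     plane_tree \<omega> = shape (tree_of (plane_tree \<omega>)) \<and> nodes (tree_of (plane_tree \<omega>)) = n"
proof -
  let ?A = "{\<omega> \<in> space (offspring_space \<xi>). finite (plane_tree \<omega>) \<and> card (plane_tree \<omega>) = n}"
  have A: "?A \<in> sets (offspring_space \<xi>)"
    using finite_plane_tree_measurable[of "\<lambda>T. card T = n" \<xi>] by (simp add: pred_def)
  have "AE \<omega> in conditioned_space \<xi> n. \<omega> \<in> ?A"
    unfolding conditioned_space_def by (rule AE_uniform_measureI[OF A]) simp
  then show ?thesis
    by (rule AE_mp) (auto intro!: AE_I2 simp: shape_tree_of card_shape[symmetric])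
qed

definition pend_prob :: real where
  "pend_prob = measure (measure_pmf GW) {t. label t = Pend}"

definition GWP :: "tree pmf" where
  "GWP = cond_pmf GW {t. label t = Pend}"

abbreviation leaf :: tree where "leaf \<equiv> Node []"

text \<open>Stars show that a \<open>Pend\<close> root has positive probability, and they are the
  bricks from which the support of \<open>block_law\<close> is later built.\<close>

lemma label_star: "j > 0 \<Longrightarrow> label (Node (replicate j leaf)) = Pend"
  by (simp add: combine_def set_replicate_conv_if)

lemma in_set_GW_iff: "Node ts \<in> set_pmf GW \<longleftrightarrow> length ts \<in> set_pmf \<xi> \<and> set ts \<subseteq> set_pmf GW"
proof -
  have "Node ts \<in> set_pmf GW \<longleftrightarrow> (\<exists>k\<in>set_pmf \<xi>. ts \<in> set_pmf (replicate_pmf k GW))"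
    by (subst GW_unfold) auto
  then show ?thesis by (auto simp: set_replicate_pmf in_lists_conv_set)
qed

lemma leaf_in_GW: "leaf \<in> set_pmf GW"
  unfolding in_set_GW_iff using zero by (simp add: set_pmf_iff)

lemma star_in_GW: "j \<in> set_pmf \<xi> \<Longrightarrow> Node (replicate j leaf) \<in> set_pmf GW"
  using leaf_in_GW by (auto simp: in_set_GW_iff)

lemma Pend_in_GW: "set_pmf GW \<inter> {t. label t = Pend} \<noteq> {}"
proof -
  obtain j where "j \<ge> 2" "pmf \<xi> j > 0" using ex_branching by blast
  then show ?thesis
    using star_in_GW[of j] label_star[of j] by (auto simp: set_pmf_iff)
qed

lemma pend_prob_pos: "pend_prob > 0"
  using Pend_in_GW unfolding pend_prob_def by (auto intro: measure_pmf_posI)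

lemma pmf_GWP: "pmf GWP t = (if label t = Pend then weight \<xi> t / pend_prob else 0)"
  unfolding GWP_def by (simp add: pmf_cond[OF Pend_in_GW] pend_prob_def pmf_GW)

lemma set_GWP: "set_pmf GWP = set_pmf GW \<inter> {t. label t = Pend}"
  unfolding GWP_def by (rule set_cond_pmf[OF Pend_in_GW])

lemma pmf_replicate_GWP:
  "pmf (replicate_pmf k GWP) l = (if length l = k \<and> (\<forall>u\<in>set l. label u = Pend)
     then prod_list (map (weight \<xi>) l) / pend_prob ^ k else 0)"
proof -
  have "prod_list (map (pmf GWP) l) = (if \<forall>u\<in>set l. label u = Pend
     then prod_list (map (weight \<xi>) l) / pend_prob ^ length l else 0)"
    by (induction l) (auto simp: pmf_GWP)
  then show ?thesis by (simp add: pmf_replicate_pmf)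
qed

text \<open>Weights multiply across the cut (\<open>weight_top\<close>), and every list of
  \<open>Pend\<close>-rooted trees of the right length can be inserted. So the cut-off trees are
  independent with law \<open>GWP\<close> given the skeleton; the powers of \<open>pend_prob\<close>
  come from normalising \<open>GWP\<close>.\<close>

lemma top_tops_law:
  "map_pmf (\<lambda>t. (top t, tops t)) GW =
    bind_pmf (map_pmf top GW) (\<lambda>r. map_pmf (Pair r) (replicate_pmf (marks r) GWP))"
proof -
  have "pmf (map_pmf (\<lambda>t. (top t, tops t)) GW) (r, l) =
     (if reduced r then skel_weight \<xi> r * pend_prob ^ marks r else 0) * pmf (replicate_pmf (marks r) GWP) l" for r l
  proof (cases "reduced r \<and> length l = marks r \<and> (\<forall>u\<in>set l. label u = Pend)")
    case True
    then obtain t where t: "top t = r" "tops t = l" using top_surj by blast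
    have "pmf (map_pmf (\<lambda>t. (top t, tops t)) GW) (top t, tops t) = pmf GW t"
      by (rule pmf_map_inj') (auto intro!: injI top_tops_inj)
    then show ?thesis using t True weight_top[of \<xi> t] pend_prob_pos
      by (simp add: pmf_GW pmf_replicate_GWP)
  next
    case False
    have "pmf (map_pmf (\<lambda>t. (top t, tops t)) GW) (r, l) = 0"
      using False by (intro pmf_map_outside) (auto simp: reduced_top length_tops dest: tops_Pend)
    then show ?thesis using False by (auto simp: pmf_replicate_GWP)
  qed
  from pmf_disintegrate[OF this] show ?thesis by (simp add: pmf.map_comp o_def)
qed

lemma block_exits_law:
  "map_pmf (\<lambda>t. (block t, exits t)) GWP =
    bind_pmf (map_pmf block GWP) (\<lambda>r. map_pmf (Pair r) (replicate_pmf (marks r) GWP))"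
proof -
  \<comment> \<open>Characterises the blocks of \<open>Pend\<close>-rooted trees: everything below
    the root is reduced and the root itself comes out as \<open>Pend\<close>. The factor 1 /
    \<open>pend_prob\<close> below accounts for the conditioning of the whole tree.\<close>
  define good where "good r \<longleftrightarrow> (\<exists>rs. r = Skel rs \<and> (\<forall>r\<in>set rs. reduced r)) \<and> skel_label r = Pend" for r
  have good_block: "good (block t)" if "label t = Pend" for t
    using that skel_label_block[of t] unfolding good_def by (auto simp: block_def reduced_top)
  have "pmf (map_pmf (\<lambda>t. (block t, exits t)) GWP) (r, l) =
     (if good r then skel_weight \<xi> r * pend_prob ^ marks r / pend_prob else 0) * pmf (replicate_pmf (marks r) GWP) l" for r l
  proof (cases "good r \<and> length l = marks r \<and> (\<forall>u\<in>set l. label u = Pend)")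
    case True
    then obtain t where t: "block t = r" "exits t = l" unfolding good_def using block_surj by metis
    have lt: "label t = Pend" using True t skel_label_block[of t] by (simp add: good_def)
    have "pmf (map_pmf (\<lambda>t. (block t, exits t)) GWP) (block t, exits t) = pmf GWP t"
      by (rule pmf_map_inj') (auto intro!: injI block_exits_inj)
    then show ?thesis using t True lt weight_block[of \<xi> t] pend_prob_pos
      by (simp add: pmf_GWP pmf_replicate_GWP)
  next
    case False
    have "pmf (map_pmf (\<lambda>t. (block t, exits t)) GWP) (r, l) = 0"
      using False good_block
      by (intro pmf_map_outside) (auto simp: length_exits set_GWP dest: exits_Pend)
    then show ?thesis using False by (auto simp: pmf_replicate_GWP)
  qed
  from pmf_disintegrate[OF this] show ?thesis by (simp add: pmf.map_comp o_def)
qed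

definition forest_law :: "nat \<Rightarrow> (nat \<times> nat) pmf" where
  "forest_law z = map_pmf (\<lambda>l. (sum_list (map nodes l), sum_list (map pend_count l))) (replicate_pmf z GWP)"

text \<open>In both laws the first coordinate is the number of exits, which will drive the walk, and
  the second the number of vertices, which is carried along. In \<open>forest_law\<close> the first
  coordinate is the number of vertices.\<close>

definition root_law :: "(nat \<times> nat) pmf" where
  "root_law = map_pmf (\<lambda>t. (marks (top t), inner (top t))) GW"

definition block_law :: "(nat \<times> nat) pmf" where
  "block_law = map_pmf (\<lambda>t. (marks (block t), inner (block t))) GWP"

lemma nodes_pend_count_law:
  "map_pmf (\<lambda>t. (nodes t, pend_count t)) GW =
    bind_pmf root_law (\<lambda>(z, x). map_pmf (\<lambda>(n, k). (n + x, k)) (forest_law z))"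
proof -
  have "map_pmf (\<lambda>t. (nodes t, pend_count t)) GW =
      map_pmf (\<lambda>(r, l). (inner r + sum_list (map nodes l), sum_list (map pend_count l)))
        (map_pmf (\<lambda>t. (top t, tops t)) GW)"
    using nodes_top pend_count_top by (simp add: pmf.map_comp o_def)
  also have "\<dots> = bind_pmf root_law (\<lambda>(z, x). map_pmf (\<lambda>(n, k). (n + x, k)) (forest_law z))"
    unfolding top_tops_law root_law_def forest_law_def
    by (simp add: map_bind_pmf bind_map_pmf pmf.map_comp o_def add.commute)
  finally show ?thesis .
qed

text \<open>Exploring the block of the first tree consumes one \<open>Pend\<close> vertex and
  \<open>x\<close> vertices and replaces the tree by its \<open>j\<close> exits, which are
  independent copies. This is the recursion of a total progeny, with \<open>Pend\<close> vertices as
  individuals.\<close>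

lemma forest_law_Suc:
  "forest_law (Suc z) =
    bind_pmf block_law (\<lambda>(j, x). map_pmf (\<lambda>(n, k). (n + x, Suc k)) (forest_law (j + z)))"
proof -
  let ?S = "\<lambda>l. (sum_list (map nodes l), sum_list (map pend_count l))"
  let ?T = "\<lambda>r l. (inner r + sum_list (map nodes l), Suc (sum_list (map pend_count l)))"
  have "forest_law (Suc z) = bind_pmf GWP (\<lambda>t. map_pmf (\<lambda>l. ?S (t # l)) (replicate_pmf z GWP))"
    unfolding forest_law_def by (simp add: map_bind_pmf map_pmf_def bind_assoc_pmf bind_return_pmf)
  also have "\<dots> = bind_pmf GWP (\<lambda>t. map_pmf (\<lambda>l. ?T (block t) (exits t @ l)) (replicate_pmf z GWP))"
  proof (rule bind_pmf_cong[OF refl])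
    fix t assume "t \<in> set_pmf GWP"
    then have "label t = Pend" by (simp add: set_GWP)
    then show "map_pmf (\<lambda>l. ?S (t # l)) (replicate_pmf z GWP) =
        map_pmf (\<lambda>l. ?T (block t) (exits t @ l)) (replicate_pmf z GWP)"
      using nodes_block[of t] pend_count_block[of t] by (simp add: add.assoc)
  qed
  also have "\<dots> = bind_pmf (map_pmf (\<lambda>t. (block t, exits t)) GWP)
      (\<lambda>(r, e). map_pmf (\<lambda>l. ?T r (e @ l)) (replicate_pmf z GWP))"
    by (simp add: bind_map_pmf)
  also have "\<dots> = bind_pmf (map_pmf block GWP)
      (\<lambda>r. bind_pmf (replicate_pmf (marks r) GWP) (\<lambda>e. bind_pmf (replicate_pmf z GWP) (\<lambda>l. return_pmf (?T r (e @ l)))))"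
    unfolding block_exits_law by (simp add: bind_assoc_pmf bind_map_pmf map_pmf_def bind_return_pmf)
  also have "\<dots> = bind_pmf (map_pmf block GWP)
      (\<lambda>r. bind_pmf (replicate_pmf (marks r + z) GWP) (\<lambda>l. return_pmf (?T r l)))"
    by (subst map_pmf_bind_replicate_append) (rule refl)
  also have "\<dots> = bind_pmf block_law (\<lambda>(j, x). map_pmf (\<lambda>(n, k). (n + x, Suc k)) (forest_law (j + z)))"
    unfolding block_law_def forest_law_def
    by (simp add: bind_map_pmf pmf.map_comp o_def map_pmf_def[symmetric] add.commute)
  finally show ?thesis .
qed

definition size_law :: "nat \<Rightarrow> nat pmf" where
  "size_law z = map_pmf (\<lambda>l. sum_list (map nodes l)) (replicate_pmf z GW)"

lemma size_law_Suc: "size_law (Suc z) = bind_pmf \<xi> (\<lambda>k. map_pmf Suc (size_law (k + z)))"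
proof -
  have "size_law (Suc z) = bind_pmf GW (\<lambda>t. map_pmf (\<lambda>l. nodes t + sum_list (map nodes l)) (replicate_pmf z GW))"
    unfolding size_law_def by (simp add: map_bind_pmf map_pmf_def bind_assoc_pmf bind_return_pmf)
  also have "\<dots> = bind_pmf \<xi> (\<lambda>k. bind_pmf (replicate_pmf k GW)
      (\<lambda>ts. bind_pmf (replicate_pmf z GW) (\<lambda>l. return_pmf (Suc (sum_list (map nodes (ts @ l)))))))"
    by (subst GW_unfold) (simp add: bind_assoc_pmf bind_map_pmf map_pmf_def bind_return_pmf add.assoc)
  also have "\<dots> = bind_pmf \<xi> (\<lambda>k. bind_pmf (replicate_pmf (k + z) GW) (\<lambda>l. return_pmf (Suc (sum_list (map nodes l)))))"
    by (subst map_pmf_bind_replicate_append) (rule refl)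
  also have "\<dots> = bind_pmf \<xi> (\<lambda>k. map_pmf Suc (size_law (k + z)))"
    unfolding size_law_def by (simp add: pmf.map_comp o_def map_pmf_def[symmetric])
  finally show ?thesis .
qed

end

section \<open>Random walks and the hitting time identity\<close>

text \<open>Coefficients of X times the derivative of H^(k+1), once read directly and once expanded
  by the power rule. In probabilistic terms, the steps of a walk are exchangeable, so given the sum
  m each of the k + 1 steps has mean m/(k + 1).\<close>

lemma fps_nth_power_euler:
  fixes H :: "'a::{idom, semiring_char_0} fps"
  shows "of_nat m * fps_nth (H ^ Suc k) m =
    of_nat (Suc k) * (\<Sum>j\<le>m. of_nat j * fps_nth H j * fps_nth (H ^ k) (m - j))"
proof -
  have nth_X_deriv: "fps_nth (fps_X * fps_deriv G) i = of_nat i * fps_nth G i" for G :: "'a fps" and i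
    by (cases i) simp_all
  have nth_of_nat: "fps_nth (of_nat n * G) i = of_nat n * fps_nth G i" for G :: "'a fps" and i n
    by (simp add: fps_of_nat[symmetric] fps_mult_left_const_nth)
  have "of_nat m * fps_nth (H ^ Suc k) m = fps_nth (fps_X * fps_deriv (H ^ Suc k)) m"
    by (rule nth_X_deriv[symmetric])
  also have "fps_X * fps_deriv (H ^ Suc k) =
      of_nat (Suc k) * ((fps_X * fps_deriv H) * H ^ k)"
    unfolding fps_deriv_power[of H "Suc k"] fps_of_nat diff_Suc_1 by (simp only: mult_ac)
  also have "fps_nth \<dots> m = of_nat (Suc k) * (\<Sum>j\<le>m. fps_nth (fps_X * fps_deriv H) j * fps_nth (H ^ k) (m - j))"
    by (simp only: nth_of_nat fps_mult_nth[of "fps_X * fps_deriv H"] atLeast0AtMost)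
  finally show ?thesis by (simp only: nth_X_deriv)
qed

text \<open>\<open>F z k\<close> plays the probability that a forest with z roots has k individuals,
  \<open>H\<close> the offspring series. The coefficients range over a domain rather than the reals
  because the second coordinate of the block walk will be stored in them as a formal variable.
  Induction on k: after one exploration step, \<open>fps_nth_power_euler\<close> evaluates the sum
  weighted by j.\<close>

lemma hitting_time_fps:
  fixes H :: "'a::{idom, semiring_char_0} fps" and F :: "nat \<Rightarrow> nat \<Rightarrow> 'a"
  assumes F00: "F 0 0 = 1" and F0: "\<And>k. F 0 (Suc k) = 0" and F_0: "\<And>z. F (Suc z) 0 = 0"
    and F_Suc: "\<And>z k. F (Suc z) (Suc k) = (\<Sum>j\<le>k. fps_nth H j * F (j + z) k)"
  shows "of_nat k * F z k = of_nat z * (if z \<le> k then fps_nth (H ^ k) (k - z) else 0)"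
proof -
  \<comment> \<open>z roots need at least z individuals; this cuts the sum in \<open>F_Suc\<close>
    down to the indices to which the induction hypothesis applies.\<close>
  have vanish: "F z k = 0" if "k < z" for z k
    using that
  proof (induction k arbitrary: z)
    case 0
    then show ?case using F_0 by (cases z) auto
  next
    case (Suc k)
    then obtain z' where z': "z = Suc z'" by (cases z) auto
    show ?case unfolding z' F_Suc using Suc z' by (intro sum.neutral) auto
  qed
  have main: "of_nat k * F z k = of_nat z * fps_nth (H ^ k) (k - z)" if "z \<le> k" for z k
    using that
  proof (induction k arbitrary: z)
    case 0
    then show ?case by simp
  next
    case (Suc k)
    show ?case
    proof (cases z)
      case 0
      then show ?thesis by (simp add: F0)
    next
      case z: (Suc z')
      define m where "m = k - z'"
      have k: "k = m + z'" using Suc.prems z by (simp add: m_def)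
      have trunc: "(\<Sum>j\<le>k. fps_nth H j * F (j + z') k) = (\<Sum>j\<le>m. fps_nth H j * F (j + z') k)"
        using k by (intro sum.mono_neutral_right) (auto intro: vanish)
      show ?thesis
      \<comment> \<open>The induction hypothesis is available only after multiplication by k, and
        this factor is cancelled at the end; k = 0 is therefore treated on its own.\<close>
      proof (cases "k = 0")
        case True
        then show ?thesis using z k by (simp add: F_Suc F00)
      next
        case False
        have eul: "of_nat m * fps_nth (H ^ Suc k) m =
            of_nat (Suc k) * (\<Sum>j\<le>m. of_nat j * fps_nth H j * fps_nth (H ^ k) (m - j))"
          by (rule fps_nth_power_euler)
        let ?A = "fps_nth (H ^ Suc k) m"
        let ?B = "\<Sum>j\<le>m. of_nat j * fps_nth H j * fps_nth (H ^ k) (m - j)"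
        have "of_nat k * F (Suc z') (Suc k) = (\<Sum>j\<le>m. fps_nth H j * (of_nat k * F (j + z') k))"
          unfolding F_Suc trunc by (simp add: sum_distrib_left algebra_simps)
        also have "\<dots> = (\<Sum>j\<le>m. fps_nth H j * (of_nat (j + z') * fps_nth (H ^ k) (m - j)))"
        proof (intro sum.cong refl)
          fix j assume "j \<in> {..m}"
          then have "of_nat k * F (j + z') k = of_nat (j + z') * fps_nth (H ^ k) (k - (j + z'))"
            using k by (intro Suc.IH) auto
          then show "fps_nth H j * (of_nat k * F (j + z') k) =
              fps_nth H j * (of_nat (j + z') * fps_nth (H ^ k) (m - j))"
            using k by simp
        qed
        also have "\<dots> = of_nat z' * ?A + ?B"
          by (simp add: fps_mult_nth atLeast0AtMost sum_distrib_left sum.distrib algebra_simps)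
        finally have "of_nat (Suc k) * (of_nat k * F (Suc z') (Suc k)) =
            of_nat (Suc k) * of_nat z' * ?A + of_nat (Suc k) * ?B"
          by (simp add: algebra_simps)
        also have "\<dots> = of_nat (Suc k) * of_nat z' * ?A + of_nat m * ?A"
          unfolding eul ..
        also have "\<dots> = of_nat k * (of_nat (Suc z') * ?A)"
          unfolding k by (simp add: algebra_simps)
        finally have "of_nat k * (of_nat (Suc k) * F (Suc z') (Suc k)) = of_nat k * (of_nat (Suc z') * ?A)"
          by (simp add: algebra_simps)
        then have "of_nat (Suc k) * F (Suc z') (Suc k) = of_nat (Suc z') * ?A"
          using False by (simp only: mult_cancel_left of_nat_eq_0_iff) blast
        then show ?thesis unfolding z by (simp only: diff_Suc_Suc m_def)
      qed
    qed
  qed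
  show ?thesis using main vanish by auto
qed

section \<open>Random walks, their generating series and Fourier inversion\<close>

primrec walk :: "'a::monoid_add pmf \<Rightarrow> nat \<Rightarrow> 'a pmf" where
  "walk M 0 = return_pmf 0"
| "walk M (Suc k) = bind_pmf M (\<lambda>s. map_pmf (\<lambda>t. s + t) (walk M k))"

lemma expectation_finite_support:
  fixes f :: "'a \<Rightarrow> real"
  assumes "finite A" "\<And>x. x \<notin> A \<Longrightarrow> f x = 0"
  shows "measure_pmf.expectation M f = (\<Sum>x\<in>A. pmf M x * f x)"
  using assms by (subst integral_measure_pmf_real[of A]) (auto simp: mult.commute)

lemma pmf_walk_nat: "pmf (walk M k) n = fps_nth (Abs_fps (pmf M) ^ k) n"
proof (induction k arbitrary: n)
  case 0
  then show ?case by (simp add: indicator_def)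
next
  case (Suc k)
  have "pmf (map_pmf ((+) s) (walk M k)) n = (if s \<le> n then pmf (walk M k) (n - s) else 0)" for s
  proof (cases "s \<le> n")
    case True
    have "pmf (map_pmf ((+) s) (walk M k)) (s + (n - s)) = pmf (walk M k) (n - s)"
      by (rule pmf_map_inj') simp
    then show ?thesis using True by simp
  next
    case False
    then show ?thesis by (simp add: pmf_map_outside image_iff)
  qed
  then have "pmf (walk M (Suc k)) n =
      measure_pmf.expectation M (\<lambda>s. if s \<le> n then pmf (walk M k) (n - s) else 0)"
    by (simp add: pmf_bind)
  also have "\<dots> = (\<Sum>s\<le>n. pmf M s * pmf (walk M k) (n - s))"
    by (subst expectation_finite_support[of "{..n}"]) auto
  finally show ?case by (simp add: fps_mult_nth Suc atLeast0AtMost)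
qed

text \<open>A bivariate generating function nested as a series in the first coordinate whose
  coefficients are series in the second. In this form \<open>hitting_time_fps\<close> applies with
  coefficients in \<open>real fps\<close>.\<close>

definition bifps :: "(nat \<times> nat \<Rightarrow> real) \<Rightarrow> real fps fps" where
  "bifps f = Abs_fps (\<lambda>a. Abs_fps (\<lambda>b. f (a, b)))"

lemma pmf_walk_nat_prod: "pmf (walk M k) (a, b) = fps_nth (fps_nth (bifps (pmf M) ^ k) a) b"
proof (induction k arbitrary: a b)
  case 0
  then show ?case by (simp add: indicator_def zero_prod_def)
next
  case (Suc k)
  have shift: "pmf (map_pmf ((+) s) (walk M k)) (a, b) =
      (if fst s \<le> a \<and> snd s \<le> b then pmf (walk M k) (a - fst s, b - snd s) else 0)" for s
  proof (cases "fst s \<le> a \<and> snd s \<le> b")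
    case True
    have "pmf (map_pmf ((+) s) (walk M k)) (s + (a - fst s, b - snd s)) = pmf (walk M k) (a - fst s, b - snd s)"
      by (rule pmf_map_inj') simp
    then show ?thesis using True by (simp add: plus_prod_def)
  next
    case False
    then have "(a, b) \<noteq> s + t" for t
      by (auto simp: plus_prod_def prod_eq_iff)
    then show ?thesis using False by (auto simp: image_iff intro!: pmf_map_outside)
  qed
  have "pmf (walk M (Suc k)) (a, b) = measure_pmf.expectation M
      (\<lambda>s. if fst s \<le> a \<and> snd s \<le> b then pmf (walk M k) (a - fst s, b - snd s) else 0)"
    by (simp add: pmf_bind shift)
  also have "\<dots> = (\<Sum>s\<in>{..a} \<times> {..b}. pmf M s * pmf (walk M k) (a - fst s, b - snd s))"
    by (subst expectation_finite_support[of "{..a} \<times> {..b}"]) (auto intro!: sum.cong)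
  also have "\<dots> = (\<Sum>i\<le>a. \<Sum>j\<le>b. pmf M (i, j) * pmf (walk M k) (a - i, b - j))"
    by (simp add: sum.cartesian_product split_beta)
  finally show ?case
    by (simp add: fps_mult_nth fps_sum_nth Suc atLeast0AtMost bifps_def)
qed

lemma expectation_bind_pmf':
  fixes f :: "'a \<Rightarrow> complex"
  assumes "\<And>x. norm (f x) \<le> B"
  shows "measure_pmf.expectation (bind_pmf M K) f =
    measure_pmf.expectation M (\<lambda>x. measure_pmf.expectation (K x) f)"
proof -
  have real: "measure_pmf.expectation (bind_pmf M K) g =
      measure_pmf.expectation M (\<lambda>x. measure_pmf.expectation (K x) g)" if "\<And>x. \<bar>g x\<bar> \<le> B" for g :: "'a \<Rightarrow> real"
    unfolding measure_pmf_bind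
    by (rule integral_bind[where K = "count_space UNIV" and B = B and B' = 1])
       (use that in \<open>auto intro!: measure_pmf_in_subprob_space\<close>)
  have int: "integrable (measure_pmf N) f" for N
    by (rule measure_pmf.integrable_const_bound[where B = B]) (use assms in auto)
  have "norm (measure_pmf.expectation (K x) f) \<le> B" for x
  proof -
    have "measure_pmf.expectation (K x) (\<lambda>x. norm (f x)) \<le> B"
      by (intro measure_pmf.integral_le_const integrable_norm int) (use assms in auto)
    then show ?thesis using integral_norm_bound[of "measure_pmf (K x)" f] by linarith
  qed
  then have int': "integrable (measure_pmf M) (\<lambda>x. measure_pmf.expectation (K x) f)"
    by (intro measure_pmf.integrable_const_bound[where B = B]) auto
  show ?thesis
  proof (rule complex_eqI)
    have "Re (measure_pmf.expectation (bind_pmf M K) f) = measure_pmf.expectation (bind_pmf M K) (\<lambda>x. Re (f x))"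
      using integral_bounded_linear[OF bounded_linear_Re int] by simp
    also have "\<dots> = measure_pmf.expectation M (\<lambda>x. measure_pmf.expectation (K x) (\<lambda>x. Re (f x)))"
      using assms abs_Re_le_cmod order_trans by (intro real) blast
    also have "\<dots> = Re (measure_pmf.expectation M (\<lambda>x. measure_pmf.expectation (K x) f))"
      using integral_bounded_linear[OF bounded_linear_Re int'] integral_bounded_linear[OF bounded_linear_Re int] by simp
    finally show "Re (measure_pmf.expectation (bind_pmf M K) f) =
        Re (measure_pmf.expectation M (\<lambda>x. measure_pmf.expectation (K x) f))" .
  next
    have "Im (measure_pmf.expectation (bind_pmf M K) f) = measure_pmf.expectation (bind_pmf M K) (\<lambda>x. Im (f x))"
      using integral_bounded_linear[OF bounded_linear_Im int] by simp
    also have "\<dots> = measure_pmf.expectation M (\<lambda>x. measure_pmf.expectation (K x) (\<lambda>x. Im (f x)))"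
      using assms abs_Im_le_cmod order_trans by (intro real) blast
    also have "\<dots> = Im (measure_pmf.expectation M (\<lambda>x. measure_pmf.expectation (K x) f))"
      using integral_bounded_linear[OF bounded_linear_Im int'] integral_bounded_linear[OF bounded_linear_Im int] by simp
    finally show "Im (measure_pmf.expectation (bind_pmf M K) f) =
        Im (measure_pmf.expectation M (\<lambda>x. measure_pmf.expectation (K x) f))" .
  qed
qed

lemma char_walk:
  fixes ph :: "'a::monoid_add \<Rightarrow> real"
  assumes "ph 0 = 0" "\<And>s t. ph (s + t) = ph s + ph t"
  shows "measure_pmf.expectation (walk M k) (\<lambda>s. iexp (ph s)) =
    measure_pmf.expectation M (\<lambda>s. iexp (ph s)) ^ k"
proof (induction k)
  case 0
  then show ?case by (simp add: assms)
next
  case (Suc k)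
  have "measure_pmf.expectation (walk M (Suc k)) (\<lambda>s. iexp (ph s)) =
      measure_pmf.expectation M (\<lambda>s. iexp (ph s) * measure_pmf.expectation (walk M k) (\<lambda>t. iexp (ph t)))"
    by (simp add: expectation_bind_pmf'[where B = 1] assms exp_add[symmetric] distrib_left
        flip: integral_mult_right_zero)
  also have "\<dots> = measure_pmf.expectation M (\<lambda>s. iexp (ph s)) ^ Suc k"
    unfolding Suc by simp
  finally show ?case .
qed

text \<open>Fubini moves the integral over \<open>B\<close> inside the expectation, where
  orthogonality of the characters leaves only the atom \<open>y\<close>. \<open>B\<close> is a
  period cell of the dual group and \<open>V\<close> its volume; this covers walks in one and in two
  dimensions at once.\<close>

lemma pmf_fourier_inversion:
  fixes M :: "'s::countable pmf" and ph :: "'a::euclidean_space \<Rightarrow> 's \<Rightarrow> real" and V :: real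
  assumes [measurable]: "\<And>s. (\<lambda>t. ph t s) \<in> borel_measurable borel" and B[measurable]: "B \<in> sets borel"
    and fin: "emeasure lborel B < \<infinity>"
    and orth: "\<And>s. (\<integral>t. indicator B t *\<^sub>R iexp (ph t s - ph t y) \<partial>lborel) = complex_of_real (V * indicator {y} s)"
  shows "complex_of_real (V * pmf M y) =
    (\<integral>t. indicator B t *\<^sub>R (measure_pmf.expectation M (\<lambda>s. iexp (ph t s)) * iexp (- ph t y)) \<partial>lborel)"
proof -
  interpret pair_sigma_finite "measure_pmf M" "lborel :: 'a measure" ..
  let ?f = "\<lambda>s t. indicator B t *\<^sub>R iexp (ph t s - ph t y)"
  have cs: "measurable (measure_pmf M \<Otimes>\<^sub>M (lborel :: 'a measure)) (borel :: complex measure) =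
      measurable (count_space UNIV \<Otimes>\<^sub>M lborel) borel"
    by (rule measurable_cong_sets) (auto intro!: sets_pair_measure_cong)
  have [measurable]: "case_prod ?f \<in> borel_measurable (measure_pmf M \<Otimes>\<^sub>M lborel)"
    unfolding cs by (rule measurable_pair_measure_countable1) (auto, measurable)
  have nf: "norm (?f s t) = indicator B t" for s t
    by (simp add: indicator_def)
  have intB: "integrable lborel (indicator B :: 'a \<Rightarrow> real)"
    using fin by (simp add: integrable_indicator_iff)
  have int: "integrable (measure_pmf M \<Otimes>\<^sub>M lborel) (case_prod ?f)"
  proof (rule Fubini_integrable)
    show "integrable (measure_pmf M) (\<lambda>s. \<integral>t. norm (case_prod ?f (s, t)) \<partial>lborel)"
      by (simp only: prod.case nf) simp
    show "AE s in measure_pmf M. integrable lborel (\<lambda>t. case_prod ?f (s, t))"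
    proof (rule AE_I2)
      fix s
      show "integrable lborel (\<lambda>t. case_prod ?f (s, t))"
      proof (rule Bochner_Integration.integrable_bound[OF intB])
        show "AE t in lborel. norm (case_prod ?f (s, t)) \<le> norm (indicator B t :: real)"
          by (intro AE_I2) (simp only: prod.case nf, simp)
      qed measurable
    qed
  qed measurable
  have "(\<integral>t. indicator B t *\<^sub>R (measure_pmf.expectation M (\<lambda>s. iexp (ph t s)) * iexp (- ph t y)) \<partial>lborel) =
      (\<integral>t. (\<integral>s. ?f s t \<partial>measure_pmf M) \<partial>lborel)"
  proof (rule Bochner_Integration.integral_cong[OF refl])
    fix t
    have e: "iexp (ph t s - ph t y) = iexp (ph t s) * iexp (- ph t y)" for s
      by (simp add: exp_add[symmetric] algebra_simps)
    show "indicator B t *\<^sub>R (measure_pmf.expectation M (\<lambda>s. iexp (ph t s)) * iexp (- ph t y)) =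
      (\<integral>s. ?f s t \<partial>measure_pmf M)" by (simp only: e) simp
  qed
  also have "\<dots> = (\<integral>s. (\<integral>t. ?f s t \<partial>lborel) \<partial>measure_pmf M)"
    using Fubini_integral[OF int] by simp
  also have "\<dots> = (\<integral>s. complex_of_real (V * indicator {y} s) \<partial>measure_pmf M)"
    by (simp only: orth)
  also have "\<dots> = complex_of_real (\<integral>s. V * indicator {y} s \<partial>measure_pmf M)"
    by (rule integral_complex_of_real)
  also have "(\<integral>s. V * indicator {y} s \<partial>measure_pmf M) = V * pmf M y"
    by (simp add: measure_pmf_single)
  finally show ?thesis ..
qed

section \<open>Local limit theorem\<close>

lemma integral_lborel_scale:
  fixes f :: "'a::euclidean_space \<Rightarrow> 'b::{banach, second_countable_topology}"
  assumes c: "c > 0" and [measurable]: "f \<in> borel_measurable borel"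
  shows "(\<integral>x. f x \<partial>lborel) = c ^ DIM('a) *\<^sub>R (\<integral>x. f (c *\<^sub>R x) \<partial>lborel)"
proof -
  have "(\<integral>x. f x \<partial>lborel) = (\<integral>x. f x \<partial>density (distr lborel borel (\<lambda>x. 0 + c *\<^sub>R x)) (\<lambda>_. \<bar>c\<bar> ^ DIM('a)))"
    using c lborel_affine[of c "0 :: 'a"] by simp
  also have "\<dots> = c ^ DIM('a) *\<^sub>R (\<integral>x. f (c *\<^sub>R x) \<partial>lborel)"
    using c by (subst integral_density) (auto simp: integral_distr)
  finally show ?thesis .
qed

text \<open>The substitution t = s / r turns the prefactor into a Jacobian and makes the bound
  independent of n, so dominated convergence applies.\<close>

lemma scaled_integral_tendsto:
  fixes F :: "nat \<Rightarrow> 'a::euclidean_space \<Rightarrow> complex" and g :: "'a \<Rightarrow> real"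
  assumes meas: "\<And>n. F n \<in> borel_measurable borel" and g: "integrable lborel g"
    and r: "\<And>n. r n > 0"
    and bound: "\<And>n t. norm (F n t) \<le> g (r n *\<^sub>R t)"
    and lim: "\<And>s. (\<lambda>n. F n ((1 / r n) *\<^sub>R s)) \<longlonglongrightarrow> L s"
  shows "(\<lambda>n. r n ^ DIM('a) *\<^sub>R (\<integral>t. F n t \<partial>lborel)) \<longlonglongrightarrow> (\<integral>s. L s \<partial>lborel)"
proof -
  have eq: "r n ^ DIM('a) *\<^sub>R (\<integral>t. F n t \<partial>lborel) = (\<integral>s. F n ((1 / r n) *\<^sub>R s) \<partial>lborel)" for n
    using integral_lborel_scale[of "1 / r n" "F n"] r[of n] meas by (simp add: power_divide)
  have m: "(\<lambda>s. F n ((1 / r n) *\<^sub>R s)) \<in> borel_measurable borel" for n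
    using meas[of n] by measurable
  have mL: "L \<in> borel_measurable borel"
    by (rule borel_measurable_LIMSEQ_metric[OF m lim])
  show ?thesis
    unfolding eq
  proof (rule integral_dominated_convergence[where w = g])
    show "AE s in lborel. norm (F n ((1 / r n) *\<^sub>R s)) \<le> g s" for n
      using bound[of n "(1 / r n) *\<^sub>R _"] r[of n] by (intro AE_I2) (simp add: less_imp_neq[THEN not_sym])
  qed (use m mL lim g in auto)
qed

lemma scaled_integral_bound:
  fixes F :: "'a::euclidean_space \<Rightarrow> complex" and g :: "'a \<Rightarrow> real"
  assumes F[measurable]: "F \<in> borel_measurable borel" and g: "integrable lborel g"
    and r: "r > 0" and bound: "\<And>t. norm (F t) \<le> g (r *\<^sub>R t)"
  shows "r ^ DIM('a) * norm (\<integral>t. F t \<partial>lborel) \<le> (\<integral>s. g s \<partial>lborel)"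
proof -
  have eq: "r ^ DIM('a) *\<^sub>R (\<integral>t. F t \<partial>lborel) = (\<integral>s. F ((1 / r) *\<^sub>R s) \<partial>lborel)"
    using integral_lborel_scale[of "1 / r" "F"] r by (simp add: power_divide)
  have "r ^ DIM('a) * norm (\<integral>t. F t \<partial>lborel) = norm (r ^ DIM('a) *\<^sub>R (\<integral>t. F t \<partial>lborel))"
    using r by simp
  also have "\<dots> \<le> (\<integral>s. g s \<partial>lborel)"
    unfolding eq
  proof (rule Bochner_Integration.integral_norm_bound_integral[OF _ g])
    have b: "norm (F ((1 / r) *\<^sub>R s)) \<le> g s" for s
      using bound[of "(1 / r) *\<^sub>R s"] r by simp
    then show "norm (F ((1 / r) *\<^sub>R s)) \<le> g s" for s .
    show "integrable lborel (\<lambda>s. F ((1 / r) *\<^sub>R s))"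
      by (rule Bochner_Integration.integrable_bound[OF g]) (use b in \<open>auto intro: order_trans[OF _ abs_ge_self]\<close>)
  qed
  finally show ?thesis .
qed

section \<open>Decay of characteristic functions\<close>

definition circ :: "real \<Rightarrow> real" where
  "circ x = norm (iexp x - 1)"

lemma norm_iexp_diff: "norm (iexp x - iexp y) = circ (x - y)"
proof -
  have "iexp x - iexp y = iexp y * (iexp (x - y) - 1)"
    by (simp add: algebra_simps exp_add[symmetric])
  then show ?thesis by (simp add: circ_def norm_mult)
qed

text \<open>\<open>circ\<close> is the length of a chord of the unit circle. It is subadditive and
  ignores multiples of 2 \<pi>, so phases can be combined with it without any care for wrap-around;
  only at the very end does \<open>circ_lower\<close> return to the absolute value.\<close>

lemma circ_diff: "circ (x - y) \<le> circ x + circ y"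
proof -
  have "circ (x - y) = norm ((iexp x - 1) - (iexp y - 1))" by (simp add: norm_iexp_diff[symmetric])
  also have "\<dots> \<le> circ x + circ y" unfolding circ_def by (rule norm_triangle_ineq4)
  finally show ?thesis .
qed

lemma circ_nonneg [simp]: "circ x \<ge> 0" by (simp add: circ_def)

lemma circ_lower:
  assumes "\<bar>x\<bar> \<le> pi"
  shows "\<bar>x\<bar> / 5 \<le> circ x"
proof -
  \<comment> \<open>On [0, 2] the Taylor bound sin y \<ge> y - y^3/6 - y^5/120 is at least (1 - 4/6
    - 16/120) y, and the bracket is exactly 1/5. The argument used below is |x|/2 \<le> \<pi>/2 <
    2.\<close>
  have pos: "y / 5 \<le> sin y" if "0 \<le> y" "y \<le> 2" for y :: real
  proof -
    have "\<bar>Im (iexp y - (\<Sum>k\<le>4. (\<i> * y) ^ k / fact k))\<bar> \<le> \<bar>y\<bar> ^ Suc 4 / fact (Suc 4)"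
      using iexp_approx1[of y 4] abs_Im_le_cmod order_trans by blast
    moreover have "Im (iexp y - (\<Sum>k\<le>4. (\<i> * y) ^ k / fact k)) = sin y - (y - y ^ 3 / 6)"
      by (simp add: numeral_eq_Suc Im_exp algebra_simps power_mult_distrib)
    ultimately have "\<bar>sin y - (y - y ^ 3 / 6)\<bar> \<le> y ^ 5 / 120"
      using that by (simp add: fact_numeral)
    moreover have "y ^ 3 \<le> 4 * y"
      using mult_mono[of "y * y" 4 y y] mult_mono[of y 2 y 2] that by (simp add: power3_eq_cube)
    moreover have "y ^ 5 \<le> 16 * y"
      using mult_mono[of "y ^ 4" "2 ^ 4" y y] power_mono[of y 2 4] that by (simp add: power_numeral_reduce)
    ultimately show ?thesis by linarith
  qed
  have "(circ x)\<^sup>2 = (cos x - 1)\<^sup>2 + (sin x)\<^sup>2"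
    by (simp add: circ_def cmod_power2 Re_exp Im_exp)
  also have "\<dots> = 2 - 2 * cos x"
    using sin_cos_squared_add[of x] by (simp add: power2_eq_square algebra_simps)
  also have "\<dots> = (2 * sin (\<bar>x\<bar> / 2))\<^sup>2"
    using cos_double_sin[of "\<bar>x\<bar> / 2"] by (simp add: power2_eq_square)
  finally have "circ x = \<bar>2 * sin (\<bar>x\<bar> / 2)\<bar>"
    by (metis abs_of_nonneg circ_nonneg power2_eq_iff abs_minus_cancel abs_mult_self_eq real_sqrt_abs)
  moreover have "(\<bar>x\<bar> / 2) / 5 \<le> sin (\<bar>x\<bar> / 2)"
    using assms pi_less_4 by (intro pos) auto
  ultimately show ?thesis by simp
qed

lemma norm_char_le_1: "norm (measure_pmf.expectation M (\<lambda>s. iexp (f s))) \<le> 1"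
proof -
  have "norm (measure_pmf.expectation M (\<lambda>s. iexp (f s))) \<le> measure_pmf.expectation M (\<lambda>s. norm (iexp (f s)))"
    by (rule integral_norm_bound)
  then show ?thesis by simp
qed

text \<open>If \<open>u\<close> is the direction of the expectation \<phi>, the mean square distance
  of the random point on the circle from \<open>u\<close> is 2 (1 - |\<phi>|). Two atoms whose
  phases differ cannot both be close to \<open>u\<close>, and their share of this mean is bounded
  below by the parallelogram inequality.\<close>

lemma char_gap:
  assumes "s \<in> set_pmf M" "s' \<in> set_pmf M"
  shows "min (pmf M s) (pmf M s') / 4 * (circ (f s - f s'))\<^sup>2 \<le>
    1 - norm (measure_pmf.expectation M (\<lambda>s. iexp (f s)))"
proof (cases "s = s'")
  case True
  then show ?thesis using norm_char_le_1[of M f] by (simp add: circ_def)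
next
  case False
  define \<phi> where "\<phi> = measure_pmf.expectation M (\<lambda>s. iexp (f s))"
  \<comment> \<open>For \<phi> = 0 any unit vector serves as direction; the identity \<phi> =
    |\<phi>| u holds in both cases.\<close>
  define u where "u = (if \<phi> = 0 then 1 else \<phi> / norm \<phi>)"
  have u: "norm u = 1" "\<phi> = norm \<phi> * u" by (auto simp: u_def norm_divide)
  have uu: "cnj u * u = 1" using u(1) by (metis complex_norm_square mult.commute of_real_1 power_one)
  let ?h = "\<lambda>x. (norm (iexp (f x) - u))\<^sup>2"
  have h: "?h x = 2 - 2 * Re (cnj u * iexp (f x))" for x
  proof -
    have "complex_of_real (?h x) = (iexp (f x) - u) * cnj (iexp (f x) - u)"
      by (simp add: complex_norm_square del: of_real_power)
    also have "\<dots> = iexp (f x) * cnj (iexp (f x)) + u * cnj u - (cnj u * iexp (f x) + cnj (cnj u * iexp (f x)))"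
      by (simp add: algebra_simps)
    also have "iexp (f x) * cnj (iexp (f x)) = 1"
      using complex_norm_square[of "iexp (f x)"] by simp
    also have "u * cnj u = 1" using uu by (simp add: mult.commute)
    also have "cnj u * iexp (f x) + cnj (cnj u * iexp (f x)) = complex_of_real (2 * Re (cnj u * iexp (f x)))"
      by (rule complex_add_cnj)
    finally have "complex_of_real (?h x) = complex_of_real (2 - 2 * Re (cnj u * iexp (f x)))" by simp
    then show ?thesis by (simp only: of_real_eq_iff)
  qed
  have int: "integrable (measure_pmf M) (\<lambda>x. iexp (f x))"
    by (rule measure_pmf.integrable_const_bound[where B = 1]) auto
  have "measure_pmf.expectation M ?h = 2 - 2 * Re (cnj u * \<phi>)"
  proof -
    have i: "integrable (measure_pmf M) (\<lambda>x. cnj u * iexp (f x))" using int by simp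
    have "measure_pmf.expectation M (\<lambda>x. Re (cnj u * iexp (f x))) = Re (measure_pmf.expectation M (\<lambda>x. cnj u * iexp (f x)))"
      by (rule integral_bounded_linear[OF bounded_linear_Re i])
    also have "\<dots> = Re (cnj u * \<phi>)" by (simp add: \<phi>_def)
    finally have eq: "measure_pmf.expectation M (\<lambda>x. Re (cnj u * iexp (f x))) = Re (cnj u * \<phi>)" .
    have gen: "measure_pmf.expectation M (\<lambda>x. 2 - 2 * g x) = 2 - 2 * measure_pmf.expectation M g"
      if "integrable (measure_pmf M) g" for g :: "'a \<Rightarrow> real" using that by simp
    show ?thesis unfolding h gen[OF integrable_bounded_linear[OF bounded_linear_Re i]] eq ..
  qed
  also have "Re (cnj u * \<phi>) = norm \<phi>"
  proof -
    have "cnj u * \<phi> = norm \<phi> * (cnj u * u)" by (subst (1) u(2)) simp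
    then show ?thesis using uu by simp
  qed
  finally have E: "measure_pmf.expectation M ?h = 2 * (1 - norm \<phi>)" by simp
  have hb: "?h x \<le> 4" for x
  proof -
    have "norm (iexp (f x) - u) \<le> 2" using norm_triangle_ineq4[of "iexp (f x)" u] u(1) by simp
    then show ?thesis using power_mono[of "norm (iexp (f x) - u)" 2 2] by simp
  qed
  have ih: "integrable (measure_pmf M) ?h"
    by (rule measure_pmf.integrable_const_bound[where B = 4]) (use hb in auto)
  let ?w = "min (pmf M s) (pmf M s')"
  have w: "?w \<ge> 0" by simp
  have "circ (f s - f s') \<le> norm (iexp (f s) - u) + norm (iexp (f s') - u)"
    unfolding norm_iexp_diff[symmetric] using norm_triangle_ineq4[of "iexp (f s) - u" "iexp (f s') - u"] by simp
  then have "(circ (f s - f s'))\<^sup>2 \<le> (norm (iexp (f s) - u) + norm (iexp (f s') - u))\<^sup>2"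
    by (rule power_mono) simp
  also have "\<dots> \<le> 2 * ?h s + 2 * ?h s'"
    using zero_le_power2[of "norm (iexp (f s) - u) - norm (iexp (f s') - u)"]
    by (simp add: power2_eq_square algebra_simps)
  finally have "?w * (circ (f s - f s'))\<^sup>2 \<le> 2 * (?w * ?h s + ?w * ?h s')"
    using mult_left_mono[OF _ w] by (fastforce simp: algebra_simps)
  also have "\<dots> \<le> 2 * (pmf M s * ?h s + pmf M s' * ?h s')"
    by (intro mult_left_mono add_mono mult_right_mono) auto
  also have "pmf M s * ?h s + pmf M s' * ?h s' = measure_pmf.expectation M (\<lambda>x. if x \<in> {s, s'} then ?h x else 0)"
    using False by (subst expectation_finite_support[of "{s, s'}"]) auto
  also have "\<dots> \<le> measure_pmf.expectation M ?h"
    by (intro integral_mono ih measure_pmf.integrable_const_bound[where B = 4]) (use hb in auto)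
  finally show ?thesis using E by (simp add: \<phi>_def)
qed

section \<open>Central limit behaviour and the general local limit theorem\<close>

lemma char_power_tendsto:
  fixes f :: "'a \<Rightarrow> real"
  assumes f: "integrable (measure_pmf M) f" "measure_pmf.expectation M f = 0"
    and f2: "integrable (measure_pmf M) (\<lambda>s. (f s)\<^sup>2)"
  shows "(\<lambda>k. measure_pmf.expectation M (\<lambda>s. iexp (f s / sqrt (real k))) ^ k) \<longlonglongrightarrow>
    complex_of_real (exp (- measure_pmf.expectation M (\<lambda>s. (f s)\<^sup>2) / 2))"
proof -
  define v where "v = measure_pmf.expectation M (\<lambda>s. (f s)\<^sup>2)"
  have v0: "v \<ge> 0" by (simp add: v_def)
  define \<psi> where "\<psi> k = measure_pmf.expectation M (\<lambda>s. iexp (f s / sqrt (real k)))" for k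
  define e where "e k = measure_pmf.expectation M (\<lambda>s. min (6 * (f s)\<^sup>2) (\<bar>1 / sqrt (real k)\<bar> * \<bar>f s\<bar> ^ 3))" for k
  have approx: "norm (\<psi> k - complex_of_real (1 + (- v / 2) / k)) \<le> (1 / k) / 6 * e k" if "k > 0" for k :: nat
  proof -
    have "norm (char (distr (measure_pmf M) borel f) (1 / sqrt k) - (1 - (1 / sqrt k)\<^sup>2 * v / 2)) \<le>
        (1 / sqrt k)\<^sup>2 / 6 * e k"
      unfolding e_def by (rule prob_space.char_approx3'[OF prob_space_measure_pmf]) (use f f2 in \<open>auto simp: v_def\<close>)
    moreover have "char (distr (measure_pmf M) borel f) (1 / sqrt k) = \<psi> k"
      by (simp add: char_def integral_distr \<psi>_def)
    ultimately show ?thesis using that by (simp add: power_divide mult.commute)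
  qed
  \<comment> \<open>Only two moments are at hand, so the third-order error is truncated at a
    multiple of f^2; it vanishes by dominated convergence, without a rate.\<close>
  have e0: "e \<longlonglongrightarrow> 0"
  proof -
    have "(\<lambda>k. min (6 * (f s)\<^sup>2) (\<bar>1 / sqrt (real k)\<bar> * \<bar>f s\<bar> ^ 3)) \<longlonglongrightarrow> min (6 * (f s)\<^sup>2) (\<bar>0\<bar> * \<bar>f s\<bar> ^ 3)" for s
      by (intro tendsto_intros) (real_asymp)
    then have "(\<lambda>k. min (6 * (f s)\<^sup>2) (\<bar>1 / sqrt (real k)\<bar> * \<bar>f s\<bar> ^ 3)) \<longlonglongrightarrow> 0" for s
      by simp
    then have "e \<longlonglongrightarrow> (\<integral>s. 0 \<partial>measure_pmf M)"
      unfolding e_def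
      by (intro integral_dominated_convergence[where w = "\<lambda>s. 6 * (f s)\<^sup>2"]) (use f2 in auto)
    then show ?thesis by simp
  qed
  have ev: "\<forall>\<^sub>F k in sequentially. norm (\<psi> k ^ k - complex_of_real ((1 + (- v / 2) / real k) ^ k)) \<le> 1 / 6 * e k"
  proof (rule eventually_sequentiallyI)
    fix k :: nat assume k: "nat \<lceil>v\<rceil> + 1 \<le> k"
    then have k': "v \<le> k" "k > 0" by linarith+
    have "norm (\<psi> k ^ k - complex_of_real (1 + (- v / 2) / real k) ^ k) \<le> k * norm (\<psi> k - complex_of_real (1 + (- v / 2) / k))"
    proof (rule norm_power_diff)
      show "norm (\<psi> k) \<le> 1" unfolding \<psi>_def by (rule norm_char_le_1)
      have "\<bar>1 + (- v / 2) / real k\<bar> \<le> 1" using k' v0 by (auto simp: abs_le_iff field_simps)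
      then show "norm (complex_of_real (1 + (- v / 2) / real k)) \<le> 1" by (simp only: norm_of_real)
    qed
    also have "\<dots> \<le> k * ((1 / k) / 6 * e k)" by (intro mult_left_mono approx k') simp
    finally show "norm (\<psi> k ^ k - complex_of_real ((1 + (- v / 2) / real k) ^ k)) \<le> 1 / 6 * e k"
      using k' by simp
  qed
  have "(\<lambda>k. \<psi> k ^ k - complex_of_real ((1 + (- v / 2) / real k) ^ k)) \<longlonglongrightarrow> 0"
    by (rule Lim_null_comparison[OF ev]) (use tendsto_mult_left[OF e0, of "1/6"] in simp)
  moreover have "(\<lambda>k. complex_of_real ((1 + (- v / 2) / real k) ^ k)) \<longlonglongrightarrow> complex_of_real (exp (- v / 2))"
    by (intro tendsto_of_real tendsto_exp_limit_sequentially)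
  ultimately have "(\<lambda>k. \<psi> k ^ k) \<longlonglongrightarrow> complex_of_real (exp (- v / 2))"
    by (rule Lim_transform[rotated])
  then show ?thesis by (simp add: \<psi>_def v_def)
qed

text \<open>Collects what a Fourier proof of a local limit theorem uses: a phase linear in both
  arguments, a period cell \<open>B\<close> with orthogonal characters, and a bound of the
  characteristic function by a Gaussian on all of \<open>B\<close>, not only near the origin. The
  last point is where aperiodicity enters.\<close>

locale lattice_walk =
  fixes M :: "'s::{countable, monoid_add} pmf" and ph :: "'a::euclidean_space \<Rightarrow> 's \<Rightarrow> real"
    and B :: "'a set" and V c :: real
  assumes ph_0: "\<And>t. ph t 0 = 0" and ph_add: "\<And>t s s'. ph t (s + s') = ph t s + ph t s'"
    and ph_scale: "\<And>r t s. ph (r *\<^sub>R t) s = r * ph t s"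
    and ph_measurable [measurable]: "\<And>s. (\<lambda>t. ph t s) \<in> borel_measurable borel"
    and B_sets [measurable]: "B \<in> sets borel" and B_finite: "emeasure lborel B < \<infinity>"
    and B_nbhd: "\<exists>d>0. ball 0 d \<subseteq> B"
    and orth: "\<And>s y. (\<integral>t. indicator B t *\<^sub>R iexp (ph t s - ph t y) \<partial>lborel) = complex_of_real (V * indicator {y} s)"
    and c_pos: "c > 0" and V_pos: "V > 0"
    and gap: "\<And>t. t \<in> B \<Longrightarrow> norm (measure_pmf.expectation M (\<lambda>s. iexp (ph t s))) \<le> exp (- (c * (norm t)\<^sup>2))"
    and gauss: "integrable lborel (\<lambda>t::'a. exp (- (c * (norm t)\<^sup>2)))"
    and square_integrable: "\<And>t. integrable (measure_pmf M) (\<lambda>s. (ph t s)\<^sup>2)"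
begin

definition cf :: "'a \<Rightarrow> complex" where
  "cf t = measure_pmf.expectation M (\<lambda>s. iexp (ph t s))"

definition ph_mean :: "'a \<Rightarrow> real" where
  "ph_mean t = measure_pmf.expectation M (ph t)"

definition ph_var :: "'a \<Rightarrow> real" where
  "ph_var t = measure_pmf.expectation M (\<lambda>s. (ph t s - ph_mean t)\<^sup>2)"

lemma cf_measurable [measurable]: "cf \<in> borel_measurable borel"
proof -
  have "(\<lambda>(t, s). iexp (ph t s)) \<in> borel_measurable (borel \<Otimes>\<^sub>M measure_pmf M)"
    unfolding split_beta
    by (rule measurable_compose_countable'[where f = "\<lambda>s z. iexp (ph (fst z) s)" and g = snd and I = UNIV])
       (auto intro!: measurable_compose[OF measurable_snd], measurable)
  then show ?thesis
    unfolding cf_def[abs_def] by (rule measure_pmf.borel_measurable_lebesgue_integral)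
qed

lemma ph_integrable: "integrable (measure_pmf M) (ph t)"
  by (rule measure_pmf.square_integrable_imp_integrable) (use square_integrable in auto)

lemma inversion:
  "complex_of_real (V * pmf (walk M k) y) = (\<integral>t. indicator B t *\<^sub>R (cf t ^ k * iexp (- ph t y)) \<partial>lborel)"
proof -
  have "complex_of_real (V * pmf (walk M k) y) =
    (\<integral>t. indicator B t *\<^sub>R (measure_pmf.expectation (walk M k) (\<lambda>s. iexp (ph t s)) * iexp (- ph t y)) \<partial>lborel)"
    by (rule pmf_fourier_inversion[OF ph_measurable B_sets B_finite orth])
  then show ?thesis by (simp add: char_walk ph_0 ph_add cf_def)
qed

lemma cf_power_bound:
  assumes "t \<in> B" "k > 0"
  shows "norm (cf t) ^ k \<le> exp (- (c * (norm (sqrt (real k) *\<^sub>R t))\<^sup>2))"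
proof -
  have "norm (cf t) ^ k \<le> exp (- (c * (norm t)\<^sup>2)) ^ k"
    using gap[OF assms(1)] by (intro power_mono) (auto simp: cf_def)
  also have "\<dots> = exp (- (c * (norm (sqrt (real k) *\<^sub>R t))\<^sup>2))"
    by (simp add: exp_of_nat_mult[symmetric] power_mult_distrib algebra_simps)
  finally show ?thesis .
qed

text \<open>Uniform in the target \<open>y\<close>; it provides the domination when local limits are
  averaged over random shifts of the target.\<close>

lemma walk_bound:
  assumes "k > 0"
  shows "sqrt (real k) ^ DIM('a) * (V * pmf (walk M k) y) \<le> (\<integral>t. exp (- (c * (norm (t::'a))\<^sup>2)) \<partial>lborel)"
proof -
  have "sqrt (real k) ^ DIM('a) * norm (\<integral>t. indicator B t *\<^sub>R (cf t ^ k * iexp (- ph t y)) \<partial>lborel) \<le>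
    (\<integral>t. exp (- (c * (norm (t::'a))\<^sup>2)) \<partial>lborel)"
  proof (rule scaled_integral_bound[OF _ gauss])
    fix t
    show "norm (indicator B t *\<^sub>R (cf t ^ k * iexp (- ph t y))) \<le> exp (- (c * (norm (sqrt (real k) *\<^sub>R t))\<^sup>2))"
      using cf_power_bound[of t k] assms by (cases "t \<in> B") (auto simp: norm_mult norm_power)
  qed (use assms in \<open>auto, measurable\<close>)
  then show ?thesis unfolding inversion[symmetric] norm_of_real using V_pos by simp
qed

text \<open>Centring the phase splits the rescaled integrand into a power of a centred
  characteristic function, which tends to a Gaussian factor, and a pure phase given by the distance
  of the target from the mean. Kept separate from \<open>local_limit\<close> because differences of
  probabilities use the same limit with an extra factor.\<close>

lemma local_limit_integrand:
  fixes K :: "nat \<Rightarrow> nat"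
  assumes K: "\<And>n. K n > 0" "filterlim K at_top sequentially"
    and w: "(\<lambda>n. (real (K n) * ph_mean s - ph s (y n)) / sqrt (real (K n))) \<longlonglongrightarrow> w"
  shows "(\<lambda>n. indicator B ((1 / sqrt (real (K n))) *\<^sub>R s) *\<^sub>R
      (cf ((1 / sqrt (real (K n))) *\<^sub>R s) ^ K n * iexp (- ph ((1 / sqrt (real (K n))) *\<^sub>R s) (y n))))
    \<longlonglongrightarrow> complex_of_real (exp (- ph_var s / 2)) * iexp w"
proof -
  let ?r = "\<lambda>n. sqrt (real (K n))"
  have r: "filterlim ?r at_top sequentially"
    by (intro filterlim_compose[OF sqrt_at_top] filterlim_compose[OF filterlim_real_sequentially] K)
  have "\<forall>\<^sub>F n in sequentially. (1 / ?r n) *\<^sub>R s \<in> B"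
  proof -
    obtain d where d: "d > 0" "ball 0 d \<subseteq> B" using B_nbhd by blast
    have "(\<lambda>n. (1 / ?r n) *\<^sub>R s) \<longlonglongrightarrow> 0 *\<^sub>R s"
      by (intro tendsto_intros tendsto_divide_0[OF tendsto_const] filterlim_at_top_imp_at_infinity[OF r])
    then have "\<forall>\<^sub>F n in sequentially. (1 / ?r n) *\<^sub>R s \<in> ball 0 d"
      using d(1) by (intro topological_tendstoD) auto
    then show ?thesis by eventually_elim (use d(2) in blast)
  qed
  moreover have "indicator B ((1 / ?r n) *\<^sub>R s) *\<^sub>R (cf ((1 / ?r n) *\<^sub>R s) ^ K n * iexp (- ph ((1 / ?r n) *\<^sub>R s) (y n))) =
      measure_pmf.expectation M (\<lambda>x. iexp ((ph s x - ph_mean s) / ?r n)) ^ K n *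
      iexp ((real (K n) * ph_mean s - ph s (y n)) / ?r n)" if "(1 / ?r n) *\<^sub>R s \<in> B" for n
  proof -
    have e: "iexp (ph ((1 / ?r n) *\<^sub>R s) x) = iexp ((ph s x - ph_mean s) / ?r n) * iexp (ph_mean s / ?r n)" for x
      by (simp add: ph_scale exp_add[symmetric] diff_divide_distrib algebra_simps)
    have "cf ((1 / ?r n) *\<^sub>R s) = measure_pmf.expectation M (\<lambda>x. iexp ((ph s x - ph_mean s) / ?r n)) * iexp (ph_mean s / ?r n)"
      unfolding cf_def e by simp
    moreover have "iexp (ph_mean s / ?r n) ^ K n * iexp (- ph ((1 / ?r n) *\<^sub>R s) (y n)) =
        iexp ((real (K n) * ph_mean s - ph s (y n)) / ?r n)"
      by (simp add: ph_scale exp_of_nat_mult[symmetric] exp_add[symmetric] diff_divide_distrib algebra_simps)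
    ultimately show ?thesis using that by (simp add: power_mult_distrib mult.assoc)
  qed
  ultimately have ev: "\<forall>\<^sub>F n in sequentially.
      measure_pmf.expectation M (\<lambda>x. iexp ((ph s x - ph_mean s) / ?r n)) ^ K n *
      iexp ((real (K n) * ph_mean s - ph s (y n)) / ?r n) =
      indicator B ((1 / ?r n) *\<^sub>R s) *\<^sub>R (cf ((1 / ?r n) *\<^sub>R s) ^ K n * iexp (- ph ((1 / ?r n) *\<^sub>R s) (y n)))"
    by (elim eventually_mono) simp
  have "(\<lambda>k. measure_pmf.expectation M (\<lambda>x. iexp ((ph s x - ph_mean s) / sqrt (real k))) ^ k) \<longlonglongrightarrow>
      complex_of_real (exp (- ph_var s / 2))"
    unfolding ph_var_def
  proof (rule char_power_tendsto)
    show "integrable (measure_pmf M) (\<lambda>x. ph s x - ph_mean s)" using ph_integrable by simp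
    show "measure_pmf.expectation M (\<lambda>x. ph s x - ph_mean s) = 0"
      using ph_integrable by (simp add: ph_mean_def)
    show "integrable (measure_pmf M) (\<lambda>x. (ph s x - ph_mean s)\<^sup>2)"
      using ph_integrable square_integrable by (simp add: power2_diff)
  qed
  from filterlim_compose[OF this K(2)]
  have "(\<lambda>n. measure_pmf.expectation M (\<lambda>x. iexp ((ph s x - ph_mean s) / ?r n)) ^ K n) \<longlonglongrightarrow>
      complex_of_real (exp (- ph_var s / 2))" .
  moreover have "(\<lambda>n. iexp ((real (K n) * ph_mean s - ph s (y n)) / ?r n)) \<longlonglongrightarrow> iexp w"
    by (intro tendsto_intros w)
  ultimately show "(\<lambda>n. indicator B ((1 / ?r n) *\<^sub>R s) *\<^sub>R (cf ((1 / ?r n) *\<^sub>R s) ^ K n * iexp (- ph ((1 / ?r n) *\<^sub>R s) (y n))))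
      \<longlonglongrightarrow> complex_of_real (exp (- ph_var s / 2)) * iexp w"
    using ev by (intro Lim_transform_eventually[OF tendsto_mult])
qed

lemma local_limit:
  fixes K :: "nat \<Rightarrow> nat"
  assumes K: "\<And>n. K n > 0" "filterlim K at_top sequentially"
    and w: "\<And>t. (\<lambda>n. (real (K n) * ph_mean t - ph t (y n)) / sqrt (real (K n))) \<longlonglongrightarrow> w t"
  shows "(\<lambda>n. sqrt (real (K n)) ^ DIM('a) *\<^sub>R complex_of_real (V * pmf (walk M (K n)) (y n))) \<longlonglongrightarrow>
    (\<integral>t. complex_of_real (exp (- ph_var t / 2)) * iexp (w t) \<partial>lborel)"
  unfolding inversion
proof (rule scaled_integral_tendsto[OF _ gauss])
  fix s
  show "(\<lambda>n. indicator B ((1 / sqrt (real (K n))) *\<^sub>R s) *\<^sub>R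
      (cf ((1 / sqrt (real (K n))) *\<^sub>R s) ^ K n * iexp (- ph ((1 / sqrt (real (K n))) *\<^sub>R s) (y n))))
    \<longlonglongrightarrow> complex_of_real (exp (- ph_var s / 2)) * iexp (w s)"
    by (rule local_limit_integrand[OF K w])
next
  show "norm (indicator B t *\<^sub>R (cf t ^ K n * iexp (- ph t (y n)))) \<le> exp (- (c * (norm (sqrt (real (K n)) *\<^sub>R t))\<^sup>2))" for n t
    using cf_power_bound[of t "K n"] K by (cases "t \<in> B") (auto simp: norm_mult norm_power)
qed (use K in \<open>auto, measurable\<close>)

text \<open>Variance 0 makes the phase almost surely constant along the ray through
  \<open>t\<close>, so the characteristic function has modulus 1 there, against the Gaussian bound
  near the origin.\<close>

lemma ph_var_pos:
  assumes "t \<noteq> 0"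
  shows "ph_var t > 0"
proof (rule ccontr)
  assume "\<not> ?thesis"
  moreover have "ph_var t \<ge> 0" by (simp add: ph_var_def)
  ultimately have "ph_var t = 0" by simp
  moreover have "integrable (measure_pmf M) (\<lambda>s. (ph t s - ph_mean t)\<^sup>2)"
    using ph_integrable square_integrable by (simp add: power2_diff)
  ultimately have const: "AE s in measure_pmf M. ph t s = ph_mean t"
    unfolding ph_var_def using integral_nonneg_eq_0_iff_AE[of "measure_pmf M" "\<lambda>s. (ph t s - ph_mean t)\<^sup>2"] by simp
  obtain d where d: "d > 0" "ball 0 d \<subseteq> B" using B_nbhd by blast
  define r where "r = d / (2 * norm t)"
  have r: "r > 0" using d assms by (simp add: r_def)
  have "r *\<^sub>R t \<in> B" using d assms by (intro subsetD[OF d(2)]) (auto simp: r_def)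
  then have "norm (cf (r *\<^sub>R t)) \<le> exp (- (c * (norm (r *\<^sub>R t))\<^sup>2))" unfolding cf_def by (rule gap)
  also have "\<dots> < 1" using c_pos r assms by simp
  finally have "norm (cf (r *\<^sub>R t)) < 1" .
  moreover have "cf (r *\<^sub>R t) = measure_pmf.expectation M (\<lambda>s. iexp (r * ph_mean t))"
    unfolding cf_def ph_scale using const by (intro integral_cong_AE) auto
  ultimately show False by simp
qed

end

lemma integral_iexp_int:
  fixes n :: int
  shows "(\<integral>t. indicator {-pi..pi} t *\<^sub>R iexp (t * of_int n) \<partial>lborel) = complex_of_real (2 * pi * of_bool (n = 0))"
proof (cases "n = 0")
  case True
  then show ?thesis by (simp add: scaleR_conv_of_real flip: of_real_mult)
next
  case False
  have "(\<integral>t. indicator {-pi..pi} t *\<^sub>R iexp (t * of_int n) \<partial>lborel) =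
      iexp (pi * of_int n) / (\<i> * of_int n) - iexp (- pi * of_int n) / (\<i> * of_int n)"
  proof (rule integral_FTC_Icc)
    fix x :: real
    have "((\<lambda>t. exp (\<i> * of_int n * t) / (\<i> * of_int n)) has_field_derivative exp (\<i> * of_int n * of_real x)) (at (of_real x))"
      using False by (auto intro!: derivative_eq_intros)
    from has_vector_derivative_real_field[OF this]
    show "((\<lambda>t. iexp (t * of_int n) / (\<i> * of_int n)) has_vector_derivative iexp (x * of_int n)) (at x within {-pi..pi})"
      by (simp add: mult_ac)
  qed (auto intro!: continuous_intros)
  also have "iexp (pi * of_int n) = iexp (- pi * of_int n)"
  proof -
    have "iexp (pi * of_int n) / iexp (- pi * of_int n) = exp (of_int n * (2 * of_real pi * \<i>))"
      by (simp add: exp_diff[symmetric] algebra_simps)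
    also have "\<dots> = 1"
      by (subst exp_eq_1) auto
    finally show ?thesis by simp
  qed
  finally show ?thesis using False by simp
qed

lemma
  fixes f g :: "real \<Rightarrow> 'b::{real_normed_field, banach, second_countable_topology}"
  assumes f: "integrable lborel f" and g: "integrable lborel g"
  shows integrable_lborel_times: "integrable lborel (\<lambda>z. f (fst z) * g (snd z))"
    and integral_lborel_times: "(\<integral>z. f (fst z) * g (snd z) \<partial>lborel) = (\<integral>x. f x \<partial>lborel) * (\<integral>y. g y \<partial>lborel)"
proof -
  have [measurable]: "f \<in> borel_measurable borel" "g \<in> borel_measurable borel"
    using f g by auto
  have int: "integrable (lborel \<Otimes>\<^sub>M lborel) (case_prod (\<lambda>x y. f x * g y))"
  proof (rule lborel_pair.Fubini_integrable)
    show "case_prod (\<lambda>x y. f x * g y) \<in> borel_measurable (lborel \<Otimes>\<^sub>M lborel)" by measurable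
    show "integrable lborel (\<lambda>x. \<integral>y. norm (case_prod (\<lambda>x y. f x * g y) (x, y)) \<partial>lborel)"
      using f by (simp add: norm_mult)
    show "AE x in lborel. integrable lborel (\<lambda>y. case_prod (\<lambda>x y. f x * g y) (x, y))"
      using g by simp
  qed
  then show "integrable lborel (\<lambda>z. f (fst z) * g (snd z))"
    by (simp add: lborel_prod split_beta')
  have "(\<integral>z. case_prod (\<lambda>x y. f x * g y) z \<partial>(lborel \<Otimes>\<^sub>M lborel)) = (\<integral>x. \<integral>y. f x * g y \<partial>lborel \<partial>lborel)"
    using lborel_pair.integral_fst'[OF int] by simp
  then show "(\<integral>z. f (fst z) * g (snd z) \<partial>lborel) = (\<integral>x. f x \<partial>lborel) * (\<integral>y. g y \<partial>lborel)"
    by (simp add: lborel_prod split_beta')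
qed

lemma exp_square_eq_normal_density:
  assumes "a > 0"
  shows "exp (- (a * x\<^sup>2) / 2) = sqrt (2 * pi / a) * normal_density 0 (1 / sqrt a) x"
  using assms by (simp add: normal_density_def real_sqrt_divide real_sqrt_mult power_divide field_simps)

lemma integrable_exp_square: "a > 0 \<Longrightarrow> integrable lborel (\<lambda>x::real. exp (- (a * x\<^sup>2) / 2))"
  unfolding exp_square_eq_normal_density by simp

lemma gauss_fourier:
  assumes a: "a > 0"
  shows "(\<integral>x. complex_of_real (exp (- (a * x\<^sup>2) / 2)) * iexp (w * x) \<partial>lborel) =
    complex_of_real (sqrt (2 * pi / a) * exp (- w\<^sup>2 / (2 * a)))"
proof -
  have std: "(\<integral>x. complex_of_real (exp (- x\<^sup>2 / 2)) * iexp (u * x) \<partial>lborel) =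
      complex_of_real (sqrt (2 * pi) * exp (- u\<^sup>2 / 2))" for u
  proof -
    have "complex_of_real (exp (- u\<^sup>2 / 2)) = (\<integral>x. iexp (u * x) \<partial>std_normal_distribution)"
      using char_std_normal_distribution by (simp add: char_def fun_eq_iff)
    also have "\<dots> = (\<integral>x. std_normal_density x *\<^sub>R iexp (u * x) \<partial>lborel)"
      by (subst integral_density) auto
    also have "\<dots> = (\<integral>x. complex_of_real (1 / sqrt (2 * pi)) * (complex_of_real (exp (- x\<^sup>2 / 2)) * iexp (u * x)) \<partial>lborel)"
      by (rule Bochner_Integration.integral_cong) (auto simp: std_normal_density_def scaleR_conv_of_real)
    also have "\<dots> = complex_of_real (1 / sqrt (2 * pi)) * (\<integral>x. complex_of_real (exp (- x\<^sup>2 / 2)) * iexp (u * x) \<partial>lborel)"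
      by simp
    finally show ?thesis by (simp add: field_simps)
  qed
  have "(\<integral>x. complex_of_real (exp (- (a * x\<^sup>2) / 2)) * iexp (w * x) \<partial>lborel) =
    (1 / sqrt a) *\<^sub>R (\<integral>x. complex_of_real (exp (- (a * ((1 / sqrt a) * x)\<^sup>2) / 2)) * iexp (w * ((1 / sqrt a) * x)) \<partial>lborel)"
    using a integral_lborel_scale[of "1 / sqrt a" "\<lambda>x. complex_of_real (exp (- (a * x\<^sup>2) / 2)) * iexp (w * x)"] by simp
  also have "\<dots> = (1 / sqrt a) *\<^sub>R (\<integral>x. complex_of_real (exp (- x\<^sup>2 / 2)) * iexp ((w / sqrt a) * x) \<partial>lborel)"
    using a by (simp add: power_mult_distrib power_divide)
  also have "\<dots> = complex_of_real (sqrt (2 * pi / a) * exp (- w\<^sup>2 / (2 * a)))"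
    unfolding std using a by (simp add: scaleR_conv_of_real real_sqrt_divide power_divide field_simps)
  finally show ?thesis .
qed

section \<open>From the support of the steps to a Gaussian bound\<close>

lemma gcd_generate:
  fixes G :: "nat set"
  assumes diff: "\<And>a b. a \<in> G \<Longrightarrow> b \<in> G \<Longrightarrow> b \<le> a \<Longrightarrow> a - b \<in> G"
    and S: "S \<subseteq> G" "Gcd S = 1"
  shows "1 \<in> G"
proof -
  have "\<exists>d>0. d \<in> G"
  proof (rule ccontr)
    assume "\<not> ?thesis"
    then have "S \<subseteq> {0}" using S(1) by auto
    then have "Gcd S = 0" by (simp add: Gcd_0_iff)
    then show False using S(2) by simp
  qed
  then obtain d where d: "d > 0" "d \<in> G" and least: "\<And>m. m < d \<Longrightarrow> \<not> (m > 0 \<and> m \<in> G)"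
    using exists_least_iff[of "\<lambda>d. d > 0 \<and> d \<in> G"] by auto
  have mod: "k mod d \<in> G" if "k \<in> G" for k
    using that
  proof (induction k rule: less_induct)
    case (less k)
    show ?case
    proof (cases "k < d")
      case False
      then have "(k - d) mod d \<in> G" using less d diff[of k d] by (intro less.IH) auto
      then show ?thesis using False by (simp add: le_mod_geq)
    qed (use less in simp)
  qed
  \<comment> \<open>Euclid: the remainder modulo the least positive element \<open>d\<close> stays
    in \<open>G\<close> and is below \<open>d\<close>, hence it is 0.\<close>
  have "d dvd k" if "k \<in> S" for k
    using mod[of k] least[of "k mod d"] that S(1) d by (auto simp: mod_greater_zero_iff_not_dvd)
  then have "d dvd Gcd S" by (rule Gcd_greatest)
  then show ?thesis using S(2) d by simp
qed

text \<open>Here \<open>g\<close> will be 1 - |\<phi>|. Differences of atoms give controlled phases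
  by \<open>char_gap\<close>, and controlled phases are closed under subtraction; so lattice algebra
  on the support turns into a quadratic lower bound for the gap.\<close>

definition controlled :: "('t \<Rightarrow> real) \<Rightarrow> ('t \<Rightarrow> real) \<Rightarrow> bool" where
  "controlled g \<psi> \<longleftrightarrow> (\<exists>C. \<forall>t. (circ (\<psi> t))\<^sup>2 \<le> C * g t)"

lemma controlled_diff:
  assumes "controlled g \<psi>" "controlled g \<psi>'"
  shows "controlled g (\<lambda>t. \<psi> t - \<psi>' t)"
proof -
  from assms obtain C C' where C: "\<And>t. (circ (\<psi> t))\<^sup>2 \<le> C * g t" "\<And>t. (circ (\<psi>' t))\<^sup>2 \<le> C' * g t"
    unfolding controlled_def by blast
  have "(circ (\<psi> t - \<psi>' t))\<^sup>2 \<le> (2 * C + 2 * C') * g t" for t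
  proof -
    have "(circ (\<psi> t - \<psi>' t))\<^sup>2 \<le> (circ (\<psi> t) + circ (\<psi>' t))\<^sup>2"
      by (intro power_mono circ_diff) simp
    also have "\<dots> \<le> 2 * (circ (\<psi> t))\<^sup>2 + 2 * (circ (\<psi>' t))\<^sup>2"
      using zero_le_power2[of "circ (\<psi> t) - circ (\<psi>' t)"] by (simp add: power2_eq_square algebra_simps)
    also have "\<dots> \<le> (2 * C + 2 * C') * g t" using C[of t] by (simp add: algebra_simps)
    finally show ?thesis .
  qed
  then show ?thesis unfolding controlled_def by blast
qed

lemma controlled_zero: "controlled g (\<lambda>t. 0)"
  unfolding controlled_def by (rule exI[of _ 0]) (simp add: circ_def)

lemma controlled_char:
  assumes "s \<in> set_pmf M" "s' \<in> set_pmf M"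
  shows "controlled (\<lambda>t. 1 - norm (measure_pmf.expectation M (\<lambda>s. iexp (f t s)))) (\<lambda>t. f t s - f t s')"
proof -
  let ?w = "min (pmf M s) (pmf M s')"
  have w: "?w > 0" using assms by (simp add: pmf_positive)
  have "(circ (f t s - f t s'))\<^sup>2 \<le> 4 / ?w * (1 - norm (measure_pmf.expectation M (\<lambda>s. iexp (f t s))))" for t
    using char_gap[OF assms, of "f t"] w by (simp add: field_simps)
  then show ?thesis unfolding controlled_def by blast
qed

lemma controlled_lower:
  assumes "controlled g \<psi>" "\<And>t. g t \<ge> 0"
  shows "\<exists>C>0. \<forall>t. \<bar>\<psi> t\<bar> \<le> pi \<longrightarrow> (\<psi> t)\<^sup>2 \<le> C * g t"
proof -
  obtain C where C: "\<And>t. (circ (\<psi> t))\<^sup>2 \<le> C * g t" using assms(1) unfolding controlled_def by blast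
  have "(\<psi> t)\<^sup>2 \<le> (25 * max C 1) * g t" if "\<bar>\<psi> t\<bar> \<le> pi" for t
  proof -
    have "(\<psi> t)\<^sup>2 = 25 * (\<bar>\<psi> t\<bar> / 5)\<^sup>2" by (simp add: power_divide)
    also have "\<dots> \<le> 25 * (circ (\<psi> t))\<^sup>2" using circ_lower[OF that] by (intro mult_left_mono power_mono) auto
    also have "\<dots> \<le> 25 * (C * g t)" using C by simp
    also have "\<dots> \<le> 25 * (max C 1 * g t)" using assms(2)[of t] by (intro mult_left_mono mult_right_mono) auto
    finally show ?thesis by simp
  qed
  then show ?thesis by (intro exI[of _ "25 * max C 1"]) auto
qed

lemma integrable_gauss_real: "c > 0 \<Longrightarrow> integrable lborel (\<lambda>t::real. exp (- (c * (norm t)\<^sup>2)))"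
  using integrable_exp_square[of "2 * c"] by simp

text \<open>As 0 is an atom, every multiple of t by an atom is controlled, and by gcd 1 so is t
  itself. Thus t^2 \<le> C (1 - |\<phi>(t)|) on the period cell, and 1 - x \<le> exp (-x)
  finishes.\<close>

lemma lattice_walk_nat:
  fixes M :: "nat pmf"
  assumes zero: "pmf M 0 > 0" and gcd: "Gcd {i. pmf M i > 0} = 1"
    and sq: "integrable (measure_pmf M) (\<lambda>k. (real k)\<^sup>2)"
  shows "\<exists>c. lattice_walk M (\<lambda>t s. t * real s) {-pi..pi} (2 * pi) c"
proof -
  define g where "g t = 1 - norm (measure_pmf.expectation M (\<lambda>s. iexp (t * real s)))" for t
  have g0: "g t \<ge> 0" for t using norm_char_le_1[of M "\<lambda>s. t * real s"] by (simp add: g_def)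
  have "1 \<in> {n. controlled g (\<lambda>t. t * real n)}"
  proof (rule gcd_generate[OF _ _ gcd])
    fix a b assume "a \<in> {n. controlled g (\<lambda>t. t * real n)}" "b \<in> {n. controlled g (\<lambda>t. t * real n)}" "b \<le> a"
    then show "a - b \<in> {n. controlled g (\<lambda>t. t * real n)}"
      using controlled_diff[of g "\<lambda>t. t * real a" "\<lambda>t. t * real b"] by (simp add: of_nat_diff right_diff_distrib)
  next
    show "{i. pmf M i > 0} \<subseteq> {n. controlled g (\<lambda>t. t * real n)}"
    proof clarify
      fix i assume "pmf M i > 0"
      then show "controlled g (\<lambda>t. t * real i)"
        using controlled_char[of i M 0 "\<lambda>t s. t * real s"] zero by (simp add: g_def[abs_def] set_pmf_iff)
    qed
  qed
  then have "controlled g (\<lambda>t. t)" by simp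
  from controlled_lower[OF this g0] obtain C where C: "C > 0" "\<And>t. \<bar>t\<bar> \<le> pi \<Longrightarrow> t\<^sup>2 \<le> C * g t" by blast
  have "lattice_walk M (\<lambda>t s. t * real s) {-pi..pi} (2 * pi) (1 / C)"
  proof
    show "\<exists>d>0. ball (0::real) d \<subseteq> {- pi..pi}"
      using pi_gt_zero by (intro exI[of _ pi]) (auto simp: dist_real_def)
    show "norm (measure_pmf.expectation M (\<lambda>s. iexp (t * real s))) \<le> exp (- (1 / C * (norm t)\<^sup>2))" if "t \<in> {-pi..pi}" for t
    proof -
      have "t\<^sup>2 / C \<le> g t" using C(2)[of t] C(1) that by (simp add: field_simps abs_le_iff)
      then have "norm (measure_pmf.expectation M (\<lambda>s. iexp (t * real s))) \<le> 1 + (- (t\<^sup>2 / C))" by (simp add: g_def)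
      also have "\<dots> \<le> exp (- (t\<^sup>2 / C))" by (rule exp_ge_add_one_self)
      finally show ?thesis by simp
    qed
    show "integrable (measure_pmf M) (\<lambda>s. (t * real s)\<^sup>2)" for t
      using sq by (simp add: power_mult_distrib)
    show "integrable lborel (\<lambda>t::real. exp (- (1 / C * (norm t)\<^sup>2)))"
      using integrable_gauss_real[of "1 / C"] C(1) by simp
    show "(\<integral>t. indicator {- pi..pi} t *\<^sub>R iexp (t * real s - t * real y) \<partial>lborel) = complex_of_real (2 * pi * indicator {y} s)" for s y
    proof -
      have "t * real s - t * real y = t * of_int (int s - int y)" for t by (simp add: right_diff_distrib)
      then show ?thesis using integral_iexp_int[of "int s - int y"] by (simp add: indicator_def)
    qed
  qed (use C in \<open>auto simp: algebra_simps\<close>)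
  then show ?thesis ..
qed

text \<open>The coordinates are crossed: \<open>fst t\<close> belongs to the number of vertices and
  \<open>snd t\<close> to the number of exits, so that the exits can be integrated out first in
  \<open>gauss_fourier_sheared\<close>.\<close>

abbreviation ph2 :: "real \<times> real \<Rightarrow> nat \<times> nat \<Rightarrow> real" where
  "ph2 t s \<equiv> fst t * real (snd s) + snd t * real (fst s)"

abbreviation box2 :: "(real \<times> real) set" where
  "box2 \<equiv> {-pi..pi} \<times> {-pi..pi}"

text \<open>The points (2, 2j - 1) and (1, 2j) make the phase \<open>snd t - fst t\<close>
  controlled; (1, j + k) and (0, j + 1) do the same for \<open>snd t + (k - 1) * fst t\<close>.
  Subtracting leaves k times \<open>fst t\<close> for each k in \<open>S\<close>, and gcd 1 yields
  \<open>fst t\<close>, then \<open>snd t\<close>.\<close>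

lemma lattice_walk_nat_prod:
  fixes M :: "(nat \<times> nat) pmf"
  assumes sq: "integrable (measure_pmf M) (\<lambda>s. (real (fst s))\<^sup>2)" "integrable (measure_pmf M) (\<lambda>s. (real (snd s))\<^sup>2)"
    and j: "j \<ge> 2" "j \<in> S" and gcd: "Gcd S = 1"
    and base: "(0, j + 1) \<in> set_pmf M"
    and supp: "\<And>a k. k \<in> S \<Longrightarrow> 1 \<le> a \<Longrightarrow> a \<le> k \<Longrightarrow> (a, j + k + 1 - a) \<in> set_pmf M"
  shows "\<exists>c. lattice_walk M ph2 box2 (4 * pi\<^sup>2) c"
proof -
  define g where "g t = 1 - norm (measure_pmf.expectation M (\<lambda>s. iexp (ph2 t s)))" for t
  have g0: "g t \<ge> 0" for t using norm_char_le_1[of M "ph2 t"] by (simp add: g_def)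
  have chr: "controlled g (\<lambda>t. ph2 t s - ph2 t s')" if "s \<in> set_pmf M" "s' \<in> set_pmf M" for s s'
    unfolding g_def[abs_def] using that by (rule controlled_char)
  have e: "controlled g (\<lambda>t. snd t - fst t)"
  proof -
    have "(2, j + j + 1 - 2) \<in> set_pmf M" "(1, j + j + 1 - 1) \<in> set_pmf M"
      using supp[of j 2] supp[of j 1] j by auto
    from chr[OF this] show ?thesis using j by (simp add: of_nat_diff algebra_simps)
  qed
  have "1 \<in> {n. controlled g (\<lambda>t. fst t * real n)}"
  proof (rule gcd_generate[OF _ _ gcd])
    fix a b assume "a \<in> {n. controlled g (\<lambda>t. fst t * real n)}" "b \<in> {n. controlled g (\<lambda>t. fst t * real n)}" "b \<le> a"
    then show "a - b \<in> {n. controlled g (\<lambda>t. fst t * real n)}"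
      using controlled_diff[of g "\<lambda>t. fst t * real a" "\<lambda>t. fst t * real b"] by (simp add: of_nat_diff right_diff_distrib)
  next
    show "S \<subseteq> {n. controlled g (\<lambda>t. fst t * real n)}"
    proof clarify
      fix k assume k: "k \<in> S"
      show "controlled g (\<lambda>t. fst t * real k)"
      proof (cases "k = 0")
        case True
        then show ?thesis by (simp add: controlled_zero)
      next
        case False
        then have "(1, j + k + 1 - 1) \<in> set_pmf M" using supp[of k 1] k by auto
        from chr[OF this base] have "controlled g (\<lambda>t. snd t + fst t * (real k - 1))"
          by (simp add: algebra_simps)
        from controlled_diff[OF this e] show ?thesis by (simp add: algebra_simps)
      qed
    qed
  qed
  then have f: "controlled g fst" by simp
  have s: "controlled g snd"
    using controlled_diff[OF e controlled_diff[OF controlled_zero f]] by simp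
  obtain C1 where C1: "C1 > 0" "\<And>t. \<bar>fst t\<bar> \<le> pi \<Longrightarrow> (fst t)\<^sup>2 \<le> C1 * g t" using controlled_lower[OF f g0] by blast
  obtain C2 where C2: "C2 > 0" "\<And>t. \<bar>snd t\<bar> \<le> pi \<Longrightarrow> (snd t)\<^sup>2 \<le> C2 * g t" using controlled_lower[OF s g0] by blast
  define C where "C = C1 + C2"
  have C0: "C > 0" using C1 C2 by (simp add: C_def)
  have n2: "(norm t)\<^sup>2 = (fst t)\<^sup>2 + (snd t)\<^sup>2" for t :: "real \<times> real"
    by (simp add: norm_prod_def)
  have "lattice_walk M ph2 box2 (4 * pi\<^sup>2) (1 / C)"
  proof
    show "box2 \<in> sets borel" by (intro borel_Times) auto
    show "emeasure lborel box2 < \<infinity>"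
      by (intro emeasure_bounded_finite bounded_Times) auto
    have "ball (0 :: real \<times> real) pi \<subseteq> box2"
    proof
      fix t :: "real \<times> real" assume "t \<in> ball 0 pi"
      then have "norm t < pi" by (simp add: dist_norm)
      moreover have "\<bar>fst t\<bar> \<le> norm t" "\<bar>snd t\<bar> \<le> norm t"
        using norm_fst_le[of "fst t" "snd t"] norm_snd_le[of "snd t" "fst t"] by auto
      ultimately show "t \<in> box2" by (cases t) (auto simp: abs_le_iff)
    qed
    then show "\<exists>d>0. ball (0::real \<times> real) d \<subseteq> box2" using pi_gt_zero by blast
    show "norm (measure_pmf.expectation M (\<lambda>s. iexp (ph2 t s))) \<le> exp (- (1 / C * (norm t)\<^sup>2))" if "t \<in> box2" for t
    proof -
      have "(norm t)\<^sup>2 \<le> C * g t"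
        using C1(2)[of t] C2(2)[of t] that by (auto simp: n2 C_def abs_le_iff algebra_simps)
      then have "(norm t)\<^sup>2 / C \<le> g t" using C0 by (simp add: field_simps)
      then have "norm (measure_pmf.expectation M (\<lambda>s. iexp (ph2 t s))) \<le> 1 + (- ((norm t)\<^sup>2 / C))" by (simp add: g_def)
      also have "\<dots> \<le> exp (- ((norm t)\<^sup>2 / C))" by (rule exp_ge_add_one_self)
      finally show ?thesis by simp
    qed
    show "integrable lborel (\<lambda>t::real \<times> real. exp (- (1 / C * (norm t)\<^sup>2)))"
      using integrable_lborel_times[OF integrable_gauss_real integrable_gauss_real, of "1 / C" "1 / C"] C0
      by (simp add: n2 exp_add[symmetric] add_divide_distrib)
    show "integrable (measure_pmf M) (\<lambda>s. (ph2 t s)\<^sup>2)" for t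
    proof (rule Bochner_Integration.integrable_bound)
      show "integrable (measure_pmf M) (\<lambda>s. 2 * (fst t)\<^sup>2 * (real (snd s))\<^sup>2 + 2 * (snd t)\<^sup>2 * (real (fst s))\<^sup>2)"
        using sq by (intro Bochner_Integration.integrable_add integrable_mult_right) auto
      show "AE s in measure_pmf M. norm ((ph2 t s)\<^sup>2) \<le> norm (2 * (fst t)\<^sup>2 * (real (snd s))\<^sup>2 + 2 * (snd t)\<^sup>2 * (real (fst s))\<^sup>2)"
      proof (rule AE_I2)
        fix s
        have "(ph2 t s)\<^sup>2 \<le> 2 * (fst t)\<^sup>2 * (real (snd s))\<^sup>2 + 2 * (snd t)\<^sup>2 * (real (fst s))\<^sup>2"
          using zero_le_power2[of "fst t * real (snd s) - snd t * real (fst s)"]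
          by (simp add: power2_eq_square algebra_simps)
        then show "norm ((ph2 t s)\<^sup>2) \<le> norm (2 * (fst t)\<^sup>2 * (real (snd s))\<^sup>2 + 2 * (snd t)\<^sup>2 * (real (fst s))\<^sup>2)" by simp
      qed
    qed simp
    show "(\<integral>t. indicator box2 t *\<^sub>R iexp (ph2 t s - ph2 t y) \<partial>lborel) = complex_of_real (4 * pi\<^sup>2 * indicator {y} s)" for s y
    proof -
      let ?h = "\<lambda>n t. indicator {-pi..pi} t *\<^sub>R iexp (t * of_int n)"
      let ?a = "int (snd s) - int (snd y)" and ?b = "int (fst s) - int (fst y)"
      have int: "integrable lborel (?h n)" for n
      proof (rule Bochner_Integration.integrable_bound)
        show "integrable lborel (indicator {-pi..pi} :: real \<Rightarrow> real)" by (simp add: integrable_indicator_iff)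
        show "AE t in lborel. norm (?h n t) \<le> norm (indicator {-pi..pi} t :: real)"
          by (intro AE_I2) (auto simp: indicator_def)
      qed measurable
      have "indicator box2 t *\<^sub>R iexp (ph2 t s - ph2 t y) = ?h ?a (fst t) * ?h ?b (snd t)" for t
      proof -
        have "ph2 t s - ph2 t y = fst t * of_int ?a + snd t * of_int ?b" by (simp add: algebra_simps)
        moreover have "indicator box2 t = (indicator {-pi..pi} (fst t) * indicator {-pi..pi} (snd t) :: real)"
          by (cases t) (auto simp: indicator_def)
        ultimately show ?thesis by (simp add: exp_add[symmetric] distrib_left)
      qed
      then have "(\<integral>t. indicator box2 t *\<^sub>R iexp (ph2 t s - ph2 t y) \<partial>lborel) =
          complex_of_real (2 * pi * of_bool (?a = 0)) * complex_of_real (2 * pi * of_bool (?b = 0))"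
        using integral_lborel_times[OF int int, of ?a ?b] by (simp only: integral_iexp_int)
      then show ?thesis by (auto simp: indicator_def prod_eq_iff power2_eq_square)
    qed
    show "(\<lambda>t. ph2 t s) \<in> borel_measurable borel" for s by (intro borel_measurable_continuous_onI continuous_intros)
  qed (use C0 in \<open>auto simp: algebra_simps\<close>)
  then show ?thesis ..
qed

section \<open>The local limit theorem in two dimensions\<close>

lemma integral_exp_square_shift:
  assumes a: "a > 0"
  shows "(\<integral>x. exp (- (a * (x + b)\<^sup>2) / 2) \<partial>lborel) = sqrt (2 * pi / a)"
    and "integrable lborel (\<lambda>x. exp (- (a * (x + b)\<^sup>2) / 2))"
proof -
  have "(\<integral>x. exp (- (a * x\<^sup>2) / 2) \<partial>lborel) = sqrt (2 * pi / a)"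
    using a unfolding exp_square_eq_normal_density[OF a] by simp
  moreover have "(\<integral>x. exp (- (a * x\<^sup>2) / 2) \<partial>lborel) = (\<integral>x. exp (- (a * (x + b)\<^sup>2) / 2) \<partial>lborel)"
    using lborel_integral_real_affine[of 1 "\<lambda>x. exp (- (a * x\<^sup>2) / 2)" b] by (simp add: add.commute)
  ultimately show "(\<integral>x. exp (- (a * (x + b)\<^sup>2) / 2) \<partial>lborel) = sqrt (2 * pi / a)" by simp
  show "integrable lborel (\<lambda>x. exp (- (a * (x + b)\<^sup>2) / 2))"
    using lborel_integrable_real_affine[OF integrable_exp_square[OF a], of 1 b] by (simp add: add.commute)
qed

text \<open>For fixed first coordinate the shear is a translation of the second, so the inner
  integral does not depend on b and a one-dimensional Fourier transform remains.\<close>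

lemma gauss_fourier_sheared:
  assumes a: "a > 0" and s: "s > 0"
  shows "(\<integral>z. complex_of_real (exp (- (s * (fst z)\<^sup>2 + a * (snd z + b * fst z)\<^sup>2) / 2)) * iexp (w * fst z) \<partial>lborel) =
    complex_of_real (sqrt (2 * pi / a) * (sqrt (2 * pi / s) * exp (- w\<^sup>2 / (2 * s))))"
proof -
  let ?f = "\<lambda>x y. complex_of_real (exp (- (s * x\<^sup>2 + a * (y + b * x)\<^sup>2) / 2)) * iexp (w * x)"
  let ?g = "\<lambda>x. complex_of_real (exp (- (s * x\<^sup>2) / 2)) * iexp (w * x)"
  have f: "?f x y = ?g x * complex_of_real (exp (- (a * (y + b * x)\<^sup>2) / 2))" for x y
    by (simp only: minus_add_distrib add_divide_distrib exp_add of_real_mult mult_ac)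
  have norm: "norm (?f x y) = exp (- (s * x\<^sup>2) / 2) * exp (- (a * (y + b * x)\<^sup>2) / 2)" for x y
    by (simp only: f norm_mult norm_of_real) simp
  have int: "integrable (lborel \<Otimes>\<^sub>M lborel) (case_prod ?f)"
  proof (rule lborel_pair.Fubini_integrable)
    show "case_prod ?f \<in> borel_measurable (lborel \<Otimes>\<^sub>M lborel)" by measurable
    have "(\<integral>y. norm (case_prod ?f (x, y)) \<partial>lborel) = exp (- (s * x\<^sup>2) / 2) * sqrt (2 * pi / a)" for x
      by (simp only: prod.case norm integral_mult_right_zero integral_exp_square_shift[OF a])
    then show "integrable lborel (\<lambda>x. \<integral>y. norm (case_prod ?f (x, y)) \<partial>lborel)"
      using integrable_exp_square[OF s] by (simp only:) simp
    show "AE x in lborel. integrable lborel (\<lambda>y. case_prod ?f (x, y))"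
      by (intro AE_I2) (simp only: prod.case f, intro integrable_mult_right integrable_of_real integral_exp_square_shift[OF a])
  qed
  have "(\<integral>z. ?f (fst z) (snd z) \<partial>lborel) = (\<integral>x. \<integral>y. ?f x y \<partial>lborel \<partial>lborel)"
    using lborel_pair.integral_fst'[OF int] by (simp add: lborel_prod split_beta')
  also have "\<dots> = (\<integral>x. ?g x * complex_of_real (sqrt (2 * pi / a)) \<partial>lborel)"
    by (simp only: f integral_mult_right_zero integral_complex_of_real integral_exp_square_shift[OF a])
  also have "\<dots> = (\<integral>x. ?g x \<partial>lborel) * complex_of_real (sqrt (2 * pi / a))" by simp
  finally show ?thesis unfolding gauss_fourier[OF s] by (simp add: mult.commute)
qed

text \<open>The targets keep the first coordinate within o(\<surd>K) of its mean, so the limit is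
  the Gaussian density of that coordinate at 0 times the conditional density of the second one.
  Hence \<open>s\<close> is a conditional standard deviation.\<close>

lemma local_limit_nat_prod:
  fixes M :: "(nat \<times> nat) pmf"
  assumes lw: "lattice_walk M ph2 box2 (4 * pi\<^sup>2) c"
  defines "mz \<equiv> measure_pmf.expectation M (\<lambda>s. real (fst s))"
    and "mx \<equiv> measure_pmf.expectation M (\<lambda>s. real (snd s))"
  defines "A \<equiv> measure_pmf.expectation M (\<lambda>s. (real (fst s) - mz)\<^sup>2)"
  shows "A > 0" and "\<exists>s>0. \<forall>K a b w. (\<forall>n. K n > 0) \<longrightarrow> filterlim K at_top sequentially \<longrightarrow>
     (\<lambda>n. (real (K n) * mz - real (a n)) / sqrt (real (K n))) \<longlonglongrightarrow> 0 \<longrightarrow>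
     (\<lambda>n. (real (K n) * mx - real (b n)) / sqrt (real (K n))) \<longlonglongrightarrow> w \<longrightarrow>
     (\<lambda>n. real (K n) * pmf (walk M (K n)) (a n, b n)) \<longlonglongrightarrow> 1 / sqrt (2 * pi * A) * normal_density 0 s w"
proof -
  interpret lattice_walk M ph2 box2 "4 * pi\<^sup>2" c by (rule lw)
  have sqz: "integrable (measure_pmf M) (\<lambda>s. (real (fst s))\<^sup>2)" and sqx: "integrable (measure_pmf M) (\<lambda>s. (real (snd s))\<^sup>2)"
    using square_integrable[of "(0, 1)"] square_integrable[of "(1, 0)"] by simp_all
  have iz: "integrable (measure_pmf M) (\<lambda>s. real (fst s))" and ix: "integrable (measure_pmf M) (\<lambda>s. real (snd s))"
    using ph_integrable[of "(0, 1)"] ph_integrable[of "(1, 0)"] by simp_all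
  define z where "z s = real (fst s) - mz" for s :: "nat \<times> nat"
  define x where "x s = real (snd s) - mx" for s :: "nat \<times> nat"
  define D where "D = measure_pmf.expectation M (\<lambda>s. (x s)\<^sup>2)"
  define E where "E = measure_pmf.expectation M (\<lambda>s. x s * z s)"
  have iz2: "integrable (measure_pmf M) (\<lambda>s. (z s)\<^sup>2)" and ix2: "integrable (measure_pmf M) (\<lambda>s. (x s)\<^sup>2)"
    using sqz sqx iz ix by (simp_all add: z_def x_def power2_diff)
  have ixz: "integrable (measure_pmf M) (\<lambda>s. x s * z s)"
  proof (rule Bochner_Integration.integrable_bound)
    show "integrable (measure_pmf M) (\<lambda>s. (x s)\<^sup>2 + (z s)\<^sup>2)" using iz2 ix2 by simp
    show "AE s in measure_pmf M. norm (x s * z s) \<le> norm ((x s)\<^sup>2 + (z s)\<^sup>2)"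
    proof (rule AE_I2)
      fix s
      have "\<bar>x s * z s\<bar> \<le> (x s)\<^sup>2 + (z s)\<^sup>2"
        using zero_le_power2[of "\<bar>x s\<bar> - \<bar>z s\<bar>"] zero_le_power2[of "x s"] zero_le_power2[of "z s"]
        unfolding power2_diff power2_abs abs_mult by linarith
      then show "norm (x s * z s) \<le> norm ((x s)\<^sup>2 + (z s)\<^sup>2)" by simp
    qed
  qed simp
  have mean: "ph_mean t = fst t * mx + snd t * mz" for t
    using iz ix by (simp add: ph_mean_def mx_def mz_def)
  have var: "ph_var t = D * (fst t)\<^sup>2 + 2 * E * fst t * snd t + A * (snd t)\<^sup>2" for t
  proof -
    have "(ph2 t s - ph_mean t)\<^sup>2 = (fst t)\<^sup>2 * (x s)\<^sup>2 + (2 * fst t * snd t) * (x s * z s) + (snd t)\<^sup>2 * (z s)\<^sup>2" for s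
      unfolding mean by (simp add: x_def z_def power2_eq_square algebra_simps)
    then have "ph_var t = measure_pmf.expectation M
        (\<lambda>s. (fst t)\<^sup>2 * (x s)\<^sup>2 + (2 * fst t * snd t) * (x s * z s) + (snd t)\<^sup>2 * (z s)\<^sup>2)"
      by (simp only: ph_var_def)
    also have "\<dots> = (fst t)\<^sup>2 * D + (2 * fst t * snd t) * E + (snd t)\<^sup>2 * A"
    proof -
      have "measure_pmf.expectation M (\<lambda>s. a * f s + b * g s + c * h s) =
          a * measure_pmf.expectation M f + b * measure_pmf.expectation M g + c * measure_pmf.expectation M h"
        if "integrable (measure_pmf M) f" "integrable (measure_pmf M) g" "integrable (measure_pmf M) h"
        for a b c :: real and f g h :: "nat \<times> nat \<Rightarrow> real"
        using that by simp
      from this[OF ix2 ixz iz2] show ?thesis by (simp only: D_def E_def A_def z_def)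
    qed
    finally show ?thesis by (simp add: mult_ac)
  qed
  show A: "A > 0" using ph_var_pos[of "(0, 1)"] var[of "(0, 1)"] by (simp add: zero_prod_def)
  \<comment> \<open>Completing the square in the covariance form: v is the variance of the second
    coordinate after its linear regression on the first. It is positive as the value of
    \<open>ph_var\<close> at (1, -E/A).\<close>
  define v where "v = D - E\<^sup>2 / A"
  have v: "v > 0"
  proof -
    have "ph_var (1, - E / A) = v"
      unfolding var v_def using A by (simp add: power2_eq_square field_simps)
    then show ?thesis using ph_var_pos[of "(1, - E / A)"] by (simp add: zero_prod_def)
  qed
  have var': "ph_var t = v * (fst t)\<^sup>2 + A * (snd t + E / A * fst t)\<^sup>2" for t
    unfolding var v_def using A by (simp add: power2_eq_square field_simps)
  show "\<exists>s>0. \<forall>K a b w. (\<forall>n. K n > 0) \<longrightarrow> filterlim K at_top sequentially \<longrightarrow>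
     (\<lambda>n. (real (K n) * mz - real (a n)) / sqrt (real (K n))) \<longlonglongrightarrow> 0 \<longrightarrow>
     (\<lambda>n. (real (K n) * mx - real (b n)) / sqrt (real (K n))) \<longlonglongrightarrow> w \<longrightarrow>
     (\<lambda>n. real (K n) * pmf (walk M (K n)) (a n, b n)) \<longlonglongrightarrow> 1 / sqrt (2 * pi * A) * normal_density 0 s w"
  proof (intro exI[of _ "sqrt v"] conjI allI impI)
    fix K :: "nat \<Rightarrow> nat" and a b :: "nat \<Rightarrow> nat" and w :: real
    assume K: "\<forall>n. K n > 0" "filterlim K at_top sequentially"
      and la: "(\<lambda>n. (real (K n) * mz - real (a n)) / sqrt (real (K n))) \<longlonglongrightarrow> 0"
      and lb: "(\<lambda>n. (real (K n) * mx - real (b n)) / sqrt (real (K n))) \<longlonglongrightarrow> w"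
    have "(\<lambda>n. (real (K n) * ph_mean t - ph2 t (a n, b n)) / sqrt (real (K n))) \<longlonglongrightarrow> w * fst t" for t
    proof -
      have "(\<lambda>n. fst t * ((real (K n) * mx - real (b n)) / sqrt (real (K n))) +
          snd t * ((real (K n) * mz - real (a n)) / sqrt (real (K n)))) \<longlonglongrightarrow> fst t * w + snd t * 0"
        by (intro tendsto_intros la lb)
      then show ?thesis unfolding mean
        by (simp add: add_divide_distrib[symmetric] algebra_simps)
    qed
    from local_limit[OF _ K(2) this] K(1)
    have "(\<lambda>n. complex_of_real (real (K n) * (4 * pi\<^sup>2 * pmf (walk M (K n)) (a n, b n)))) \<longlonglongrightarrow>
      complex_of_real (sqrt (2 * pi / A) * (sqrt (2 * pi / v) * exp (- w\<^sup>2 / (2 * v))))"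
      unfolding var' gauss_fourier_sheared[OF A v] by (simp add: scaleR_conv_of_real)
    then have "(\<lambda>n. real (K n) * (4 * pi\<^sup>2 * pmf (walk M (K n)) (a n, b n))) \<longlonglongrightarrow>
      sqrt (2 * pi / A) * (sqrt (2 * pi / v) * exp (- w\<^sup>2 / (2 * v)))"
      by (simp only: tendsto_of_real_iff)
    then have "(\<lambda>n. 1 / (4 * pi\<^sup>2) * (real (K n) * (4 * pi\<^sup>2 * pmf (walk M (K n)) (a n, b n)))) \<longlonglongrightarrow>
      1 / (4 * pi\<^sup>2) * (sqrt (2 * pi / A) * (sqrt (2 * pi / v) * exp (- w\<^sup>2 / (2 * v))))"
      by (rule tendsto_mult_left)
    moreover have "1 / (4 * pi\<^sup>2) * (sqrt (2 * pi / A) * (sqrt (2 * pi / v) * exp (- w\<^sup>2 / (2 * v)))) =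
      1 / sqrt (2 * pi * A) * normal_density 0 (sqrt v) w"
      using A v by (simp add: normal_density_def real_sqrt_divide real_sqrt_mult power2_eq_square field_simps)
    ultimately show "(\<lambda>n. real (K n) * pmf (walk M (K n)) (a n, b n)) \<longlonglongrightarrow>
        1 / sqrt (2 * pi * A) * normal_density 0 (sqrt v) w" by simp
  qed (use v in simp)
qed

section \<open>Return probabilities of the offspring walk\<close>

locale centred_walk_nat = lattice_walk M "\<lambda>t s. t * real s" "{-pi..pi}" "2 * pi" c
  for M :: "nat pmf" and c +
  assumes mean_1: "measure_pmf.expectation M real = 1"
begin

definition v :: real where "v = measure_pmf.variance M real"

lemma norm_cf_le_1: "norm (cf t) \<le> 1"
  unfolding cf_def by (rule norm_char_le_1)

lemma ph_mean_eq: "ph_mean t = t"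
  by (simp add: ph_mean_def mean_1)

lemma ph_var_eq: "ph_var t = v * t\<^sup>2"
proof -
  have "(t * real s - t)\<^sup>2 = (real s - 1)\<^sup>2 * t\<^sup>2" for s
    by (simp add: power2_eq_square algebra_simps)
  then show ?thesis by (simp add: ph_var_def ph_mean_eq v_def mean_1)
qed

lemma v_pos: "v > 0"
  using ph_var_pos[of 1] by (simp add: ph_var_eq)

text \<open>n + 1 steps with sum n: by the hitting time identity this probability is (n + 1) P(|T| =
  n + 1), see \<open>size_prob_eq\<close>. The target misses the mean by 1, which is invisible on
  the scale \<surd>n.\<close>

lemma local_limit_pred:
  "(\<lambda>n. sqrt (real (Suc n)) * pmf (walk M (Suc n)) n) \<longlonglongrightarrow> 1 / sqrt (2 * pi * v)"
proof -
  have "(\<lambda>n. (real (Suc n) * ph_mean t - t * real n) / sqrt (real (Suc n))) \<longlonglongrightarrow> 0" for t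
  proof -
    have "(\<lambda>n. t / sqrt (real (Suc n))) \<longlonglongrightarrow> 0" by real_asymp
    then show ?thesis by (simp add: ph_mean_eq algebra_simps)
  qed
  from local_limit[OF _ _ this] have "(\<lambda>n. complex_of_real (sqrt (real (Suc n)) * (2 * pi * pmf (walk M (Suc n)) n))) \<longlonglongrightarrow>
      (\<integral>t. complex_of_real (exp (- (v * t\<^sup>2) / 2)) * iexp (0 * t) \<partial>lborel)"
    by (simp add: ph_var_eq scaleR_conv_of_real filterlim_Suc)
  then have "(\<lambda>n. sqrt (real (Suc n)) * (2 * pi * pmf (walk M (Suc n)) n)) \<longlonglongrightarrow> sqrt (2 * pi / v)"
    unfolding gauss_fourier[OF v_pos] by (simp only: tendsto_of_real_iff) simp
  then have "(\<lambda>n. 1 / (2 * pi) * (sqrt (real (Suc n)) * (2 * pi * pmf (walk M (Suc n)) n))) \<longlonglongrightarrow> 1 / (2 * pi) * sqrt (2 * pi / v)"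
    by (rule tendsto_mult_left)
  moreover have "1 / (2 * pi) * sqrt (2 * pi / v) = 1 / sqrt (2 * pi * v)"
    using v_pos by (simp add: real_sqrt_divide real_sqrt_mult field_simps)
  ultimately show ?thesis by simp
qed

lemma return_bound: "\<exists>C. \<forall>m>0. sqrt (real m) * pmf (walk M m) m \<le> C"
proof -
  have "sqrt (real m) * pmf (walk M m) m \<le> (\<integral>t. exp (- (c * (norm (t::real))\<^sup>2)) \<partial>lborel) / (2 * pi)" if "m > 0" for m
    using walk_bound[OF that, of m] by (simp add: field_simps)
  then show ?thesis by blast
qed

lemma square_exp_bound: "c * t\<^sup>2 * exp (- (c * t\<^sup>2)) \<le> 2 * exp (- (c * t\<^sup>2) / 2)"
proof -
  have "c * t\<^sup>2 \<le> 2 * exp (c * t\<^sup>2 / 2)"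
    using exp_ge_add_one_self[of "c * t\<^sup>2 / 2"] by linarith
  then have "c * t\<^sup>2 * exp (- (c * t\<^sup>2)) \<le> 2 * exp (c * t\<^sup>2 / 2) * exp (- (c * t\<^sup>2))"
    by (intro mult_right_mono) auto
  also have "\<dots> = 2 * exp (- (c * t\<^sup>2) / 2)" by (simp add: mult_exp_exp)
  finally show ?thesis .
qed

text \<open>With mean 1 the factor iexp (-t) centres the step and removes the linear term, so the
  second-order Taylor bound under the expectation is all that remains.\<close>

lemma cf_second_order: "norm (1 - cf t * iexp (- t)) \<le> v * t\<^sup>2"
proof -
  have sq: "integrable (measure_pmf M) (\<lambda>s. (real s)\<^sup>2)" using square_integrable[of 1] by simp
  have i1: "integrable (measure_pmf M) real" using ph_integrable[of 1] by simp
  have i2: "integrable (measure_pmf M) (\<lambda>s. (real s - 1)\<^sup>2)" using sq i1 by (simp add: power2_diff)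
  let ?y = "\<lambda>s. t * (real s - 1)"
  have ie: "integrable (measure_pmf M) (\<lambda>s. iexp (?y s))"
    by (rule measure_pmf.integrable_const_bound[where B = 1]) auto
  have iy: "integrable (measure_pmf M) (\<lambda>s. complex_of_real (?y s))"
    by (intro integrable_of_real integrable_mult_right Bochner_Integration.integrable_diff i1) simp
  have "measure_pmf.expectation M ?y = 0" using i1 mean_1 by simp
  then have y0: "measure_pmf.expectation M (\<lambda>s. complex_of_real (?y s)) = 0"
    by (simp only: integral_complex_of_real) simp
  have "iexp (t * real s) * iexp (- t) = iexp (?y s)" for s
    by (simp add: exp_add[symmetric] algebra_simps)
  then have "cf t * iexp (- t) = measure_pmf.expectation M (\<lambda>s. iexp (?y s))"
    unfolding cf_def by (simp add: integral_mult_left_zero[symmetric] del: integral_mult_left_zero)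
  then have "cf t * iexp (- t) - 1 = measure_pmf.expectation M (\<lambda>s. iexp (?y s)) - 1 - \<i> * measure_pmf.expectation M (\<lambda>s. complex_of_real (?y s))"
    using y0 by simp
  also have "\<dots> = measure_pmf.expectation M (\<lambda>s. iexp (?y s) - 1 - \<i> * complex_of_real (?y s))"
    using ie iy by simp
  also have "norm \<dots> \<le> measure_pmf.expectation M (\<lambda>s. (real s - 1)\<^sup>2 * t\<^sup>2)"
  proof (rule order_trans[OF integral_norm_bound], rule integral_mono)
    show "integrable (measure_pmf M) (\<lambda>s. norm (iexp (?y s) - 1 - \<i> * complex_of_real (?y s)))"
      using ie iy by (intro integrable_norm) simp
    show "integrable (measure_pmf M) (\<lambda>s. (real s - 1)\<^sup>2 * t\<^sup>2)" using i2 by simp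
    fix s
    have "norm (iexp (?y s) - 1 - \<i> * complex_of_real (?y s)) \<le> \<bar>?y s\<bar> ^ 2 / 2"
      using iexp_approx1[of "?y s" 1] by (simp add: numeral_2_eq_2 diff_diff_eq)
    also have "\<dots> \<le> (real s - 1)\<^sup>2 * t\<^sup>2" by (simp add: power_mult_distrib)
    finally show "norm (iexp (?y s) - 1 - \<i> * complex_of_real (?y s)) \<le> (real s - 1)\<^sup>2 * t\<^sup>2" .
  qed
  also have "\<dots> = v * t\<^sup>2" by (simp add: v_def mean_1)
  finally show ?thesis by (simp add: norm_minus_commute)
qed

lemma gauss_half: "integrable lborel (\<lambda>t::real. exp (- (c * t\<^sup>2) / 2))"
  using integrable_exp_square c_pos by blast

text \<open>The difference inserts the factor 1 - cf(t) iexp (-t) into the inversion integral. By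
  \<open>cf_second_order\<close> it is of order t^2, and on the scale t = s/\<surd>m this gains 1/m
  over the order m^(-1/2) of the probabilities.\<close>

lemma return_difference: "\<exists>C. \<forall>m>0. \<bar>pmf (walk M m) m - pmf (walk M (Suc m)) (Suc m)\<bar> \<le> C / (real m * sqrt (real m))"
proof -
  let ?g = "\<lambda>t::real. 2 * v / c * exp (- (c * t\<^sup>2) / 2)"
  have "\<bar>pmf (walk M m) m - pmf (walk M (Suc m)) (Suc m)\<bar> \<le> ((\<integral>t. ?g t \<partial>lborel) / (2 * pi)) / (real m * sqrt (real m))"
    if m: "m > 0" for m
  proof -
    let ?I = "\<lambda>k y t. indicator {-pi..pi} t *\<^sub>R (cf t ^ k * iexp (- (t * real y)))"
    have int: "integrable lborel (?I k y)" for k y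
    proof (rule Bochner_Integration.integrable_bound)
      show "integrable lborel (indicator {-pi..pi} :: real \<Rightarrow> real)" by (simp add: integrable_indicator_iff)
      show "AE t in lborel. norm (?I k y t) \<le> norm (indicator {-pi..pi} t :: real)"
        by (intro AE_I2) (auto simp: indicator_def norm_mult norm_power intro!: power_le_one norm_cf_le_1)
    qed measurable
    let ?F = "\<lambda>t. complex_of_real (real m) * (?I m m t - ?I (Suc m) (Suc m) t)"
    have F: "?F t = complex_of_real (real m) * (indicator {-pi..pi} t *\<^sub>R (cf t ^ m * iexp (- (t * real m)) * (1 - cf t * iexp (- t))))" for t
    proof -
      have "iexp (- (t * real (Suc m))) = iexp (- (t * real m)) * iexp (- t)"
        by (simp add: exp_add[symmetric] algebra_simps)
      then show ?thesis by (simp only: power_Suc) (simp add: algebra_simps)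
    qed
    have "complex_of_real (2 * pi * pmf (walk M m) m) - complex_of_real (2 * pi * pmf (walk M (Suc m)) (Suc m)) =
        (\<integral>t. ?I m m t - ?I (Suc m) (Suc m) t \<partial>lborel)"
      unfolding inversion by (rule Bochner_Integration.integral_diff[OF int int, symmetric])
    then have eq: "complex_of_real (real m * (2 * pi * (pmf (walk M m) m - pmf (walk M (Suc m)) (Suc m)))) = (\<integral>t. ?F t \<partial>lborel)"
    proof -
      have "complex_of_real (real m * (2 * pi * (a - b))) =
          complex_of_real (real m) * (complex_of_real (2 * pi * a) - complex_of_real (2 * pi * b))" for a b
        by (simp add: algebra_simps)
      then show ?thesis
        by (simp only: \<open>complex_of_real (2 * pi * pmf (walk M m) m) - _ = _\<close> integral_mult_right_zero)
    qed
    have "sqrt (real m) ^ DIM(real) * norm (\<integral>t. ?F t \<partial>lborel) \<le> (\<integral>t. ?g t \<partial>lborel)"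
    proof (rule scaled_integral_bound)
      show "integrable lborel ?g" using gauss_half by simp
      fix t :: real
      show "norm (?F t) \<le> ?g (sqrt (real m) *\<^sub>R t)"
      proof (cases "t \<in> {-pi..pi}")
        case True
        have "norm (?F t) = real m * (norm (cf t) ^ m * norm (1 - cf t * iexp (- t)))"
          using True unfolding F by (simp add: norm_mult norm_power)
        also have "\<dots> \<le> real m * (exp (- (c * (norm (sqrt (real m) *\<^sub>R t))\<^sup>2)) * (v * t\<^sup>2))"
          by (intro mult_left_mono mult_mono cf_power_bound True m cf_second_order) auto
        also have "\<dots> = v / c * (c * (sqrt (real m) * t)\<^sup>2 * exp (- (c * (sqrt (real m) * t)\<^sup>2)))"
          using c_pos by (simp add: power_mult_distrib)
        also have "\<dots> \<le> v / c * (2 * exp (- (c * (sqrt (real m) * t)\<^sup>2) / 2))"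
          using v_pos c_pos by (intro mult_left_mono square_exp_bound) auto
        also have "\<dots> = ?g (sqrt (real m) *\<^sub>R t)" by simp
        finally show ?thesis .
      next
        case False
        then show ?thesis using v_pos c_pos by simp
      qed
    qed (use m in \<open>auto, measurable\<close>)
    then have "sqrt (real m) * (real m * (2 * pi * \<bar>pmf (walk M m) m - pmf (walk M (Suc m)) (Suc m)\<bar>)) \<le> (\<integral>t. ?g t \<partial>lborel)"
      unfolding eq[symmetric] norm_of_real by (simp add: abs_mult)
    moreover have "x \<le> J / (2 * pi) / (real m * sqrt (real m))"
      if "sqrt (real m) * (real m * (2 * pi * x)) \<le> J" for x J
      using that m by (simp add: field_simps)
    ultimately show ?thesis by blast
  qed
  then show ?thesis by blast
qed

text \<open>Neighbouring targets differ by the factor 1 - iexp t, of order t, which gains one factor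
  1/\<surd>n. So n times the difference has a limit, and this is the integral of an odd
  function.\<close>

lemma return_vs_pred:
  "(\<lambda>n. real (Suc n) * (pmf (walk M (Suc n)) (Suc n) - pmf (walk M (Suc n)) n)) \<longlonglongrightarrow> 0"
proof -
  let ?I = "\<lambda>k y t. indicator {-pi..pi} t *\<^sub>R (cf t ^ k * iexp (- (t * real y)))"
  have int: "integrable lborel (?I k y)" for k y
  proof (rule Bochner_Integration.integrable_bound)
    show "integrable lborel (indicator {-pi..pi} :: real \<Rightarrow> real)" by (simp add: integrable_indicator_iff)
    show "AE t in lborel. norm (?I k y t) \<le> norm (indicator {-pi..pi} t :: real)"
      by (intro AE_I2) (auto simp: indicator_def norm_mult norm_power intro!: power_le_one norm_cf_le_1)
  qed measurable
  let ?r = "\<lambda>n. sqrt (real (Suc n))"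
  let ?F = "\<lambda>n t. complex_of_real (?r n) * (?I (Suc n) (Suc n) t - ?I (Suc n) n t)"
  have F: "?F n t = ?I (Suc n) (Suc n) t * (complex_of_real (?r n) * (1 - iexp t))" for n t
  proof -
    have "iexp (- (t * real n)) = iexp (- (t * real (Suc n))) * iexp t"
      by (simp add: exp_add[symmetric] algebra_simps)
    then show ?thesis by (simp only:) (simp add: algebra_simps del: of_nat_Suc power_Suc)
  qed
  let ?L = "\<lambda>s. complex_of_real (exp (- (v * s\<^sup>2) / 2)) * (- \<i> * s)"
  have "(\<lambda>n. ?r n ^ DIM(real) *\<^sub>R (\<integral>t. ?F n t \<partial>lborel)) \<longlonglongrightarrow> (\<integral>s. ?L s \<partial>lborel)"
  proof (rule scaled_integral_tendsto)
    show "integrable lborel (\<lambda>t::real. exp (- (c * (norm t)\<^sup>2)) + 2 / c * exp (- (c * t\<^sup>2) / 2))"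
      using gauss gauss_half by simp
    show "norm (?F n t) \<le> exp (- (c * (norm (?r n *\<^sub>R t))\<^sup>2)) + 2 / c * exp (- (c * (?r n *\<^sub>R t)\<^sup>2) / 2)" for n and t :: real
    proof (cases "t \<in> {-pi..pi}")
      case True
      let ?s = "?r n * t"
      have "norm (1 - iexp t) \<le> \<bar>t\<bar>"
        using iexp_approx1[of t 0] by (simp add: norm_minus_commute)
      then have "norm (?F n t) \<le> exp (- (c * (norm (?r n *\<^sub>R t))\<^sup>2)) * (?r n * \<bar>t\<bar>)"
        unfolding F using True cf_power_bound[OF True, of "Suc n"]
        by (simp only: norm_mult norm_power norm_scaleR) (intro mult_mono, auto)
      also have "\<dots> = exp (- (c * ?s\<^sup>2)) * \<bar>?s\<bar>" by (simp add: abs_mult power_mult_distrib)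
      also have "\<dots> \<le> exp (- (c * ?s\<^sup>2)) * (1 + ?s\<^sup>2)"
      proof (intro mult_left_mono)
        show "\<bar>?s\<bar> \<le> 1 + ?s\<^sup>2"
          using zero_le_power2[of "\<bar>?s\<bar> - 1"] unfolding power2_diff power2_abs by simp
      qed simp
      also have "\<dots> = exp (- (c * ?s\<^sup>2)) + 1 / c * (c * ?s\<^sup>2 * exp (- (c * ?s\<^sup>2)))"
        using c_pos by (simp add: algebra_simps)
      also have "\<dots> \<le> exp (- (c * ?s\<^sup>2)) + 1 / c * (2 * exp (- (c * ?s\<^sup>2) / 2))"
        using c_pos by (intro add_left_mono mult_left_mono square_exp_bound) auto
      finally have "norm (?F n t) \<le> exp (- (c * ?s\<^sup>2)) + 2 / c * exp (- (c * ?s\<^sup>2) / 2)" by simp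
      moreover have "(norm (?r n *\<^sub>R t))\<^sup>2 = ?s\<^sup>2" unfolding real_scaleR_def real_norm_def power2_abs ..
      ultimately show ?thesis by (simp only: real_scaleR_def)
    next
      case False
      then show ?thesis using c_pos by (simp add: add_nonneg_nonneg)
    qed
    fix s :: real
    have lim0: "(\<lambda>n. (real (Suc n) * ph_mean s - s * real (Suc n)) / sqrt (real (Suc n))) \<longlonglongrightarrow> 0"
      by (simp add: ph_mean_eq mult.commute)
    have "(\<lambda>n. indicator {-pi..pi} ((1 / ?r n) *\<^sub>R s) *\<^sub>R
      (cf ((1 / ?r n) *\<^sub>R s) ^ Suc n * iexp (- ((1 / ?r n) *\<^sub>R s * real (Suc n)))))
      \<longlonglongrightarrow> complex_of_real (exp (- ph_var s / 2)) * iexp 0"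
      by (rule local_limit_integrand[OF _ filterlim_Suc lim0]) simp
    then have l1: "(\<lambda>n. ?I (Suc n) (Suc n) ((1 / ?r n) *\<^sub>R s)) \<longlonglongrightarrow> complex_of_real (exp (- (v * s\<^sup>2) / 2))"
      unfolding ph_var_eq by simp
    have l2: "(\<lambda>n. complex_of_real (?r n) * (1 - iexp ((1 / ?r n) *\<^sub>R s))) \<longlonglongrightarrow> - \<i> * s"
    proof -
      have b: "norm (complex_of_real (?r n) * (1 - iexp ((1 / ?r n) *\<^sub>R s)) - (- \<i> * s)) \<le> s\<^sup>2 / 2 / ?r n" for n
      proof -
        let ?x = "(1 / ?r n) *\<^sub>R s"
        have "complex_of_real (?r n) * (1 - iexp ?x) - (- \<i> * s) = - (complex_of_real (?r n) * (iexp ?x - (1 + \<i> * complex_of_real ?x)))"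
          by (simp add: algebra_simps)
        then have "norm (complex_of_real (?r n) * (1 - iexp ?x) - (- \<i> * s)) = ?r n * norm (iexp ?x - (1 + \<i> * complex_of_real ?x))"
          by (simp only: norm_minus_cancel norm_mult norm_of_real) simp
        also have "\<dots> \<le> ?r n * (\<bar>?x\<bar> ^ 2 / 2)"
          using iexp_approx1[of ?x 1] by (intro mult_left_mono) (simp_all add: numeral_2_eq_2)
        also have "\<dots> = s\<^sup>2 / 2 / ?r n"
        proof -
          have "x * (\<bar>(1 / x) *\<^sub>R s\<bar>\<^sup>2 / 2) = s\<^sup>2 / 2 / x" if "x > 0" for x
            using that unfolding power2_abs real_scaleR_def by (simp add: power2_eq_square field_simps)
          then show ?thesis by simp
        qed
        finally show ?thesis .
      qed
      have z: "(\<lambda>n. s\<^sup>2 / 2 / ?r n) \<longlonglongrightarrow> 0" by real_asymp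
      have "(\<lambda>n. complex_of_real (?r n) * (1 - iexp ((1 / ?r n) *\<^sub>R s)) - (- \<i> * s)) \<longlonglongrightarrow> 0"
        by (rule Lim_null_comparison[OF _ z], rule always_eventually, rule allI, rule b)
      then show ?thesis by (rule LIM_zero_cancel)
    qed
    show "(\<lambda>n. ?F n ((1 / ?r n) *\<^sub>R s)) \<longlonglongrightarrow> ?L s"
      unfolding F by (intro tendsto_mult l1 l2)
  qed auto
  \<comment> \<open>The reflection s to -s changes the sign of the integrand, so the integral is its
    own negative.\<close>
  moreover have "(\<integral>s. ?L s \<partial>lborel) = 0"
  proof -
    have "(\<integral>s. ?L s \<partial>lborel) = (\<integral>s. - ?L s \<partial>lborel)"
      using lborel_integral_real_affine[of "-1" ?L 0] by simp
    then show ?thesis by simp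
  qed
  moreover have "complex_of_real (2 * pi * pmf (walk M (Suc n)) (Suc n)) - complex_of_real (2 * pi * pmf (walk M (Suc n)) n) =
        (\<integral>t. ?I (Suc n) (Suc n) t - ?I (Suc n) n t \<partial>lborel)" for n
    unfolding inversion by (rule Bochner_Integration.integral_diff[OF int int, symmetric])
  then have "?r n ^ DIM(real) *\<^sub>R (\<integral>t. ?F n t \<partial>lborel) =
      complex_of_real (2 * pi * (real (Suc n) * (pmf (walk M (Suc n)) (Suc n) - pmf (walk M (Suc n)) n)))" for n
  proof -
    have "complex_of_real (2 * pi * (real (Suc n) * (a - b))) = ?r n ^ DIM(real) *\<^sub>R
        (complex_of_real (?r n) * (complex_of_real (2 * pi * a) - complex_of_real (2 * pi * b)))" for a b
    proof -
      have "complex_of_real (?r n) * complex_of_real (?r n) = complex_of_real (real (Suc n))"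
        by (simp only: of_real_mult[symmetric] real_sqrt_mult_self) simp
      then have A: "?r n ^ DIM(real) *\<^sub>R (complex_of_real (?r n) * X) = complex_of_real (real (Suc n)) * X" for X
        by (simp only: DIM_real power_one_right scaleR_conv_of_real mult.assoc[symmetric])
      have C: "2 * pi * (real (Suc n) * (a - b)) = real (Suc n) * (2 * pi * a - 2 * pi * b)"
        by algebra
      show ?thesis by (simp only: A C of_real_mult of_real_diff)
    qed
    then show ?thesis
      by (simp only: \<open>complex_of_real (2 * pi * pmf (walk M (Suc n)) (Suc n)) - _ = _\<close> integral_mult_right_zero)
  qed
  ultimately have "(\<lambda>n. complex_of_real (2 * pi * (real (Suc n) * (pmf (walk M (Suc n)) (Suc n) - pmf (walk M (Suc n)) n)))) \<longlonglongrightarrow> complex_of_real 0"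
    by (simp only: of_real_0)
  then have "(\<lambda>n. 2 * pi * (real (Suc n) * (pmf (walk M (Suc n)) (Suc n) - pmf (walk M (Suc n)) n))) \<longlonglongrightarrow> 0"
    by (rule tendsto_of_real_iff[THEN iffD1])
  from tendsto_mult_left[OF this, of "1 / (2 * pi)"] show ?thesis by simp
qed

end

section \<open>Exact formulas for the size and the number of \<open>Pend\<close> vertices\<close>

context critical_offspring
begin

definition size_prob :: "nat \<Rightarrow> real" where
  "size_prob n = measure (measure_pmf GW) {t. nodes t = n}"

definition pend_size_prob :: "nat \<Rightarrow> real" where
  "pend_size_prob n = measure (measure_pmf GW) {t. label t = Pend \<and> nodes t = n}"

definition joint_prob :: "nat \<Rightarrow> nat \<Rightarrow> real" where
  "joint_prob n k = measure (measure_pmf GW) {t. nodes t = n \<and> pend_count t = k}"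

definition pend_joint_prob :: "nat \<Rightarrow> nat \<Rightarrow> real" where
  "pend_joint_prob n k = measure (measure_pmf GW) {t. label t = Pend \<and> nodes t = n \<and> pend_count t = k}"

lemma nodes_pos: "nodes t > 0"
  by (cases t) simp

lemma pend_count_pos: "label t = Pend \<Longrightarrow> pend_count t > 0"
  by (cases t) simp

lemma length_le_sum_list: "(\<And>x. x \<in> set xs \<Longrightarrow> f x > 0) \<Longrightarrow> length xs \<le> sum_list (map f xs)" for f :: "'a \<Rightarrow> nat"
proof (induction xs)
  case (Cons a xs)
  from Cons.prems[of a] have "f a > 0" by simp
  moreover have "length xs \<le> sum_list (map f xs)" using Cons by simp
  ultimately show ?case by simp
qed simp

lemma size_law_zero: "n < z \<Longrightarrow> pmf (size_law z) n = 0"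
proof -
  assume n: "n < z"
  have "length l \<le> sum_list (map nodes l)" for l
    by (rule length_le_sum_list) (rule nodes_pos)
  then have "z \<le> sum_list (map nodes l)" if "l \<in> set_pmf (replicate_pmf z GW)" for l
    using that by (auto simp: set_replicate_pmf)
  then show ?thesis unfolding size_law_def using n by (intro pmf_map_outside) fastforce
qed

lemma forest_law_zero: "k < z \<Longrightarrow> pmf (forest_law z) (n, k) = 0"
proof -
  assume k: "k < z"
  have "z \<le> sum_list (map pend_count l)" if "l \<in> set_pmf (replicate_pmf z GWP)" for l
    using that length_le_sum_list[of l pend_count] pend_count_pos
    by (auto simp: set_replicate_pmf set_GWP in_lists_conv_set)
  then show ?thesis unfolding forest_law_def using k by (intro pmf_map_outside) fastforce
qed

lemma pmf_size_law: "real n * pmf (size_law z) n = real z * (if z \<le> n then pmf (walk \<xi> n) (n - z) else 0)"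
proof -
  have "real n * pmf (size_law z) n = real z * (if z \<le> n then fps_nth (Abs_fps (pmf \<xi>) ^ n) (n - z) else 0)"
  proof (rule hitting_time_fps)
    show "pmf (size_law 0) 0 = 1" "pmf (size_law 0) (Suc k) = 0" for k
      by (simp_all add: size_law_def)
    show "pmf (size_law (Suc z)) 0 = 0" for z by (rule size_law_zero) simp
    show "pmf (size_law (Suc z)) (Suc k) = (\<Sum>j\<le>k. fps_nth (Abs_fps (pmf \<xi>)) j * pmf (size_law (j + z)) k)" for z k
    proof -
      have "pmf (map_pmf Suc (size_law (j + z))) (Suc k) = pmf (size_law (j + z)) k" for j
        by (rule pmf_map_inj') simp
      then have "pmf (size_law (Suc z)) (Suc k) = measure_pmf.expectation \<xi> (\<lambda>j. pmf (size_law (j + z)) k)"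
        unfolding size_law_Suc pmf_bind by simp
      also have "\<dots> = (\<Sum>j\<le>k. pmf \<xi> j * pmf (size_law (j + z)) k)"
        by (rule expectation_finite_support) (auto intro: size_law_zero)
      finally show ?thesis by simp
    qed
  qed
  then show ?thesis by (simp add: pmf_walk_nat)
qed

lemma pmf_map_shift:
  "pmf (map_pmf (\<lambda>(n, k). (n + x, h k)) N) (n, h k) = (if x \<le> n then pmf N (n - x, k) else 0)"
  if "inj h" for N :: "(nat \<times> nat) pmf"
proof (cases "x \<le> n")
  case True
  have "pmf (map_pmf (\<lambda>(n, k). (n + x, h k)) N) ((\<lambda>(n, k). (n + x, h k)) (n - x, k)) = pmf N (n - x, k)"
    by (rule pmf_map_inj') (use that in \<open>auto intro!: injI dest: injD\<close>)
  then show ?thesis using True by simp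
next
  case False
  then show ?thesis by (auto intro!: pmf_map_outside)
qed

text \<open>The hitting time identity with \<open>Pend\<close> vertices as individuals: time is
  their number k, exits are offspring, and the number n of vertices is the exponent of the formal
  variable in the coefficients.\<close>

lemma pmf_forest_law:
  "real k * pmf (forest_law z) (n, k) = real z * (if z \<le> k then pmf (walk block_law k) (k - z, n) else 0)"
proof -
  let ?F = "\<lambda>z k. Abs_fps (\<lambda>n. pmf (forest_law z) (n, k))"
  have "of_nat k * ?F z k = of_nat z * (if z \<le> k then fps_nth (bifps (pmf block_law) ^ k) (k - z) else 0)"
  proof (rule hitting_time_fps)
    show "?F 0 0 = 1" by (rule fps_ext) (auto simp: forest_law_def)
    show "?F 0 (Suc k) = 0" for k by (rule fps_ext) (auto simp: forest_law_def)
    show "?F (Suc z) 0 = 0" for z by (rule fps_ext) (simp add: forest_law_zero)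
    show "?F (Suc z) (Suc k) = (\<Sum>j\<le>k. fps_nth (bifps (pmf block_law)) j * ?F (j + z) k)" for z k
    proof (rule fps_ext)
      fix n
      have "pmf (forest_law (Suc z)) (n, Suc k) = measure_pmf.expectation block_law
          (\<lambda>s. if snd s \<le> n then pmf (forest_law (fst s + z)) (n - snd s, k) else 0)"
        unfolding forest_law_Suc pmf_bind
        proof (rule Bochner_Integration.integral_cong[OF refl])
          fix s :: "nat \<times> nat"
          obtain j x where s: "s = (j, x)" by (cases s)
          show "pmf (case s of (j, x) \<Rightarrow> map_pmf (\<lambda>(n, k). (n + x, Suc k)) (forest_law (j + z))) (n, Suc k) =
              (if snd s \<le> n then pmf (forest_law (fst s + z)) (n - snd s, k) else 0)"
            using pmf_map_shift[of Suc x "forest_law (j + z)" n k] by (simp add: s)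
        qed
      also have "\<dots> = (\<Sum>s\<in>{..k} \<times> {..n}. pmf block_law s * (if snd s \<le> n then pmf (forest_law (fst s + z)) (n - snd s, k) else 0))"
        proof (rule expectation_finite_support)
          fix s :: "nat \<times> nat" assume "s \<notin> {..k} \<times> {..n}"
          then show "(if snd s \<le> n then pmf (forest_law (fst s + z)) (n - snd s, k) else 0) = 0"
            by (cases s) (auto simp: not_le intro!: forest_law_zero)
        qed simp
      also have "\<dots> = (\<Sum>j\<le>k. \<Sum>x\<le>n. pmf block_law (j, x) * pmf (forest_law (j + z)) (n - x, k))"
        unfolding sum.cartesian_product by (intro sum.cong refl) auto
      finally show "fps_nth (?F (Suc z) (Suc k)) n = fps_nth (\<Sum>j\<le>k. fps_nth (bifps (pmf block_law)) j * ?F (j + z) k) n"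
        by (simp add: fps_sum_nth fps_mult_nth bifps_def atLeast0AtMost)
    qed
  qed
  then have "fps_nth (of_nat k * ?F z k) n = fps_nth (of_nat z * (if z \<le> k then fps_nth (bifps (pmf block_law) ^ k) (k - z) else 0)) n"
    by (rule arg_cong)
  then show ?thesis
    by (simp add: fps_of_nat[symmetric] fps_mult_left_const_nth pmf_walk_nat_prod)
qed

text \<open>Conditioning on the part above the topmost \<open>Pend\<close> vertices: it has z cuts
  and x vertices and contains no \<open>Pend\<close> vertex, so all k of them lie in a forest of z
  blocks with n - x vertices.\<close>

lemma joint_prob_eq:
  assumes "k > 0"
  shows "joint_prob n k = measure_pmf.expectation root_law
    (\<lambda>(z, x). if x \<le> n \<and> z \<le> k then real z / real k * pmf (walk block_law k) (k - z, n - x) else 0)"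
proof -
  have "joint_prob n k = pmf (map_pmf (\<lambda>t. (nodes t, pend_count t)) GW) (n, k)"
    unfolding joint_prob_def by (simp add: pmf_map vimage_def)
  also have "\<dots> = measure_pmf.expectation root_law
      (\<lambda>(z, x). if x \<le> n then pmf (forest_law z) (n - x, k) else 0)"
    unfolding nodes_pend_count_law pmf_bind
    proof (rule Bochner_Integration.integral_cong[OF refl])
    fix s :: "nat \<times> nat"
    obtain z x where s: "s = (z, x)" by (cases s)
    show "pmf (case s of (z, x) \<Rightarrow> map_pmf (\<lambda>(n, k). (n + x, k)) (forest_law z)) (n, k) =
        (case s of (z, x) \<Rightarrow> if x \<le> n then pmf (forest_law z) (n - x, k) else 0)"
      using pmf_map_shift[of "\<lambda>k. k" x "forest_law z" n k] by (simp add: s)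
  qed
  also have "\<dots> = measure_pmf.expectation root_law
    (\<lambda>(z, x). if x \<le> n \<and> z \<le> k then real z / real k * pmf (walk block_law k) (k - z, n - x) else 0)"
  proof (rule Bochner_Integration.integral_cong[OF refl])
    fix s :: "nat \<times> nat"
    obtain z x where s: "s = (z, x)" by (cases s)
    have "pmf (forest_law z) (n - x, k) = (if z \<le> k then real z / real k * pmf (walk block_law k) (k - z, n - x) else 0)"
      using pmf_forest_law[of k z "n - x"] assms by (auto simp: field_simps)
    then show "(case s of (z, x) \<Rightarrow> if x \<le> n then pmf (forest_law z) (n - x, k) else 0) =
      (case s of (z, x) \<Rightarrow> if x \<le> n \<and> z \<le> k then real z / real k * pmf (walk block_law k) (k - z, n - x) else 0)"
      by (simp add: s)
  qed
  finally show ?thesis .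
qed

lemma measure_GWP: "measure (measure_pmf GWP) A = measure (measure_pmf GW) ({t. label t = Pend} \<inter> A) / pend_prob"
  unfolding GWP_def cond_pmf.rep_eq[OF Pend_in_GW] pend_prob_def
  using pend_prob_pos unfolding pend_prob_def
  by (subst measure_uniform_measure) (auto simp: measure_pmf.emeasure_eq_measure)

lemma pend_joint_prob_eq:
  assumes "k > 0"
  shows "pend_joint_prob n k = pend_prob / real k * pmf (walk block_law k) (k - 1, n)"
proof -
  have "forest_law 1 = map_pmf (\<lambda>t. (nodes t, pend_count t)) GWP"
    unfolding forest_law_def replicate_pmf_1 by (simp add: pmf.map_comp o_def)
  then have "pmf (forest_law 1) (n, k) = measure (measure_pmf GWP) {t. nodes t = n \<and> pend_count t = k}"
    by (simp add: pmf_map vimage_def)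
  also have "\<dots> = pend_joint_prob n k / pend_prob"
    by (simp add: measure_GWP pend_joint_prob_def Int_def)
  finally have "pend_joint_prob n k = pend_prob * pmf (forest_law 1) (n, k)"
    using pend_prob_pos by simp
  moreover have "pmf (forest_law 1) (n, k) = 1 / real k * pmf (walk block_law k) (k - 1, n)"
    using pmf_forest_law[of k 1 n] assms by (simp add: field_simps)
  ultimately show ?thesis by simp
qed

lemma size_prob_eq: "n > 0 \<Longrightarrow> real n * size_prob n = pmf (walk \<xi> n) (n - 1)"
proof -
  assume n: "n > 0"
  have "size_law 1 = map_pmf nodes GW"
    unfolding size_law_def replicate_pmf_1 by (simp add: pmf.map_comp o_def)
  then have "size_prob n = pmf (size_law 1) n"
    by (simp add: size_prob_def pmf_map vimage_def)
  then show ?thesis using pmf_size_law[of n 1] n by simp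
qed

end

section \<open>Moments of the block law\<close>

text \<open>A concrete decreasing null sequence in (0, 1/2]. Generating functions are evaluated at 1
  - \<open>gap n\<close>; monotonicity in n permits monotone convergence, which needs no prior
  integrability.\<close>

definition gap :: "nat \<Rightarrow> real" where "gap n = 1 / (real n + 2)"

lemma gap_bounds: "0 < gap n" "gap n \<le> 1 / 2"
  by (simp_all add: gap_def)

lemma gap_le_1: "gap n \<le> 1"
  by (simp add: gap_def)

lemma gap_tendsto: "gap \<longlonglongrightarrow> 0"
  unfolding gap_def by real_asymp

lemma gap_antimono: "m \<le> n \<Longrightarrow> gap n \<le> gap m"
  by (simp add: gap_def frac_le)

lemma integrable_power_pmf:
  fixes s :: real
  shows "0 \<le> s \<Longrightarrow> s \<le> 1 \<Longrightarrow> integrable (measure_pmf M) (\<lambda>x. s ^ L x)"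
  by (rule measure_pmf.integrable_const_bound[where B = 1]) (auto simp: power_le_one)

lemma one_minus_power: "1 - (1 - d) ^ k = d * (\<Sum>i<k. (1 - d) ^ i)" for d :: real
  using one_diff_power_eq[of "1 - d" k] by simp

lemma power_second_difference:
  "(1 - d) ^ k - 1 + real k * d = d\<^sup>2 * (\<Sum>i<k. \<Sum>j<i. (1 - d) ^ j)" for d :: real
proof -
  have "d\<^sup>2 * (\<Sum>i<k. \<Sum>j<i. (1 - d) ^ j) = d * (\<Sum>i<k. d * (\<Sum>j<i. (1 - d) ^ j))"
    by (simp add: power2_eq_square sum_distrib_left mult.assoc)
  also have "\<dots> = d * (\<Sum>i<k. 1 - (1 - d) ^ i)" by (simp only: one_minus_power)
  also have "\<dots> = real k * d - d * (\<Sum>i<k. (1 - d) ^ i)" by (simp add: sum_subtractf algebra_simps)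
  finally show ?thesis using one_minus_power[of d k] by simp
qed

lemma sum_lessThan_real: "(\<Sum>i<k. real i) = real k * (real k - 1) / 2"
  by (induction k) (auto simp: field_simps)

text \<open>The difference quotient at 1 is the expectation of the geometric sum \<open>f n\<close>,
  which increases to L as the argument tends to 1. A bound on the quotients therefore forces
  integrability and identifies the limit.\<close>

lemma first_moment:
  assumes bound: "\<forall>\<^sub>F n in sequentially. 1 - measure_pmf.expectation M (\<lambda>x. (1 - gap n) ^ L x) \<le> K * gap n"
  shows "integrable (measure_pmf M) (\<lambda>x. real (L x))"
    and "(\<lambda>n. (1 - measure_pmf.expectation M (\<lambda>x. (1 - gap n) ^ L x)) / gap n) \<longlonglongrightarrow>
      measure_pmf.expectation M (\<lambda>x. real (L x))"
proof -
  define f where "f n x = (\<Sum>i<L x. (1 - gap n) ^ i)" for n x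
  have f: "f n x = (1 - (1 - gap n) ^ L x) / gap n" for n x
    using one_minus_power[of "gap n" "L x"] gap_bounds[of n] by (simp add: f_def field_simps)
  have int: "integrable (measure_pmf M) (f n)" for n
    unfolding f[abs_def] using gap_bounds[of n]
    by (intro integrable_divide Bochner_Integration.integrable_diff integrable_power_pmf) auto
  have Ef: "measure_pmf.expectation M (f n) = (1 - measure_pmf.expectation M (\<lambda>x. (1 - gap n) ^ L x)) / gap n" for n
    unfolding f[abs_def] using gap_bounds[of n] integrable_power_pmf[of "1 - gap n" M L] by simp
  have mono: "mono (\<lambda>n. f n x)" for x
    unfolding f_def using gap_bounds gap_le_1 gap_antimono
    by (intro monoI sum_mono power_mono) (auto intro: order_trans)
  have inc: "incseq (\<lambda>n. measure_pmf.expectation M (f n))"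
    using mono by (intro monoI integral_mono int) (auto simp: mono_def)
  obtain N where N: "\<And>n. n \<ge> N \<Longrightarrow> 1 - measure_pmf.expectation M (\<lambda>x. (1 - gap n) ^ L x) \<le> K * gap n"
    using bound by (auto simp: eventually_sequentially)
  have "measure_pmf.expectation M (f n) \<le> K" for n
  proof -
    have "measure_pmf.expectation M (f n) \<le> measure_pmf.expectation M (f (max n N))"
      using inc by (auto simp: mono_def)
    also have "\<dots> \<le> K" unfolding Ef using N[of "max n N"] gap_bounds[of "max n N"] by (simp add: field_simps)
    finally show ?thesis .
  qed
  then obtain x0 where x0: "(\<lambda>n. measure_pmf.expectation M (f n)) \<longlonglongrightarrow> x0"
    using incseq_convergent[OF inc] by blast
  have lim: "(\<lambda>n. f n x) \<longlonglongrightarrow> real (L x)" for x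
  proof -
    have "(\<lambda>n. f n x) \<longlonglongrightarrow> (\<Sum>i<L x. (1 - 0) ^ i)"
      unfolding f_def by (intro tendsto_intros gap_tendsto)
    then show ?thesis by simp
  qed
  have "integrable (measure_pmf M) (\<lambda>x. real (L x))"
    by (rule integrable_monotone_convergence[OF int _ _ x0]) (use mono lim in auto)
  moreover have "measure_pmf.expectation M (\<lambda>x. real (L x)) = x0"
    by (rule integral_monotone_convergence[OF int _ _ x0]) (use mono lim in auto)
  ultimately show "integrable (measure_pmf M) (\<lambda>x. real (L x))"
    "(\<lambda>n. (1 - measure_pmf.expectation M (\<lambda>x. (1 - gap n) ^ L x)) / gap n) \<longlonglongrightarrow>
      measure_pmf.expectation M (\<lambda>x. real (L x))"
    using x0 by (simp_all add: Ef)
qed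

text \<open>A second-order expansion at 1 is turned into moments: its linear coefficient is the
  mean, and the second-order quotient is the expectation of a double sum that increases to L (L -
  1)/2. Integrability is part of the conclusion.\<close>

lemma second_moment:
  assumes lim: "(\<lambda>n. (measure_pmf.expectation M (\<lambda>x. (1 - gap n) ^ L x) - 1 + a * gap n) / (gap n)\<^sup>2) \<longlonglongrightarrow> y"
  shows "integrable (measure_pmf M) (\<lambda>x. real (L x))"
    and "integrable (measure_pmf M) (\<lambda>x. (real (L x))\<^sup>2)"
    and "measure_pmf.expectation M (\<lambda>x. real (L x)) = a"
    and "measure_pmf.expectation M (\<lambda>x. real (L x) * (real (L x) - 1)) = 2 * y"
proof -
  define H where "H n = measure_pmf.expectation M (\<lambda>x. (1 - gap n) ^ L x)" for n
  have "(\<lambda>n. a - gap n * ((H n - 1 + a * gap n) / (gap n)\<^sup>2)) \<longlonglongrightarrow> a - 0 * y"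
    unfolding H_def by (intro tendsto_intros gap_tendsto lim)
  moreover have "a - gap n * ((H n - 1 + a * gap n) / (gap n)\<^sup>2) = (1 - H n) / gap n" for n
    using gap_bounds[of n] by (simp add: field_simps power2_eq_square)
  ultimately have l1: "(\<lambda>n. (1 - H n) / gap n) \<longlonglongrightarrow> a" by simp
  have "\<forall>\<^sub>F n in sequentially. (1 - H n) / gap n < a + 1"
    using order_tendstoD(2)[OF l1, of "a + 1"] by simp
  then have "\<forall>\<^sub>F n in sequentially. 1 - H n \<le> (a + 1) * gap n"
    by eventually_elim (use gap_bounds in \<open>simp add: divide_less_eq\<close>)
  then have "\<forall>\<^sub>F n in sequentially. 1 - measure_pmf.expectation M (\<lambda>x. (1 - gap n) ^ L x) \<le> (a + 1) * gap n"
    by (simp add: H_def)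
  note fm = first_moment[OF this]
  show int1: "integrable (measure_pmf M) (\<lambda>x. real (L x))" by (rule fm)
  show E1: "measure_pmf.expectation M (\<lambda>x. real (L x)) = a"
    using fm(2) l1 unfolding H_def by (rule LIMSEQ_unique)
  define h where "h n x = (\<Sum>i<L x. \<Sum>j<i. (1 - gap n) ^ j)" for n x
  have h: "h n x = ((1 - gap n) ^ L x - 1 + real (L x) * gap n) / (gap n)\<^sup>2" for n x
    using power_second_difference[of "gap n" "L x"] gap_bounds[of n] by (simp add: h_def field_simps)
  have int: "integrable (measure_pmf M) (h n)" for n
    unfolding h[abs_def] using gap_bounds[of n]
    by (intro integrable_divide Bochner_Integration.integrable_diff Bochner_Integration.integrable_add
        integrable_power_pmf integrable_mult_left int1) auto
  have Eh: "measure_pmf.expectation M (h n) = (measure_pmf.expectation M (\<lambda>x. (1 - gap n) ^ L x) - 1 + a * gap n) / (gap n)\<^sup>2" for n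
    unfolding h[abs_def] using gap_bounds[of n] integrable_power_pmf[of "1 - gap n" M L] int1 E1 by simp
  have mono: "mono (\<lambda>n. h n x)" for x
    unfolding h_def using gap_bounds gap_le_1 gap_antimono
    by (intro monoI sum_mono power_mono) (auto intro: order_trans)
  have lim': "(\<lambda>n. h n x) \<longlonglongrightarrow> real (L x) * (real (L x) - 1) / 2" for x
  proof -
    have "(\<lambda>n. h n x) \<longlonglongrightarrow> (\<Sum>i<L x. \<Sum>j<i. (1 - 0) ^ j)"
      unfolding h_def by (intro tendsto_intros gap_tendsto)
    then show ?thesis by (simp add: sum_lessThan_real)
  qed
  have ly: "(\<lambda>n. measure_pmf.expectation M (h n)) \<longlonglongrightarrow> y" unfolding Eh by (rule lim)
  have i2: "integrable (measure_pmf M) (\<lambda>x. real (L x) * (real (L x) - 1) / 2)"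
    by (rule integrable_monotone_convergence[OF int _ _ ly]) (use mono lim' in auto)
  have "measure_pmf.expectation M (\<lambda>x. real (L x) * (real (L x) - 1) / 2) = y"
    by (rule integral_monotone_convergence[OF int _ _ ly]) (use mono lim' in auto)
  then show "measure_pmf.expectation M (\<lambda>x. real (L x) * (real (L x) - 1)) = 2 * y" by simp
  have "integrable (measure_pmf M) (\<lambda>x. 2 * (real (L x) * (real (L x) - 1) / 2) + real (L x))"
    using i2 int1 by (intro Bochner_Integration.integrable_add integrable_mult_right) auto
  moreover have "(real k)\<^sup>2 = 2 * (real k * (real k - 1) / 2) + real k" for k
    by (simp add: power2_eq_square field_simps)
  ultimately show "integrable (measure_pmf M) (\<lambda>x. (real (L x))\<^sup>2)" by (simp only:)
qed

lemma expectation_of_bool: "measure_pmf.expectation M (\<lambda>x. of_bool (P x)) = measure (measure_pmf M) {x. P x}"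
proof -
  have "(\<lambda>x. of_bool (P x)) = (indicator {x. P x} :: _ \<Rightarrow> real)" by (auto simp: indicator_def)
  then show ?thesis by simp
qed

context critical_offspring
begin

definition pgf :: "real \<Rightarrow> real" where
  "pgf r = measure_pmf.expectation \<xi> (\<lambda>k. r ^ k)"

definition var :: real where
  "var = measure_pmf.variance \<xi> real"

lemma var_eq: "measure_pmf.expectation \<xi> (\<lambda>k. real k * (real k - 1)) = var"
proof -
  have "measure_pmf.expectation \<xi> (\<lambda>k. real k * (real k - 1)) = measure_pmf.expectation \<xi> (\<lambda>k. (real k)\<^sup>2 - real k)"
    by (simp add: power2_eq_square algebra_simps)
  also have "\<dots> = measure_pmf.expectation \<xi> (\<lambda>k. (real k)\<^sup>2) - 1"
    using integrable_offspring finite_variance mean by simp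
  also have "\<dots> = var"
    using measure_pmf.variance_eq[OF integrable_offspring finite_variance] mean by (simp add: var_def)
  finally show ?thesis .
qed

lemma var_pos: "var > 0"
  using positive_variance by (simp add: var_def)

text \<open>Here the second moment is given, so dominated convergence works along any null sequence
  in (0, 1]. That freedom is used, since \<open>h\<close> will be the deficit of another generating
  function.\<close>

lemma pgf_second_order:
  assumes h: "\<And>n. 0 < h n" "\<And>n. h n \<le> 1" "h \<longlonglongrightarrow> 0"
  shows "(\<lambda>n. (pgf (1 - h n) - 1 + h n) / (h n)\<^sup>2) \<longlonglongrightarrow> var / 2"
proof -
  let ?f = "\<lambda>n k. \<Sum>i<k. \<Sum>j<i. (1 - h n) ^ j"
  have f: "?f n k = ((1 - h n) ^ k - 1 + real k * h n) / (h n)\<^sup>2" for n k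
    using power_second_difference[of "h n" k] h(1)[of n] by (simp add: field_simps)
  have E: "measure_pmf.expectation \<xi> (?f n) = (pgf (1 - h n) - 1 + h n) / (h n)\<^sup>2" for n
    unfolding f pgf_def using h(1)[of n] h(2)[of n] integrable_power_pmf[of "1 - h n" \<xi> "\<lambda>k. k"] integrable_offspring mean by simp
  have "(\<lambda>n. measure_pmf.expectation \<xi> (?f n)) \<longlonglongrightarrow> measure_pmf.expectation \<xi> (\<lambda>k. real k * (real k - 1) / 2)"
  proof (rule integral_dominated_convergence[where w = "\<lambda>k. (real k)\<^sup>2"])
    show "AE k in measure_pmf \<xi>. (\<lambda>n. ?f n k) \<longlonglongrightarrow> real k * (real k - 1) / 2"
    proof (rule AE_I2)
      fix k
      have "(\<lambda>n. ?f n k) \<longlonglongrightarrow> (\<Sum>i<k. \<Sum>j<i. (1 - 0) ^ j)"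
        by (intro tendsto_intros h)
      then show "(\<lambda>n. ?f n k) \<longlonglongrightarrow> real k * (real k - 1) / 2" by (simp add: sum_lessThan_real)
    qed
    show "AE k in measure_pmf \<xi>. norm (?f n k) \<le> (real k)\<^sup>2" for n
    proof (rule AE_I2)
      fix k
      have "?f n k \<ge> 0" using h(2)[of n] by (intro sum_nonneg) auto
      moreover have "?f n k \<le> (\<Sum>i<k. \<Sum>j<i. 1)"
        using h(1)[of n] h(2)[of n] by (intro sum_mono power_le_one) auto
      moreover have "(\<Sum>i<k. \<Sum>j<i. 1 :: real) \<le> (real k)\<^sup>2"
        by (simp add: sum_lessThan_real power2_eq_square algebra_simps)
      ultimately show "norm (?f n k) \<le> (real k)\<^sup>2" by simp
    qed
  qed (use finite_variance in auto)
  then show ?thesis unfolding E by (simp add: var_eq)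
qed

lemma integral_GWP:
  fixes f :: "tree \<Rightarrow> real"
  shows "pend_prob * measure_pmf.expectation GWP f = measure_pmf.expectation GW (\<lambda>t. f t * of_bool (label t = Pend))"
proof -
  have "pend_prob * measure_pmf.expectation GWP f = (\<integral>t. pend_prob * (pmf GWP t * f t) \<partial>count_space UNIV)"
    unfolding measure_pmf_eq_density by (subst integral_density) auto
  also have "\<dots> = (\<integral>t. pmf GW t * (f t * of_bool (label t = Pend)) \<partial>count_space UNIV)"
    using pend_prob_pos by (intro Bochner_Integration.integral_cong) (auto simp: pmf_GWP pmf_GW)
  also have "\<dots> = measure_pmf.expectation GW (\<lambda>t. f t * of_bool (label t = Pend))"
    unfolding measure_pmf_eq_density by (subst integral_density) auto
  finally show ?thesis .
qed

lemma expectation_block: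
  assumes "0 \<le> x" "x \<le> 1" "0 \<le> v" "v \<le> 1"
  shows "measure_pmf.expectation GW (\<lambda>t. x ^ inner (block t) * v ^ marks (block t)) =
    x * pgf (measure_pmf.expectation GW (\<lambda>t. x ^ inner (top t) * v ^ marks (top t)))"
proof -
  let ?f = "\<lambda>t. x ^ inner (top t) * v ^ marks (top t)"
  have b: "\<bar>?f t\<bar> \<le> 1" for t using assms by (simp add: mult_le_one power_le_one)
  have eq: "x ^ inner (block t) * v ^ marks (block t) = x * prod_list (map ?f (children t))" for t
  proof -
    have "x ^ sum_list (map inner (map top ts)) * v ^ sum_list (map marks (map top ts)) = prod_list (map ?f ts)" for ts
      by (induction ts) (auto simp: power_add mult_ac)
    then show ?thesis by (simp add: block_def)
  qed
  show ?thesis unfolding eq pgf_def using expectation_prod_children[of ?f] b by simp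
qed

text \<open>\<open>top\<close> agrees with \<open>block\<close> unless the root is
  \<open>Pend\<close>, where it contributes \<open>v\<close>. By \<open>expectation_block\<close>
  the unrestricted block series is x times \<open>pgf\<close> of Y, so the part with a
  \<open>Pend\<close> root is obtained by subtraction.\<close>

lemma expectation_top:
  assumes "0 \<le> x" "x \<le> 1" "0 \<le> v" "v \<le> 1"
  defines "Y \<equiv> measure_pmf.expectation GW (\<lambda>t. x ^ inner (top t) * v ^ marks (top t))"
  shows "pend_prob * measure_pmf.expectation GWP (\<lambda>t. x ^ inner (block t) * v ^ marks (block t)) =
    x * pgf Y + pend_prob * v - Y"
proof -
  let ?b = "\<lambda>t. x ^ inner (block t) * v ^ marks (block t)"
  have int: "integrable (measure_pmf GW) (\<lambda>t. ?b t * of_bool (P t))" for P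
    using assms by (intro measure_pmf.integrable_const_bound[where B = 1]) (auto simp: mult_le_one power_le_one)
  have int': "integrable (measure_pmf GW) (\<lambda>t. v * of_bool (P t))" for P
    using assms by (intro measure_pmf.integrable_const_bound[where B = 1]) auto
  have "x ^ inner (top t) * v ^ marks (top t) =
      (v * of_bool (label t = Pend) + ?b t * of_bool True) - ?b t * of_bool (label t = Pend)" for t
    by (simp add: top_eq)
  then have "Y = (measure_pmf.expectation GW (\<lambda>t. v * of_bool (label t = Pend)) + measure_pmf.expectation GW (\<lambda>t. ?b t * of_bool True))
      - measure_pmf.expectation GW (\<lambda>t. ?b t * of_bool (label t = Pend))"
    unfolding Y_def using int[of "\<lambda>_. True"] int[of "\<lambda>t. label t = Pend"] int'[of "\<lambda>t. label t = Pend"] by simp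
  also have "measure_pmf.expectation GW (\<lambda>t. v * of_bool (label t = Pend)) = pend_prob * v"
  proof -
    have "measure_pmf.expectation GW (\<lambda>t. of_bool (label t = Pend)) = pend_prob"
    proof -
      have "(\<lambda>t. of_bool (label t = Pend) :: real) = indicator {t. label t = Pend}" by (auto simp: indicator_def)
      then show ?thesis by (simp add: pend_prob_def)
    qed
    then show ?thesis by simp
  qed
  also have "measure_pmf.expectation GW (\<lambda>t. ?b t * of_bool True) = x * pgf Y"
    unfolding Y_def using expectation_block[OF assms(1-4)] by simp
  finally show ?thesis unfolding integral_GWP by simp
qed

definition top_size :: "tree \<Rightarrow> nat" where
  "top_size t = inner (top t) + marks (top t)"

definition unpend_gf :: "real \<Rightarrow> real" where
  "unpend_gf s = measure_pmf.expectation GW (\<lambda>t. s ^ top_size t * of_bool (label t \<noteq> Pend))"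

text \<open>Matched and covered children are those that force nothing on their parent; if all
  children are of this kind, the parent is not \<open>Pend\<close>.\<close>

definition inert_gf :: "real \<Rightarrow> real" where
  "inert_gf s = measure_pmf.expectation GW (\<lambda>t. s ^ top_size t * of_bool (label t \<in> {Matched, Covered}))"

lemma integrable_top_size:
  fixes s :: real
  shows "0 \<le> s \<Longrightarrow> s \<le> 1 \<Longrightarrow> integrable (measure_pmf GW) (\<lambda>t. s ^ top_size t * of_bool (P t))"
  by (intro measure_pmf.integrable_const_bound[where B = 1]) (auto simp: power_le_one)

lemma expectation_top_size:
  assumes "0 \<le> s" "s \<le> 1"
  shows "measure_pmf.expectation GW (\<lambda>t. s ^ top_size t) = pend_prob * s + unpend_gf s"
proof -
  have "s ^ top_size t = s * of_bool (label t = Pend) + s ^ top_size t * of_bool (label t \<noteq> Pend)" for t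
    by (simp add: top_size_def top_eq)
  then have "measure_pmf.expectation GW (\<lambda>t. s ^ top_size t) =
      measure_pmf.expectation GW (\<lambda>t. s * of_bool (label t = Pend) + s ^ top_size t * of_bool (label t \<noteq> Pend))"
    by simp
  also have "\<dots> = s * measure_pmf.expectation GW (\<lambda>t. of_bool (label t = Pend)) + unpend_gf s"
  proof (subst Bochner_Integration.integral_add)
    show "integrable (measure_pmf GW) (\<lambda>t. s * of_bool (label t = Pend))"
      by (rule measure_pmf.integrable_const_bound[where B = 1]) (use assms in auto)
    show "integrable (measure_pmf GW) (\<lambda>t. s ^ top_size t * of_bool (label t \<noteq> Pend))"
      by (rule integrable_top_size[OF assms])
  qed (simp add: unpend_gf_def)
  finally show ?thesis by (simp add: expectation_of_bool pend_prob_def)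
qed

text \<open>The root fails to be \<open>Pend\<close> unless no child is \<open>Pend\<close> and some
  child is \<open>Bare\<close>. By inclusion and exclusion: all families of children, minus those
  without \<open>Pend\<close>, plus those without \<open>Pend\<close> and \<open>Bare\<close>. Each
  term is a product over independent children.\<close>

lemma unpend_gf_eq:
  assumes "0 \<le> s" "s \<le> 1"
  shows "unpend_gf s = s * (pgf (pend_prob * s + unpend_gf s) - pgf (unpend_gf s) + pgf (inert_gf s))"
proof -
  let ?f = "\<lambda>P t. s ^ top_size t * of_bool (P t)"
  let ?P = "\<lambda>t. True" and ?Q = "\<lambda>t. label t \<noteq> Pend" and ?R = "\<lambda>t. label t \<in> {Matched, Covered}"
  have prod: "prod_list (map (?f P) ts) = prod_list (map (\<lambda>t. s ^ top_size t) ts) * of_bool (\<forall>t\<in>set ts. P t)" for P ts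
    by (induction ts) auto
  have b: "\<bar>?f P t\<bar> \<le> 1" for P t using assms by (simp add: power_le_one)
  have bp: "\<bar>prod_list (map (?f P) ts)\<bar> \<le> 1" for P ts
  proof (induction ts)
    case (Cons a ts)
    then show ?case using mult_le_one[OF b[of a P] abs_ge_zero Cons] by (simp only: list.map prod_list.Cons abs_mult)
  qed simp
  have int: "integrable (measure_pmf GW) (\<lambda>t. prod_list (map (?f P) (children t)))" for P
    by (rule measure_pmf.integrable_const_bound[where B = 1]) (use bp in auto)
  have size: "s ^ top_size t = s * prod_list (map (\<lambda>t. s ^ top_size t) (children t))" if "label t \<noteq> Pend" for t
  proof -
    have "prod_list (map (\<lambda>t. s ^ top_size t) ts) = s ^ (sum_list (map inner (map top ts)) + sum_list (map marks (map top ts)))" for ts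
      by (induction ts) (auto simp: top_size_def power_add)
    then show ?thesis using that by (simp add: top_size_def top_eq block_def power_add)
  qed
  have pt: "s ^ top_size t * of_bool (?Q t) = s * (prod_list (map (?f ?P) (children t)) - prod_list (map (?f ?Q) (children t))
      + prod_list (map (?f ?R) (children t)))" for t
  proof -
    obtain ts where t: "t = Node ts" by (cases t)
    have im: "(\<forall>u\<in>set ts. label u \<noteq> a) \<longleftrightarrow> a \<notin> label ` set ts" for a
      by (metis image_iff)
    then have q: "(\<forall>u\<in>set ts. ?Q u) \<longleftrightarrow> Pend \<notin> label ` set ts" .
    have r: "(\<forall>u\<in>set ts. ?R u) \<longleftrightarrow> Pend \<notin> label ` set ts \<and> Bare \<notin> label ` set ts"
    proof -
      have "?R u \<longleftrightarrow> label u \<noteq> Pend \<and> label u \<noteq> Bare" for u by (cases "label u") auto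
      then show ?thesis by (simp only: ball_conj_distrib im)
    qed
    have lab: "label t \<noteq> Pend \<longleftrightarrow> Pend \<in> label ` set ts \<or> Bare \<notin> label ` set ts"
      unfolding t by (auto simp: combine_def)
    show ?thesis
    proof (cases "label t = Pend")
      case True
      then have "Pend \<notin> label ` set ts" "Bare \<in> label ` set ts" using lab by auto
      then show ?thesis unfolding prod using True q r by (simp add: t)
    next
      case False
      then have "Pend \<in> label ` set ts \<or> Pend \<notin> label ` set ts \<and> Bare \<notin> label ` set ts" using lab by auto
      then show ?thesis unfolding prod using size[OF False] False q r by (auto simp: t)
    qed
  qed
  have E: "measure_pmf.expectation GW (\<lambda>t. prod_list (map (?f P) (children t))) =
      pgf (measure_pmf.expectation GW (?f P))" for P
    unfolding pgf_def by (rule expectation_prod_children[OF b])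
  have "unpend_gf s = s * (measure_pmf.expectation GW (\<lambda>t. prod_list (map (?f ?P) (children t)))
      - measure_pmf.expectation GW (\<lambda>t. prod_list (map (?f ?Q) (children t)))
      + measure_pmf.expectation GW (\<lambda>t. prod_list (map (?f ?R) (children t))))"
  proof -
    have lin: "measure_pmf.expectation GW (\<lambda>t. s * (a t - b t + d t)) =
        s * (measure_pmf.expectation GW a - measure_pmf.expectation GW b + measure_pmf.expectation GW d)"
      if "integrable (measure_pmf GW) a" "integrable (measure_pmf GW) b" "integrable (measure_pmf GW) d"
      for a b d :: "tree \<Rightarrow> real"
      using that by simp
    have "unpend_gf s = measure_pmf.expectation GW (\<lambda>t. s * (prod_list (map (?f ?P) (children t))
        - prod_list (map (?f ?Q) (children t)) + prod_list (map (?f ?R) (children t))))"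
      unfolding unpend_gf_def by (rule Bochner_Integration.integral_cong[OF refl pt])
    also note lin[OF int[of ?P] int[of ?Q] int[of ?R]]
    finally show ?thesis .
  qed
  moreover have "measure_pmf.expectation GW (?f ?P) = pend_prob * s + unpend_gf s"
    using expectation_top_size[OF assms] by simp
  ultimately show ?thesis by (simp only: E unpend_gf_def[symmetric] inert_gf_def[symmetric])
qed

lemma power_diff_lower:
  fixes x y :: real
  assumes "0 \<le> y" "y \<le> x"
  shows "real k * y ^ (k - 1) * (x - y) \<le> x ^ k - y ^ k" "x ^ k - y ^ k \<le> real k * x ^ (k - 1) * (x - y)"
proof -
  have eq: "x ^ k - y ^ k = (x - y) * (\<Sum>i<k. x ^ i * y ^ (k - 1 - i))"
  proof (cases k)
    case (Suc n)
    then show ?thesis using power_diff_sumr2[of x k y] by (simp add: mult.commute)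
  qed simp
  have "y ^ (k - 1) \<le> x ^ i * y ^ (k - 1 - i)" if "i < k" for i
  proof -
    have "y ^ (k - 1) = y ^ i * y ^ (k - 1 - i)" using that by (simp flip: power_add)
    then show ?thesis using assms by (auto intro!: mult_right_mono power_mono)
  qed
  then have "(\<Sum>i<k. y ^ (k - 1)) \<le> (\<Sum>i<k. x ^ i * y ^ (k - 1 - i))" by (intro sum_mono) auto
  then show "real k * y ^ (k - 1) * (x - y) \<le> x ^ k - y ^ k"
    unfolding eq using mult_left_mono[of "real k * y ^ (k - 1)" "\<Sum>i<k. x ^ i * y ^ (k - 1 - i)" "x - y"] assms
    by (simp only: sum_constant card_lessThan diff_ge_0_iff_ge mult_ac)
  have "x ^ i * y ^ (k - 1 - i) \<le> x ^ (k - 1)" if "i < k" for i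
  proof -
    have "x ^ (k - 1) = x ^ i * x ^ (k - 1 - i)" using that by (simp flip: power_add)
    then show ?thesis using assms by (auto intro!: mult_left_mono power_mono)
  qed
  then have "(\<Sum>i<k. x ^ i * y ^ (k - 1 - i)) \<le> (\<Sum>i<k. x ^ (k - 1))" by (intro sum_mono) auto
  then show "x ^ k - y ^ k \<le> real k * x ^ (k - 1) * (x - y)"
    unfolding eq using mult_left_mono[of "\<Sum>i<k. x ^ i * y ^ (k - 1 - i)" "real k * x ^ (k - 1)" "x - y"] assms
    by (simp only: sum_constant card_lessThan diff_ge_0_iff_ge mult_ac)
qed

lemma integrable_pgf: "0 \<le> (r :: real) \<Longrightarrow> r \<le> 1 \<Longrightarrow> integrable (measure_pmf \<xi>) (\<lambda>k. r ^ k)"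
  by (rule integrable_power_pmf)

lemma integrable_pgf_deriv:
  assumes "0 \<le> r" "r \<le> 1" shows "integrable (measure_pmf \<xi>) (\<lambda>k. real k * r ^ (k - 1))"
  by (rule Bochner_Integration.integrable_bound[OF integrable_offspring])
     (use assms in \<open>auto simp: abs_mult intro!: mult_left_le power_le_one\<close>)

definition pgf' :: "real \<Rightarrow> real" where
  "pgf' r = measure_pmf.expectation \<xi> (\<lambda>k. real k * r ^ (k - 1))"

lemma pgf_diff_lower:
  assumes "0 \<le> y" "y \<le> x" "x \<le> 1"
  shows "pgf' y * (x - y) \<le> pgf x - pgf y" "pgf x - pgf y \<le> pgf' x * (x - y)"
proof -
  have "measure_pmf.expectation \<xi> (\<lambda>k. real k * y ^ (k - 1) * (x - y)) \<le> measure_pmf.expectation \<xi> (\<lambda>k. x ^ k - y ^ k)"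
    using assms by (intro integral_mono Bochner_Integration.integrable_diff integrable_mult_left integrable_pgf integrable_pgf_deriv power_diff_lower) auto
  then show "pgf' y * (x - y) \<le> pgf x - pgf y"
    using assms integrable_pgf[of x] integrable_pgf[of y] by (simp add: pgf_def pgf'_def)
  have "measure_pmf.expectation \<xi> (\<lambda>k. x ^ k - y ^ k) \<le> measure_pmf.expectation \<xi> (\<lambda>k. real k * x ^ (k - 1) * (x - y))"
    using assms by (intro integral_mono Bochner_Integration.integrable_diff integrable_mult_left integrable_pgf integrable_pgf_deriv power_diff_lower) auto
  then show "pgf x - pgf y \<le> pgf' x * (x - y)"
    using assms integrable_pgf[of x] integrable_pgf[of y] by (simp add: pgf_def pgf'_def)
qed

lemma pgf'_nonneg: "0 \<le> r \<Longrightarrow> 0 \<le> pgf' r"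
  unfolding pgf'_def by (intro Bochner_Integration.integral_nonneg) simp

lemma pgf'_1: "pgf' 1 = 1"
  by (simp add: pgf'_def mean)

lemma pgf_bounds: "0 \<le> r \<Longrightarrow> r \<le> 1 \<Longrightarrow> 0 \<le> pgf r \<and> pgf r \<le> 1"
  unfolding pgf_def using integrable_pgf[of r]
  by (auto intro!: integral_nonneg measure_pmf.integral_le_const power_le_one)

lemma pgf_1: "pgf 1 = 1" by (simp add: pgf_def)

lemma pgf'_mono:
  assumes "0 \<le> x" "x \<le> y" "y \<le> 1" shows "pgf' x \<le> pgf' y"
  unfolding pgf'_def using assms
  by (intro integral_mono integrable_pgf_deriv mult_left_mono power_mono) auto

lemma pgf'_strict_mono:
  assumes "0 \<le> x" "x < y" "y \<le> 1" shows "pgf' x < pgf' y"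
proof -
  define f where "f k = real k * y ^ (k - 1) - real k * x ^ (k - 1)" for k
  have f0: "f k \<ge> 0" for k using assms by (auto simp: f_def intro!: mult_left_mono power_mono)
  have int: "integrable (measure_pmf \<xi>) f"
    unfolding f_def using assms by (intro Bochner_Integration.integrable_diff integrable_pgf_deriv) auto
  obtain j where j: "j \<ge> 2" "pmf \<xi> j > 0" using ex_branching by blast
  have fj: "f j > 0" using assms j by (auto simp: f_def intro!: mult_strict_left_mono power_strict_mono)
  have "measure_pmf.expectation \<xi> f \<noteq> 0"
  proof
    assume "measure_pmf.expectation \<xi> f = 0"
    then have "AE k in measure_pmf \<xi>. f k = 0"
      using integral_nonneg_eq_0_iff_AE[OF int] f0 by simp
    then show False using j fj by (auto simp: AE_measure_pmf_iff set_pmf_iff)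
  qed
  moreover have "measure_pmf.expectation \<xi> f \<ge> 0" using f0 by simp
  moreover have "measure_pmf.expectation \<xi> f = pgf' y - pgf' x"
    unfolding f_def pgf'_def using assms integrable_pgf_deriv[of x] integrable_pgf_deriv[of y] by simp
  ultimately show ?thesis by simp
qed

text \<open>Let \<Delta> be the deficit of \<open>unpend_gf\<close> at s against its value at 1.
  Linearising \<open>unpend_gf_eq\<close> at 1, the first term returns \<Delta> with coefficient
  \<open>pgf'\<close> 1 = 1, which cancels against the left side. What remains is a positive
  multiple of \<Delta>, bounded by a multiple of 1 - s: \<open>pgf'\<close> is strictly increasing
  and \<open>unpend_gf\<close> 1 exceeds \<open>inert_gf\<close> 1 by P(root \<open>Bare\<close>) >
  0.\<close>

lemma top_size_bound: "\<exists>K. \<forall>\<^sub>F n in sequentially. 1 - measure_pmf.expectation GW (\<lambda>t. (1 - gap n) ^ top_size t) \<le> K * gap n"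
proof -
  define s where "s n = 1 - gap n" for n
  have s: "0 \<le> s n" "s n \<le> 1" for n using gap_bounds[of n] by (auto simp: s_def)
  have slim: "s \<longlonglongrightarrow> 1" unfolding s_def[abs_def] using tendsto_diff[OF tendsto_const[of 1] gap_tendsto] by simp
  let ?C = "unpend_gf" and ?B = "inert_gf"
  have C1: "pend_prob + ?C 1 = 1" using expectation_top_size[of 1] by simp
  have BC: "?C r - ?B r = measure_pmf.expectation GW (\<lambda>t. r ^ top_size t * of_bool (label t = Bare))" if "0 \<le> r" "r \<le> 1" for r
  proof -
    have "r ^ top_size t * of_bool (label t = Bare) = r ^ top_size t * of_bool (label t \<noteq> Pend) - r ^ top_size t * of_bool (label t \<in> {Matched, Covered})" for t
      by (cases "label t") auto
    then have "measure_pmf.expectation GW (\<lambda>t. r ^ top_size t * of_bool (label t = Bare)) =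
        measure_pmf.expectation GW (\<lambda>t. r ^ top_size t * of_bool (label t \<noteq> Pend) -
          r ^ top_size t * of_bool (label t \<in> {Matched, Covered}))"
      by (simp only:)
    also have "\<dots> = ?C r - ?B r" unfolding unpend_gf_def inert_gf_def
      by (rule Bochner_Integration.integral_diff) (rule integrable_top_size[OF that])+
    finally show ?thesis ..
  qed
  have nonneg: "0 \<le> measure_pmf.expectation GW (\<lambda>t. r ^ top_size t * of_bool (P t))" if "0 \<le> r" "r \<le> 1" for r :: real and P
    using that by (intro Bochner_Integration.integral_nonneg) auto
  have mono: "measure_pmf.expectation GW (\<lambda>t. r ^ top_size t * of_bool (P t)) \<le> measure_pmf.expectation GW (\<lambda>t. 1 ^ top_size t * of_bool (P t))"
    if "0 \<le> r" "r \<le> 1" for r :: real and P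
    using that by (intro integral_mono integrable_top_size) (auto simp: power_le_one)
  have w: "?C 1 - ?B 1 > 0"
  proof -
    have "label leaf = Bare" by (simp add: combine_def)
    then have "measure (measure_pmf GW) {t. label t = Bare} > 0"
      using leaf_in_GW by (intro measure_pmf_posI[of leaf]) auto
    then show ?thesis by (simp add: BC expectation_of_bool)
  qed
  \<comment> \<open>The midpoint leaves a margin: \<open>unpend_gf\<close> at s is only known to
    converge to its value at 1, so it is eventually above c0, and \<kappa> is the remaining positive
    coefficient.\<close>
  define c0 where "c0 = (?C 1 + ?B 1) / 2"
  have B1: "0 \<le> ?B 1" "?B 1 < c0" "c0 < ?C 1" "c0 \<le> 1"
    using w nonneg[of 1] C1 pend_prob_pos by (auto simp: c0_def inert_gf_def)
  define \<kappa> where "\<kappa> = pgf' c0 - pgf' (?B 1)"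
  have \<kappa>: "\<kappa> > 0" using pgf'_strict_mono[of "?B 1" c0] B1 by (simp add: \<kappa>_def)
  have Clim: "(\<lambda>n. ?C (s n)) \<longlonglongrightarrow> ?C 1"
    unfolding unpend_gf_def
  proof (rule integral_dominated_convergence[where w = "\<lambda>_. 1"])
    show "AE t in measure_pmf GW. (\<lambda>n. s n ^ top_size t * of_bool (label t \<noteq> Pend)) \<longlonglongrightarrow> 1 ^ top_size t * of_bool (label t \<noteq> Pend)"
      by (intro AE_I2 tendsto_intros slim)
    show "AE t in measure_pmf GW. norm (s n ^ top_size t * of_bool (label t \<noteq> Pend)) \<le> 1" for n
      using s by (intro AE_I2) (auto simp: power_le_one)
  qed auto
  have "\<forall>\<^sub>F n in sequentially. c0 < ?C (s n)"
    by (rule order_tendstoD(1)[OF Clim]) (use B1 in simp)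
  then have "\<forall>\<^sub>F n in sequentially. 1 - measure_pmf.expectation GW (\<lambda>t. (1 - gap n) ^ top_size t) \<le> (1 + 2 / \<kappa>) * gap n"
  proof eventually_elim
    case (elim n)
    define C where "C = ?C (s n)"
    define B where "B = ?B (s n)"
    define \<Delta> where "\<Delta> = ?C 1 - C"
    have CB: "0 \<le> B" "B \<le> ?B 1" "C \<le> ?C 1" "B \<le> C" "?B 1 - B \<le> \<Delta>"
    proof -
      let ?I = "\<lambda>t. label t \<in> {Matched, Covered}" and ?U = "\<lambda>t. label t \<noteq> Pend" and ?R = "\<lambda>t. label t = Bare"
      show "0 \<le> B" using nonneg[of "s n" ?I, OF s] by (simp only: B_def inert_gf_def)
      show "B \<le> ?B 1" using mono[of "s n" ?I, OF s] by (simp only: B_def inert_gf_def)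
      show "C \<le> ?C 1" using mono[of "s n" ?U, OF s] by (simp only: C_def unpend_gf_def)
      have "C - B \<ge> 0" using nonneg[of "s n" ?R, OF s] BC[OF s, of n] by (simp only: C_def B_def)
      then show "B \<le> C" by simp
      have "C - B \<le> ?C 1 - ?B 1" using mono[of "s n" ?R, OF s] BC[OF s, of n] BC[of 1] by (simp only: C_def B_def)
      then show "?B 1 - B \<le> \<Delta>" by (simp add: \<Delta>_def)
    qed
    have y: "0 \<le> pend_prob * s n + C" "pend_prob * s n + C \<le> 1"
    proof -
      have "0 \<le> pend_prob * s n" "pend_prob * s n \<le> pend_prob"
        using pend_prob_pos s[of n] by (auto intro: mult_left_le)
      then show "0 \<le> pend_prob * s n + C" "pend_prob * s n + C \<le> 1"
        using CB C1 by linarith+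
    qed
    have p1: "pend_prob \<le> 1" using C1 CB by simp
    let ?K = "pgf (pend_prob * s n + C) - pgf C + pgf B"
    have eq: "C = s n * ?K" unfolding C_def B_def by (rule unpend_gf_eq[OF s])
    have eq1: "?C 1 = 1 - pgf (?C 1) + pgf (?B 1)" using unpend_gf_eq[of 1] C1 by (simp add: pgf_1)
    have C1': "?C 1 \<le> 1" using C1 pend_prob_pos by simp
    have g1: "1 - pgf (pend_prob * s n + C) \<le> 1 - (pend_prob * s n + C)"
      using pgf_diff_lower(2)[of "pend_prob * s n + C" 1] y by (simp add: pgf_1 pgf'_1)
    have g2: "pgf' c0 * \<Delta> \<le> pgf (?C 1) - pgf C"
    proof -
      have "pgf' c0 * \<Delta> \<le> pgf' C * \<Delta>"
        using elim B1 CB C1' by (intro mult_right_mono pgf'_mono) (auto simp: C_def \<Delta>_def)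
      also have "\<dots> \<le> pgf (?C 1) - pgf C" unfolding \<Delta>_def using CB C1' by (intro pgf_diff_lower) auto
      finally show ?thesis .
    qed
    have g3: "pgf (?B 1) - pgf B \<le> pgf' (?B 1) * \<Delta>"
    proof -
      have "pgf (?B 1) - pgf B \<le> pgf' (?B 1) * (?B 1 - B)" using CB B1 by (intro pgf_diff_lower) auto
      also have "\<dots> \<le> pgf' (?B 1) * \<Delta>"
        using CB B1 by (intro mult_left_mono) (auto simp: pgf'_def intro!: Bochner_Integration.integral_nonneg)
      finally show ?thesis .
    qed
    have K1: "?K \<le> 1"
    proof -
      have "pgf B \<le> pgf C"
      proof -
        have "0 \<le> pgf' B * (C - B)" using CB pgf'_nonneg[of B] by simp
        also have "\<dots> \<le> pgf C - pgf B" using CB C1' by (intro pgf_diff_lower) auto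
        finally show ?thesis by simp
      qed
      then show ?thesis using pgf_bounds[of "pend_prob * s n + C"] y by simp
    qed
    have "gap n * ?K \<le> gap n" using K1 gap_bounds[of n] by (intro mult_left_le) auto
    moreover have "\<Delta> = (?C 1 - ?K) + gap n * ?K" unfolding \<Delta>_def using eq by (simp add: s_def algebra_simps)
    moreover have "?C 1 - ?K \<le> (1 - (pend_prob * s n + C)) - pgf' c0 * \<Delta> + pgf' (?B 1) * \<Delta>"
      using eq1 g1 g2 g3 by simp
    moreover have sum: "1 - (pend_prob * s n + C) = pend_prob * gap n + \<Delta>"
      using C1 by (simp add: \<Delta>_def s_def algebra_simps)
    moreover have "pend_prob * gap n \<le> gap n" using p1 gap_bounds[of n] by (simp add: mult_left_le_one_le pend_prob_pos less_imp_le)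
    \<comment> \<open>\<Delta> occurs with coefficient 1 on both sides and drops out. The 2 adds the
      contribution of the cut vertices and that of the prefactor s = 1 - \<open>gap n\<close>, each
      at most \<open>gap n\<close>.\<close>
    ultimately have "\<kappa> * \<Delta> \<le> 2 * gap n" unfolding \<kappa>_def left_diff_distrib by linarith
    then have "\<Delta> \<le> 2 / \<kappa> * gap n" using \<kappa> by (simp add: field_simps)
    moreover have "measure_pmf.expectation GW (\<lambda>t. (1 - gap n) ^ top_size t) = pend_prob * s n + C"
      using expectation_top_size[OF s, of n] by (simp add: s_def C_def)
    ultimately show ?case using sum \<open>pend_prob * gap n \<le> gap n\<close> by (simp add: algebra_simps)
  qed
  then show ?thesis by blast
qed

lemma integrable_top_size_real: "integrable (measure_pmf GW) (\<lambda>t. real (top_size t))"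
  using top_size_bound first_moment(1) by blast

section \<open>Moments of the blocks\<close>

definition root_mean :: real where
  "root_mean = measure_pmf.expectation GW (\<lambda>t. real (marks (top t)))"

lemma integrable_marks_top: "integrable (measure_pmf GW) (\<lambda>t. real (marks (top t)))"
  by (rule Bochner_Integration.integrable_bound[OF integrable_top_size_real]) (auto simp: top_size_def)

text \<open>\<open>pgf_second_order\<close> divides by the deficit, which must therefore be
  positive; trees with a \<open>Pend\<close> root, where L is 1, guarantee this.\<close>

lemma expectation_deficit_pos:
  fixes s :: real and L :: "tree \<Rightarrow> nat"
  assumes L: "\<And>t. label t = Pend \<Longrightarrow> L t = 1" and s: "0 < s" "s < 1"
  shows "0 < 1 - measure_pmf.expectation GW (\<lambda>t. s ^ L t)" "1 - measure_pmf.expectation GW (\<lambda>t. s ^ L t) \<le> 1"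
proof -
  have int: "integrable (measure_pmf GW) (\<lambda>t. s ^ L t)" using s by (intro integrable_power_pmf) auto
  have i2: "integrable (measure_pmf GW) (\<lambda>t. (1 - s) * of_bool (label t = Pend))"
    by (rule measure_pmf.integrable_const_bound[where B = 1]) (use s in auto)
  have "0 < (1 - s) * pend_prob" using s pend_prob_pos by simp
  also have "\<dots> = measure_pmf.expectation GW (\<lambda>t. (1 - s) * of_bool (label t = Pend))"
    by (simp add: expectation_of_bool pend_prob_def)
  also have "\<dots> \<le> measure_pmf.expectation GW (\<lambda>t. 1 - s ^ L t)"
    using i2 int s L by (intro integral_mono) (auto simp: power_le_one)
  also have "\<dots> = 1 - measure_pmf.expectation GW (\<lambda>t. s ^ L t)" using int by simp
  finally show "0 < 1 - measure_pmf.expectation GW (\<lambda>t. s ^ L t)" .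
  show "1 - measure_pmf.expectation GW (\<lambda>t. s ^ L t) \<le> 1"
    using s by (simp add: Bochner_Integration.integral_nonneg)
qed

lemma marks_top_deficit:
  "(\<lambda>n. (1 - measure_pmf.expectation GW (\<lambda>t. (1 - gap n) ^ marks (top t))) / gap n) \<longlonglongrightarrow> root_mean"
proof -
  obtain K where K: "\<forall>\<^sub>F n in sequentially. 1 - measure_pmf.expectation GW (\<lambda>t. (1 - gap n) ^ top_size t) \<le> K * gap n"
    using top_size_bound by blast
  have "measure_pmf.expectation GW (\<lambda>t. (1 - gap n) ^ top_size t) \<le> measure_pmf.expectation GW (\<lambda>t. (1 - gap n) ^ marks (top t))" for n
    using gap_bounds[of n] gap_le_1[of n]
    by (intro integral_mono integrable_power_pmf power_decreasing) (auto simp: top_size_def)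
  then have le: "1 - measure_pmf.expectation GW (\<lambda>t. (1 - gap n) ^ marks (top t)) \<le>
      1 - measure_pmf.expectation GW (\<lambda>t. (1 - gap n) ^ top_size t)" for n
    by simp
  have "\<forall>\<^sub>F n in sequentially. 1 - measure_pmf.expectation GW (\<lambda>t. (1 - gap n) ^ marks (top t)) \<le> K * gap n"
    using K
  proof eventually_elim
    case (elim n)
    then show ?case using le[of n] by linarith
  qed
  from first_moment(2)[OF this] show ?thesis by (simp add: root_mean_def)
qed

lemma root_mean_pos: "root_mean > 0"
proof -
  have "pend_prob = measure_pmf.expectation GW (\<lambda>t. of_bool (label t = Pend))"
    by (simp add: expectation_of_bool pend_prob_def)
  also have "\<dots> \<le> root_mean"
    unfolding root_mean_def
    by (intro integral_mono integrable_marks_top measure_pmf.integrable_const_bound[where B = 1]) (auto simp: top_eq)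
  finally show ?thesis using pend_prob_pos by simp
qed

text \<open>With x = 1, \<open>expectation_top\<close> expresses \<open>pend_prob\<close> times the
  error of the block series against 1 - \<open>gap n\<close> as \<open>pgf\<close> Y - Y. At the
  critical point this is of second order in the deficit of Y, about var/2 times its square, and the
  deficit is about \<open>root_mean\<close> times \<open>gap n\<close>. No linear term is left, so
  the mean number of exits is 1.\<close>

lemma block_marks_moments:
  shows "integrable (measure_pmf GWP) (\<lambda>t. (real (marks (block t)))\<^sup>2)"
    and "integrable (measure_pmf GWP) (\<lambda>t. real (marks (block t)))"
    and "measure_pmf.expectation GWP (\<lambda>t. real (marks (block t))) = 1"
    and "measure_pmf.expectation GWP (\<lambda>t. real (marks (block t)) * (real (marks (block t)) - 1)) =
      var * root_mean\<^sup>2 / pend_prob"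
proof -
  define Y where "Y n = measure_pmf.expectation GW (\<lambda>t. (1 - gap n) ^ marks (top t))" for n
  define h where "h n = 1 - Y n" for n
  have g: "0 < 1 - gap n" "1 - gap n < 1" for n using gap_bounds[of n] by auto
  have h: "0 < h n" "h n \<le> 1" for n
    unfolding h_def Y_def by (rule expectation_deficit_pos[OF _ g]; simp add: top_eq)+
  have hl: "(\<lambda>n. h n / gap n) \<longlonglongrightarrow> root_mean"
    unfolding h_def Y_def by (rule marks_top_deficit)
  have h0: "h \<longlonglongrightarrow> 0"
  proof -
    have "(\<lambda>n. h n / gap n * gap n) \<longlonglongrightarrow> root_mean * 0" by (intro tendsto_mult hl gap_tendsto)
    then show ?thesis using gap_bounds by (simp add: less_imp_neq[THEN not_sym])
  qed
  have "(\<lambda>n. (1 / pend_prob) * ((pgf (1 - h n) - 1 + h n) / (h n)\<^sup>2 * (h n / gap n)\<^sup>2)) \<longlonglongrightarrow>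
      (1 / pend_prob) * (var / 2 * root_mean\<^sup>2)"
    by (intro tendsto_intros hl pgf_second_order h h0)
  moreover have "(1 / pend_prob) * ((pgf (1 - h n) - 1 + h n) / (h n)\<^sup>2 * (h n / gap n)\<^sup>2) =
      (measure_pmf.expectation GWP (\<lambda>t. (1 - gap n) ^ marks (block t)) - 1 + 1 * gap n) / (gap n)\<^sup>2" for n
  proof -
    have "pend_prob * measure_pmf.expectation GWP (\<lambda>t. (1 - gap n) ^ marks (block t)) = pgf (Y n) + pend_prob * (1 - gap n) - Y n"
      using expectation_top[of 1 "1 - gap n"] g[of n] by (simp add: Y_def)
    then have "measure_pmf.expectation GWP (\<lambda>t. (1 - gap n) ^ marks (block t)) - 1 + 1 * gap n = (pgf (Y n) - Y n) / pend_prob"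
      using pend_prob_pos by (simp add: field_simps)
    then show ?thesis using h(1)[of n] by (simp add: h_def power_divide)
  qed
  ultimately have "(\<lambda>n. (measure_pmf.expectation GWP (\<lambda>t. (1 - gap n) ^ marks (block t)) - 1 + 1 * gap n) / (gap n)\<^sup>2)
      \<longlonglongrightarrow> (1 / pend_prob) * (var / 2 * root_mean\<^sup>2)" by simp
  note sm = second_moment[OF this]
  show "integrable (measure_pmf GWP) (\<lambda>t. (real (marks (block t)))\<^sup>2)"
    "integrable (measure_pmf GWP) (\<lambda>t. real (marks (block t)))"
    "measure_pmf.expectation GWP (\<lambda>t. real (marks (block t))) = 1"
    by (rule sm)+
  show "measure_pmf.expectation GWP (\<lambda>t. real (marks (block t)) * (real (marks (block t)) - 1)) =
      var * root_mean\<^sup>2 / pend_prob"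
    using sm(4) by simp
qed

text \<open>The same expansion with x = v. The prefactor x now adds a linear term, which contributes
  the 1 / \<open>pend_prob\<close> to the mean; this makes the mean number of vertices per
  \<open>Pend\<close> vertex 1 / \<open>pend_prob\<close> once the exits are subtracted.\<close>

lemma block_size_moments:
  shows "integrable (measure_pmf GWP) (\<lambda>t. (real (inner (block t) + marks (block t)))\<^sup>2)"
    and "integrable (measure_pmf GWP) (\<lambda>t. real (inner (block t) + marks (block t)))"
    and "measure_pmf.expectation GWP (\<lambda>t. real (inner (block t) + marks (block t))) = 1 + 1 / pend_prob"
proof -
  define Y where "Y n = measure_pmf.expectation GW (\<lambda>t. (1 - gap n) ^ top_size t)" for n
  define m where "m = measure_pmf.expectation GW (\<lambda>t. real (top_size t))"
  define h where "h n = 1 - Y n" for n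
  have g: "0 < 1 - gap n" "1 - gap n < 1" for n using gap_bounds[of n] by auto
  have h: "0 < h n" "h n \<le> 1" for n
    unfolding h_def Y_def by (rule expectation_deficit_pos[OF _ g]; simp add: top_eq top_size_def)+
  have hl: "(\<lambda>n. h n / gap n) \<longlonglongrightarrow> m"
    unfolding h_def Y_def m_def using top_size_bound first_moment(2) by blast
  have h0: "h \<longlonglongrightarrow> 0"
  proof -
    have "(\<lambda>n. h n / gap n * gap n) \<longlonglongrightarrow> m * 0" by (intro tendsto_mult hl gap_tendsto)
    then show ?thesis using gap_bounds by (simp add: less_imp_neq[THEN not_sym])
  qed
  define q where "q n = (pgf (1 - h n) - 1 + h n) / (h n)\<^sup>2" for n
  have "(\<lambda>n. (1 / pend_prob) * (h n / gap n + (1 - gap n) * (q n * (h n / gap n)\<^sup>2))) \<longlonglongrightarrow>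
      (1 / pend_prob) * (m + (1 - 0) * (var / 2 * m\<^sup>2))"
    unfolding q_def by (intro tendsto_intros hl gap_tendsto pgf_second_order h h0)
  moreover have "(1 / pend_prob) * (h n / gap n + (1 - gap n) * (q n * (h n / gap n)\<^sup>2)) =
      (measure_pmf.expectation GWP (\<lambda>t. (1 - gap n) ^ (inner (block t) + marks (block t))) - 1 + (1 + 1 / pend_prob) * gap n) / (gap n)\<^sup>2" for n
  proof -
    have pg: "pgf (Y n) = 1 - h n + q n * (h n)\<^sup>2"
      using h(1)[of n] by (simp add: q_def) (simp add: h_def)
    have "pend_prob * measure_pmf.expectation GWP (\<lambda>t. (1 - gap n) ^ (inner (block t) + marks (block t))) =
        (1 - gap n) * pgf (Y n) + pend_prob * (1 - gap n) - Y n"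
      using expectation_top[of "1 - gap n" "1 - gap n"] g[of n] by (simp add: Y_def top_size_def power_add)
    also have "\<dots> = pend_prob - (pend_prob + 1) * gap n + (gap n * h n + (1 - gap n) * q n * (h n)\<^sup>2)"
      unfolding pg by (simp add: h_def algebra_simps)
    finally have "measure_pmf.expectation GWP (\<lambda>t. (1 - gap n) ^ (inner (block t) + marks (block t))) - 1 + (1 + 1 / pend_prob) * gap n =
        (gap n * h n + (1 - gap n) * q n * (h n)\<^sup>2) / pend_prob"
      using pend_prob_pos by (simp add: field_simps)
    then show ?thesis using gap_bounds(1)[of n] by (simp add: power_divide power2_eq_square field_simps)
  qed
  ultimately have "(\<lambda>n. (measure_pmf.expectation GWP (\<lambda>t. (1 - gap n) ^ (inner (block t) + marks (block t))) - 1 + (1 + 1 / pend_prob) * gap n) / (gap n)\<^sup>2)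
      \<longlonglongrightarrow> (1 / pend_prob) * (m + (1 - 0) * (var / 2 * m\<^sup>2))" by simp
  note sm = second_moment[OF this]
  show "integrable (measure_pmf GWP) (\<lambda>t. (real (inner (block t) + marks (block t)))\<^sup>2)"
    "integrable (measure_pmf GWP) (\<lambda>t. real (inner (block t) + marks (block t)))"
    "measure_pmf.expectation GWP (\<lambda>t. real (inner (block t) + marks (block t))) = 1 + 1 / pend_prob"
    by (rule sm)+
qed

lemma block_law_moments:
  shows "integrable (measure_pmf block_law) (\<lambda>s. (real (fst s))\<^sup>2)"
    and "integrable (measure_pmf block_law) (\<lambda>s. (real (snd s))\<^sup>2)"
    and "measure_pmf.expectation block_law (\<lambda>s. real (fst s)) = 1"
    and "measure_pmf.expectation block_law (\<lambda>s. real (snd s)) = 1 / pend_prob"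
    and "measure_pmf.expectation block_law (\<lambda>s. (real (fst s) - 1)\<^sup>2) = var * root_mean\<^sup>2 / pend_prob"
proof -
  let ?Z = "\<lambda>t. real (marks (block t))" and ?X = "\<lambda>t. real (inner (block t))"
  show "integrable (measure_pmf block_law) (\<lambda>s. (real (fst s))\<^sup>2)"
    using block_marks_moments(1) by (simp add: block_law_def)
  have "integrable (measure_pmf GWP) (\<lambda>t. (?X t)\<^sup>2)"
    by (rule Bochner_Integration.integrable_bound[OF block_size_moments(1)]) (auto intro!: power_mono)
  then show "integrable (measure_pmf block_law) (\<lambda>s. (real (snd s))\<^sup>2)"
    by (simp add: block_law_def)
  show "measure_pmf.expectation block_law (\<lambda>s. real (fst s)) = 1"
    using block_marks_moments(3) by (simp add: block_law_def)
  have "measure_pmf.expectation GWP (\<lambda>t. real (inner (block t) + marks (block t)) - ?Z t) = 1 / pend_prob"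
    using block_size_moments(2,3) block_marks_moments(2,3) by (subst Bochner_Integration.integral_diff) auto
  then show "measure_pmf.expectation block_law (\<lambda>s. real (snd s)) = 1 / pend_prob"
    by (simp add: block_law_def)
  have "measure_pmf.expectation GWP (\<lambda>t. ?Z t * (?Z t - 1) - (?Z t - 1)) = var * root_mean\<^sup>2 / pend_prob"
  proof (subst Bochner_Integration.integral_diff)
    show "integrable (measure_pmf GWP) (\<lambda>t. ?Z t * (?Z t - 1))"
      using block_marks_moments(1,2) by (simp add: power2_eq_square right_diff_distrib)
  qed (use block_marks_moments(2-4) in auto)
  then show "measure_pmf.expectation block_law (\<lambda>s. (real (fst s) - 1)\<^sup>2) = var * root_mean\<^sup>2 / pend_prob"
    by (simp add: block_law_def power2_eq_square algebra_simps)
qed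

end

section \<open>Convergence of the distribution functions\<close>

text \<open>Truncation at h makes ordinary dominated convergence applicable. The excess of g over h
  is at most that of f over h, whose integral vanishes because the integrals of f converge to that
  of h.\<close>

lemma generalized_dominated_convergence:
  fixes f g :: "nat \<Rightarrow> 'a \<Rightarrow> real" and h g' :: "'a \<Rightarrow> real"
  assumes f: "\<And>n. integrable M (f n)" and h: "integrable M h"
    and g[measurable]: "\<And>n. g n \<in> borel_measurable M" "g' \<in> borel_measurable M"
    and gf: "\<And>n x. 0 \<le> g n x" "\<And>n x. g n x \<le> f n x"
    and fh: "AE x in M. (\<lambda>n. f n x) \<longlonglongrightarrow> h x" and gg: "AE x in M. (\<lambda>n. g n x) \<longlonglongrightarrow> g' x"
    and lim: "(\<lambda>n. \<integral>x. f n x \<partial>M) \<longlonglongrightarrow> (\<integral>x. h x \<partial>M)"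
  shows "(\<lambda>n. \<integral>x. g n x \<partial>M) \<longlonglongrightarrow> (\<integral>x. g' x \<partial>M)"
proof -
  have [measurable]: "\<And>n. f n \<in> borel_measurable M" "h \<in> borel_measurable M" using f h by auto
  have gi: "integrable M (g n)" for n
  proof (rule Bochner_Integration.integrable_bound[OF f[of n]])
    have "norm (g n x) \<le> norm (f n x)" for x using gf(1)[of n x] gf(2)[of n x] by simp
    then show "AE x in M. norm (g n x) \<le> norm (f n x)" by simp
  qed simp
  have h0: "AE x in M. 0 \<le> h x"
    using fh
  proof eventually_elim
    case (elim x)
    then show ?case by (rule LIMSEQ_le_const) (use order_trans[OF gf(1) gf(2)] in auto)
  qed
  have g'h: "AE x in M. min (g' x) (h x) = g' x"
    using fh gg
  proof eventually_elim
    case (elim x)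
    have "g' x \<le> h x" by (rule LIMSEQ_le[OF elim(2) elim(1)]) (use gf(2) in auto)
    then show ?case by simp
  qed
  have mi: "integrable M (\<lambda>x. min (g n x) (h x))" "integrable M (\<lambda>x. min (f n x) (h x))" for n
    using gi f h by (auto intro: integrable_min)
  have mg: "(\<lambda>n. \<integral>x. min (g n x) (h x) \<partial>M) \<longlonglongrightarrow> (\<integral>x. g' x \<partial>M)"
  proof -
    have "(\<lambda>n. \<integral>x. min (g n x) (h x) \<partial>M) \<longlonglongrightarrow> (\<integral>x. min (g' x) (h x) \<partial>M)"
    proof (rule integral_dominated_convergence[where w = h])
      show "AE x in M. (\<lambda>n. min (g n x) (h x)) \<longlonglongrightarrow> min (g' x) (h x)"
        using gg by eventually_elim (intro tendsto_intros)
      show "AE x in M. norm (min (g n x) (h x)) \<le> h x" for n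
        using h0 by eventually_elim (use gf(1)[of n] in \<open>auto simp: abs_le_iff min_def\<close>)
    qed (use h in auto)
    also have "(\<integral>x. min (g' x) (h x) \<partial>M) = (\<integral>x. g' x \<partial>M)"
      using g'h by (intro integral_cong_AE) auto
    finally show ?thesis .
  qed
  have mf: "(\<lambda>n. \<integral>x. min (f n x) (h x) \<partial>M) \<longlonglongrightarrow> (\<integral>x. h x \<partial>M)"
  proof -
    have "(\<lambda>n. \<integral>x. min (f n x) (h x) \<partial>M) \<longlonglongrightarrow> (\<integral>x. min (h x) (h x) \<partial>M)"
    proof (rule integral_dominated_convergence[where w = h])
      show "AE x in M. (\<lambda>n. min (f n x) (h x)) \<longlonglongrightarrow> min (h x) (h x)"
        using fh by eventually_elim (intro tendsto_intros)
      show "AE x in M. norm (min (f n x) (h x)) \<le> h x" for n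
        using h0 by eventually_elim (use order_trans[OF gf(1)[of n] gf(2)[of n]] in \<open>auto simp: abs_le_iff min_def\<close>)
    qed (use h in auto)
    then show ?thesis by simp
  qed
  have d0: "(\<lambda>n. (\<integral>x. f n x \<partial>M) - (\<integral>x. min (f n x) (h x) \<partial>M)) \<longlonglongrightarrow> 0"
    using tendsto_diff[OF lim mf] by simp
  have dn: "norm ((\<integral>x. g n x \<partial>M) - (\<integral>x. min (g n x) (h x) \<partial>M)) \<le> (\<integral>x. f n x \<partial>M) - (\<integral>x. min (f n x) (h x) \<partial>M)" for n
  proof -
    have "0 \<le> (\<integral>x. g n x - min (g n x) (h x) \<partial>M)"
      by (intro Bochner_Integration.integral_nonneg) auto
    moreover have "(\<integral>x. g n x - min (g n x) (h x) \<partial>M) \<le> (\<integral>x. f n x - min (f n x) (h x) \<partial>M)"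
      using gf(2) by (intro integral_mono Bochner_Integration.integrable_diff gi f mi) (smt (verit) min_def)
    ultimately show ?thesis using gi f mi by simp
  qed
  have "(\<lambda>n. (\<integral>x. g n x \<partial>M) - (\<integral>x. min (g n x) (h x) \<partial>M)) \<longlonglongrightarrow> 0"
    by (rule Lim_null_comparison[OF always_eventually d0]) (use dn in auto)
  from tendsto_add[OF this mg] show ?thesis by simp
qed

text \<open>Spreads point masses on the integers into a step function of u: each integer occupies a
  cell of width 1/r, so integrating over u recovers the total mass divided by r.\<close>

lemma floor_density:
  fixes M :: "'a::countable pmf" and N :: "'a \<Rightarrow> nat" and a r :: real
  assumes r: "r > 0"
  shows "(\<lambda>u. measure (measure_pmf M) {x \<in> A. int (N x) = \<lfloor>a + u * r\<rfloor>}) \<in> borel_measurable borel"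
    and "integrable lborel (\<lambda>u. measure (measure_pmf M) {x \<in> A. int (N x) = \<lfloor>a + u * r\<rfloor>})"
    and "(\<integral>u. measure (measure_pmf M) {x \<in> A. int (N x) = \<lfloor>a + u * r\<rfloor>} \<partial>lborel) = measure (measure_pmf M) A / r"
proof -
  let ?f = "\<lambda>u. measure (measure_pmf M) {x \<in> A. int (N x) = \<lfloor>a + u * r\<rfloor>}"
  interpret pair_sigma_finite "measure_pmf M" "lborel :: real measure" ..
  have "(\<lambda>u. \<lfloor>a + u * r\<rfloor>) \<in> measurable borel (count_space UNIV)" by measurable
  from measurable_compose[OF this, of "\<lambda>m. measure (measure_pmf M) {x \<in> A. int (N x) = m}"]
  show meas: "?f \<in> borel_measurable borel" by simp
  have cell: "int k = \<lfloor>a + u * r\<rfloor> \<longleftrightarrow> u \<in> {(real k - a) / r ..< (real k + 1 - a) / r}" for k u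
    unfolding eq_commute[of "int k"] floor_eq_iff using r by (auto simp: field_simps)
  have ind: "(indicator {x \<in> A. int (N x) = \<lfloor>a + u * r\<rfloor>} x :: ennreal) =
      indicator A x * indicator {(real (N x) - a) / r ..< (real (N x) + 1 - a) / r} u" for x u
    using cell[of "N x" u] by (cases "x \<in> A") (simp_all add: indicator_def)
  have "(\<integral>\<^sup>+u. ennreal (?f u) \<partial>lborel) = (\<integral>\<^sup>+u. \<integral>\<^sup>+x. indicator {x \<in> A. int (N x) = \<lfloor>a + u * r\<rfloor>} x \<partial>measure_pmf M \<partial>lborel)"
    by (simp add: measure_pmf.emeasure_eq_measure)
  also have "\<dots> = (\<integral>\<^sup>+x. \<integral>\<^sup>+u. indicator {x \<in> A. int (N x) = \<lfloor>a + u * r\<rfloor>} x \<partial>lborel \<partial>measure_pmf M)"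
  proof (rule Fubini')
    have cs: "measurable (measure_pmf M \<Otimes>\<^sub>M (lborel :: real measure)) (borel :: ennreal measure) =
        measurable (count_space UNIV \<Otimes>\<^sub>M lborel) borel"
      by (rule measurable_cong_sets) (auto intro!: sets_pair_measure_cong)
    show "(\<lambda>(x, u). indicator {x \<in> A. int (N x) = \<lfloor>a + u * r\<rfloor>} x :: ennreal) \<in> borel_measurable (measure_pmf M \<Otimes>\<^sub>M lborel)"
      unfolding cs
    proof (rule measurable_pair_measure_countable1)
      fix x :: 'a
      show "(\<lambda>u. (\<lambda>(x, u). indicator {x \<in> A. int (N x) = \<lfloor>a + u * r\<rfloor>} x :: ennreal) (x, u)) \<in> borel_measurable lborel"
        by (simp only: prod.case ind) measurable
    qed simp
  qed
  also have "\<dots> = (\<integral>\<^sup>+x. ennreal (1 / r) * indicator A x \<partial>measure_pmf M)"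
  proof (rule nn_integral_cong)
    fix x
    have "(\<integral>\<^sup>+u. indicator {x \<in> A. int (N x) = \<lfloor>a + u * r\<rfloor>} x \<partial>lborel) =
        (\<integral>\<^sup>+u. indicator A x * indicator {(real (N x) - a) / r ..< (real (N x) + 1 - a) / r} u \<partial>lborel)"
      by (simp only: ind)
    also have "\<dots> = indicator A x * ennreal ((real (N x) + 1 - a) / r - (real (N x) - a) / r)"
      using r by (subst nn_integral_cmult_indicator) (auto simp: divide_right_mono)
    also have "(real (N x) + 1 - a) / r - (real (N x) - a) / r = 1 / r"
      using r by (simp add: field_simps)
    finally show "(\<integral>\<^sup>+u. indicator {x \<in> A. int (N x) = \<lfloor>a + u * r\<rfloor>} x \<partial>lborel) = ennreal (1 / r) * indicator A x"
      by (simp add: mult.commute)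
  qed
  also have "\<dots> = ennreal (1 / r) * emeasure (measure_pmf M) A"
    by (subst nn_integral_cmult) auto
  also have "\<dots> = ennreal (measure (measure_pmf M) A / r)"
    using r by (simp add: measure_pmf.emeasure_eq_measure ennreal_mult[symmetric])
  finally have nn: "(\<integral>\<^sup>+u. ennreal (?f u) \<partial>lborel) = ennreal (measure (measure_pmf M) A / r)" .
  show "integrable lborel ?f"
    using meas nn by (intro integrableI_nonneg) (auto simp: top.not_eq_extremum)
  show "(\<integral>u. ?f u \<partial>lborel) = measure (measure_pmf M) A / r"
    using meas nn r by (subst integral_eq_nn_integral) auto
qed

section \<open>Support and local limit of the block law\<close>

context critical_offspring
begin

lemma aperiodic_set: "Gcd (set_pmf \<xi>) = 1"
proof -
  have "set_pmf \<xi> = {i. pmf \<xi> i > 0}" by (auto simp: set_pmf_iff order.strict_iff_order)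
  then show ?thesis using aperiodic by simp
qed

lemma top_leaf: "top leaf = Skel []"
  by (simp add: combine_def)

lemma top_star: "j > 0 \<Longrightarrow> top (Node (replicate j leaf)) = Mark"
  using label_star[of j] by (simp add: top_eq)

lemma in_block_law: "t \<in> set_pmf GWP \<Longrightarrow> (marks (block t), inner (block t)) \<in> set_pmf block_law"
  unfolding block_law_def set_map_pmf by (rule imageI)

lemma block_law_star:
  assumes "j \<in> set_pmf \<xi>" "j > 0"
  shows "(0, j + 1) \<in> set_pmf block_law"
proof -
  let ?t = "Node (replicate j leaf)"
  have "?t \<in> set_pmf GWP" using assms star_in_GW label_star by (simp add: set_GWP)
  moreover have "(marks (block ?t), inner (block ?t)) = (0, j + 1)"
    by (simp add: block_def top_leaf sum_list_replicate del: top.simps)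
  ultimately show ?thesis using in_block_law by metis
qed

text \<open>The root of \<open>t\<close> has j - 1 leaves and one child \<open>q\<close>, whose
  children are \<open>a\<close> stars and k - a leaves. The stars are \<open>Pend\<close> and become
  the exits; they make \<open>q\<close> \<open>Matched\<close>, and at least one \<open>Bare\<close>
  leaf makes the root \<open>Pend\<close>. These points and \<open>block_law_star\<close> are what
  \<open>lattice_walk_nat_prod\<close> asks for.\<close>

lemma block_law_support:
  assumes j: "j \<in> set_pmf \<xi>" "j \<ge> 2" and k: "k \<in> set_pmf \<xi>" and a: "1 \<le> a" "a \<le> k"
  shows "(a, j + k + 1 - a) \<in> set_pmf block_law"
proof -
  define q where "q = Node (replicate a (Node (replicate j leaf)) @ replicate (k - a) leaf)"
  define t where "t = Node (q # replicate (j - 1) leaf)"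
  have q_in: "q \<in> set_pmf GW"
    unfolding q_def in_set_GW_iff using k a star_in_GW[OF j(1)] leaf_in_GW by auto
  have t_in: "t \<in> set_pmf GW"
    unfolding t_def in_set_GW_iff using j q_in leaf_in_GW by auto
  have lq: "label q = Matched"
    using a j label_star[of j] by (simp add: q_def combine_def set_replicate_conv_if del: label.simps(1)) (simp add: combine_def)
  have lt: "label t = Pend"
    using lq j unfolding t_def by (simp add: combine_def set_replicate_conv_if)
  have tq: "top q = Skel (replicate a Mark @ replicate (k - a) (Skel []))"
    using lq top_star[of j] top_leaf j by (simp add: top_eq[of q] del: top.simps) (simp add: q_def block_def del: top.simps)
  have "block t = Skel (top q # replicate (j - 1) (Skel []))"
    using top_leaf by (simp add: t_def block_def del: top.simps)
  then have "(marks (block t), inner (block t)) = (a, j + k + 1 - a)"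
    using tq j a by (simp add: sum_list_replicate)
  moreover have "t \<in> set_pmf GWP" using t_in lt by (simp add: set_GWP)
  ultimately show ?thesis using in_block_law by metis
qed

lemma lattice_walk_block_law: "\<exists>c. lattice_walk block_law ph2 box2 (4 * pi\<^sup>2) c"
proof -
  obtain j where j: "j \<ge> 2" "pmf \<xi> j > 0" using ex_branching by blast
  then have jS: "j \<in> set_pmf \<xi>" by (simp add: set_pmf_iff)
  show ?thesis
    by (rule lattice_walk_nat_prod[OF block_law_moments(1,2) j(1) jS aperiodic_set])
       (use block_law_star[OF jS] block_law_support[OF jS] j in auto)
qed

lemma block_walk_bound: "\<exists>C. \<forall>k y. real k * pmf (walk block_law k) y \<le> C"
proof -
  obtain c where "lattice_walk block_law ph2 box2 (4 * pi\<^sup>2) c" using lattice_walk_block_law by blast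
  then interpret lattice_walk block_law ph2 box2 "4 * pi\<^sup>2" c .
  let ?C = "(\<integral>t. exp (- (c * (norm (t :: real \<times> real))\<^sup>2)) \<partial>lborel) / (4 * pi\<^sup>2)"
  have "real k * pmf (walk block_law k) y \<le> max 0 ?C" for k y
  proof (cases "k = 0")
    case False
    then have "real k * pmf (walk block_law k) y \<le> ?C"
      using walk_bound[of k y] by (simp add: field_simps)
    then show ?thesis by simp
  qed simp
  then show ?thesis by blast
qed

definition block_var :: real where
  "block_var = var * root_mean\<^sup>2 / pend_prob"

lemma block_local_limit:
  "\<exists>s>0. \<forall>K a b w. (\<forall>n. K n > 0) \<longrightarrow> filterlim K at_top sequentially \<longrightarrow>
     (\<lambda>n. (real (K n) - real (a n)) / sqrt (real (K n))) \<longlonglongrightarrow> 0 \<longrightarrow>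
     (\<lambda>n. (real (K n) / pend_prob - real (b n)) / sqrt (real (K n))) \<longlonglongrightarrow> w \<longrightarrow>
     (\<lambda>n. real (K n) * pmf (walk block_law (K n)) (a n, b n)) \<longlonglongrightarrow> 1 / sqrt (2 * pi * block_var) * normal_density 0 s w"
proof -
  obtain c where "lattice_walk block_law ph2 box2 (4 * pi\<^sup>2) c" using lattice_walk_block_law by blast
  from local_limit_nat_prod(2)[OF this] show ?thesis
    unfolding block_law_moments(3,4) block_law_moments(5)[folded block_var_def] by simp
qed

end

lemma normal_density_scale:
  assumes "s > 0" "c > 0"
  shows "normal_density 0 s (u / c) = c * normal_density 0 (s * c) u"
  using assms by (simp add: normal_density_def real_sqrt_mult power_mult_distrib power_divide mult_ac)

section \<open>Joint local limit of the size and the number of \<open>Pend\<close> vertices\<close>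

context critical_offspring
begin

lemma centred_walk: "\<exists>c. centred_walk_nat \<xi> c"
proof -
  obtain c where "lattice_walk \<xi> (\<lambda>t s. t * real s) {-pi..pi} (2 * pi) c"
    using lattice_walk_nat[OF zero aperiodic finite_variance] by blast
  then have "centred_walk_nat \<xi> c"
    by (simp add: centred_walk_nat_def centred_walk_nat_axioms_def mean)
  then show ?thesis ..
qed

lemma size_prob_tendsto:
  "(\<lambda>n. real n * sqrt (real n) * size_prob n) \<longlonglongrightarrow> 1 / sqrt (2 * pi * var)"
proof -
  obtain c where "centred_walk_nat \<xi> c" using centred_walk by blast
  then interpret centred_walk_nat \<xi> c .
  have v: "v = var" by (simp add: v_def var_def)
  have eq: "sqrt (real (Suc n)) * pmf (walk \<xi> (Suc n)) n = real (Suc n) * sqrt (real (Suc n)) * size_prob (Suc n)" for n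
    using size_prob_eq[of "Suc n"] by (simp del: of_nat_Suc walk.simps add: mult_ac)
  have "(\<lambda>n. real (Suc n) * sqrt (real (Suc n)) * size_prob (Suc n)) \<longlonglongrightarrow> 1 / sqrt (2 * pi * var)"
    using local_limit_pred unfolding eq v .
  then show ?thesis by (rule LIMSEQ_imp_Suc)
qed

text \<open>The integer part of a point at u standard units from \<open>pend_prob\<close> n. The
  \<open>max\<close> with 1 makes the value positive for every n, as the exact formulas divide by
  it.\<close>

definition index :: "real \<Rightarrow> nat \<Rightarrow> nat" where
  "index u n = max 1 (nat \<lfloor>pend_prob * real n + u * sqrt (real n)\<rfloor>)"

lemma scale_at_top: "filterlim (\<lambda>n. pend_prob * real n + u * sqrt (real n)) at_top sequentially"
  using pend_prob_pos by real_asymp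

lemma index_close:
  "\<forall>\<^sub>F n in sequentially. int (index u n) = \<lfloor>pend_prob * real n + u * sqrt (real n)\<rfloor> \<and>
     \<bar>real (index u n) - (pend_prob * real n + u * sqrt (real n))\<bar> \<le> 1"
proof -
  have "\<forall>\<^sub>F n in sequentially. 1 \<le> pend_prob * real n + u * sqrt (real n)"
    using scale_at_top by (simp add: filterlim_at_top)
  then show ?thesis
  proof eventually_elim
    case (elim n)
    then have "1 \<le> \<lfloor>pend_prob * real n + u * sqrt (real n)\<rfloor>" by (simp add: le_floor_iff)
    then have eq: "int (index u n) = \<lfloor>pend_prob * real n + u * sqrt (real n)\<rfloor>"
    proof -
      have "int (max 1 (nat m)) = m" if "1 \<le> m" for m using that by simp
      then show ?thesis unfolding index_def using \<open>1 \<le> \<lfloor>_\<rfloor>\<close> by blast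
    qed
    then have "real (index u n) = of_int \<lfloor>pend_prob * real n + u * sqrt (real n)\<rfloor>"
      by (metis of_int_of_nat_eq)
    then show ?case using eq by linarith
  qed
qed

lemma index_pos: "index u n > 0"
  by (simp add: index_def)

lemma index_at_top: "filterlim (\<lambda>n. real (index u n)) at_top sequentially"
proof (rule filterlim_at_top_mono)
  show "filterlim (\<lambda>n. (pend_prob * real n + u * sqrt (real n)) + (- 1)) at_top sequentially"
    using pend_prob_pos by real_asymp
  show "\<forall>\<^sub>F n in sequentially. pend_prob * real n + u * sqrt (real n) + - 1 \<le> real (index u n)"
    using index_close[of u] by eventually_elim linarith
qed

lemma index_at_top_nat: "filterlim (index u) at_top sequentially"
  using index_at_top[of u] by (simp add: filterlim_at_top) (metis (mono_tags, lifting) eventually_mono of_nat_le_iff)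

lemma index_ratio: "(\<lambda>n. real n / real (index u n)) \<longlonglongrightarrow> 1 / pend_prob"
proof -
  have "(\<lambda>n. real (index u n) / real n - (pend_prob * real n + u * sqrt (real n)) / real n) \<longlonglongrightarrow> 0"
  proof (rule Lim_null_comparison)
    show "\<forall>\<^sub>F n in sequentially. norm (real (index u n) / real n - (pend_prob * real n + u * sqrt (real n)) / real n) \<le> 1 / real n"
      using index_close[of u]
    proof eventually_elim
      case (elim n)
      then show ?case by (simp add: diff_divide_distrib[symmetric] divide_right_mono del: diff_divide_distrib)
    qed
    show "(\<lambda>n. 1 / real n) \<longlonglongrightarrow> 0" by real_asymp
  qed
  moreover have "(\<lambda>n. (pend_prob * real n + u * sqrt (real n)) / real n) \<longlonglongrightarrow> pend_prob" by real_asymp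
  ultimately have "(\<lambda>n. real (index u n) / real n) \<longlonglongrightarrow> pend_prob"
    by (rule Lim_transform[rotated])
  then have "(\<lambda>n. 1 / (real (index u n) / real n)) \<longlonglongrightarrow> 1 / pend_prob"
    using pend_prob_pos by (intro tendsto_intros) auto
  then show ?thesis by simp
qed

text \<open>With K about \<open>pend_prob\<close> n + u \<surd>n, the numerator is about u \<surd>n
  / \<open>pend_prob\<close> and the root of K about \<surd>(\<open>pend_prob\<close> n). Rounding
  and the fixed shift x contribute only O(1) to the numerator.\<close>

lemma index_deviation:
  "(\<lambda>n. (real (index u n) / pend_prob - real (n - x)) / sqrt (real (index u n))) \<longlonglongrightarrow> u / (pend_prob * sqrt pend_prob)"
proof -
  let ?K = "\<lambda>n. real (index u n)" and ?k = "\<lambda>n. pend_prob * real n + u * sqrt (real n)"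
  have rt: "filterlim (\<lambda>n. sqrt (?K n)) at_top sequentially"
    by (rule filterlim_compose[OF sqrt_at_top index_at_top])
  have 1: "(\<lambda>n. ((?K n - ?k n) / pend_prob + real x) / sqrt (?K n)) \<longlonglongrightarrow> 0"
  proof (rule Lim_null_comparison)
    show "\<forall>\<^sub>F n in sequentially. norm (((?K n - ?k n) / pend_prob + real x) / sqrt (?K n)) \<le> (1 / pend_prob + real x) / sqrt (?K n)"
      using index_close[of u]
    proof eventually_elim
      case (elim n)
      have "\<bar>(?K n - ?k n) / pend_prob\<bar> \<le> 1 / pend_prob"
        using elim pend_prob_pos by (simp add: abs_divide divide_right_mono)
      then have "\<bar>(?K n - ?k n) / pend_prob + real x\<bar> \<le> 1 / pend_prob + real x" by linarith
      then show ?case by (simp add: abs_divide divide_right_mono)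
    qed
    show "(\<lambda>n. (1 / pend_prob + real x) / sqrt (?K n)) \<longlonglongrightarrow> 0"
      by (rule tendsto_divide_0[OF tendsto_const filterlim_at_top_imp_at_infinity[OF rt]])
  qed
  have 2: "(\<lambda>n. u / pend_prob * sqrt (real n / ?K n)) \<longlonglongrightarrow> u / pend_prob * sqrt (1 / pend_prob)"
    by (intro tendsto_intros index_ratio)
  have "(\<lambda>n. ((?K n - ?k n) / pend_prob + real x) / sqrt (?K n) + u / pend_prob * sqrt (real n / ?K n)) \<longlonglongrightarrow>
      0 + u / pend_prob * sqrt (1 / pend_prob)"
    by (rule tendsto_add[OF 1 2])
  moreover have "\<forall>\<^sub>F n in sequentially. ((?K n - ?k n) / pend_prob + real x) / sqrt (?K n) + u / pend_prob * sqrt (real n / ?K n) =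
      (?K n / pend_prob - real (n - x)) / sqrt (?K n)"
    using eventually_ge_at_top[of x]
  proof eventually_elim
    case (elim n)
    have E: "(?K n - ?k n) / pend_prob + real x + u / pend_prob * sqrt (real n) = ?K n / pend_prob - real (n - x)"
      using elim pend_prob_pos by (simp add: of_nat_diff field_simps)
    have "((?K n - ?k n) / pend_prob + real x) / sqrt (?K n) + u / pend_prob * sqrt (real n / ?K n) =
        ((?K n - ?k n) / pend_prob + real x + u / pend_prob * sqrt (real n)) / sqrt (?K n)"
      by (simp only: real_sqrt_divide add_divide_distrib times_divide_eq_right)
    then show ?case by (simp only: E)
  qed
  ultimately show ?thesis
    using pend_prob_pos by (subst (asm) tendsto_cong) (simp_all add: real_sqrt_divide)
qed

lemma index_shift: "(\<lambda>n. (real (index u n) - real (index u n - z)) / sqrt (real (index u n))) \<longlonglongrightarrow> 0"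
proof (rule Lim_null_comparison)
  show "\<forall>\<^sub>F n in sequentially. norm ((real (index u n) - real (index u n - z)) / sqrt (real (index u n))) \<le> real z / sqrt (real (index u n))"
    by (intro always_eventually allI) (simp add: abs_divide divide_right_mono)
  show "(\<lambda>n. real z / sqrt (real (index u n))) \<longlonglongrightarrow> 0"
    by (rule tendsto_divide_0[OF tendsto_const filterlim_at_top_imp_at_infinity[OF filterlim_compose[OF sqrt_at_top index_at_top]]])
qed

text \<open>Averaging the walk estimate over the part above the topmost \<open>Pend\<close> vertices
  brings in its mean number of cuts, \<open>root_mean\<close>. A \<open>Pend\<close> root means a
  single block tree and no such average, hence the factor \<open>pend_prob\<close> /
  \<open>root_mean\<close> in the second limit.\<close>

lemma local_limits:
  "\<exists>s>0. \<forall>u. (\<lambda>n. (real n)\<^sup>2 * joint_prob n (index u n)) \<longlonglongrightarrow> 1 / sqrt (2 * pi * var) * normal_density 0 s u \<and>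
    (\<lambda>n. (real n)\<^sup>2 * pend_joint_prob n (index u n)) \<longlonglongrightarrow>
      pend_prob / root_mean * (1 / sqrt (2 * pi * var) * normal_density 0 s u)"
proof -
  obtain s where s: "s > 0" and lim: "\<And>K a b w. (\<forall>n. K n > 0) \<Longrightarrow> filterlim K at_top sequentially \<Longrightarrow>
     (\<lambda>n. (real (K n) - real (a n)) / sqrt (real (K n))) \<longlonglongrightarrow> 0 \<Longrightarrow>
     (\<lambda>n. (real (K n) / pend_prob - real (b n)) / sqrt (real (K n))) \<longlonglongrightarrow> w \<Longrightarrow>
     (\<lambda>n. real (K n) * pmf (walk block_law (K n)) (a n, b n)) \<longlonglongrightarrow> 1 / sqrt (2 * pi * block_var) * normal_density 0 s w"
    using block_local_limit by blast
  define c where "c = pend_prob * sqrt pend_prob"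
  have c: "c > 0" using pend_prob_pos by (simp add: c_def)
  \<comment> \<open>\<open>block_var\<close> contains \<open>root_mean\<close> squared, so
    \<open>root_mean\<close> cancels. The limit has total mass 1/\<surd>(2 \<pi> var), exactly the
    constant of \<open>size_prob_tendsto\<close>; the passage to integrals rests on this
    match.\<close>
  have const: "root_mean / pend_prob\<^sup>2 * (1 / sqrt (2 * pi * block_var) * normal_density 0 s (u / c)) =
      1 / sqrt (2 * pi * var) * normal_density 0 (s * c) u" for u
  proof -
    have "sqrt (2 * pi * block_var) = sqrt (2 * pi * var) * root_mean / sqrt pend_prob"
      using root_mean_pos by (simp add: block_var_def real_sqrt_mult real_sqrt_divide)
    then have A: "root_mean / pend_prob\<^sup>2 * (1 / sqrt (2 * pi * block_var) * (c * x)) =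
        root_mean / pend_prob\<^sup>2 * (1 / (sqrt (2 * pi * var) * root_mean / sqrt pend_prob) * (c * x))" for x
      by (simp only:)
    have B: "r / p\<^sup>2 * (1 / (w * r / q) * (p * q * x)) = 1 / w * x"
      if "r > 0" "w > 0" "q > 0" "p = q * q" for r p w q x :: real
      using that by (simp add: power2_eq_square field_simps)
    show ?thesis
      unfolding normal_density_scale[OF s c] A unfolding c_def
      by (rule B) (use root_mean_pos pend_prob_pos var_pos in auto)
  qed
  show ?thesis
  proof (intro exI[of _ "s * c"] conjI allI)
    fix u
    let ?K = "index u"
    let ?phi = "1 / sqrt (2 * pi * block_var) * normal_density 0 s (u / c)"
    have walk_lim: "(\<lambda>n. real (?K n) * pmf (walk block_law (?K n)) (?K n - z, n - x)) \<longlonglongrightarrow> ?phi" for z x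
      by (rule lim) (use index_pos index_at_top_nat index_shift index_deviation[of u x] in \<open>auto simp: c_def\<close>)
    have sq: "(\<lambda>n. (real n / real (?K n))\<^sup>2) \<longlonglongrightarrow> (1 / pend_prob)\<^sup>2"
      by (intro tendsto_intros index_ratio)
    obtain D where D: "\<And>n. norm ((real n / real (?K n))\<^sup>2) \<le> D"
      using convergent_imp_Bseq[OF convergentI[OF sq]] unfolding Bseq_def by blast
    obtain C where C: "\<And>k y. real k * pmf (walk block_law k) y \<le> C" using block_walk_bound by blast
    let ?F = "\<lambda>n y. (real n / real (?K n))\<^sup>2 * real (fst y) * (real (?K n) * pmf (walk block_law (?K n)) (?K n - fst y, n - snd y)) *
        of_bool (snd y \<le> n \<and> fst y \<le> ?K n)"
    have eq: "(real n)\<^sup>2 * joint_prob n (?K n) = measure_pmf.expectation root_law (?F n)" for n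
      unfolding joint_prob_eq[OF index_pos] integral_mult_right_zero[symmetric]
      using index_pos[of u n] by (intro Bochner_Integration.integral_cong) (auto simp: power2_eq_square split: prod.splits)
    have "(\<lambda>n. measure_pmf.expectation root_law (?F n)) \<longlonglongrightarrow>
        measure_pmf.expectation root_law (\<lambda>y. (1 / pend_prob)\<^sup>2 * real (fst y) * ?phi)"
    \<comment> \<open>D bounds the ratio n^2/K^2 and C comes from the uniform bound on the block
      walk; the finite mean of the number of cuts makes the majorant integrable.\<close>
    proof (rule integral_dominated_convergence[where w = "\<lambda>y. D * real (fst y) * C"])
      show "integrable (measure_pmf root_law) (\<lambda>y. D * real (fst y) * C)"
        using integrable_marks_top by (simp add: root_law_def)
      show "AE y in measure_pmf root_law. norm (?F n y) \<le> D * real (fst y) * C" for n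
      proof (rule AE_I2)
        fix y
        have D0: "D \<ge> 0" using order_trans[OF norm_ge_zero D] .
        have C0: "C \<ge> 0" using C[of 0] by simp
        have "norm (?F n y) \<le> \<bar>(real n / real (?K n))\<^sup>2\<bar> * real (fst y) * (real (?K n) * pmf (walk block_law (?K n)) (?K n - fst y, n - snd y)) * 1"
          unfolding real_norm_def abs_mult by (intro mult_mono) auto
        also have "\<dots> \<le> D * real (fst y) * C * 1"
          using D[of n] C D0 C0 by (intro mult_mono) auto
        finally show "norm (?F n y) \<le> D * real (fst y) * C" by simp
      qed
      show "AE y in measure_pmf root_law. (\<lambda>n. ?F n y) \<longlonglongrightarrow> (1 / pend_prob)\<^sup>2 * real (fst y) * ?phi"
      proof (rule AE_I2)
        fix y :: "nat \<times> nat"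
        have "\<forall>\<^sub>F n in sequentially. snd y \<le> n \<and> fst y \<le> ?K n"
          using eventually_ge_at_top[of "snd y"] index_at_top_nat[of u] by (auto simp: filterlim_at_top intro: eventually_conj)
        then have "\<forall>\<^sub>F n in sequentially. (real n / real (?K n))\<^sup>2 * real (fst y) * (real (?K n) * pmf (walk block_law (?K n)) (?K n - fst y, n - snd y)) = ?F n y"
          by eventually_elim simp
        moreover have "(\<lambda>n. (real n / real (?K n))\<^sup>2 * real (fst y) * (real (?K n) * pmf (walk block_law (?K n)) (?K n - fst y, n - snd y)))
            \<longlonglongrightarrow> (1 / pend_prob)\<^sup>2 * real (fst y) * ?phi"
          by (intro tendsto_mult sq walk_lim tendsto_const)
        ultimately show "(\<lambda>n. ?F n y) \<longlonglongrightarrow> (1 / pend_prob)\<^sup>2 * real (fst y) * ?phi"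
          by (rule Lim_transform_eventually[rotated])
      qed
    qed auto
    moreover have "measure_pmf.expectation root_law (\<lambda>y. (1 / pend_prob)\<^sup>2 * real (fst y) * ?phi) = root_mean / pend_prob\<^sup>2 * ?phi"
      by (simp add: root_law_def root_mean_def power_divide)
    ultimately show "(\<lambda>n. (real n)\<^sup>2 * joint_prob n (?K n)) \<longlonglongrightarrow> 1 / sqrt (2 * pi * var) * normal_density 0 (s * c) u"
      unfolding eq const[symmetric] by (simp only:)
    have "(\<lambda>n. pend_prob * ((real n / real (?K n))\<^sup>2 * (real (?K n) * pmf (walk block_law (?K n)) (?K n - 1, n - 0)))) \<longlonglongrightarrow>
        pend_prob * ((1 / pend_prob)\<^sup>2 * ?phi)"
      by (intro tendsto_mult sq walk_lim tendsto_const)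
    moreover have "pend_prob * ((real n / real (?K n))\<^sup>2 * (real (?K n) * pmf (walk block_law (?K n)) (?K n - 1, n - 0))) =
        (real n)\<^sup>2 * pend_joint_prob n (?K n)" for n
      unfolding pend_joint_prob_eq[OF index_pos] using index_pos[of u n] by (simp add: power2_eq_square)
    moreover have "pend_prob * ((1 / pend_prob)\<^sup>2 * ?phi) = pend_prob / root_mean * (1 / sqrt (2 * pi * var) * normal_density 0 (s * c) u)"
      unfolding const[symmetric] using root_mean_pos by (simp add: power_divide)
    ultimately show "(\<lambda>n. (real n)\<^sup>2 * pend_joint_prob n (?K n)) \<longlonglongrightarrow>
        pend_prob / root_mean * (1 / sqrt (2 * pi * var) * normal_density 0 (s * c) u)" by simp
  qed (use s c in simp)
qed

text \<open>n^2 is n^(3/2) times \<surd>n: the first factor compensates P(|T| = n), the second is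
  the number of integers per unit of u.\<close>

definition dens :: "tree set \<Rightarrow> nat \<Rightarrow> real \<Rightarrow> real" where
  "dens A n u = (real n)\<^sup>2 * measure (measure_pmf GW)
     {t \<in> A \<inter> {t. nodes t = n}. int (pend_count t) = \<lfloor>pend_prob * real n + u * sqrt (real n)\<rfloor>}"

lemma dens_integral:
  shows "dens A n \<in> borel_measurable borel" "integrable lborel (dens A n)"
    and "(\<integral>u. dens A n u \<partial>lborel) = real n * sqrt (real n) * measure (measure_pmf GW) (A \<inter> {t. nodes t = n})"
proof -
  have "dens A n \<in> borel_measurable borel \<and> integrable lborel (dens A n) \<and>
    (\<integral>u. dens A n u \<partial>lborel) = real n * sqrt (real n) * measure (measure_pmf GW) (A \<inter> {t. nodes t = n})"
  proof (cases "n = 0")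
    case True
    then show ?thesis by (simp add: dens_def[abs_def])
  next
    case False
    then have r: "sqrt (real n) > 0" by simp
    note fd = floor_density[OF r, of GW "A \<inter> {t. nodes t = n}" pend_count "pend_prob * real n"]
    have sq: "(real n)\<^sup>2 / sqrt (real n) = real n * sqrt (real n)"
      using False by (simp add: power2_eq_square real_div_sqrt field_simps)
    show ?thesis
      unfolding dens_def[abs_def]
    proof (intro conjI)
      have "(real n)\<^sup>2 * (m / sqrt (real n)) = real n * sqrt (real n) * m" for m
        unfolding sq[symmetric] by simp
      then show "(\<integral>u. (real n)\<^sup>2 * measure (measure_pmf GW)
          {t \<in> A \<inter> {t. nodes t = n}. int (pend_count t) = \<lfloor>pend_prob * real n + u * sqrt (real n)\<rfloor>} \<partial>lborel) =
          real n * sqrt (real n) * measure (measure_pmf GW) (A \<inter> {t. nodes t = n})"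
        by (simp only: integral_mult_right_zero fd(3))
    qed (intro borel_measurable_times borel_measurable_const integrable_mult_right fd(1) fd(2))+
  qed
  then show "dens A n \<in> borel_measurable borel" "integrable lborel (dens A n)"
    "(\<integral>u. dens A n u \<partial>lborel) = real n * sqrt (real n) * measure (measure_pmf GW) (A \<inter> {t. nodes t = n})"
    by auto
qed

lemma dens_mono: "A \<subseteq> B \<Longrightarrow> dens A n u \<le> dens B n u"
  unfolding dens_def by (intro mult_left_mono measure_pmf.finite_measure_mono) auto

lemma dens_nonneg: "0 \<le> dens A n u"
  by (simp add: dens_def)

lemma dens_limits:
  "\<exists>s>0. \<forall>u. (\<lambda>n. dens UNIV n u) \<longlonglongrightarrow> 1 / sqrt (2 * pi * var) * normal_density 0 s u \<and>
    (\<lambda>n. dens {t. label t = Pend} n u) \<longlonglongrightarrow> pend_prob / root_mean * (1 / sqrt (2 * pi * var) * normal_density 0 s u)"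
proof -
  obtain s where s: "s > 0" and lim: "\<And>u. (\<lambda>n. (real n)\<^sup>2 * joint_prob n (index u n)) \<longlonglongrightarrow> 1 / sqrt (2 * pi * var) * normal_density 0 s u"
    "\<And>u. (\<lambda>n. (real n)\<^sup>2 * pend_joint_prob n (index u n)) \<longlonglongrightarrow>
      pend_prob / root_mean * (1 / sqrt (2 * pi * var) * normal_density 0 s u)"
    using local_limits by blast
  have ev: "\<forall>\<^sub>F n in sequentially. (real n)\<^sup>2 * joint_prob n (index u n) = dens UNIV n u"
    "\<forall>\<^sub>F n in sequentially. (real n)\<^sup>2 * pend_joint_prob n (index u n) = dens {t. label t = Pend} n u" for u
  proof -
    show "\<forall>\<^sub>F n in sequentially. (real n)\<^sup>2 * joint_prob n (index u n) = dens UNIV n u"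
      using index_close[of u]
    proof eventually_elim
      case (elim n)
      then have "\<lfloor>pend_prob * real n + u * sqrt (real n)\<rfloor> = int (index u n)" by simp
      then show ?case unfolding dens_def joint_prob_def by simp
    qed
    show "\<forall>\<^sub>F n in sequentially. (real n)\<^sup>2 * pend_joint_prob n (index u n) = dens {t. label t = Pend} n u"
      using index_close[of u]
    proof eventually_elim
      case (elim n)
      then have "\<lfloor>pend_prob * real n + u * sqrt (real n)\<rfloor> = int (index u n)" by simp
      then show ?case unfolding dens_def pend_joint_prob_def by (simp add: conj_assoc)
    qed
  qed
  show ?thesis
    using s Lim_transform_eventually[OF lim(1) ev(1)] Lim_transform_eventually[OF lim(2) ev(2)] by blast
qed

definition limit_sd :: real where
  "limit_sd = (SOME s. s > 0 \<and> (\<forall>u. (\<lambda>n. dens UNIV n u) \<longlonglongrightarrow> 1 / sqrt (2 * pi * var) * normal_density 0 s u \<and>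
    (\<lambda>n. dens {t. label t = Pend} n u) \<longlonglongrightarrow> pend_prob / root_mean * (1 / sqrt (2 * pi * var) * normal_density 0 s u)))"

lemma limit_sd:
  shows "limit_sd > 0" and "(\<lambda>n. dens UNIV n u) \<longlonglongrightarrow> 1 / sqrt (2 * pi * var) * normal_density 0 limit_sd u"
    and "(\<lambda>n. dens {t. label t = Pend} n u) \<longlonglongrightarrow> pend_prob / root_mean * (1 / sqrt (2 * pi * var) * normal_density 0 limit_sd u)"
  using someI_ex[OF dens_limits] unfolding limit_sd_def by blast+

text \<open>Any sequence of events inherits convergence of its integrated densities from the full
  event: there the integrals are known by \<open>size_prob_tendsto\<close>, so no mass can
  escape.\<close>

lemma dens_integral_tendsto:
  assumes [measurable]: "g \<in> borel_measurable borel"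
    and lim: "AE u in lborel. (\<lambda>n. dens (A n) n u) \<longlonglongrightarrow> g u"
  shows "(\<lambda>n. real n * sqrt (real n) * measure (measure_pmf GW) (A n \<inter> {t. nodes t = n})) \<longlonglongrightarrow> (\<integral>u. g u \<partial>lborel)"
  unfolding dens_integral(3)[symmetric]
proof (rule generalized_dominated_convergence[where f = "dens UNIV" and h = "\<lambda>u. 1 / sqrt (2 * pi * var) * normal_density 0 limit_sd u"])
  show "(\<lambda>n. \<integral>u. dens UNIV n u \<partial>lborel) \<longlonglongrightarrow> (\<integral>u. 1 / sqrt (2 * pi * var) * normal_density 0 limit_sd u \<partial>lborel)"
    unfolding dens_integral(3) using size_prob_tendsto limit_sd(1) by (simp add: size_prob_def)
  show "AE u in lborel. (\<lambda>n. dens UNIV n u) \<longlonglongrightarrow> 1 / sqrt (2 * pi * var) * normal_density 0 limit_sd u"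
    by (intro AE_I2 limit_sd)
qed (use dens_integral(1,2) dens_mono dens_nonneg lim limit_sd(1) in auto)

text \<open>The limit carries the same Gaussian as the full density up to the factor
  \<open>pend_prob\<close> / \<open>root_mean\<close>, so integration leaves this ratio. It will
  tune the comparison of convolutions for the mean.\<close>

lemma pend_size_prob_tendsto:
  "(\<lambda>n. real n * sqrt (real n) * pend_size_prob n) \<longlonglongrightarrow> pend_prob / root_mean * (1 / sqrt (2 * pi * var))"
proof -
  have "(\<lambda>n. real n * sqrt (real n) * measure (measure_pmf GW) ({t. label t = Pend} \<inter> {t. nodes t = n})) \<longlonglongrightarrow>
      (\<integral>u. pend_prob / root_mean * (1 / sqrt (2 * pi * var) * normal_density 0 limit_sd u) \<partial>lborel)"
    by (rule dens_integral_tendsto) (use limit_sd(3) in auto)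
  then show ?thesis using limit_sd(1) by (simp add: pend_size_prob_def Int_def)
qed

text \<open>For fixed u other than x the bound on the event is eventually satisfied, or eventually
  violated, by all trees in the cell of u, because the root correction is at most 1 while |x - u|
  \<surd>n grows.\<close>

lemma cdf_tendsto:
  "(\<lambda>n. real n * sqrt (real n) * measure (measure_pmf GW)
      ({t. real (pend_count t + of_bool (label t = Bare)) \<le> pend_prob * real n + x * sqrt (real n)} \<inter> {t. nodes t = n})) \<longlonglongrightarrow>
    1 / sqrt (2 * pi * var) * (\<integral>u. indicator {..x} u * normal_density 0 limit_sd u \<partial>lborel)"
proof -
  let ?A = "\<lambda>n. {t. real (pend_count t + of_bool (label t = Bare)) \<le> pend_prob * real n + x * sqrt (real n)}"
  let ?g = "\<lambda>u. indicator {..x} u * (1 / sqrt (2 * pi * var) * normal_density 0 limit_sd u)"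
  \<comment> \<open>At u = x rounding and the root correction decide, but a single point is a null
    set.\<close>
  have "AE u in lborel. u \<noteq> x" by (rule AE_lborel_singleton)
  then have "AE u in lborel. (\<lambda>n. dens (?A n) n u) \<longlonglongrightarrow> ?g u"
  proof eventually_elim
    case (elim u)
    show ?case
    proof (cases "u < x")
      case True
      then have "\<forall>\<^sub>F n in sequentially. 1 \<le> (x - u) * sqrt (real n)"
      proof -
        have "filterlim (\<lambda>n. (x - u) * sqrt (real n)) at_top sequentially" using True by real_asymp
        then show ?thesis by (simp add: filterlim_at_top)
      qed
      then have "\<forall>\<^sub>F n in sequentially. dens UNIV n u = dens (?A n) n u"
      proof eventually_elim
        case (elim n)
        have "t \<in> ?A n" if "int (pend_count t) = \<lfloor>pend_prob * real n + u * sqrt (real n)\<rfloor>" for t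
        proof -
          have "real (pend_count t) \<le> pend_prob * real n + u * sqrt (real n)"
            using that by (metis of_int_floor_le of_int_of_nat_eq)
          moreover have "real (of_bool (label t = Bare)) \<le> 1" by simp
          ultimately show ?thesis using elim by (simp add: algebra_simps)
        qed
        then have "{t \<in> UNIV \<inter> {t. nodes t = n}. int (pend_count t) = \<lfloor>pend_prob * real n + u * sqrt (real n)\<rfloor>} =
            {t \<in> ?A n \<inter> {t. nodes t = n}. int (pend_count t) = \<lfloor>pend_prob * real n + u * sqrt (real n)\<rfloor>}" by blast
        then show ?case unfolding dens_def by (simp only:)
      qed
      from Lim_transform_eventually[OF limit_sd(2) this] show ?thesis using True by simp
    next
      case False
      then have "x < u" using elim by simp
      then have "\<forall>\<^sub>F n in sequentially. 1 \<le> (u - x) * sqrt (real n)"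
      proof -
        assume "x < u"
        then have "filterlim (\<lambda>n. (u - x) * sqrt (real n)) at_top sequentially" by real_asymp
        then show ?thesis by (simp add: filterlim_at_top)
      qed
      then have "\<forall>\<^sub>F n in sequentially. 0 = dens (?A n) n u"
      proof eventually_elim
        case (elim n)
        have "t \<notin> ?A n" if "int (pend_count t) = \<lfloor>pend_prob * real n + u * sqrt (real n)\<rfloor>" for t
        proof -
          have "real (pend_count t) = of_int \<lfloor>pend_prob * real n + u * sqrt (real n)\<rfloor>"
            using that by (metis of_int_of_nat_eq)
          then have "real (pend_count t) > pend_prob * real n + u * sqrt (real n) - 1" by linarith
          then show ?thesis using elim by (simp add: algebra_simps)
        qed
        then have "{t \<in> ?A n \<inter> {t. nodes t = n}. int (pend_count t) = \<lfloor>pend_prob * real n + u * sqrt (real n)\<rfloor>} = {}" by blast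
        then show ?case unfolding dens_def by (simp only: measure_empty mult_zero_right)
      qed
      from Lim_transform_eventually[OF tendsto_const this] show ?thesis using \<open>x < u\<close> by simp
    qed
  qed
  from dens_integral_tendsto[OF _ this]
  have "(\<lambda>n. real n * sqrt (real n) * measure (measure_pmf GW) (?A n \<inter> {t. nodes t = n})) \<longlonglongrightarrow> (\<integral>u. ?g u \<partial>lborel)"
    by simp
  also have "(\<integral>u. ?g u \<partial>lborel) = (\<integral>u. 1 / sqrt (2 * pi * var) * (indicator {..x} u * normal_density 0 limit_sd u) \<partial>lborel)"
    by (simp only: mult.left_commute)
  also have "\<dots> = 1 / sqrt (2 * pi * var) * (\<integral>u. indicator {..x} u * normal_density 0 limit_sd u \<partial>lborel)"
    by (rule integral_mult_right_zero)
  finally show ?thesis .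
qed

end

section \<open>Convolution asymptotics and the mean\<close>

lemma fps_power_nth_eq_0:
  fixes y :: "'a::comm_ring_1 fps"
  assumes "fps_nth y 0 = 0" "n < j" shows "fps_nth (y ^ j) n = 0"
  using assms by (simp add: startsby_zero_power_prefix)

lemma fps_mult_power_nth_eq_0:
  fixes y :: "'a::comm_ring_1 fps"
  assumes "fps_nth y 0 = 0" "n < j" shows "fps_nth (y ^ j * A) n = 0"
  unfolding fps_mult_nth using assms by (intro sum.neutral) (auto simp: fps_power_nth_eq_0)

text \<open>Split at an index beyond which \<eta> is small: the initial columns vanish one by one,
  the rest is controlled by the bounded row sums.\<close>

lemma toeplitz_null:
  fixes w :: "nat \<Rightarrow> nat \<Rightarrow> real"
  assumes w0: "\<And>n i. 0 \<le> w n i" and bound: "\<And>n. (\<Sum>i\<le>n. w n i) \<le> K"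
    and col: "\<And>i. (\<lambda>n. w n i) \<longlonglongrightarrow> 0" and \<eta>: "\<eta> \<longlonglongrightarrow> 0"
  shows "(\<lambda>n. \<Sum>i\<le>n. w n i * \<eta> i) \<longlonglongrightarrow> 0"
proof (rule LIMSEQ_I)
  fix e :: real assume e: "e > 0"
  define K' where "K' = max K 0 + 1"
  have K': "K' > 0" "\<And>n. (\<Sum>i\<le>n. w n i) \<le> K'"
    using bound by (auto simp: K'_def intro: order_trans[OF bound])
  obtain N where N: "\<And>i. i \<ge> N \<Longrightarrow> \<bar>\<eta> i\<bar> < e / (2 * K')"
    using LIMSEQ_D[OF \<eta>, of "e / (2 * K')"] e K' by auto
  have "(\<lambda>n. \<Sum>i<N. w n i * \<bar>\<eta> i\<bar>) \<longlonglongrightarrow> (\<Sum>i<N. 0 * \<bar>\<eta> i\<bar>)"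
    by (intro tendsto_intros col)
  then have "\<forall>\<^sub>F n in sequentially. (\<Sum>i<N. w n i * \<bar>\<eta> i\<bar>) < e / 2"
    using e by (intro order_tendstoD(2)) auto
  then obtain N' where N': "\<And>n. n \<ge> N' \<Longrightarrow> (\<Sum>i<N. w n i * \<bar>\<eta> i\<bar>) < e / 2"
    by (auto simp: eventually_sequentially)
  have "norm ((\<Sum>i\<le>n. w n i * \<eta> i) - 0) < e" if "n \<ge> max N N'" for n
  proof -
    have "\<bar>\<Sum>i\<le>n. w n i * \<eta> i\<bar> \<le> (\<Sum>i\<le>n. w n i * \<bar>\<eta> i\<bar>)"
      by (rule order_trans[OF sum_abs]) (simp add: abs_mult w0)
    also have "\<dots> = (\<Sum>i<N. w n i * \<bar>\<eta> i\<bar>) + (\<Sum>i\<in>{N..n}. w n i * \<bar>\<eta> i\<bar>)"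
      using that by (subst sum.union_disjoint[symmetric]) (auto intro!: sum.cong)
    also have "(\<Sum>i\<in>{N..n}. w n i * \<bar>\<eta> i\<bar>) \<le> (\<Sum>i\<in>{N..n}. w n i * (e / (2 * K')))"
      using N by (intro sum_mono mult_left_mono w0) (auto intro: less_imp_le)
    also have "\<dots> \<le> (\<Sum>i\<le>n. w n i * (e / (2 * K')))"
      using e K' by (intro sum_mono2) (auto simp: w0)
    also have "\<dots> = (\<Sum>i\<le>n. w n i) * (e / (2 * K'))" by (rule sum_distrib_right[symmetric])
    also have "\<dots> \<le> K' * (e / (2 * K'))" using e K' by (intro mult_right_mono) auto
    also have "\<dots> = e / 2" using K' by simp
    finally show ?thesis using N'[of n] that by simp
  qed
  then show "\<exists>no. \<forall>n\<ge>no. norm ((\<Sum>i\<le>n. w n i * \<eta> i) - 0) < e" by blast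
qed

lemma sum_inverse_sqrt_le: "(\<Sum>i=1..n. 1 / sqrt (real i)) \<le> 2 * sqrt (real n)"
proof (induction n)
  case (Suc n)
  have "1 / sqrt (real (Suc n)) \<le> 2 * sqrt (real (Suc n)) - 2 * sqrt (real n)"
  proof -
    define a where "a = sqrt (real (Suc n))"
    define b where "b = sqrt (real n)"
    have ab: "a > 0" "b \<ge> 0" "a\<^sup>2 = b\<^sup>2 + 1" by (simp_all add: a_def b_def)
    have "1 \<le> (2 * a - 2 * b) * a"
      using ab(3) zero_le_power2[of "a - b"] by (simp only: power2_diff) (simp add: power2_eq_square algebra_simps)
    then show ?thesis using ab(1) unfolding a_def[symmetric] b_def[symmetric] by (simp only: pos_divide_le_eq)
  qed
  then show ?case using Suc by simp
qed simp

text \<open>With a, b the roots of i and i + 1, 1 = (b - a)(b + a) \<le> 2 b (b - a) and b^2 \<le> 2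
  a^2; together they give the constant 4.\<close>

lemma inverse_power_3_2_telescope:
  assumes "i > 0"
  shows "1 / (real i * sqrt (real i)) \<le> 4 * (1 / sqrt (real i) - 1 / sqrt (real (Suc i)))"
proof -
  define a where "a = sqrt (real i)"
  define b where "b = sqrt (real (Suc i))"
  have ab: "a > 0" "b > 0" "b\<^sup>2 = a\<^sup>2 + 1" "real i = a\<^sup>2" using assms by (simp_all add: a_def b_def)
  have "a \<ge> 1" using assms by (simp add: a_def)
  then have a2: "a\<^sup>2 \<ge> 1" by simp
  have "a \<le> b" by (simp add: a_def b_def)
  have "1 = (b - a) * (b + a)" using ab(3) by (simp add: power2_eq_square algebra_simps)
  also have "\<dots> \<le> (b - a) * (2 * b)"
    using \<open>a \<le> b\<close> by (intro mult_left_mono) auto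
  finally have "b * 1 \<le> b * ((b - a) * (2 * b))" using ab(2) by (intro mult_left_mono) auto
  also have "\<dots> = 2 * b\<^sup>2 * (b - a)" by (simp only: power2_eq_square mult_ac)
  also have "\<dots> \<le> 4 * a\<^sup>2 * (b - a)" using ab(3) a2 \<open>a \<le> b\<close> by (intro mult_right_mono) auto
  finally have "b / (a\<^sup>2 * a * b) \<le> 4 * a\<^sup>2 * (b - a) / (a\<^sup>2 * a * b)"
    using ab by (intro divide_right_mono) auto
  also have "4 * a\<^sup>2 * (b - a) / (a\<^sup>2 * a * b) = 4 * ((b - a) / (a * b))" using ab(1) by simp
  also have "(b - a) / (a * b) = 1 / a - 1 / b" using ab(1,2) by (simp add: diff_divide_distrib)
  finally show ?thesis using ab(1,2) unfolding a_def[symmetric] b_def[symmetric] ab(4) by simp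
qed

lemma tail_sum_tendsto:
  fixes \<delta> :: "nat \<Rightarrow> real"
  assumes lim: "(\<lambda>i. real i * sqrt (real i) * \<delta> i) \<longlonglongrightarrow> 0" and sum: "summable (\<lambda>i. \<bar>\<delta> i\<bar>)"
  shows "(\<lambda>m. sqrt (real m) * (\<Sum>i. \<bar>\<delta> (i + m)\<bar>)) \<longlonglongrightarrow> 0"
proof (rule LIMSEQ_I)
  fix e :: real assume e: "e > 0"
  obtain N where N: "\<And>i. i \<ge> N \<Longrightarrow> \<bar>real i * sqrt (real i) * \<delta> i\<bar> < e / 8"
    using LIMSEQ_D[OF lim, of "e / 8"] e by auto
  have "norm (sqrt (real m) * (\<Sum>i. \<bar>\<delta> (i + m)\<bar>) - 0) < e" if m: "m \<ge> max N 1" for m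
  proof -
    let ?t = "\<lambda>i. e / 2 * (1 / sqrt (real (i + m)) - 1 / sqrt (real (Suc i + m)))"
    have le: "\<bar>\<delta> (i + m)\<bar> \<le> ?t i" for i
    proof -
      have im: "real (i + m) * sqrt (real (i + m)) > 0" using m by simp
      have "\<bar>\<delta> (i + m)\<bar> \<le> e / 8 * (1 / (real (i + m) * sqrt (real (i + m))))"
      proof -
        have "(real (i + m) * sqrt (real (i + m))) * \<bar>\<delta> (i + m)\<bar> < e / 8"
          using N[of "i + m"] m im by (simp only: abs_mult[of "real (i + m) * sqrt (real (i + m))"] abs_of_pos)
        then have "\<bar>\<delta> (i + m)\<bar> \<le> e / 8 / (real (i + m) * sqrt (real (i + m)))"
          using im by (simp only: pos_le_divide_eq mult.commute less_imp_le)
        then show ?thesis by simp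
      qed
      also have "\<dots> \<le> e / 8 * (4 * (1 / sqrt (real (i + m)) - 1 / sqrt (real (Suc (i + m)))))"
        using m e by (intro mult_left_mono inverse_power_3_2_telescope) auto
      also have "\<dots> = ?t i" by (simp only: add_Suc mult.assoc[symmetric])
      finally show ?thesis .
    qed
    have "(\<lambda>i. 1 / sqrt (real (i + m))) \<longlonglongrightarrow> 0" by real_asymp
    from telescope_sums'[OF this] have ts: "(\<lambda>i. 1 / sqrt (real (i + m)) - 1 / sqrt (real (Suc i + m))) sums (1 / sqrt (real m))"
      by simp
    then have ts': "?t sums (e / 2 * (1 / sqrt (real m)))" by (rule sums_mult)
    have "(\<Sum>i. \<bar>\<delta> (i + m)\<bar>) \<le> (\<Sum>i. ?t i)"
      using ts' by (intro suminf_le le summable_ignore_initial_segment[OF sum]) (auto simp: sums_iff)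
    also have "\<dots> = e / 2 * (1 / sqrt (real m))" using ts' by (simp add: sums_iff)
    finally have "sqrt (real m) * (\<Sum>i. \<bar>\<delta> (i + m)\<bar>) \<le> sqrt (real m) * (e / 2 * (1 / sqrt (real m)))"
      by (intro mult_left_mono) auto
    also have "\<dots> = e / 2" using m by simp
    finally have "sqrt (real m) * (\<Sum>i. \<bar>\<delta> (i + m)\<bar>) \<le> e / 2" .
    moreover have "0 \<le> sqrt (real m) * (\<Sum>i. \<bar>\<delta> (i + m)\<bar>)"
      by (intro mult_nonneg_nonneg suminf_nonneg summable_ignore_initial_segment[OF sum]) auto
    ultimately show ?thesis using e by simp
  qed
  then show "\<exists>no. \<forall>m\<ge>no. norm (sqrt (real m) * (\<Sum>i. \<bar>\<delta> (i + m)\<bar>) - 0) < e" by blast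
qed

text \<open>\<open>b\<close> will be the return probabilities, of order n^(-1/2), and \<delta> is
  o(i^(-3/2)). The mass of \<delta> sits at small indices, where b (n - i) can be replaced by b n,
  so the convolution is e n times the sum of \<delta> up to o(1/n).\<close>

lemma convolution_asymptotics:
  fixes b e \<delta> :: "nat \<Rightarrow> real"
  assumes b: "\<And>m. 0 \<le> b m" "\<And>m. m > 0 \<Longrightarrow> sqrt (real m) * b m \<le> C"
    and bd: "\<And>m. m > 0 \<Longrightarrow> \<bar>b m - b (Suc m)\<bar> \<le> C / (real m * sqrt (real m))"
    and be: "(\<lambda>n. real n * (b n - e n)) \<longlonglongrightarrow> 0"
    and e: "(\<lambda>n. sqrt (real n) * e n) \<longlonglongrightarrow> E"
    and \<delta>: "(\<lambda>i. real i * sqrt (real i) * \<delta> i) \<longlonglongrightarrow> 0" "summable (\<lambda>i. \<bar>\<delta> i\<bar>)"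
  shows "(\<lambda>n. real n * ((\<Sum>i\<le>n. b (n - i) * \<delta> i) - e n * (\<Sum>i. \<delta> i))) \<longlonglongrightarrow> 0"
proof -
  define \<eta> where "\<eta> i = real i * sqrt (real i) * \<bar>\<delta> i\<bar>" for i
  have \<eta>: "\<eta> \<longlonglongrightarrow> 0"
    using tendsto_rabs_zero[OF \<delta>(1)] by (simp add: \<eta>_def[abs_def] abs_mult)
  have \<delta>\<eta>: "\<bar>\<delta> i\<bar> = 1 / (real i * sqrt (real i)) * \<eta> i" if "i > 0" for i
    using that by (simp add: \<eta>_def)
  have C: "C \<ge> 0" using order_trans[OF _ b(2)[of 1]] b(1)[of 1] by simp
  have S: "summable \<delta>" using \<delta>(2) by (rule summable_rabs_cancel)
  \<comment> \<open>Four errors, split at n/2: freezing b at n for small i, the large indices, the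
    tail missing from the sum of \<delta>, and the exchange of b n for e n.\<close>
  define h where "h n = n div 2" for n :: nat
  define P1 where "P1 n = real n * (\<Sum>i\<le>h n. (b (n - i) - b n) * \<delta> i)" for n
  define P2 where "P2 n = real n * (\<Sum>i\<in>{h n<..n}. b (n - i) * \<delta> i)" for n
  define P3 where "P3 n = real n * e n * (\<Sum>i. \<delta> (i + Suc (h n)))" for n
  define P4 where "P4 n = real n * (b n - e n) * (\<Sum>i\<le>h n. \<delta> i)" for n
  have split: "real n * ((\<Sum>i\<le>n. b (n - i) * \<delta> i) - e n * (\<Sum>i. \<delta> i)) = P1 n + P2 n - P3 n + P4 n" for n
  proof -
    have 1: "(\<Sum>i\<le>n. b (n - i) * \<delta> i) = (\<Sum>i\<le>h n. b (n - i) * \<delta> i) + (\<Sum>i\<in>{h n<..n}. b (n - i) * \<delta> i)"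
      by (subst sum.union_disjoint[symmetric]) (auto simp: h_def intro!: sum.cong)
    have 2: "(\<Sum>i. \<delta> i) = (\<Sum>i. \<delta> (i + Suc (h n))) + (\<Sum>i\<le>h n. \<delta> i)"
      using suminf_split_initial_segment[OF S, of "Suc (h n)"] by (simp add: lessThan_Suc_atMost)
    have 3: "(\<Sum>i\<le>h n. (b (n - i) - b n) * \<delta> i) = (\<Sum>i\<le>h n. b (n - i) * \<delta> i) - b n * (\<Sum>i\<le>h n. \<delta> i)"
      by (simp add: left_diff_distrib sum_subtractf sum_distrib_left)
    show ?thesis unfolding P1_def P2_def P3_def P4_def 1 2 3 by (simp add: algebra_simps)
  qed
  have diff: "\<bar>b (m + i) - b m\<bar> \<le> real i * (C / (real m * sqrt (real m)))" if m: "m > 0" for m i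
  proof (induction i)
    case (Suc i)
    have "\<bar>b (m + i) - b (Suc (m + i))\<bar> \<le> C / (real (m + i) * sqrt (real (m + i)))" using m by (intro bd) simp
    also have "\<dots> \<le> C / (real m * sqrt (real m))"
      using m C by (intro divide_left_mono mult_mono) auto
    finally have "\<bar>b (m + Suc i) - b m\<bar> \<le> \<bar>b (m + i) - b m\<bar> + C / (real m * sqrt (real m))" by simp
    also have "\<dots> \<le> real (Suc i) * (C / (real m * sqrt (real m)))" using Suc by (simp add: algebra_simps add_divide_distrib)
    finally show ?case .
  qed simp
  have half: "1 / (real m * sqrt (real m)) \<le> 4 / (real n * sqrt (real n))" if "n > 0" "n \<le> 2 * m" for m n :: nat
  proof -
    have "real n * sqrt (real n) \<le> (2 * real m) * (2 * sqrt (real m))"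
    proof (intro mult_mono)
      have "sqrt (real n) \<le> sqrt (4 * real m)" using that by (intro real_sqrt_le_mono) linarith
      then show "sqrt (real n) \<le> 2 * sqrt (real m)" by (simp add: real_sqrt_mult)
    qed (use that in auto)
    then show ?thesis using that by (simp add: divide_simps)
  qed
  have P1: "P1 \<longlonglongrightarrow> 0"
  proof -
    \<comment> \<open>By \<open>diff\<close> and \<open>half\<close> the increment of b over i steps
      is at most 4 C i / n^(3/2). Writing |\<delta> i| as \<eta> i / i^(3/2) leaves these weights,
      whose row sums are at most 8 C.\<close>
    define w where "w n i = (if 0 < i \<and> 0 < n \<and> i \<le> n then 4 * C * (1 / sqrt (real n)) * (1 / sqrt (real i)) else 0)" for n i
    have "(\<lambda>n. \<Sum>i\<le>n. w n i * \<eta> i) \<longlonglongrightarrow> 0"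
    proof (rule toeplitz_null[OF _ _ _ \<eta>])
      show "0 \<le> w n i" for n i using C by (simp add: w_def)
      show "(\<Sum>i\<le>n. w n i) \<le> 8 * C" for n
      proof (cases "n = 0")
        case False
        have "(\<Sum>i\<le>n. w n i) = (\<Sum>i=1..n. 4 * C * (1 / sqrt (real n)) * (1 / sqrt (real i)))"
          using False by (intro sum.mono_neutral_cong_right) (auto simp: w_def)
        also have "\<dots> = 4 * C * (1 / sqrt (real n)) * (\<Sum>i=1..n. 1 / sqrt (real i))" by (simp only: sum_distrib_left)
        also have "\<dots> \<le> 4 * C * (1 / sqrt (real n)) * (2 * sqrt (real n))"
          using C by (intro mult_left_mono sum_inverse_sqrt_le) auto
        also have "\<dots> = 8 * C" using False by simp
        finally show ?thesis .
      qed (use C in \<open>simp add: w_def\<close>)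
      fix i
      show "(\<lambda>n. w n i) \<longlonglongrightarrow> 0"
      proof (rule Lim_null_comparison)
        show "\<forall>\<^sub>F n in sequentially. norm (w n i) \<le> 4 * C * (1 / sqrt (real i)) * (1 / sqrt (real n))"
          using C by (intro always_eventually allI) (auto simp: w_def abs_mult mult.commute)
        show "(\<lambda>n. 4 * C * (1 / sqrt (real i)) * (1 / sqrt (real n))) \<longlonglongrightarrow> 0" by real_asymp
      qed
    qed
    moreover have "norm (P1 n) \<le> (\<Sum>i\<le>n. w n i * \<eta> i)" for n
    proof (cases "n = 0")
      case False
      have w0: "0 \<le> w n i * \<eta> i" for i using C by (simp add: w_def \<eta>_def)
      have "norm (P1 n) \<le> real n * (\<Sum>i\<le>h n. \<bar>b (n - i) - b n\<bar> * \<bar>\<delta> i\<bar>)"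
        unfolding P1_def real_norm_def abs_mult by (simp add: sum_abs[THEN order_trans] abs_mult mult_left_mono)
      also have "\<dots> = (\<Sum>i\<le>h n. real n * (\<bar>b (n - i) - b n\<bar> * \<bar>\<delta> i\<bar>))" by (simp only: sum_distrib_left)
      also have "\<dots> \<le> (\<Sum>i\<le>h n. w n i * \<eta> i)"
      proof (intro sum_mono)
        fix i assume "i \<in> {..h n}"
        then have i: "2 * i \<le> n" by (auto simp: h_def)
        show "real n * (\<bar>b (n - i) - b n\<bar> * \<bar>\<delta> i\<bar>) \<le> w n i * \<eta> i"
        proof (cases "i = 0")
          case True
          then show ?thesis by (simp add: w_def)
        next
          case ip: False
          have m: "n - i > 0" using i False by simp
          have "\<bar>b (n - i) - b n\<bar> \<le> real i * (C / (real (n - i) * sqrt (real (n - i))))"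
            using diff[OF m, of i] i by (simp add: abs_minus_commute)
          also have "\<dots> \<le> real i * (C * (4 / (real n * sqrt (real n))))"
            using half[of n "n - i"] i False C mult_left_mono[of "1 / (real (n - i) * sqrt (real (n - i)))" "4 / (real n * sqrt (real n))" "real i * C"]
            by (simp add: mult_ac)
          finally have "real n * (\<bar>b (n - i) - b n\<bar> * \<bar>\<delta> i\<bar>) \<le>
              real n * (real i * (C * (4 / (real n * sqrt (real n)))) * \<bar>\<delta> i\<bar>)"
            by (intro mult_left_mono mult_right_mono) auto
          also have "\<dots> = w n i * \<eta> i"
            using ip False i unfolding \<delta>\<eta>[of i, OF neq0_conv[THEN iffD1, OF ip]]
            by (simp add: w_def)
          finally show ?thesis .
        qed
      qed
      also have "\<dots> \<le> (\<Sum>i\<le>n. w n i * \<eta> i)"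
        using w0 by (intro sum_mono2) (auto simp: h_def)
      finally show ?thesis .
    qed (simp add: P1_def w_def)
    ultimately show ?thesis by (rule Lim_null_comparison[OF always_eventually[OF allI], rotated])
  qed
  have P2: "P2 \<longlonglongrightarrow> 0"
  proof -
    \<comment> \<open>For i beyond n/2 the factor i^(-3/2) is at most 4 n^(-3/2), and the sum of b
      up to n is O(\<surd>n), so the rows are again bounded. Each column is eventually 0.\<close>
    define w where "w n i = (if h n < i \<and> i \<le> n then real n * b (n - i) * (1 / (real i * sqrt (real i))) else 0)" for n i
    have "(\<lambda>n. \<Sum>i\<le>n. w n i * \<eta> i) \<longlonglongrightarrow> 0"
    proof (rule toeplitz_null[OF _ _ _ \<eta>])
      show "0 \<le> w n i" for n i using b(1) by (simp add: w_def)
      show "(\<Sum>i\<le>n. w n i) \<le> 4 * (b 0 + 2 * C)" for n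
      proof (cases "n = 0")
        case False
        have s1: "sqrt (real n) \<ge> 1" using False by simp
        have "(\<Sum>i\<le>n. w n i) \<le> (\<Sum>i\<le>n. 4 / sqrt (real n) * b (n - i))"
        proof (intro sum_mono)
          fix i assume "i \<in> {..n}"
          show "w n i \<le> 4 / sqrt (real n) * b (n - i)"
          proof (cases "h n < i \<and> i \<le> n")
            case True
            then have "n \<le> 2 * i" by (auto simp: h_def)
            then have "real n * b (n - i) * (1 / (real i * sqrt (real i))) \<le> real n * b (n - i) * (4 / (real n * sqrt (real n)))"
              using half[of n i] False b(1) by (intro mult_left_mono) auto
            then show ?thesis using True False by (simp add: w_def mult_ac)
          qed (use b(1) in \<open>auto simp: w_def\<close>)
        qed
        also have "\<dots> = 4 / sqrt (real n) * (\<Sum>i\<le>n. b (n - i))" by (simp only: sum_distrib_left)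
        also have "(\<Sum>i\<le>n. b (n - i)) = (\<Sum>i\<le>n. b i)"
          by (rule sum.reindex_bij_witness[of _ "\<lambda>i. n - i" "\<lambda>i. n - i"]) auto
        also have "\<dots> = b 0 + (\<Sum>i=1..n. b i)"
          by (simp add: sum.atLeast_Suc_atMost atLeast0AtMost[symmetric])
        also have "(\<Sum>i=1..n. b i) \<le> (\<Sum>i=1..n. C * (1 / sqrt (real i)))"
          using b(2) by (intro sum_mono) (auto simp: field_simps)
        also have "\<dots> = C * (\<Sum>i=1..n. 1 / sqrt (real i))" by (simp only: sum_distrib_left)
        also have "\<dots> \<le> C * (2 * sqrt (real n))" using C by (intro mult_left_mono sum_inverse_sqrt_le)
        finally have "(\<Sum>i\<le>n. w n i) \<le> 4 / sqrt (real n) * (b 0 + C * (2 * sqrt (real n)))" using s1 by (simp add: mult_left_mono divide_right_mono)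
        also have "\<dots> = 4 * (b 0 / sqrt (real n) + 2 * C)" using False by (simp add: field_simps)
        also have "\<dots> \<le> 4 * (b 0 + 2 * C)" using divide_left_mono[OF s1 b(1)[of 0]] s1 by simp
        finally show ?thesis .
      qed (use C b(1) in \<open>simp add: w_def h_def\<close>)
      fix i
      have "\<forall>\<^sub>F n in sequentially. 0 = w n i"
        using eventually_ge_at_top[of "2 * i"] by eventually_elim (auto simp: w_def h_def)
      then show "(\<lambda>n. w n i) \<longlonglongrightarrow> 0" by (rule Lim_transform_eventually[OF tendsto_const])
    qed
    moreover have "norm (P2 n) \<le> (\<Sum>i\<le>n. w n i * \<eta> i)" for n
    proof -
      have "norm (P2 n) \<le> real n * (\<Sum>i\<in>{h n<..n}. b (n - i) * \<bar>\<delta> i\<bar>)"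
        unfolding P2_def real_norm_def abs_mult
        using b(1) by (simp add: sum_abs[THEN order_trans] abs_mult mult_left_mono)
      also have "\<dots> = (\<Sum>i\<in>{h n<..n}. w n i * \<eta> i)"
        unfolding sum_distrib_left by (intro sum.cong refl) (auto simp: w_def \<delta>\<eta>)
      also have "\<dots> \<le> (\<Sum>i\<le>n. w n i * \<eta> i)"
        using b(1) by (intro sum_mono2) (auto simp: w_def \<eta>_def)
      finally show ?thesis .
    qed
    ultimately show ?thesis by (rule Lim_null_comparison[OF always_eventually[OF allI], rotated])
  qed
  have P3: "P3 \<longlonglongrightarrow> 0"
  proof -
    obtain D where D: "\<And>n. norm (sqrt (real n) * e n) \<le> D"
      using convergent_imp_Bseq[OF convergentI[OF e]] unfolding Bseq_def by blast
    have D0: "D \<ge> 0" using order_trans[OF norm_ge_zero D] .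
    let ?t = "\<lambda>m. \<Sum>i. \<bar>\<delta> (i + m)\<bar>"
    have t0: "?t m \<ge> 0" for m by (intro suminf_nonneg summable_ignore_initial_segment[OF \<delta>(2)]) simp
    have hl: "filterlim (\<lambda>n. Suc (h n)) sequentially sequentially"
      unfolding filterlim_at_top
    proof
      fix Z :: nat
      show "\<forall>\<^sub>F n in sequentially. Z \<le> Suc (h n)"
        using eventually_ge_at_top[of "2 * Z"] by eventually_elim (simp add: h_def)
    qed
    have "(\<lambda>n. D * (2 * (sqrt (real (Suc (h n))) * ?t (Suc (h n))))) \<longlonglongrightarrow> D * (2 * 0)"
      by (intro tendsto_mult tendsto_const filterlim_compose[OF tail_sum_tendsto[OF \<delta>] hl])
    then have lim0: "(\<lambda>n. D * (2 * (sqrt (real (Suc (h n))) * ?t (Suc (h n))))) \<longlonglongrightarrow> 0" by simp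
    moreover have "norm (P3 n) \<le> D * (2 * (sqrt (real (Suc (h n))) * ?t (Suc (h n))))" for n
    proof -
      have "\<bar>\<Sum>i. \<delta> (i + Suc (h n))\<bar> \<le> ?t (Suc (h n))"
        by (rule summable_rabs[OF summable_ignore_initial_segment[OF \<delta>(2)]])
      then have "norm (P3 n) \<le> \<bar>real n * e n\<bar> * ?t (Suc (h n))"
        unfolding P3_def real_norm_def abs_mult[of "real n * e n"] by (rule mult_left_mono) simp
      also have "real n * e n = sqrt (real n) * (sqrt (real n) * e n)"
        by (simp add: mult.assoc[symmetric])
      also have "\<bar>\<dots>\<bar> * ?t (Suc (h n)) \<le> (sqrt (real n) * D) * ?t (Suc (h n))"
        using D[of n] by (intro mult_right_mono t0) (auto simp: abs_mult intro!: mult_left_mono)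
      also have "\<dots> \<le> (2 * sqrt (real (Suc (h n))) * D) * ?t (Suc (h n))"
      proof (intro mult_right_mono D0 t0)
        have "real n \<le> 4 * real (Suc (h n))" by (simp add: h_def)
        then have "sqrt (real n) \<le> sqrt (4 * real (Suc (h n)))" by (rule real_sqrt_le_mono)
        then show "sqrt (real n) \<le> 2 * sqrt (real (Suc (h n)))" by (simp only: real_sqrt_mult) simp
      qed
      finally show ?thesis by (simp add: mult_ac)
    qed
    ultimately show ?thesis by (rule Lim_null_comparison[OF always_eventually[OF allI], rotated])
  qed
  have P4: "P4 \<longlonglongrightarrow> 0"
  proof (rule Lim_null_comparison[OF always_eventually[OF allI]])
    fix n
    have "\<bar>\<Sum>i\<le>h n. \<delta> i\<bar> \<le> (\<Sum>i\<le>h n. \<bar>\<delta> i\<bar>)" by (rule sum_abs)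
    also have "\<dots> \<le> (\<Sum>i. \<bar>\<delta> i\<bar>)" by (rule sum_le_suminf[OF \<delta>(2)]) auto
    finally show "norm (P4 n) \<le> \<bar>real n * (b n - e n)\<bar> * (\<Sum>i. \<bar>\<delta> i\<bar>)"
      unfolding P4_def real_norm_def abs_mult[of "real n * (b n - e n)"] by (rule mult_left_mono) simp
  next
    show "(\<lambda>n. \<bar>real n * (b n - e n)\<bar> * (\<Sum>i. \<bar>\<delta> i\<bar>)) \<longlonglongrightarrow> 0"
      using tendsto_mult_right[OF tendsto_rabs_zero[OF be], of "\<Sum>i. \<bar>\<delta> i\<bar>"] by simp
  qed
  have "(\<lambda>n. P1 n + P2 n - P3 n + P4 n) \<longlonglongrightarrow> 0 + 0 - 0 + 0"
    by (intro tendsto_intros P1 P2 P3 P4)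
  then show ?thesis unfolding split by simp
qed

section \<open>Lagrange inversion on the diagonal\<close>

lemma fps_compose_mult_nth:
  fixes y :: "'a::comm_ring_1 fps"
  assumes y0: "fps_nth y 0 = 0"
  shows "fps_nth ((a oo y) * A) n = (\<Sum>j\<le>n. fps_nth a j * fps_nth (y ^ j * A) n)"
proof -
  have "fps_nth ((a oo y) * A) n = (\<Sum>i\<le>n. (\<Sum>j\<le>i. fps_nth a j * fps_nth (y ^ j) i) * fps_nth A (n - i))"
    by (simp add: fps_mult_nth fps_compose_nth atLeast0AtMost)
  also have "\<dots> = (\<Sum>i\<le>n. (\<Sum>j\<le>n. fps_nth a j * fps_nth (y ^ j) i) * fps_nth A (n - i))"
    by (intro sum.cong refl arg_cong2[where f = "times"] sum.mono_neutral_left)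
      (auto simp: fps_power_nth_eq_0[OF y0])
  also have "\<dots> = (\<Sum>j\<le>n. \<Sum>i\<le>n. fps_nth a j * fps_nth (y ^ j) i * fps_nth A (n - i))"
    unfolding sum_distrib_right by (rule sum.swap)
  also have "\<dots> = (\<Sum>j\<le>n. fps_nth a j * fps_nth (y ^ j * A) n)"
    unfolding fps_mult_nth[of "y ^ _" A] atLeast0AtMost sum_distrib_left by (simp only: mult.assoc)
  finally show ?thesis .
qed

text \<open>Differentiating y = X \<phi>(y) gives X y' = y Q. The off-diagonal coefficients of
  powers of \<phi> are supplied by \<open>inversion\<close>; the diagonal ones, where it reads 0 = 0
  for i = 0, turn out to be the coefficients of the same Q. For size series this makes Q the series
  of return probabilities.\<close>

lemma lagrange_diagonal:
  fixes y \<phi> :: "real fps"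
  assumes y: "y = fps_X * (\<phi> oo y)"
    and inversion: "\<And>n i. i \<le> n \<Longrightarrow> real n * fps_nth (y ^ i) n = real i * fps_nth (\<phi> ^ n) (n - i)"
  defines "Q \<equiv> inverse (1 - fps_X * (fps_deriv \<phi> oo y))"
  shows "fps_X * fps_deriv y = y * Q"
    and "fps_nth (\<phi> ^ m) m = fps_nth Q m"
proof -
  have y0: "fps_nth y 0 = 0" by (subst y) simp
  let ?P = "fps_deriv \<phi> oo y"
  have inv: "Q * (1 - fps_X * ?P) = 1" unfolding Q_def by (rule inverse_mult_eq_1) simp
  have "fps_deriv y = (\<phi> oo y) + fps_X * (?P * fps_deriv y)"
    by (subst y) (simp add: fps_compose_deriv[OF y0])
  then have "fps_X * fps_deriv y = fps_X * (\<phi> oo y) + fps_X * (fps_X * (?P * fps_deriv y))"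
    by (metis distrib_left)
  then have "fps_X * fps_deriv y - fps_X * (fps_X * (?P * fps_deriv y)) = y"
    unfolding y[symmetric] diff_eq_eq .
  moreover have "(1 - fps_X * ?P) * (fps_X * fps_deriv y) = fps_X * fps_deriv y - fps_X * (fps_X * (?P * fps_deriv y))"
    by (simp only: left_diff_distrib mult_1_left) (simp only: mult_ac)
  ultimately have "(1 - fps_X * ?P) * (fps_X * fps_deriv y) = y" by simp
  then have "Q * ((1 - fps_X * ?P) * (fps_X * fps_deriv y)) = Q * y" by simp
  then show Xy: "fps_X * fps_deriv y = y * Q" unfolding mult.assoc[symmetric] inv by (simp add: mult.commute)
  have Q: "Q = 1 + fps_X * (?P * Q)" using inv by (simp add: algebra_simps)
  have XD: "fps_nth (fps_X * fps_deriv G) i = real i * fps_nth G i" for G :: "real fps" and i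
    by (cases i) simp_all
  have diag: "real n * fps_nth (y ^ i) n = real i * fps_nth (y ^ i * Q) n" for i n
  proof (cases i)
    case (Suc i')
    have "real n * fps_nth (y ^ i) n = fps_nth (fps_X * fps_deriv (y ^ i)) n" by (simp only: XD)
    also have "fps_X * fps_deriv (y ^ i) = fps_const (real i) * (y ^ i' * (fps_X * fps_deriv y))"
      unfolding fps_deriv_power Suc by (simp add: mult_ac)
    also have "\<dots> = fps_const (real i) * (y ^ i * Q)" unfolding Xy Suc by (simp add: mult_ac)
    finally show ?thesis by simp
  qed (cases n; simp)
  show "fps_nth (\<phi> ^ m) m = fps_nth Q m"
  proof (induction m)
    case 0
    show ?case by (simp add: Q_def)
  next
    case (Suc m)
    have "real (Suc m) * fps_nth (\<phi> ^ Suc m) (Suc m) =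
        real (Suc m) * (\<Sum>j\<le>Suc m. real j * fps_nth \<phi> j * fps_nth (\<phi> ^ m) (Suc m - j))"
      by (rule fps_nth_power_euler)
    then have "fps_nth (\<phi> ^ Suc m) (Suc m) = (\<Sum>j\<le>Suc m. real j * fps_nth \<phi> j * fps_nth (\<phi> ^ m) (Suc m - j))"
      unfolding mult_cancel_left by simp
    also have "\<dots> = (\<Sum>i\<le>m. real (Suc i) * fps_nth \<phi> (Suc i) * fps_nth (\<phi> ^ m) (m - i))"
      by (subst sum.atMost_Suc_shift) simp
    also have "\<dots> = (\<Sum>i\<le>m. real (Suc i) * fps_nth \<phi> (Suc i) * fps_nth (y ^ i * Q) m)"
    proof (intro sum.cong refl)
      fix i assume "i \<in> {..m}"
      then have i: "i \<le> m" by simp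
      have "fps_nth (\<phi> ^ m) (m - i) = fps_nth (y ^ i * Q) m"
      \<comment> \<open>\<open>inversion\<close> carries the factor i and says nothing for i = 0;
        that term is the diagonal coefficient of the previous step, known by induction.\<close>
      proof (cases "i = 0")
        case True
        then show ?thesis using Suc by simp
      next
        case False
        have "real i * fps_nth (\<phi> ^ m) (m - i) = real i * fps_nth (y ^ i * Q) m"
          using inversion[OF i] diag[of m i] by linarith
        then show ?thesis using False by (simp only: mult_cancel_left of_nat_eq_0_iff simp_thms)
      qed
      then show "real (Suc i) * fps_nth \<phi> (Suc i) * fps_nth (\<phi> ^ m) (m - i) =
          real (Suc i) * fps_nth \<phi> (Suc i) * fps_nth (y ^ i * Q) m" by simp
    qed
    also have "\<dots> = fps_nth (?P * Q) m" unfolding fps_compose_mult_nth[OF y0] by simp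
    also have "\<dots> = fps_nth Q (Suc m)" by (subst (2) Q) simp
    finally show ?case .
  qed
qed

section \<open>Mean number of \<open>Pend\<close> vertices\<close>

context critical_offspring
begin

definition size_fps :: "real fps" where
  "size_fps = Abs_fps size_prob"

definition pend_mean :: "nat \<Rightarrow> real" where
  "pend_mean n = measure_pmf.expectation GW (\<lambda>t. real (pend_count t) * of_bool (nodes t = n))"

lemma size_law_walk: "size_law j = walk (map_pmf nodes GW) j"
proof (induction j)
  case (Suc j)
  have "size_law (Suc j) = bind_pmf GW (\<lambda>t. map_pmf (\<lambda>s. nodes t + s) (size_law j))"
    unfolding size_law_def by (simp add: map_bind_pmf map_pmf_def bind_assoc_pmf bind_return_pmf)
  also have "\<dots> = walk (map_pmf nodes GW) (Suc j)"
    by (simp add: Suc bind_map_pmf)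
  finally show ?case .
qed (simp add: size_law_def)

lemma pmf_size_law_fps: "pmf (size_law j) n = fps_nth (size_fps ^ j) n"
proof -
  have "pmf (map_pmf nodes GW) = size_prob"
    by (simp add: fun_eq_iff pmf_map size_prob_def vimage_def)
  then show ?thesis by (simp add: size_law_walk pmf_walk_nat size_fps_def)
qed

lemma nodes_neq_0 [simp]: "nodes t \<noteq> 0"
  using nodes_pos[of t] by simp

lemma size_prob_0: "size_prob 0 = 0"
  by (simp add: size_prob_def)

lemma size_fps_nth: "fps_nth size_fps n = size_prob n"
  by (simp add: size_fps_def)

lemma size_fps_0: "fps_nth size_fps 0 = 0"
  by (simp add: size_fps_nth size_prob_0)

lemma size_fps_eq: "size_fps = fps_X * (Abs_fps (pmf \<xi>) oo size_fps)"
proof (rule fps_ext)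
  fix n
  show "fps_nth size_fps n = fps_nth (fps_X * (Abs_fps (pmf \<xi>) oo size_fps)) n"
  proof (cases n)
    case (Suc m)
    have "fps_nth size_fps n = pmf (size_law (Suc 0)) (Suc m)" by (simp add: pmf_size_law_fps Suc)
    also have "\<dots> = measure_pmf.expectation \<xi> (\<lambda>k. pmf (size_law k) m)"
      unfolding size_law_Suc by (simp add: pmf_bind pmf_map_inj')
    also have "\<dots> = (\<Sum>k\<le>m. pmf \<xi> k * pmf (size_law k) m)"
      by (rule expectation_finite_support) (auto simp: size_law_zero)
    also have "\<dots> = fps_nth (fps_X * (Abs_fps (pmf \<xi>) oo size_fps)) n"
      by (simp add: Suc fps_compose_nth pmf_size_law_fps atLeast0AtMost)
    finally show ?thesis .
  qed (simp add: size_fps_0)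
qed

definition diag_fps :: "real fps" where
  "diag_fps = inverse (1 - fps_X * (fps_deriv (Abs_fps (pmf \<xi>)) oo size_fps))"

lemma size_fps_inversion:
  "i \<le> n \<Longrightarrow> real n * fps_nth (size_fps ^ i) n = real i * fps_nth (Abs_fps (pmf \<xi>) ^ n) (n - i)"
  using pmf_size_law[of n i] by (simp add: pmf_size_law_fps pmf_walk_nat)

lemma diag_fps_nth: "fps_nth diag_fps m = pmf (walk \<xi> m) m"
  unfolding diag_fps_def pmf_walk_nat
  by (rule lagrange_diagonal(2)[OF size_fps_eq size_fps_inversion, symmetric])

text \<open>Coefficients of X y' = y Q for the size series y. Since n counts all vertices, this is
  the analogue of \<open>pend_mean_eq\<close> with every vertex counted, and the kernel of return
  probabilities is the same in both.\<close>

lemma mult_size_prob: "real n * size_prob n = (\<Sum>i\<le>n. pmf (walk \<xi> (n - i)) (n - i) * size_prob i)"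
proof -
  have "real n * size_prob n = fps_nth (fps_X * fps_deriv size_fps) n"
    by (cases n) (simp_all add: size_fps_def)
  also have "fps_X * fps_deriv size_fps = size_fps * diag_fps"
    unfolding diag_fps_def by (rule lagrange_diagonal(1)[OF size_fps_eq size_fps_inversion])
  finally show ?thesis
    unfolding fps_mult_nth atLeast0AtMost by (simp only: diag_fps_nth size_fps_nth mult.commute)
qed

lemma pend_count_le_nodes: "pend_count t \<le> nodes t"
proof (induction t)
  case (Node ts)
  then have "sum_list (map pend_count ts) \<le> sum_list (map nodes ts)" by (intro sum_list_mono) auto
  then show ?case by simp
qed

definition forest_mean :: "nat \<Rightarrow> nat \<Rightarrow> real" where
  "forest_mean j n = measure_pmf.expectation (replicate_pmf j GW)
    (\<lambda>l. real (sum_list (map pend_count l)) * of_bool (sum_list (map nodes l) = n))"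

lemma forest_bounded:
  "\<bar>real (sum_list (map pend_count l)) * of_bool (sum_list (map nodes l) = n)\<bar> \<le> real n"
proof -
  have "sum_list (map pend_count l) \<le> sum_list (map nodes l)"
    by (intro sum_list_mono pend_count_le_nodes)
  then show ?thesis by auto
qed

lemma pend_mean_bounded: "\<bar>real (pend_count t) * of_bool (nodes t = n)\<bar> \<le> real n"
  using pend_count_le_nodes[of t] by auto

lemma forest_mean_Suc:
  "forest_mean (Suc j) n = (\<Sum>i\<le>n. pend_mean i * pmf (size_law j) (n - i) + size_prob i * forest_mean j (n - i))"
proof -
  let ?N = "\<lambda>l. sum_list (map nodes l)" and ?C = "\<lambda>l. sum_list (map pend_count l)"
  have sz: "pmf (size_law j) m = measure_pmf.expectation (replicate_pmf j GW) (\<lambda>l. of_bool (?N l = m))" for m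
    by (simp add: size_law_def pmf_map vimage_def expectation_of_bool)
  have inner: "measure_pmf.expectation (replicate_pmf j GW)
      (\<lambda>l. real (?C (t # l)) * of_bool (?N (t # l) = n)) =
    (\<Sum>i\<le>n. real (pend_count t) * of_bool (nodes t = i) * pmf (size_law j) (n - i) + of_bool (nodes t = i) * forest_mean j (n - i))" for t
  proof (cases "nodes t \<le> n")
    case True
    have "(\<lambda>l. real (?C (t # l)) * of_bool (?N (t # l) = n)) =
       (\<lambda>l. real (pend_count t) * of_bool (?N l = n - nodes t) + real (?C l) * of_bool (?N l = n - nodes t))"
      using True by (auto simp: fun_eq_iff algebra_simps)
    moreover have "integrable (replicate_pmf j GW) (\<lambda>l. real (pend_count t) * of_bool (?N l = n - nodes t))"
      by (rule measure_pmf.integrable_const_bound[where B = "real (pend_count t)"]) auto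
    moreover have "integrable (replicate_pmf j GW) (\<lambda>l. real (?C l) * of_bool (?N l = n - nodes t))"
      by (rule measure_pmf.integrable_const_bound[OF always_eventually[OF allI, OF forest_bounded[folded real_norm_def]]]) simp
    ultimately have "measure_pmf.expectation (replicate_pmf j GW)
      (\<lambda>l. real (?C (t # l)) * of_bool (?N (t # l) = n)) =
      real (pend_count t) * pmf (size_law j) (n - nodes t) + forest_mean j (n - nodes t)"
      unfolding sz forest_mean_def by (simp only: Bochner_Integration.integral_add integral_mult_right_zero)
    also have "\<dots> = (\<Sum>i\<in>{nodes t}. real (pend_count t) * of_bool (nodes t = i) * pmf (size_law j) (n - i) + of_bool (nodes t = i) * forest_mean j (n - i))"
      by simp
    also have "\<dots> = (\<Sum>i\<le>n. real (pend_count t) * of_bool (nodes t = i) * pmf (size_law j) (n - i) + of_bool (nodes t = i) * forest_mean j (n - i))"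
      using True by (intro sum.mono_neutral_left) auto
    finally show ?thesis .
  next
    case False
    then have "(\<lambda>l. real (?C (t # l)) * of_bool (?N (t # l) = n)) = (\<lambda>l. 0)" by (auto simp: fun_eq_iff)
    moreover have "(\<Sum>i\<le>n. real (pend_count t) * of_bool (nodes t = i) * pmf (size_law j) (n - i) + of_bool (nodes t = i) * forest_mean j (n - i)) = 0"
      using False by (intro sum.neutral) auto
    ultimately show ?thesis by simp
  qed
  have sp: "size_prob i = measure_pmf.expectation GW (\<lambda>t. of_bool (nodes t = i))" for i
    by (simp add: size_prob_def expectation_of_bool)
  have "forest_mean (Suc j) n = measure_pmf.expectation (bind_pmf GW (\<lambda>t. map_pmf (\<lambda>l. t # l) (replicate_pmf j GW)))
     (\<lambda>l. real (?C l) * of_bool (?N l = n))"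
    unfolding forest_mean_def by (simp add: map_pmf_def)
  also have "\<dots> = measure_pmf.expectation GW (\<lambda>t. measure_pmf.expectation (map_pmf (\<lambda>l. t # l) (replicate_pmf j GW))
     (\<lambda>l. real (?C l) * of_bool (?N l = n)))"
    by (rule expectation_bind_pmf[OF forest_bounded])
  also have "\<dots> = measure_pmf.expectation GW (\<lambda>t. \<Sum>i\<le>n. real (pend_count t) * of_bool (nodes t = i) * pmf (size_law j) (n - i) + of_bool (nodes t = i) * forest_mean j (n - i))"
    unfolding integral_map_pmf inner ..
  also have "\<dots> = (\<Sum>i\<le>n. pend_mean i * pmf (size_law j) (n - i) + size_prob i * forest_mean j (n - i))"
  proof -
    have i1: "integrable GW (\<lambda>t. real (pend_count t) * of_bool (nodes t = i))" for i
      by (rule measure_pmf.integrable_const_bound[where B = "real i"]) (auto intro!: always_eventually simp: pend_mean_bounded[simplified])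
    have i2: "integrable GW (\<lambda>t. of_bool (nodes t = i) :: real)" for i
      by (rule measure_pmf.integrable_const_bound[where B = 1]) (auto intro!: always_eventually)
    show ?thesis
      unfolding pend_mean_def sp
      by (subst Bochner_Integration.integral_sum)
        (auto intro!: sum.cong integrable_mult_left i1 i2 simp: Bochner_Integration.integral_add integrable_mult_left i1 i2)
  qed
  finally show ?thesis .
qed

text \<open>By linearity each of the j trees contributes once the series of
  \<open>pend_mean\<close>, while the other j - 1 contribute the size series.\<close>

lemma forest_mean_fps:
  "forest_mean j n = real j * fps_nth (size_fps ^ (j - 1) * Abs_fps pend_mean) n"
proof (induction j arbitrary: n)
  case 0
  show ?case by (simp add: forest_mean_def)
next
  case (Suc j)
  have "forest_mean (Suc j) n = fps_nth (Abs_fps pend_mean * size_fps ^ j) n + fps_nth (size_fps * (fps_const (real j) * (size_fps ^ (j - 1) * Abs_fps pend_mean))) n"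
    unfolding forest_mean_Suc Suc fps_mult_nth[of "Abs_fps pend_mean" "size_fps ^ j"] fps_mult_nth[of size_fps]
      atLeast0AtMost sum.distrib pmf_size_law_fps size_fps_nth by simp
  also have "size_fps * (fps_const (real j) * (size_fps ^ (j - 1) * Abs_fps pend_mean)) =
      fps_const (real j) * (size_fps ^ j * Abs_fps pend_mean)"
    by (cases j) (simp_all add: mult_ac)
  finally show ?case by (simp add: mult.commute[of _ "size_fps ^ j"] distrib_right)
qed

lemma pend_mean_Suc:
  "pend_mean (Suc n) = pend_size_prob (Suc n) + (\<Sum>j\<le>Suc n. pmf \<xi> j * forest_mean j n)"
proof -
  let ?N = "\<lambda>l. sum_list (map nodes l)" and ?C = "\<lambda>l. sum_list (map pend_count l)"
  have eq: "real (pend_count t) * of_bool (nodes t = Suc n) =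
      of_bool (label t = Pend \<and> nodes t = Suc n) + real (?C (children t)) * of_bool (?N (children t) = n)" for t
    by (cases t) (auto simp: algebra_simps)
  have "pend_mean (Suc n) = measure_pmf.expectation GW (\<lambda>t. of_bool (label t = Pend \<and> nodes t = Suc n))
      + measure_pmf.expectation GW (\<lambda>t. real (?C (children t)) * of_bool (?N (children t) = n))"
    unfolding pend_mean_def eq
  proof (rule Bochner_Integration.integral_add)
    show "integrable GW (\<lambda>t. of_bool (label t = Pend \<and> nodes t = Suc n) :: real)"
      by (rule measure_pmf.integrable_const_bound[where B = 1]) auto
    show "integrable GW (\<lambda>t. real (?C (children t)) * of_bool (?N (children t) = n))"
      by (rule measure_pmf.integrable_const_bound[OF always_eventually[OF allI, OF forest_bounded[folded real_norm_def]]]) simp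
  qed
  also have "measure_pmf.expectation GW (\<lambda>t. of_bool (label t = Pend \<and> nodes t = Suc n)) = pend_size_prob (Suc n)"
    by (simp only: pend_size_prob_def expectation_of_bool)
  also have "measure_pmf.expectation GW (\<lambda>t. real (?C (children t)) * of_bool (?N (children t) = n)) =
      measure_pmf.expectation (map_pmf children GW) (\<lambda>l. real (?C l) * of_bool (?N l = n))"
    by simp
  also have "\<dots> = measure_pmf.expectation \<xi> (\<lambda>k. forest_mean k n)"
    unfolding children_GW forest_mean_def by (rule expectation_bind_pmf[OF forest_bounded])
  also have "\<dots> = (\<Sum>j\<le>Suc n. pmf \<xi> j * forest_mean j n)"
    by (rule expectation_finite_support) (auto simp: forest_mean_fps fps_mult_power_nth_eq_0[OF size_fps_0])
  finally show ?thesis .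
qed

text \<open>A \<open>Pend\<close> vertex is the root or lies below one of the children, which gives
  M = S + X \<phi>'(y) M, where M and S are the series of \<open>pend_mean\<close> and
  \<open>pend_size_prob\<close> and y is the size series. Solving for M multiplies S by the inverse
  of 1 - X \<phi>'(y), the series of return probabilities.\<close>

lemma pend_mean_eq: "pend_mean n = (\<Sum>i\<le>n. pmf (walk \<xi> (n - i)) (n - i) * pend_size_prob i)"
proof -
  let ?P = "fps_deriv (Abs_fps (pmf \<xi>)) oo size_fps" and ?M = "Abs_fps pend_mean" and ?S = "Abs_fps pend_size_prob"
  have "?M = ?S + fps_X * (?P * ?M)"
  proof (rule fps_ext)
    fix n
    show "fps_nth ?M n = fps_nth (?S + fps_X * (?P * ?M)) n"
    proof (cases n)
      case 0
      then show ?thesis by (simp add: pend_mean_def pend_size_prob_def)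
    next
      case (Suc m)
      have "(\<Sum>j\<le>Suc m. pmf \<xi> j * forest_mean j m) = (\<Sum>i\<le>m. pmf \<xi> (Suc i) * forest_mean (Suc i) m)"
        by (subst sum.atMost_Suc_shift) (simp add: forest_mean_fps)
      also have "\<dots> = fps_nth (?P * ?M) m"
        unfolding fps_compose_mult_nth[OF size_fps_0] forest_mean_fps by (intro sum.cong) simp_all
      finally show ?thesis by (simp add: Suc pend_mean_Suc)
    qed
  qed
  then have "?S = (1 - fps_X * ?P) * ?M" by (simp add: algebra_simps)
  then have "diag_fps * ?S = (diag_fps * (1 - fps_X * ?P)) * ?M" by (simp add: mult.assoc)
  also have "diag_fps * (1 - fps_X * ?P) = 1" unfolding diag_fps_def by (rule inverse_mult_eq_1) simp
  finally have "?M = ?S * diag_fps" by (simp add: mult.commute)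
  then have "fps_nth ?M n = fps_nth (?S * diag_fps) n" by simp
  then show ?thesis
    unfolding fps_mult_nth atLeast0AtMost by (simp only: diag_fps_nth fps_nth_Abs_fps mult.commute)
qed

end

section \<open>Transfer to the conditioned tree\<close>

lemma expectation_cond_pmf:
  fixes f :: "'a \<Rightarrow> real"
  assumes "set_pmf p \<inter> A \<noteq> {}"
  shows "measure_pmf.expectation (cond_pmf p A) f =
    measure_pmf.expectation p (\<lambda>x. f x * of_bool (x \<in> A)) / measure (measure_pmf p) A"
proof -
  have pos: "measure (measure_pmf p) A > 0"
    using assms by (simp add: measure_pmf_zero_iff zero_less_measure_iff)
  have "measure_pmf (cond_pmf p A) = density p (\<lambda>x. ennreal (of_bool (x \<in> A) / measure (measure_pmf p) A))"
    unfolding cond_pmf.rep_eq[OF assms] uniform_measure_def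
    using pos by (intro arg_cong2[where f = density] refl ext)
      (auto simp: measure_pmf.emeasure_eq_measure divide_ennreal[symmetric] indicator_def)
  then have "measure_pmf.expectation (cond_pmf p A) f =
      (\<integral>x. of_bool (x \<in> A) / measure (measure_pmf p) A * f x \<partial>p)"
    using pos integral_density[of f p "\<lambda>x. of_bool (x \<in> A) / measure (measure_pmf p) A"] by simp
  also have "\<dots> = (\<integral>x. f x * of_bool (x \<in> A) / measure (measure_pmf p) A \<partial>p)"
    by (simp add: mult.commute)
  finally show ?thesis by simp
qed

lemma measure_cond_pmf:
  assumes "set_pmf p \<inter> A \<noteq> {}"
  shows "measure (measure_pmf (cond_pmf p A)) B = measure (measure_pmf p) (B \<inter> A) / measure (measure_pmf p) A"
  using expectation_cond_pmf[OF assms, of "\<lambda>x. of_bool (x \<in> B)"]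
  by (simp add: expectation_of_bool of_bool_conj[symmetric] Int_def)

lemma cdf_std_normal_distribution:
  assumes "s > 0"
  shows "cdf std_normal_distribution y = (\<integral>u. indicator {..s * y} u * normal_density 0 s u \<partial>lborel)"
proof -
  have "(\<integral>u. indicator {..s * y} u * normal_density 0 s u \<partial>lborel) =
      \<bar>s\<bar> *\<^sub>R (\<integral>x. indicator {..s * y} (0 + s * x) * normal_density 0 s (0 + s * x) \<partial>lborel)"
    using assms by (intro lborel_integral_real_affine) simp
  also have "(\<lambda>x. indicator {..s * y} (0 + s * x) * normal_density 0 s (0 + s * x)) =
      (\<lambda>x. (std_normal_density x * indicator {..y} x) / s)"
    using assms by (auto simp: fun_eq_iff normal_density_def indicator_def real_sqrt_mult power_mult_distrib)
  also have "\<bar>s\<bar> *\<^sub>R (\<integral>x. (std_normal_density x * indicator {..y} x) / s \<partial>lborel) =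
      (\<integral>x. std_normal_density x * indicator {..y} x \<partial>lborel)"
    using assms by simp
  also have "\<dots> = (\<integral>x. indicator {..y} x \<partial>std_normal_distribution)"
    by (subst integral_density) auto
  also have "\<dots> = cdf std_normal_distribution y"
    by (simp add: cdf_def)
  finally show ?thesis ..
qed

context critical_offspring
begin

lemma size_prob_sums: "size_prob sums 1"
proof -
  have "(\<lambda>n. measure (measure_pmf GW) {t. nodes t = n}) sums measure (measure_pmf GW) (\<Union>n. {t. nodes t = n})"
    by (rule measure_pmf.finite_measure_UNION) (auto simp: disjoint_family_on_def)
  moreover have "(\<Union>n. {t. nodes t = n}) = UNIV" by auto
  ultimately show ?thesis by (simp add: size_prob_def[abs_def])
qed

lemma pend_size_prob_sums: "pend_size_prob sums pend_prob"
proof -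
  have "(\<lambda>n. measure (measure_pmf GW) {t. label t = Pend \<and> nodes t = n}) sums
      measure (measure_pmf GW) (\<Union>n. {t. label t = Pend \<and> nodes t = n})"
    by (rule measure_pmf.finite_measure_UNION) (auto simp: disjoint_family_on_def)
  moreover have "(\<Union>n. {t. label t = Pend \<and> nodes t = n}) = {t. label t = Pend}" by auto
  ultimately show ?thesis by (simp add: pend_size_prob_def[abs_def] pend_prob_def)
qed

text \<open>\<delta> sums to \<open>pend_prob\<close> - c, so its convolution is
  (\<open>pend_prob\<close> - c) n P(|T| = n) up to o(1/n). By \<open>mult_size_prob\<close> the
  subtracted convolution is exactly c n P(|T| = n), hence c cancels in the result.\<close>

lemma pend_mean_asymptotics:
  "(\<lambda>n. real n * (pend_mean n - pend_prob * (real n * size_prob n))) \<longlonglongrightarrow> 0"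
proof -
  obtain c0 where "centred_walk_nat \<xi> c0" using centred_walk by blast
  then interpret W: centred_walk_nat \<xi> c0 .
  \<comment> \<open>The ratio of the n^(-3/2) constants of \<open>pend_size_prob\<close> and
    \<open>size_prob\<close>; this choice makes \<delta> of order o(i^(-3/2)), as
    \<open>convolution_asymptotics\<close> demands.\<close>
  define c where "c = pend_prob / root_mean"
  define b where "b m = pmf (walk \<xi> m) m" for m
  define \<delta> where "\<delta> i = pend_size_prob i - c * size_prob i" for i
  obtain C1 C2 where C1: "\<And>m. m > 0 \<Longrightarrow> sqrt (real m) * b m \<le> C1"
    and C2: "\<And>m. m > 0 \<Longrightarrow> \<bar>b m - b (Suc m)\<bar> \<le> C2 / (real m * sqrt (real m))"
    using W.return_bound W.return_difference unfolding b_def by blast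
  have sums: "\<delta> sums (pend_prob - c)"
    unfolding \<delta>_def using sums_diff[OF pend_size_prob_sums sums_mult[OF size_prob_sums, of c]] by simp
  have "(\<lambda>n. real n * ((\<Sum>i\<le>n. b (n - i) * \<delta> i) - real n * size_prob n * (\<Sum>i. \<delta> i))) \<longlonglongrightarrow> 0"
  proof (rule convolution_asymptotics[where C = "max C1 C2"])
    show "0 \<le> b m" for m by (simp add: b_def)
    show "sqrt (real m) * b m \<le> max C1 C2" if "m > 0" for m using C1[OF that] by simp
    show "\<bar>b m - b (Suc m)\<bar> \<le> max C1 C2 / (real m * sqrt (real m))" if "m > 0" for m
      by (rule order_trans[OF C2[OF that]]) (intro divide_right_mono, auto)
    have "real (Suc n) * (b (Suc n) - real (Suc n) * size_prob (Suc n)) =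
        real (Suc n) * (pmf (walk \<xi> (Suc n)) (Suc n) - pmf (walk \<xi> (Suc n)) n)" for n
      using size_prob_eq[of "Suc n"] by (simp only: b_def) simp
    then have "(\<lambda>n. real (Suc n) * (b (Suc n) - real (Suc n) * size_prob (Suc n))) \<longlonglongrightarrow> 0"
      using W.return_vs_pred by (simp only:)
    then show "(\<lambda>n. real n * (b n - real n * size_prob n)) \<longlonglongrightarrow> 0" by (rule LIMSEQ_imp_Suc)
    show "(\<lambda>n. sqrt (real n) * (real n * size_prob n)) \<longlonglongrightarrow> 1 / sqrt (2 * pi * var)"
      using size_prob_tendsto by (simp add: mult_ac)
    have "(\<lambda>i. real i * sqrt (real i) * pend_size_prob i - c * (real i * sqrt (real i) * size_prob i))
        \<longlonglongrightarrow> pend_prob / root_mean * (1 / sqrt (2 * pi * var)) - c * (1 / sqrt (2 * pi * var))"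
      by (intro tendsto_diff tendsto_mult tendsto_const pend_size_prob_tendsto size_prob_tendsto)
    then show "(\<lambda>i. real i * sqrt (real i) * \<delta> i) \<longlonglongrightarrow> 0"
      by (simp add: \<delta>_def c_def algebra_simps)
    show "summable (\<lambda>i. \<bar>\<delta> i\<bar>)"
    proof (rule summable_comparison_test)
      show "summable (\<lambda>i. pend_size_prob i + \<bar>c\<bar> * size_prob i)"
        using pend_size_prob_sums size_prob_sums by (intro summable_add summable_mult) (auto simp: sums_iff)
      have "\<bar>\<delta> i\<bar> \<le> pend_size_prob i + \<bar>c\<bar> * size_prob i" for i
        unfolding \<delta>_def using abs_triangle_ineq4[of "pend_size_prob i" "c * size_prob i"]
        by (simp add: abs_mult pend_size_prob_def size_prob_def)
      then show "\<exists>N. \<forall>n\<ge>N. norm \<bar>\<delta> n\<bar> \<le> pend_size_prob n + \<bar>c\<bar> * size_prob n" by simp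
    qed
  qed
  moreover have "(\<Sum>i\<le>n. b (n - i) * \<delta> i) - real n * size_prob n * (\<Sum>i. \<delta> i) =
      pend_mean n - pend_prob * (real n * size_prob n)" for n
  proof -
    have "(\<Sum>i\<le>n. b (n - i) * \<delta> i) = (\<Sum>i\<le>n. b (n - i) * pend_size_prob i) - c * (\<Sum>i\<le>n. b (n - i) * size_prob i)"
      unfolding \<delta>_def sum_distrib_left sum_subtractf[symmetric] by (intro sum.cong refl) (simp add: algebra_simps)
    also have "\<dots> = pend_mean n - c * (real n * size_prob n)"
      unfolding b_def pend_mean_eq[symmetric] mult_size_prob[symmetric] ..
    also have "c = pend_prob - (\<Sum>i. \<delta> i)" using sums by (simp add: sums_iff)
    finally show ?thesis by (simp add: algebra_simps)
  qed
  ultimately show ?thesis by simp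
qed

lemma size_prob_eventually_pos: "\<forall>\<^sub>F n in sequentially. size_prob n > 0"
proof -
  have "1 / sqrt (2 * pi * var) > 0" using var_pos by simp
  from order_tendstoD(1)[OF size_prob_tendsto this] show ?thesis
    by eventually_elim (simp add: size_prob_def zero_less_mult_iff zero_less_measure_iff)
qed

text \<open>Dividing an error o(1/n) by P(|T| = n), of order n^(-3/2), leaves o(\<surd>n).\<close>

lemma pend_mean_ratio:
  "(\<lambda>n. (pend_mean n / size_prob n - pend_prob * real n) / sqrt (real n)) \<longlonglongrightarrow> 0"
proof -
  have "1 / sqrt (2 * pi * var) \<noteq> 0" using var_pos by simp
  from tendsto_divide[OF pend_mean_asymptotics size_prob_tendsto this]
  have lim: "(\<lambda>n. real n * (pend_mean n - pend_prob * (real n * size_prob n)) / (real n * sqrt (real n) * size_prob n)) \<longlonglongrightarrow> 0"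
    by simp
  have "\<forall>\<^sub>F n in sequentially. real n * (pend_mean n - pend_prob * (real n * size_prob n)) / (real n * sqrt (real n) * size_prob n) =
      (pend_mean n / size_prob n - pend_prob * real n) / sqrt (real n)"
    using size_prob_eventually_pos eventually_gt_at_top[of 0]
    by eventually_elim (simp add: divide_simps mult_ac)
  from Lim_transform_eventually[OF lim this] show ?thesis .
qed

text \<open>The number of pairs in a minimum paired dominating set, that is, half of the paired
  domination number.\<close>

definition pair_number :: "tree \<Rightarrow> real" where
  "pair_number t = real (pend_count t + of_bool (label t = Bare))"

lemma number_measurable:
  "(\<lambda>\<omega>. paired_domination_number (tree_graph (plane_tree \<omega>))) \<in> measurable (conditioned_space \<xi> n) (count_space UNIV)"
  using paired_domination_number_measurable by (simp add: conditioned_space_def)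

lemma conditioned_tree_measurable:
  "(\<lambda>\<omega>. tree_of (plane_tree \<omega>)) \<in> measurable (conditioned_space \<xi> n) (count_space UNIV)"
  using tree_of_measurable by (simp add: conditioned_space_def)

lemma AE_number:
  assumes "n > 1"
  shows "AE \<omega> in conditioned_space \<xi> n.
    real (paired_domination_number (tree_graph (plane_tree \<omega>))) = 2 * pair_number (tree_of (plane_tree \<omega>))"
  using AE_conditioned_space
proof eventually_elim
  case (elim \<omega>)
  then have eq: "plane_tree \<omega> = shape (tree_of (plane_tree \<omega>))" and n: "nodes (tree_of (plane_tree \<omega>)) = n" by auto
  show ?case
    by (subst (1) eq, subst paired_domination_number_shape) (use n assms in \<open>auto simp: pair_number_def\<close>)
qed

lemma nodes_support: "size_prob n > 0 \<Longrightarrow> set_pmf GW \<inter> {t. nodes t = n} \<noteq> {}"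
  by (simp add: size_prob_def measure_pmf_zero_iff zero_less_measure_iff)

lemma expectation_number:
  assumes n: "n > 1" and pos: "size_prob n > 0"
  shows "(\<integral>\<omega>. real (paired_domination_number (tree_graph (plane_tree \<omega>))) \<partial>conditioned_space \<xi> n) =
    2 * (pend_mean n + measure (measure_pmf GW) {t. label t = Bare \<and> nodes t = n}) / size_prob n"
proof -
  let ?M = "conditioned_space \<xi> n" and ?X = "\<lambda>\<omega>. tree_of (plane_tree \<omega>)"
  have "(\<integral>\<omega>. real (paired_domination_number (tree_graph (plane_tree \<omega>))) \<partial>?M) = (\<integral>\<omega>. 2 * pair_number (?X \<omega>) \<partial>?M)"
    by (rule integral_cong_AE[OF _ _ AE_number[OF n]])
      (auto intro: measurable_compose[OF number_measurable] measurable_compose[OF conditioned_tree_measurable])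
  also have "\<dots> = (\<integral>t. 2 * pair_number t \<partial>distr ?M (count_space UNIV) ?X)"
    by (rule integral_distr[OF conditioned_tree_measurable, symmetric]) simp
  also have "\<dots> = (\<integral>t. 2 * pair_number t \<partial>cond_pmf GW {t. nodes t = n})"
    using pos by (subst conditioned_distr) (simp_all add: size_prob_def)
  also have "\<dots> = 2 * (\<integral>t. pair_number t * of_bool (nodes t = n) \<partial>GW) / size_prob n"
    by (simp add: expectation_cond_pmf[OF nodes_support[OF pos]] size_prob_def)
  also have "(\<lambda>t. pair_number t * of_bool (nodes t = n)) =
      (\<lambda>t. real (pend_count t) * of_bool (nodes t = n) + of_bool (label t = Bare \<and> nodes t = n))"
    by (auto simp: pair_number_def)
  also have "(\<integral>t. real (pend_count t) * of_bool (nodes t = n) + of_bool (label t = Bare \<and> nodes t = n) \<partial>GW) =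
      (\<integral>t. real (pend_count t) * of_bool (nodes t = n) \<partial>GW) + (\<integral>t. of_bool (label t = Bare \<and> nodes t = n) \<partial>GW)"
  proof (rule Bochner_Integration.integral_add)
    show "integrable GW (\<lambda>t. real (pend_count t) * of_bool (nodes t = n))"
      by (rule measure_pmf.integrable_const_bound[OF always_eventually[OF allI, OF pend_mean_bounded[folded real_norm_def]]]) simp
    show "integrable GW (\<lambda>t. of_bool (label t = Bare \<and> nodes t = n) :: real)"
      by (rule measure_pmf.integrable_const_bound[where B = 1]) auto
  qed
  finally show ?thesis by (simp only: pend_mean_def expectation_of_bool)
qed

lemma cdf_number:
  assumes n: "n > 1" and pos: "size_prob n > 0" and s: "s > 0"
  shows "cdf (distr (conditioned_space \<xi> n) borel
      (\<lambda>\<omega>. (real (paired_domination_number (tree_graph (plane_tree \<omega>))) - 2 * pend_prob * real n) / (2 * s * sqrt (real n)))) y =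
    measure (measure_pmf GW) ({t. pair_number t \<le> pend_prob * real n + s * y * sqrt (real n)} \<inter> {t. nodes t = n}) / size_prob n"
proof -
  let ?M = "conditioned_space \<xi> n" and ?X = "\<lambda>\<omega>. tree_of (plane_tree \<omega>)"
  let ?f = "\<lambda>\<omega>. (real (paired_domination_number (tree_graph (plane_tree \<omega>))) - 2 * pend_prob * real n) / (2 * s * sqrt (real n))"
  let ?S = "{t. pair_number t \<le> pend_prob * real n + s * y * sqrt (real n)}"
  have f: "?f \<in> borel_measurable ?M"
    by (rule measurable_compose[OF number_measurable]) simp
  have "cdf (distr ?M borel ?f) y = measure ?M (?f -` {..y} \<inter> space ?M)"
    by (simp add: cdf_def measure_distr[OF f])
  also have "\<dots> = measure ?M (?X -` ?S \<inter> space ?M)"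
  proof (rule measure_eq_AE)
    show "AE \<omega> in ?M. \<omega> \<in> ?f -` {..y} \<inter> space ?M \<longleftrightarrow> \<omega> \<in> ?X -` ?S \<inter> space ?M"
      using AE_number[OF n]
    proof eventually_elim
      case (elim \<omega>)
      \<comment> \<open>The 2 in front of \<open>pend_prob\<close> and in front of s both come from
        counting two vertices per pair, so they cancel.\<close>
      have "(2 * p - 2 * pend_prob * real n) / (2 * s * sqrt (real n)) \<le> y \<longleftrightarrow> p \<le> pend_prob * real n + s * y * sqrt (real n)" for p
        using s n by (subst pos_divide_le_eq) (auto simp: algebra_simps)
      then show ?case by (simp add: elim)
    qed
    show "?f -` {..y} \<inter> space ?M \<in> sets ?M" using f by (rule measurable_sets) simp
    show "?X -` ?S \<inter> space ?M \<in> sets ?M" using conditioned_tree_measurable by (rule measurable_sets) simp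
  qed
  also have "\<dots> = measure (distr ?M (count_space UNIV) ?X) ?S"
    by (rule measure_distr[OF conditioned_tree_measurable, symmetric]) simp
  also have "\<dots> = measure (cond_pmf GW {t. nodes t = n}) ?S"
    using pos by (subst conditioned_distr) (simp_all add: size_prob_def)
  also have "\<dots> = measure (measure_pmf GW) (?S \<inter> {t. nodes t = n}) / size_prob n"
    by (simp add: measure_cond_pmf[OF nodes_support[OF pos]] size_prob_def)
  finally show ?thesis .
qed

text \<open>The \<open>Bare\<close> root adds a conditional probability to the mean number of pairs;
  it lies in [0, 1] and is absorbed by o(\<surd>n).\<close>

lemma expectation_number_asymptotics:
  "(\<lambda>n. (\<integral>\<omega>. real (paired_domination_number (tree_graph (plane_tree \<omega>))) \<partial>conditioned_space \<xi> n) - 2 * pend_prob * real n)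
    \<in> o(\<lambda>n. sqrt (real n))"
proof (rule smalloI_tendsto)
  let ?B = "\<lambda>n. measure (measure_pmf GW) {t. label t = Bare \<and> nodes t = n} / size_prob n"
  let ?E = "\<lambda>n. (\<integral>\<omega>. real (paired_domination_number (tree_graph (plane_tree \<omega>))) \<partial>conditioned_space \<xi> n)"
  have B1: "?B n \<le> 1" for n
    using measure_pmf.finite_measure_mono[of "{t. label t = Bare \<and> nodes t = n}" "{t. nodes t = n}" GW]
    by (auto simp: size_prob_def divide_le_eq zero_less_measure_iff)
  have B0: "0 \<le> ?B n" for n by (simp add: size_prob_def)
  have "(\<lambda>n. ?B n / sqrt (real n)) \<longlonglongrightarrow> 0"
  proof (rule Lim_null_comparison)
    show "\<forall>\<^sub>F n in sequentially. norm (?B n / sqrt (real n)) \<le> 1 / sqrt (real n)"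
    proof (intro always_eventually allI)
      fix n
      have "norm (?B n / sqrt (real n)) = ?B n / sqrt (real n)"
        unfolding real_norm_def by (rule abs_of_nonneg[OF divide_nonneg_nonneg[OF B0]]) simp
      also have "\<dots> \<le> 1 / sqrt (real n)" by (rule divide_right_mono[OF B1]) simp
      finally show "norm (?B n / sqrt (real n)) \<le> 1 / sqrt (real n)" .
    qed
    show "(\<lambda>n. 1 / sqrt (real n)) \<longlonglongrightarrow> 0" by real_asymp
  qed
  from tendsto_mult_right_zero[OF tendsto_add_zero[OF pend_mean_ratio this], of 2]
  have lim: "(\<lambda>n. 2 * ((pend_mean n / size_prob n - pend_prob * real n) / sqrt (real n) + ?B n / sqrt (real n))) \<longlonglongrightarrow> 0" .
  have "\<forall>\<^sub>F n in sequentially. 2 * ((pend_mean n / size_prob n - pend_prob * real n) / sqrt (real n) + ?B n / sqrt (real n)) =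
      (?E n - 2 * pend_prob * real n) / sqrt (real n)"
    using size_prob_eventually_pos eventually_gt_at_top[of 1]
  proof eventually_elim
    case (elim n)
    show ?case unfolding expectation_number[OF elim(2,1)] using elim
      by (simp add: add_divide_distrib diff_divide_distrib)
  qed
  from Lim_transform_eventually[OF lim this]
  show "(\<lambda>n. (?E n - 2 * pend_prob * real n) / sqrt (real n)) \<longlonglongrightarrow> 0" .
  show "\<forall>\<^sub>F n in sequentially. sqrt (real n) \<noteq> 0"
    using eventually_gt_at_top[of 0] by eventually_elim simp
qed

lemma number_weak_conv:
  "weak_conv_m
    (\<lambda>n. distr (conditioned_space \<xi> n) borel
      (\<lambda>\<omega>. (real (paired_domination_number (tree_graph (plane_tree \<omega>))) - 2 * pend_prob * real n) / (2 * limit_sd * sqrt (real n))))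
    std_normal_distribution"
  unfolding weak_conv_m_def weak_conv_def
proof (intro allI impI)
  fix y
  let ?F = "\<lambda>n. distr (conditioned_space \<xi> n) borel
      (\<lambda>\<omega>. (real (paired_domination_number (tree_graph (plane_tree \<omega>))) - 2 * pend_prob * real n) / (2 * limit_sd * sqrt (real n)))"
  let ?m = "\<lambda>n. measure (measure_pmf GW) ({t. pair_number t \<le> pend_prob * real n + limit_sd * y * sqrt (real n)} \<inter> {t. nodes t = n})"
  have "1 / sqrt (2 * pi * var) \<noteq> 0" using var_pos by simp
  from tendsto_divide[OF cdf_tendsto[of "limit_sd * y", folded pair_number_def] size_prob_tendsto this]
  have lim: "(\<lambda>n. real n * sqrt (real n) * ?m n / (real n * sqrt (real n) * size_prob n)) \<longlonglongrightarrow> cdf std_normal_distribution y"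
    using var_pos by (simp add: cdf_std_normal_distribution[OF limit_sd(1)])
  have "\<forall>\<^sub>F n in sequentially. real n * sqrt (real n) * ?m n / (real n * sqrt (real n) * size_prob n) = cdf (?F n) y"
    using size_prob_eventually_pos eventually_gt_at_top[of 1]
  proof eventually_elim
    case (elim n)
    show ?case unfolding cdf_number[OF elim(2,1) limit_sd(1)] using elim by simp
  qed
  from Lim_transform_eventually[OF lim this] show "(\<lambda>n. cdf (?F n) y) \<longlonglongrightarrow> cdf std_normal_distribution y" .
qed

end

theorem theorem2:
  fixes \<xi> :: "nat pmf"
  assumes mean: "measure_pmf.expectation \<xi> real = 1"
    and finite_variance: "integrable (measure_pmf \<xi>) (\<lambda>k. (real k)\<^sup>2)"
    and positive_variance: "0 < measure_pmf.variance \<xi> real"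
    and zero: "pmf \<xi> 0 > 0"
    and aperiodic: "Gcd {i. pmf \<xi> i > 0} = 1"
  defines "\<gamma> \<equiv> \<lambda>\<omega>. real (paired_domination_number (tree_graph (plane_tree \<omega>)))"
  shows "\<exists>\<mu> > 0. \<exists>\<sigma> > 0.
    (\<lambda>n. integral\<^sup>L (conditioned_space \<xi> n) \<gamma> - \<mu> * real n) \<in> o(\<lambda>n. sqrt (real n)) \<and>
    weak_conv_m
      (\<lambda>n. distr (conditioned_space \<xi> n) borel
             (\<lambda>\<omega>. (\<gamma> \<omega> - \<mu> * real n) / (\<sigma> * sqrt (real n))))
      std_normal_distribution"
proof -
  interpret critical_offspring \<xi>
    using mean finite_variance positive_variance zero aperiodic by unfold_locales
  show ?thesis
    unfolding \<gamma>_def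
  proof (rule exI[of _ "2 * pend_prob"], rule conjI, goal_cases)
    case 2
    show ?case
      using limit_sd(1) expectation_number_asymptotics number_weak_conv
      by (intro exI[of _ "2 * limit_sd"] conjI) simp_all
  qed (use pend_prob_pos in simp)
qed

end
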